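(* Let $d\in\{1,2\}$. For $K\in\mathbb{T}^d$ and $\mu\in\mathbb{R}$ let $H_\mu(K)=H_0(K)+\mu\mathbb{V}$ be the bounded self-adjoint operator on $L^{2,s}[(\mathbb{T}^d)^2]$ described in the context, and let $\tau^{b}_{\mathrm{ess}}(H_\mu(K))=\inf\sigma_{\mathrm{ess}}(H_\mu(K))$ and $\tau^{t}_{\mathrm{ess}}(H_\mu(K))=\sup\sigma_{\mathrm{ess}}(H_\mu(K))$. (i) For every $\mu<0$ and every $K\in\mathbb{T}^d$ the operator $H_\mu(K)$ has an eigenvalue $E_\mu(K)<\tau^{b}_{\mathrm{ess}}(H_\mu(K))$. The eigenvalue $E_\mu(K)$ is a holomorphic function of $K\in\mathbb{T}^d$; the associated eigenfunction (bound state) $f_{\mu,E_\mu(K)}\in L^{2,s}[(\mathbb{T}^d)^2]$ is holomorphic in $(p,q)\in(\mathbb{T}^d)^2$, and the vector-valued map $K\mapsto f_{\mu,E_\mu(K)}$, from $\mathbb{T}^d$ into $L^{2,s}[(\mathbb{T}^d)^2]$, is holomorphic in $K\in\mathbb{T}^d$. (ii) For every $\mu>0$ and every $K\in\mathbb{T}^d$ the operator $H_\mu(K)$ has an eigenvalue $E_\mu(K)>\tau^{t}_{\mathrm{ess}}(H_\mu(K))$. The eigenvalue $E_\mu(K)$ is a holomorphic function of $K\in\mathbb{T}^d$; the associated eigenfunction $f_{\mu,E_\mu(K)}\in L^{2,s}[(\mathbb{T}^d)^2]$ is holomorphic in $(p,q)\in(\mathbb{T}^d)^2$, and the vector-valued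 map $K\mapsto f_{\mu,E_\mu(K)}$, from $\mathbb{T}^d$ into $L^{2,s}[(\mathbb{T}^d)^2]$, is holomorphic in $K\in\mathbb{T}^d$. (iii) For every $\mu<0$ (resp. $\mu>0$) and every $K\in\mathbb{T}^d$ the operator $H_\mu(K)$ has no eigenvalue lying above $\tau^{t}_{\mathrm{ess}}(H_\mu(K))$ (resp. below $\tau^{b}_{\mathrm{ess}}(H_\mu(K))$).
   Context: $\mathbb{T}^d=(-\pi,\pi]^d=\mathbb{R}^d/(2\pi\mathbb{Z}^d)$ is the $d$-dimensional torus (addition modulo $2\pi$), with normalized Haar measure $\eta(dp)=d^dp/(2\pi)^d$. Let $\varepsilon(p)=2\sum_{i=1}^d(1-\cos p^{(i)})$ for $p=(p^{(1)},\dots,p^{(d)})\in\mathbb{T}^d$. $L^{2,s}[(\mathbb{T}^d)^2]$ denotes the subspace of $L^2[(\mathbb{T}^d)^2,\eta\otimes\eta]$ of functions symmetric under permutation of the variables, $f(p,q)=f(q,p)$. For $K\in\mathbb{T}^d$ set $E(K;p,q)=\varepsilon(K-p-q)+\varepsilon(p)+\varepsilon(q)$; $H_0(K)$ is multiplication by $E(K;p,q)$, and $(\mathbb{V}f)(p,q)=\int_{\mathbb{T}^d}f(p,t)\eta(dt)+\int_{\mathbb{T}^d}f(t,q)\eta(dt)+\int_{\mathbb{T}^d}f(t,K-p-q)\eta(dt)$. $H_\mu(K)=H_0(K)+\mu\mathbb{V}$ is the fiber Hamiltonian at total quasi-momentum $K$ of three identical bosons on $\mathbb{Z}^d$ with zero-range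 pair interaction of strength $\mu$. "Holomorphic" in a variable of the torus means real-analytic (extending holomorphically to a complex neighborhood). *)

theory Defs
  imports "HOL-Analysis.Analysis"
begin

text \<open>The torus T^d is represented by the fundamental domain (-pi,pi]^d inside real^'n,
  with d = CARD('n); functions on the torus are 2pi-periodic functions on real^'n.\<close>

definition Tcube :: "(real^'n) set" where
  "Tcube = {x. \<forall>i. - pi < x $ i \<and> x $ i \<le> pi}"

definition shiftv :: "'n::finite \<Rightarrow> real^'n" where
  "shiftv i = (2 * pi) *\<^sub>R axis i 1"

definition per1 :: "(real^'n \<Rightarrow> 'b) \<Rightarrow> bool" where
  "per1 g \<longleftrightarrow> (\<forall>x i. g (x + shiftv i) = g x)"

definition per2 :: "(real^'n \<Rightarrow> real^'n \<Rightarrow> 'b) \<Rightarrow> bool" where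
  "per2 f \<longleftrightarrow> (\<forall>p q i. f (p + shiftv i) q = f p q \<and> f p (q + shiftv i) = f p q)"

definition eps :: "real^'n \<Rightarrow> real" where
  "eps p = 2 * (\<Sum>i\<in>UNIV. 1 - cos (p $ i))"

definition Etot :: "real^'n \<Rightarrow> real^'n \<Rightarrow> real^'n \<Rightarrow> real" where
  "Etot K p q = eps (K - p - q) + eps p + eps q"

definition eta_int :: "(real^'n \<Rightarrow> complex) \<Rightarrow> complex" where
  "eta_int g = (1 / (2 * pi) ^ CARD('n)) *\<^sub>R (set_lebesgue_integral lborel Tcube g)"

definition sqnorm :: "(real^'n \<Rightarrow> real^'n \<Rightarrow> complex) \<Rightarrow> ennreal" where
  "sqnorm f = ennreal (1 / (2 * pi) ^ (2 * CARD('n))) *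
      (\<integral>\<^sup>+ z. ennreal ((cmod (f (fst z) (snd z)))\<^sup>2) * indicator (Tcube \<times> Tcube) z \<partial>lborel)"

definition l2norm :: "(real^'n \<Rightarrow> real^'n \<Rightarrow> complex) \<Rightarrow> real" where
  "l2norm f = sqrt (enn2real (sqnorm f))"

definition ip :: "(real^'n \<Rightarrow> real^'n \<Rightarrow> complex) \<Rightarrow> (real^'n \<Rightarrow> real^'n \<Rightarrow> complex) \<Rightarrow> complex" where
  "ip f g = (1 / (2 * pi) ^ (2 * CARD('n))) *\<^sub>R
      (set_lebesgue_integral lborel (Tcube \<times> Tcube) (\<lambda>z. f (fst z) (snd z) * cnj (g (fst z) (snd z))))"

definition L2fn :: "(real^'n \<Rightarrow> real^'n \<Rightarrow> complex) \<Rightarrow> bool" where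
  "L2fn f \<longleftrightarrow> (\<lambda>z. f (fst z) (snd z)) \<in> borel_measurable lborel \<and> sqnorm f < \<infinity>"

definition L2s :: "(real^'n \<Rightarrow> real^'n \<Rightarrow> complex) \<Rightarrow> bool" where
  "L2s f \<longleftrightarrow> per2 f \<and> (\<forall>p q. f p q = f q p) \<and> L2fn f"

definition Vop :: "real^'n \<Rightarrow> (real^'n \<Rightarrow> real^'n \<Rightarrow> complex) \<Rightarrow> real^'n \<Rightarrow> real^'n \<Rightarrow> complex" where
  "Vop K f p q = eta_int (\<lambda>t. f p t) + eta_int (\<lambda>t. f t q) + eta_int (\<lambda>t. f t (K - p - q))"

definition Hop :: "real \<Rightarrow> real^'n \<Rightarrow> (real^'n \<Rightarrow> real^'n \<Rightarrow> complex) \<Rightarrow> real^'n \<Rightarrow> real^'n \<Rightarrow> complex" where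
  "Hop \<mu> K f p q = complex_of_real (Etot K p q) * f p q + complex_of_real \<mu> * Vop K f p q"

definition is_eigfn :: "real \<Rightarrow> real^'n \<Rightarrow> real \<Rightarrow> (real^'n \<Rightarrow> real^'n \<Rightarrow> complex) \<Rightarrow> bool" where
  "is_eigfn \<mu> K E f \<longleftrightarrow> L2s f \<and> sqnorm f \<noteq> 0 \<and>
     (AE z in lborel. Hop \<mu> K f (fst z) (snd z) = complex_of_real E * f (fst z) (snd z))"

definition is_eigenvalue :: "real \<Rightarrow> real^'n \<Rightarrow> real \<Rightarrow> bool" where
  "is_eigenvalue \<mu> K E \<longleftrightarrow> (\<exists>f. is_eigfn \<mu> K E f)"

text \<open>Essential spectrum of the (bounded self-adjoint) operator H_mu(K), via singular
  (orthonormal) Weyl sequences.\<close>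

definition ess_spec :: "real \<Rightarrow> real^'n \<Rightarrow> real set" where
  "ess_spec \<mu> K = {lam. \<exists>\<phi> :: nat \<Rightarrow> real^'n \<Rightarrow> real^'n \<Rightarrow> complex.
      (\<forall>n. L2s (\<phi> n)) \<and>
      (\<forall>n m. ip (\<phi> n) (\<phi> m) = (if n = m then 1 else 0)) \<and>
      (\<lambda>n. l2norm (\<lambda>p q. Hop \<mu> K (\<phi> n) p q - complex_of_real lam * \<phi> n p q)) \<longlonglongrightarrow> 0}"

definition tau_b :: "real \<Rightarrow> real^'n \<Rightarrow> real" where
  "tau_b \<mu> K = Inf (ess_spec \<mu> K)"

definition tau_t :: "real \<Rightarrow> real^'n \<Rightarrow> real" where
  "tau_t \<mu> K = Sup (ess_spec \<mu> K)"

text \<open>Real-analyticity ("holomorphic") of a function on a Euclidean space: locally the sum of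
  a convergent power series in the coordinates.\<close>

definition ra_at :: "('a::euclidean_space \<Rightarrow> 'b::real_normed_vector) \<Rightarrow> 'a \<Rightarrow> bool" where
  "ra_at f x \<longleftrightarrow> (\<exists>r>0. \<exists>c :: ('a \<Rightarrow> nat) \<Rightarrow> 'b. \<forall>y\<in>ball x r.
      ((\<lambda>\<alpha>. (\<Prod>b\<in>Basis. ((y - x) \<bullet> b) ^ \<alpha> b) *\<^sub>R c \<alpha>) has_sum f y)
        {\<alpha>. \<forall>b. b \<notin> Basis \<longrightarrow> \<alpha> b = 0})"

definition real_analytic :: "('a::euclidean_space \<Rightarrow> 'b::real_normed_vector) \<Rightarrow> bool" where
  "real_analytic f \<longleftrightarrow> (\<forall>x. ra_at f x)"

definition mono :: "real^'n \<Rightarrow> real^'n \<Rightarrow> ('n \<Rightarrow> nat) \<Rightarrow> real" where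
  "mono K0 K \<alpha> = (\<Prod>i\<in>UNIV. (K $ i - K0 $ i) ^ \<alpha> i)"

definition L2_analytic :: "(real^'n \<Rightarrow> real^'n \<Rightarrow> real^'n \<Rightarrow> complex) \<Rightarrow> bool" where
  "L2_analytic F \<longleftrightarrow> (\<forall>K0. \<exists>r>0. \<exists>G :: ('n \<Rightarrow> nat) \<Rightarrow> real^'n \<Rightarrow> real^'n \<Rightarrow> complex.
      (\<forall>\<alpha>. L2fn (G \<alpha>)) \<and>
      (\<forall>K\<in>ball K0 r.
         (\<lambda>\<alpha>. \<bar>mono K0 K \<alpha>\<bar> * l2norm (G \<alpha>)) summable_on UNIV \<and>
         (\<forall>e>0. \<exists>A0. finite A0 \<and> (\<forall>A. finite A \<and> A0 \<subseteq> A \<longrightarrow>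
            l2norm (\<lambda>p q. F K p q - (\<Sum>\<alpha>\<in>A. complex_of_real (mono K0 K \<alpha>) * G \<alpha> p q)) < e))))"

end

theory Submission
  imports Defs "HOL-Complex_Analysis.Cauchy_Integral_Formula"
begin

text \<open>Up to the sign \<open>s\<close> one looks for a bound state below the essential spectrum of \<open>W - \<kappa> * Vop\<close>.
  If \<open>f\<close> is an eigenfunction for \<open>z\<close> and \<open>g p\<close> its mean over the second variable, then
  \<open>f = \<kappa> (g p + g q + g (K - p - q)) / (W - z)\<close> and \<open>g\<close> satisfies the Faddeev equation
  \<open>Dl g = 2 \<kappa> \<integral> R g\<close>, where \<open>R = 1 / (W - z)\<close> and \<open>Dl = 1 - \<kappa> \<integral> R\<close>. Splitting off the constant
  \<open>1 / (Mtop - z)\<close> from \<open>R\<close> leaves a positive kernel \<open>b\<close>, whose Neumann series \<open>G\<close> reduces the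
  equation to the scalar condition \<open>\<integral> G = Mtop - z\<close>. Here \<open>R\<close>, \<open>1 / Dl\<close>, \<open>b\<close> and
  \<open>G\<close> increase with \<open>z\<close>.

  For \<open>d \<le> 2\<close> the minimum of \<open>Dl\<close> vanishes at most quadratically at the threshold, so \<open>\<integral> 1 / Dl\<close>, a
  lower bound for \<open>\<integral> G\<close>, diverges; hence the scalar condition has a solution \<open>e(K)\<close>
  strictly below the essential spectrum. There \<open>G\<close> itself is a strictly positive supersolution, which
  makes the Neumann series converge geometrically for all nearby complex parameters.
  Analyticity of \<open>e\<close> follows from a contraction argument, and joint analyticity in all variables from
  separate holomorphy (Osgood) with Cauchy bounds.

  If \<open>W - z\<close> and \<open>Dl\<close> are bounded away from 0, then the Faddeev reduction applied to an orthonormal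
  Weyl sequence forces its norm to 0, because the remaining integral operator is compact; so such
  \<open>z\<close> are not in the essential spectrum. The range of \<open>W\<close>, on the other hand, is in it. Beyond the
  range on the repulsive side, pairing \<open>f\<close> with
  \<open>g p + g q + g (K - p - q)\<close> gives \<open>3 \<integral> |g|\<^sup>2 = - \<kappa> \<integral> |g p + g q + g (K - p - q)|\<^sup>2 / (z - W)\<close>, so \<open>f = 0\<close>.\<close>

subsection \<open>Power series of bounded, separately holomorphic functions\<close>

text \<open>The rank-one splitting stands in for the spectral theory of the Faddeev operator.
  Writing the equation as \<open>g = u * \<integral> R g\<close> and normalising
  \<open>\<integral> g = Mtop - z\<close>, the term removed from \<open>R\<close> turns into the
  source \<open>u\<close>; what remains is a fixed point problem with nonnegative kernel and one
  increasing scalar equation.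

  The obstacle is that the series \<open>G\<close> might stop converging before its integral reaches
  the required value, or that \<open>Dl\<close> might vanish first. So the energy is defined as the
  supremum of those \<open>z\<close> for which all partial sums of \<open>\<integral> G\<close> stay
  below \<open>Mtop - z\<close>. Since \<open>b\<close> is bounded, this control of integrals alone
  forces pointwise convergence, and convergence at one parameter persists nearby; hence at the
  supremum the inequality can only hold as an equality.

  Low dimension enters twice. Divergence of the integral of \<open>1 / (W - min W)\<close> makes
  \<open>Dl\<close> reach zero while \<open>z\<close> is still away from the range of
  \<open>W\<close>; there \<open>R\<close> is smooth, so the zero of \<open>Dl\<close> at its
  minimum is quadratic and the second divergence becomes available.\<close>

definition taylor_coeff :: "(complex \<Rightarrow> complex) \<Rightarrow> nat \<Rightarrow> complex" where
  "taylor_coeff h m = (deriv ^^ m) h 0 / fact m"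

lemma taylor_sums:
  assumes "h holomorphic_on ball 0 r" "x \<in> ball 0 r"
  shows "(\<lambda>m. taylor_coeff h m * x ^ m) sums h x"
  using holomorphic_power_series[OF assms] by (simp add: taylor_coeff_def)

text \<open>Cauchy's inequality asks for continuity up to the circle, so it is applied for radii
  \<open>\<rho> < r\<close>, and the bound survives the limit of \<open>\<rho>\<close> to
  \<open>r\<close>.\<close>

lemma taylor_coeff_bound:
  assumes hol: "h holomorphic_on ball 0 r" and r: "r > 0"
    and B: "\<And>x. x \<in> ball 0 r \<Longrightarrow> norm (h x) \<le> B"
  shows "norm (taylor_coeff h m) \<le> B / r ^ m"
proof -
  have "norm (taylor_coeff h m) \<le> B / \<rho> ^ m" if "0 < \<rho>" "\<rho> < r" for \<rho>
  proof -
    have sub: "ball 0 \<rho> \<subseteq> ball 0 r" "cball 0 \<rho> \<subseteq> ball 0 r" using that by auto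
    have "norm ((deriv ^^ m) h 0) \<le> fact m * B / \<rho> ^ m"
      by (rule Cauchy_inequality)
        (use that sub hol in \<open>auto intro!: B holomorphic_on_imp_continuous_on
            intro: holomorphic_on_subset[OF hol]\<close>)
    then show ?thesis
      by (simp add: taylor_coeff_def norm_divide field_simps)
  qed
  moreover have "((\<lambda>\<rho>. B / \<rho> ^ m) \<longlongrightarrow> B / r ^ m) (at_left r)"
    using r by (intro tendsto_intros) auto
  moreover have "eventually (\<lambda>\<rho>. 0 < \<rho> \<and> \<rho> < r) (at_left r)"
    using r by (auto simp: eventually_at_left_field)
  ultimately show ?thesis
    by (intro tendsto_lowerbound[where F="at_left r"]) (auto elim: eventually_mono)
qed

text \<open>Exhibits the \<open>n\<close>-th coefficient as a limit of quotients built from values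
  of \<open>h\<close> and lower coefficients, at a rate that involves only \<open>B\<close> and
  \<open>r\<close>. This uniformity lets closure properties of a family of functions pass to their
  coefficients.\<close>

lemma taylor_coeff_rate:
  assumes hol: "h holomorphic_on ball 0 r" and r: "r > 0"
    and B: "\<And>x. x \<in> ball 0 r \<Longrightarrow> norm (h x) \<le> B"
    and x: "x \<noteq> 0" "norm x \<le> r / 2"
  shows "norm ((h x - (\<Sum>m<n. taylor_coeff h m * x ^ m)) / x ^ n - taylor_coeff h n)
    \<le> 2 * B * norm x / r ^ Suc n"
proof -
  let ?a = "taylor_coeff h"
  have xr: "x \<in> ball 0 r" using x r by auto
  have s: "(\<lambda>m. ?a (m + Suc n) * x ^ (m + Suc n)) sums (h x - (\<Sum>m<Suc n. ?a m * x ^ m))"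
    using sums_split_initial_segment[OF taylor_sums[OF hol xr]] .
  let ?t = "norm x / r"
  have t: "0 \<le> ?t" "?t \<le> 1/2" using x r by (auto simp: field_simps)
  have nb: "norm (?a (m + Suc n) * x ^ (m + Suc n)) \<le> (B * ?t ^ Suc n) * (1/2) ^ m" for m
  proof -
    have B0: "0 \<le> B" using B[of 0] r by (metis centre_in_ball norm_ge_zero order_trans)
    have "norm (?a (m + Suc n) * x ^ (m + Suc n)) \<le> B / r ^ (m + Suc n) * norm x ^ (m + Suc n)"
      unfolding norm_mult norm_power
      by (intro mult_right_mono taylor_coeff_bound[OF hol r B]) auto
    also have "\<dots> = (B * ?t ^ Suc n) * ?t ^ m"
      using r by (simp add: field_simps power_add)
    also have "\<dots> \<le> (B * ?t ^ Suc n) * (1/2) ^ m"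
      using t B0 by (intro mult_left_mono power_mono mult_nonneg_nonneg zero_le_power) auto
    finally show ?thesis .
  qed
  have ground_state: "(\<lambda>m. (B * ?t ^ Suc n) * (1/2) ^ m) sums ((B * ?t ^ Suc n) * 2)"
    using sums_mult[OF geometric_sums[of "1/2::real"], of "B * ?t ^ Suc n"] by simp
  have le: "norm (h x - (\<Sum>m<Suc n. ?a m * x ^ m)) \<le> (B * ?t ^ Suc n) * 2"
  proof -
    have "norm (suminf (\<lambda>m. ?a (m + Suc n) * x ^ (m + Suc n))) \<le> suminf (\<lambda>m. (B * ?t ^ Suc n) * (1/2) ^ m)"
      by (rule norm_suminf_le[OF nb sums_summable[OF ground_state]])
    then show ?thesis using sums_unique[OF s] sums_unique[OF ground_state] by simp
  qed
  have "(h x - (\<Sum>m<n. ?a m * x ^ m)) / x ^ n - ?a n = (h x - (\<Sum>m<Suc n. ?a m * x ^ m)) / x ^ n"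
    using x by (simp add: field_simps)
  also have "norm \<dots> \<le> (B * ?t ^ Suc n) * 2 / norm x ^ n"
    unfolding norm_divide norm_power using le by (intro divide_right_mono) auto
  also have "\<dots> = 2 * B * norm x / r ^ Suc n"
    using x r by (simp add: field_simps)
  finally show ?thesis .
qed

text \<open>For \<open>I = Basis\<close> this is the index set in \<open>ra_at\<close>. Exponents
  off \<open>I\<close> are pinned to 0 so that multi-indices over different \<open>I\<close> share
  one type and an induction over \<open>I\<close> is possible; \<open>poly_disc\<close> treats the
  variables in the same way.\<close>

definition multi_idx :: "'i set \<Rightarrow> ('i \<Rightarrow> nat) set" where
  "multi_idx I = {\<alpha>. \<forall>i. i \<notin> I \<longrightarrow> \<alpha> i = 0}"

definition poly_disc :: "'i set \<Rightarrow> real \<Rightarrow> ('i \<Rightarrow> complex) set" where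
  "poly_disc I r = {w. (\<forall>i\<in>I. norm (w i) < r) \<and> (\<forall>i. i \<notin> I \<longrightarrow> w i = 0)}"

lemma multi_idx_empty: "multi_idx {} = {\<lambda>_. 0}"
  by (auto simp: multi_idx_def)

text \<open>Separates the exponent of one new variable; this is the induction step for every sum
  over multi-indices.\<close>

lemma has_sum_multi_idx_insert:
  assumes "j \<notin> I"
  shows "(f has_sum S) (multi_idx (insert j I)) \<longleftrightarrow>
    ((\<lambda>(n, \<beta>). f (\<beta>(j := n))) has_sum S) (UNIV \<times> multi_idx I)"
proof (rule has_sum_reindex_bij_witness[where i="\<lambda>(n, \<beta>). \<beta>(j := n)" and j="\<lambda>\<alpha>. (\<alpha> j, \<alpha>(j := 0))"])
  show "\<And>b. b \<in> UNIV \<times> multi_idx I \<Longrightarrow> (case b of (n, \<beta>) \<Rightarrow> \<beta>(j := n)) \<in> multi_idx (insert j I)"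
    by (auto simp: multi_idx_def)
  show "\<And>b. b \<in> UNIV \<times> multi_idx I \<Longrightarrow> ((case b of (n, \<beta>) \<Rightarrow> \<beta>(j := n)) j, (case b of (n, \<beta>) \<Rightarrow> \<beta>(j := n))(j := 0)) = b"
    using assms by (auto simp: multi_idx_def fun_eq_iff)
qed (auto simp: multi_idx_def)

text \<open>The majorant for all power series below: Cauchy bounds make the terms at most geometric
  in each variable.\<close>

lemma geometric_multi_idx:
  fixes x :: "'i \<Rightarrow> real"
  assumes "finite I" "\<And>i. i \<in> I \<Longrightarrow> 0 \<le> x i \<and> x i < 1"
  shows "((\<lambda>\<alpha>. \<Prod>i\<in>I. x i ^ \<alpha> i) has_sum (\<Prod>i\<in>I. 1 / (1 - x i))) (multi_idx I)"
  using assms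
proof (induction I rule: finite_induct)
  case empty
  then show ?case by (auto simp: multi_idx_empty intro!: has_sum_finiteI)
next
  case (insert j I)
  have eq: "(\<Prod>i\<in>insert j I. x i ^ (\<beta>(j := n)) i) = x j ^ n * (\<Prod>i\<in>I. x i ^ \<beta> i)" for n \<beta>
  proof -
    have "(\<Prod>i\<in>I. x i ^ (\<beta>(j := n)) i) = (\<Prod>i\<in>I. x i ^ \<beta> i)"
      using insert.hyps by (intro prod.cong) auto
    then show ?thesis using insert.hyps by simp
  qed
  have inner: "((\<lambda>\<beta>. x j ^ n * (\<Prod>i\<in>I. x i ^ \<beta> i)) has_sum (x j ^ n * (\<Prod>i\<in>I. 1 / (1 - x i)))) (multi_idx I)" for n
    by (intro has_sum_cmult_right insert.IH) (use insert.prems in auto)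
  have xj: "0 \<le> x j" "x j < 1" using insert.prems by auto
  have "(\<lambda>n. x j ^ n) sums (1 / (1 - x j))" using xj by (intro geometric_sums) auto
  then have "((\<lambda>n. x j ^ n) has_sum (1 / (1 - x j))) UNIV"
    using xj by (intro norm_summable_imp_has_sum) (auto simp: sums_iff norm_power intro: summable_geometric)
  then have outer: "((\<lambda>n. x j ^ n * (\<Prod>i\<in>I. 1 / (1 - x i))) has_sum (1 / (1 - x j) * (\<Prod>i\<in>I. 1 / (1 - x i)))) UNIV"
    by (rule has_sum_cmult_left)
  have "((\<lambda>(n, \<beta>). x j ^ n * (\<Prod>i\<in>I. x i ^ \<beta> i)) has_sum (1 / (1 - x j) * (\<Prod>i\<in>I. 1 / (1 - x i)))) (UNIV \<times> multi_idx I)"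
  proof (rule has_sum_SigmaI)
    show "(\<lambda>(n, \<beta>). x j ^ n * (\<Prod>i\<in>I. x i ^ \<beta> i)) summable_on UNIV \<times> multi_idx I"
      by (rule summable_on_SigmaI[where g="\<lambda>n. x j ^ n * (\<Prod>i\<in>I. 1 / (1 - x i))"])
        (use inner outer insert.prems in \<open>auto simp: summable_on_def intro!: mult_nonneg_nonneg prod_nonneg\<close>)
  qed (use inner outer in auto)
  then show ?case
    unfolding has_sum_multi_idx_insert[OF insert.hyps(2)] eq using insert.hyps by simp
qed

text \<open>Coefficients are obtained recursively as uniform limits of linear combinations of values
  \<open>F s x\<close>, so any property of functions of \<open>s\<close> that is stable under both
  operations is inherited. It is used for holomorphy in the remaining variables and for
  measurability in a parameter.\<close>

lemma taylor_coeff_parametric: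
  fixes F :: "'p \<Rightarrow> complex \<Rightarrow> complex"
  assumes r: "r > 0"
    and hol: "\<And>s. s \<in> S \<Longrightarrow> F s holomorphic_on ball 0 r"
    and B: "\<And>s x. s \<in> S \<Longrightarrow> x \<in> ball 0 r \<Longrightarrow> norm (F s x) \<le> B"
    and closed_lim: "\<And>u v. (\<And>k. P (u k)) \<Longrightarrow> uniform_limit S u v sequentially \<Longrightarrow> P v"
    and closed_add: "\<And>u v c. P u \<Longrightarrow> P v \<Longrightarrow> P (\<lambda>s. u s + c * v s)"
    and PF: "\<And>x. x \<in> ball 0 r \<Longrightarrow> P (\<lambda>s. F s x)"
  shows "P (\<lambda>s. taylor_coeff (F s) n)"
proof (induction n rule: less_induct)
  case (less n)
  \<comment> \<open>Any null sequence of nonzero points in the disc of radius \<open>r / 2\<close>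
    would do, that being the range of \<open>taylor_coeff_rate\<close>.\<close>
  define x :: "nat \<Rightarrow> complex" where "x k = of_real (r / (2 * real (Suc k)))" for k
  have x: "x k \<noteq> 0" "norm (x k) \<le> r / 2" "x k \<in> ball 0 r" for k
  proof -
    show "x k \<noteq> 0" using r by (simp add: x_def del: of_nat_Suc)
    have "norm (x k) = r / (2 * real (Suc k))"
      unfolding x_def norm_of_real using r by (simp del: of_nat_Suc)
    also have "\<dots> \<le> r / 2" using r by (intro divide_left_mono) auto
    finally show "norm (x k) \<le> r / 2" .
    then show "x k \<in> ball 0 r" using r by auto
  qed
  have sumP: "P (\<lambda>s. F s (x k) + (\<Sum>m<j. (- (x k ^ m)) * taylor_coeff (F s) m))" if "j \<le> n" for j k
    using that
  proof (induction j)
    case 0 then show ?case using PF[OF x(3)] by simp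
  next
    case (Suc j)
    have "P (\<lambda>s. (F s (x k) + (\<Sum>m<j. (- (x k ^ m)) * taylor_coeff (F s) m)) + (- (x k ^ j)) * taylor_coeff (F s) j)"
      by (intro closed_add Suc.IH less.IH) (use Suc.prems in auto)
    then show ?case by (simp add: add_diff_eq)
  qed
  let ?q = "\<lambda>k s. (F s (x k) + (\<Sum>m<n. (- (x k ^ m)) * taylor_coeff (F s) m)) / x k ^ n"
  have "P (?q k)" for k
  proof -
    \<comment> \<open>Division by \<open>x k ^ n\<close> has to be expressed through the only
      available closure rule \<open>u + c * v\<close>, here with \<open>u = v\<close> and
      \<open>c = 1 / x k ^ n - 1\<close>.\<close>
    have "P (\<lambda>s. (F s (x k) + (\<Sum>m<n. (- (x k ^ m)) * taylor_coeff (F s) m)) + (1 / x k ^ n - 1) * (F s (x k) + (\<Sum>m<n. (- (x k ^ m)) * taylor_coeff (F s) m)))"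
      by (intro closed_add sumP) auto
    moreover have "u + (1 / c - 1) * u = u / c" for u c :: complex
      by (simp add: algebra_simps)
    ultimately show ?thesis by simp
  qed
  moreover have "uniform_limit S ?q (\<lambda>s. taylor_coeff (F s) n) sequentially"
  proof (rule uniform_limitI)
    fix e :: real assume e: "e > 0"
    have lim: "(\<lambda>k. 2 * B * norm (x k) / r ^ Suc n) \<longlonglongrightarrow> 0"
    proof -
      have "x \<longlonglongrightarrow> 0"
      proof -
        have "(\<lambda>k. r / 2 * (1 / real (Suc k))) \<longlonglongrightarrow> r / 2 * 0"
          using LIMSEQ_inverse_real_of_nat by (intro tendsto_intros) (simp add: inverse_eq_divide)
        then have "(\<lambda>k. of_real (r / 2 * (1 / real (Suc k))) :: complex) \<longlonglongrightarrow> of_real 0"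
          by (intro tendsto_of_real) simp
        then show ?thesis by (simp add: x_def[abs_def])
      qed
      then have "(\<lambda>k. 2 * B * norm (x k) / r ^ Suc n) \<longlonglongrightarrow> 2 * B * norm (0::complex) / r ^ Suc n"
        using r by (intro tendsto_intros) auto
      then show ?thesis by simp
    qed
    have "eventually (\<lambda>k. 2 * B * norm (x k) / r ^ Suc n < e) sequentially"
      using order_tendstoD(2)[OF lim e] .
    then show "\<forall>\<^sub>F k in sequentially. \<forall>s\<in>S. dist (?q k s) (taylor_coeff (F s) n) < e"
    proof eventually_elim
      case (elim k)
      show ?case
      proof
        fix s assume s: "s \<in> S"
        have "norm ((F s (x k) - (\<Sum>m<n. taylor_coeff (F s) m * x k ^ m)) / x k ^ n - taylor_coeff (F s) n)
          \<le> 2 * B * norm (x k) / r ^ Suc n"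
          by (rule taylor_coeff_rate[OF hol[OF s] r B[OF s] x(1,2)])
        then show "dist (?q k s) (taylor_coeff (F s) n) < e"
          using elim by (simp add: dist_norm sum_negf mult.commute)
      qed
    qed
  qed
  ultimately show ?case by (rule closed_lim)
qed

text \<open>Osgood's lemma: expand in one variable; by Cauchy's bound and
  \<open>taylor_coeff_parametric\<close> the coefficients are again bounded and separately
  holomorphic in the other variables. The parameter \<open>s\<close> is carried along because the
  \<open>L2\<close>-valued expansion of the ground state needs coefficients that are measurable in
  the momenta.\<close>

lemma osgood_power_series:
  fixes f :: "'s \<Rightarrow> ('i \<Rightarrow> complex) \<Rightarrow> complex"
  assumes "finite I" and r: "r > 0"
    and "\<And>s w. s \<in> space M \<Longrightarrow> w \<in> poly_disc I r \<Longrightarrow> norm (f s w) \<le> B"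
    and "\<And>s w i. s \<in> space M \<Longrightarrow> w \<in> poly_disc I r \<Longrightarrow> i \<in> I \<Longrightarrow> (\<lambda>x. f s (w(i := x))) holomorphic_on ball 0 r"
    and "\<And>w. w \<in> poly_disc I r \<Longrightarrow> (\<lambda>s. f s w) \<in> borel_measurable M"
  shows "\<exists>c. (\<forall>\<alpha>\<in>multi_idx I. c \<alpha> \<in> borel_measurable M) \<and>
    (\<forall>s\<in>space M. \<forall>\<alpha>\<in>multi_idx I. norm (c \<alpha> s) \<le> B / (\<Prod>i\<in>I. r ^ \<alpha> i)) \<and>
    (\<forall>s\<in>space M. \<forall>w\<in>poly_disc I r. ((\<lambda>\<alpha>. (\<Prod>i\<in>I. w i ^ \<alpha> i) * c \<alpha> s) has_sum f s w) (multi_idx I))"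
  using assms(1,3-)
proof (induction I arbitrary: f B rule: finite_induct)
  case empty
  have "(\<lambda>_. 0) \<in> poly_disc {} r" by (auto simp: poly_disc_def)
  moreover have "w = (\<lambda>_. 0)" if "w \<in> poly_disc {} r" for w :: "'i \<Rightarrow> complex"
    using that by (auto simp: poly_disc_def)
  ultimately show ?case using empty
    by (intro exI[of _ "\<lambda>\<alpha> s. f s (\<lambda>_. 0)"]) (auto simp: multi_idx_empty intro!: has_sum_finiteI)
next
  case (insert j I)
  have upd: "w(j := x) \<in> poly_disc (insert j I) r" if "w \<in> poly_disc I r" "x \<in> ball 0 r" for w x
    using that insert.hyps by (auto simp: poly_disc_def)
  have disc_upd: "w(i := x) \<in> poly_disc I r" if "w \<in> poly_disc I r" "x \<in> ball 0 r" "i \<in> I" for w x i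
    using that by (auto simp: poly_disc_def)
  define a where "a n s w = taylor_coeff (\<lambda>x. f s (w(j := x))) n" for n s w
  have holj: "(\<lambda>x. f s (w(j := x))) holomorphic_on ball 0 r" if "s \<in> space M" "w \<in> poly_disc I r" for s w
    using insert.prems(2)[OF that(1) upd[OF that(2), of 0], of j] r by (simp del: fun_upd_apply)
  have Bj: "norm (f s (w(j := x))) \<le> B" if "s \<in> space M" "w \<in> poly_disc I r" "x \<in> ball 0 r" for s w x
    using insert.prems(1) that upd by blast
  define Q where "Q n c \<longleftrightarrow> (\<forall>\<alpha>\<in>multi_idx I. c \<alpha> \<in> borel_measurable M) \<and>
    (\<forall>s\<in>space M. \<forall>\<alpha>\<in>multi_idx I. norm (c \<alpha> s) \<le> (B / r ^ n) / (\<Prod>i\<in>I. r ^ \<alpha> i)) \<and>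
    (\<forall>s\<in>space M. \<forall>w\<in>poly_disc I r. ((\<lambda>\<alpha>. (\<Prod>i\<in>I. w i ^ \<alpha> i) * c \<alpha> s) has_sum a n s w) (multi_idx I))" for n c
  have IH: "\<exists>c. Q n c" for n
    unfolding Q_def
  proof (rule insert.IH)
    fix s w assume s: "s \<in> space M" and w: "w \<in> poly_disc I r"
    show "norm (a n s w) \<le> B / r ^ n"
      unfolding a_def by (rule taylor_coeff_bound[OF holj[OF s w] r Bj[OF s w]])
    fix i assume i: "i \<in> I"
    have ij: "i \<noteq> j" using i insert.hyps by auto
    show "(\<lambda>x. a n s (w(i := x))) holomorphic_on ball 0 r"
      unfolding a_def
    proof (rule taylor_coeff_parametric[where S="ball 0 r" and r=r and B=B and P="\<lambda>g. g holomorphic_on ball 0 r"])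
      fix u :: "nat \<Rightarrow> complex \<Rightarrow> complex" and v assume u: "\<And>k. u k holomorphic_on ball 0 r" and lim: "uniform_limit (ball 0 r) u v sequentially"
      show "v holomorphic_on ball 0 r"
      proof (rule holomorphic_uniform_sequence[OF _ u])
        fix x :: complex assume "x \<in> ball 0 r"
        then obtain d where "d > 0" "cball x d \<subseteq> ball 0 r"
          using open_contains_cball[of "ball 0 r"] by (metis open_ball)
        then show "\<exists>d>0. cball x d \<subseteq> ball 0 r \<and> uniform_limit (cball x d) u v sequentially"
          using lim uniform_limit_on_subset by blast
      qed auto
    next
      fix x assume x: "x \<in> ball (0::complex) r"
      have "(\<lambda>y. f s ((w(j := x))(i := y))) holomorphic_on ball 0 r"
        by (rule insert.prems(2)[OF s upd[OF w x]]) (use i in auto)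
      then show "(\<lambda>y. f s (w(i := y, j := x))) holomorphic_on ball 0 r"
        by (subst fun_upd_twist[OF ij]) 
    next
      show "(\<lambda>x. f s ((w(i := y))(j := x))) holomorphic_on ball 0 r" if "y \<in> ball 0 r" for y
        by (rule holj[OF s disc_upd[OF w that i]])
      show "norm (f s ((w(i := y))(j := x))) \<le> B" if "y \<in> ball 0 r" "x \<in> ball 0 r" for y x
        by (rule Bj[OF s disc_upd[OF w that(1) i] that(2)])
      show "(\<lambda>s. u s + c * v s) holomorphic_on ball 0 r"
        if "u holomorphic_on ball 0 r" "v holomorphic_on ball 0 r" for u v c
        using that by (intro holomorphic_intros)
    qed (rule r)
  next
    fix w assume w: "w \<in> poly_disc I r"
    show "(\<lambda>s. a n s w) \<in> borel_measurable M"
      unfolding a_def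
    proof (rule taylor_coeff_parametric[where S="space M" and r=r and B=B and P="\<lambda>g. g \<in> borel_measurable M"])
      fix u :: "nat \<Rightarrow> 's \<Rightarrow> complex" and v assume "\<And>k. u k \<in> borel_measurable M" and lim: "uniform_limit (space M) u v sequentially"
      show "v \<in> borel_measurable M"
        by (rule borel_measurable_LIMSEQ_metric[OF \<open>\<And>k. u k \<in> borel_measurable M\<close> tendsto_uniform_limitI[OF lim]])
    next
      show "(\<lambda>s. f s (w(j := x))) \<in> borel_measurable M" if "x \<in> ball 0 r" for x
        by (rule insert.prems(3)[OF upd[OF w that]])
      show "(\<lambda>x. f s (w(j := x))) holomorphic_on ball 0 r" if "s \<in> space M" for s
        by (rule holj[OF that w])
      show "norm (f s (w(j := x))) \<le> B" if "s \<in> space M" "x \<in> ball 0 r" for s x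
        by (rule Bj[OF that(1) w that(2)])
      show "(\<lambda>s. u s + c * v s) \<in> borel_measurable M"
        if "u \<in> borel_measurable M" "v \<in> borel_measurable M" for u v :: "'s \<Rightarrow> complex" and c
        using that by measurable
    qed (rule r)
  qed
  then obtain c where "\<forall>n. Q n (c n)" by metis
  then have c:
    "\<And>n \<alpha>. \<alpha> \<in> multi_idx I \<Longrightarrow> c n \<alpha> \<in> borel_measurable M"
    "\<And>n s \<alpha>. s \<in> space M \<Longrightarrow> \<alpha> \<in> multi_idx I \<Longrightarrow> norm (c n \<alpha> s) \<le> (B / r ^ n) / (\<Prod>i\<in>I. r ^ \<alpha> i)"
    "\<And>n s w. s \<in> space M \<Longrightarrow> w \<in> poly_disc I r \<Longrightarrow> ((\<lambda>\<alpha>. (\<Prod>i\<in>I. w i ^ \<alpha> i) * c n \<alpha> s) has_sum a n s w) (multi_idx I)"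
    unfolding Q_def by blast+
  define C where "C \<alpha> = c (\<alpha> j) (\<alpha>(j := 0))" for \<alpha>
  have idx: "\<alpha>(j := 0) \<in> multi_idx I" if "\<alpha> \<in> multi_idx (insert j I)" for \<alpha>
    using that by (auto simp: multi_idx_def)
  have prod_upd: "(\<Prod>i\<in>I. g i ((\<alpha>(j := 0)) i)) = (\<Prod>i\<in>I. g i (\<alpha> i))" for \<alpha> :: "'i \<Rightarrow> nat" and g :: "'i \<Rightarrow> nat \<Rightarrow> real"
    using insert.hyps by (intro prod.cong) auto
  have Cb: "norm (C \<alpha> s) \<le> B / (\<Prod>i\<in>insert j I. r ^ \<alpha> i)" if "s \<in> space M" "\<alpha> \<in> multi_idx (insert j I)" for \<alpha> s
    using c(2)[OF that(1) idx[OF that(2)], of "\<alpha> j"] insert.hyps prod_upd[of "\<lambda>i m. r ^ m"]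
    by (simp add: C_def mult.commute)
  have "((\<lambda>\<alpha>. (\<Prod>i\<in>insert j I. w i ^ \<alpha> i) * C \<alpha> s) has_sum f s w) (multi_idx (insert j I))"
    if s: "s \<in> space M" and w: "w \<in> poly_disc (insert j I) r" for s w
  proof -
    define v where "v = w(j := 0)"
    have v: "v \<in> poly_disc I r" using w r by (auto simp: v_def poly_disc_def)
    have wj: "w j \<in> ball 0 r" using w by (auto simp: poly_disc_def)
    have fw: "f s w = f s (v(j := w j))" by (simp add: v_def)
    \<comment> \<open>The Cauchy bounds give absolute summability over the joint index set first;
      only then may the iterated sum, over \<open>n\<close> and then over the other exponents, be
      identified with the joint one.\<close>
    have summ: "(\<lambda>\<alpha>. (\<Prod>i\<in>insert j I. w i ^ \<alpha> i) * C \<alpha> s) summable_on multi_idx (insert j I)"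
    proof (rule Infinite_Sum.abs_summable_summable, rule Infinite_Sum.abs_summable_on_comparison_test')
      show "(\<lambda>\<alpha>. B * (\<Prod>i\<in>insert j I. (norm (w i) / r) ^ \<alpha> i)) summable_on multi_idx (insert j I)"
        using geometric_multi_idx[of "insert j I" "\<lambda>i. norm (w i) / r"] insert.hyps w r
        by (intro summable_on_cmult_right) (auto simp: summable_on_def poly_disc_def)
      fix \<alpha> assume al: "\<alpha> \<in> multi_idx (insert j I)"
      have "norm ((\<Prod>i\<in>insert j I. w i ^ \<alpha> i) * C \<alpha> s) \<le> (\<Prod>i\<in>insert j I. norm (w i) ^ \<alpha> i) * (B / (\<Prod>i\<in>insert j I. r ^ \<alpha> i))"
        unfolding norm_mult prod_norm[symmetric] norm_power
        by (intro mult_left_mono Cb s al prod_nonneg) auto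
      then show "norm ((\<Prod>i\<in>insert j I. w i ^ \<alpha> i) * C \<alpha> s) \<le> B * (\<Prod>i\<in>insert j I. (norm (w i) / r) ^ \<alpha> i)"
        by (simp add: power_divide prod_dividef mult.commute)
    qed
    have eq: "(\<Prod>i\<in>insert j I. w i ^ (\<beta>(j := n)) i) * C (\<beta>(j := n)) s = w j ^ n * ((\<Prod>i\<in>I. v i ^ \<beta> i) * c n \<beta> s)"
      if "\<beta> \<in> multi_idx I" for n \<beta>
    proof -
      have "(\<Prod>i\<in>I. w i ^ (\<beta>(j := n)) i) = (\<Prod>i\<in>I. v i ^ \<beta> i)"
        using insert.hyps by (intro prod.cong) (auto simp: v_def)
      moreover have "\<beta>(j := 0) = \<beta>" using that insert.hyps by (auto simp: multi_idx_def)
      ultimately show ?thesis using insert.hyps by (simp add: C_def)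
    qed
    let ?g = "\<lambda>(n, \<beta>). (\<Prod>i\<in>insert j I. w i ^ (\<beta>(j := n)) i) * C (\<beta>(j := n)) s"
    have "(?g has_sum f s w) (UNIV \<times> multi_idx I)"
    proof (rule has_sum_SigmaI)
      show "((\<lambda>\<beta>. ?g (n, \<beta>)) has_sum w j ^ n * a n s v) (multi_idx I)" for n
        using has_sum_cmult_right[OF c(3)[OF s v], of "w j ^ n" n]
        by (rule has_sum_cong[THEN iffD1, rotated]) (simp add: eq del: fun_upd_apply)
      show "((\<lambda>n. w j ^ n * a n s v) has_sum f s w) UNIV"
      proof (rule norm_summable_imp_has_sum)
        show "(\<lambda>n. w j ^ n * a n s v) sums f s w"
          using taylor_sums[OF holj[OF s v] wj] by (simp add: a_def fw mult.commute)
        show "summable (\<lambda>n. norm (w j ^ n * a n s v))"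
        proof (rule summable_comparison_test')
          show "summable (\<lambda>n. B * (norm (w j) / r) ^ n)"
            using wj r by (intro summable_mult summable_geometric) auto
          show "norm (norm (w j ^ n * a n s v)) \<le> B * (norm (w j) / r) ^ n" if "n \<ge> 0" for n
            using mult_left_mono[OF taylor_coeff_bound[OF holj[OF s v] r Bj[OF s v], of n], of "norm (w j) ^ n"]
            by (simp add: a_def norm_mult norm_power power_divide mult.commute)
        qed
      qed
      show "?g summable_on UNIV \<times> multi_idx I"
        using summ has_sum_multi_idx_insert[OF insert.hyps(2), of "\<lambda>\<alpha>. (\<Prod>i\<in>insert j I. w i ^ \<alpha> i) * C \<alpha> s"]
        unfolding summable_on_def by auto
    qed
    then show ?thesis using has_sum_multi_idx_insert[OF insert.hyps(2), of "\<lambda>\<alpha>. (\<Prod>i\<in>insert j I. w i ^ \<alpha> i) * C \<alpha> s"] by simp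
  qed
  then show ?case using Cb c(1) idx
    by (intro exI[of _ C]) (auto simp: C_def)
qed

subsection \<open>Holomorphic dependence on parameters\<close>

text \<open>Cauchy's estimate bounds the derivatives by \<open>C / r\<close> uniformly in
  \<open>t\<close>, so all difference quotients have this constant as integrable majorant and
  dominated convergence applies. The derivative is measurable in \<open>t\<close> as a limit of such
  quotients.\<close>

lemma holomorphic_parametric_integral:
  fixes f :: "complex \<Rightarrow> 'b \<Rightarrow> complex"
  assumes U: "open U" and fin: "finite_measure M"
    and hol: "\<And>t. (\<lambda>x. f x t) holomorphic_on U"
    and meas: "\<And>x. x \<in> U \<Longrightarrow> f x \<in> borel_measurable M"
    and bd: "\<And>x t. x \<in> U \<Longrightarrow> norm (f x t) \<le> C"
  shows "(\<lambda>x. \<integral>t. f x t \<partial>M) holomorphic_on U"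
proof -
  interpret finite_measure M by fact
  have "\<exists>D. ((\<lambda>x. \<integral>t. f x t \<partial>M) has_field_derivative D) (at x0)" if x0: "x0 \<in> U" for x0
  proof -
    obtain r where r: "r > 0" and sub: "cball x0 (2 * r) \<subseteq> U"
    proof -
      obtain e where "e > 0" "cball x0 e \<subseteq> U" using U x0 open_contains_cball by metis
      then show ?thesis using that[of "e / 2"] by auto
    qed
    have dbd: "norm (deriv (\<lambda>x. f x t) y) \<le> C / r" if y: "y \<in> cball x0 r" for t y
    proof -
      have c: "cball y r \<subseteq> U"
      proof
        fix z assume "z \<in> cball y r"
        then have "dist x0 z \<le> 2 * r" using y dist_triangle[of x0 z y] by auto
        then show "z \<in> U" using sub by auto
      qed
      then have b: "ball y r \<subseteq> U" by auto
      have "norm ((deriv ^^ 1) (\<lambda>x. f x t) y) \<le> fact 1 * C / r ^ 1"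
        by (rule Cauchy_inequality[OF holomorphic_on_subset[OF hol b]
              holomorphic_on_imp_continuous_on[OF holomorphic_on_subset[OF hol c]] r])
          (use c in \<open>auto intro!: bd simp: dist_norm\<close>)
      then show ?thesis by simp
    qed
    have der: "((\<lambda>x. f x t) has_field_derivative deriv (\<lambda>x. f x t) y) (at y)" if "y \<in> U" for t y
      using holomorphic_derivI[OF hol U that] .
    have lip: "norm (f y t - f x0 t) \<le> C / r * norm (y - x0)" if y: "y \<in> cball x0 r" for t y
      by (rule field_differentiable_bound[of "cball x0 r" "\<lambda>x. f x t" "deriv (\<lambda>x. f x t)"])
        (use sub r y in \<open>auto intro!: dbd DERIV_subset[OF der]\<close>)
    have "((\<lambda>x. \<integral>t. f x t \<partial>M) has_field_derivative (\<integral>t. deriv (\<lambda>x. f x t) x0 \<partial>M)) (at x0)"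
      unfolding has_field_derivative_iff tendsto_at_iff_sequentially comp_def
    proof (intro allI impI)
      fix X :: "nat \<Rightarrow> complex" assume X0: "\<forall>i. X i \<in> UNIV - {x0}" and X: "X \<longlonglongrightarrow> x0"
      have ev: "eventually (\<lambda>i. X i \<in> cball x0 r) sequentially"
        using X r unfolding tendsto_iff by (auto simp: dist_commute elim!: eventually_mono dest!: spec[of _ r])
      obtain N where N: "\<And>i. i \<ge> N \<Longrightarrow> X i \<in> cball x0 r"
        using ev by (auto simp: eventually_sequentially)
      \<comment> \<open>Dropping finitely many terms makes the Lipschitz bound, and hence the
        domination, hold for every index.\<close>
      define Y where "Y i = X (i + N)" for i
      have Y: "Y i \<in> cball x0 r" "Y i \<noteq> x0" for i using N X0 by (auto simp: Y_def)
      have YU: "Y i \<in> U" for i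
      proof -
        have "Y i \<in> cball x0 (2 * r)" using Y(1)[of i] r by auto
        then show ?thesis using sub by blast
      qed
      have Ylim: "Y \<longlonglongrightarrow> x0" unfolding Y_def using X by (rule LIMSEQ_ignore_initial_segment)
      have int: "integrable M (f x)" if "x \<in> U" for x
        by (rule integrable_const_bound[where B=C]) (use that meas bd in auto)
      have *: "(\<lambda>i. \<integral>t. (f (Y i) t - f x0 t) / (Y i - x0) \<partial>M) \<longlonglongrightarrow> (\<integral>t. deriv (\<lambda>x. f x t) x0 \<partial>M)"
      proof (rule integral_dominated_convergence[where w="\<lambda>_. C / r"])
        have lim: "(\<lambda>i. (f (Y i) t - f x0 t) / (Y i - x0)) \<longlonglongrightarrow> deriv (\<lambda>x. f x t) x0" for t
          using der[OF x0, of t] Y(2) Ylim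
          unfolding has_field_derivative_iff tendsto_at_iff_sequentially comp_def by auto
        then show "AE t in M. (\<lambda>i. (f (Y i) t - f x0 t) / (Y i - x0)) \<longlonglongrightarrow> deriv (\<lambda>x. f x t) x0" by auto
        have m: "(\<lambda>t. (f (Y i) t - f x0 t) / (Y i - x0)) \<in> borel_measurable M" for i
          using meas[OF YU] meas[OF x0] by measurable
        show "(\<lambda>t. (f (Y i) t - f x0 t) / (Y i - x0)) \<in> borel_measurable M" for i by (rule m)
        show "(\<lambda>t. deriv (\<lambda>x. f x t) x0) \<in> borel_measurable M"
          by (rule borel_measurable_LIMSEQ_metric[OF m lim])
        show "AE t in M. norm ((f (Y i) t - f x0 t) / (Y i - x0)) \<le> C / r" for i
          using lip[OF Y(1)] Y(2) by (auto simp: norm_divide divide_le_eq)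
      qed auto
      have eq: "(\<integral>t. (f (Y i) t - f x0 t) / (Y i - x0) \<partial>M) = ((\<integral>t. f (Y i) t \<partial>M) - (\<integral>t. f x0 t \<partial>M)) / (Y i - x0)" for i
        using int[OF YU] int[OF x0] by simp
      have "(\<lambda>i. ((\<integral>t. f (X (i + N)) t \<partial>M) - (\<integral>t. f x0 t \<partial>M)) / (X (i + N) - x0)) \<longlonglongrightarrow> (\<integral>t. deriv (\<lambda>x. f x t) x0 \<partial>M)"
        using *[unfolded eq] unfolding Y_def .
      then show "(\<lambda>i. ((\<integral>t. f (X i) t \<partial>M) - (\<integral>t. f x0 t \<partial>M)) / (X i - x0)) \<longlonglongrightarrow> (\<integral>t. deriv (\<lambda>x. f x t) x0 \<partial>M)"
        by (rule LIMSEQ_offset)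
    qed
    then show ?thesis by blast
  qed
  then show ?thesis using U by (auto simp: holomorphic_on_open)
qed

text \<open>Holomorphic functions of several complex variables are handled through their restrictions to
  holomorphic curves, so that compositions need no multivariate differential calculus.\<close>

definition curve :: "complex set \<Rightarrow> (complex \<Rightarrow> complex^'n) \<Rightarrow> bool" where
  "curve U \<gamma> \<longleftrightarrow> (\<forall>i. (\<lambda>x. \<gamma> x $ i) holomorphic_on U)"

definition curve_hol :: "((complex^'n) \<times> complex) set \<Rightarrow> (complex^'n \<Rightarrow> complex \<Rightarrow> complex) \<Rightarrow> bool" where
  "curve_hol N D \<longleftrightarrow> (\<forall>U \<gamma> \<zeta>. open U \<longrightarrow> curve U \<gamma> \<longrightarrow> \<zeta> holomorphic_on U \<longrightarrow>
     (\<forall>x\<in>U. (\<gamma> x, \<zeta> x) \<in> N) \<longrightarrow> (\<lambda>x. D (\<gamma> x) (\<zeta> x)) holomorphic_on U)"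

lemma curve_const [simp]: "curve U (\<lambda>_. k)"
  by (simp add: curve_def)

text \<open>Newton's iteration with frozen slope \<open>a\<close> is a contraction with factor 1/2,
  uniformly for \<open>k\<close> near \<open>k0\<close>; its iterates are holomorphic along curves
  and converge uniformly. The pair \<open>X\<close>, \<open>A\<close> records an invariant: a closed
  set preserved by the iteration for \<open>k\<close> in \<open>X\<close> contains the solution.
  With the real vectors and the real numbers this yields real roots for real parameters.\<close>

lemma implicit_curve_hol:
  fixes D :: "complex^'n \<Rightarrow> complex \<Rightarrow> complex"
  assumes r: "r > 0"
    and hol: "curve_hol (ball k0 r \<times> ball z0 r) D"
    and bd: "\<And>k z. k \<in> ball k0 r \<Longrightarrow> z \<in> ball z0 r \<Longrightarrow> norm (D k z) \<le> B"
    and D0: "D k0 z0 = 0"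
    and a: "deriv (D k0) z0 = a" "a \<noteq> 0"
    and closedA: "closed A" "z0 \<in> A"
    and A: "\<And>k z. k \<in> X \<Longrightarrow> z \<in> A \<Longrightarrow> k \<in> ball k0 r \<Longrightarrow> z \<in> ball z0 r \<Longrightarrow> z - D k z / a \<in> A"
  shows "\<exists>\<rho>>0. \<exists>\<epsilon>. (\<forall>k\<in>ball k0 \<rho>. \<epsilon> k \<in> ball z0 r \<and> D k (\<epsilon> k) = 0 \<and> (k \<in> X \<longrightarrow> \<epsilon> k \<in> A)) \<and>
    (\<forall>U \<gamma>. open U \<longrightarrow> curve U \<gamma> \<longrightarrow> (\<forall>x\<in>U. \<gamma> x \<in> ball k0 \<rho>) \<longrightarrow> (\<lambda>x. \<epsilon> (\<gamma> x)) holomorphic_on U)"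
proof -
  have holz: "D k holomorphic_on ball z0 r" if "k \<in> ball k0 r" for k
    using hol[unfolded curve_hol_def, rule_format, of "ball z0 r" "\<lambda>_. k" "\<lambda>x. x"] that by auto
  have B0: "B \<ge> 0" using bd[of k0 z0] r by (metis centre_in_ball norm_ge_zero order_trans)
  have diffk: "norm (D k z - D k0 z) \<le> 4 * B / r * norm (k - k0)"
    if k: "k \<in> ball k0 (r/2)" and z: "z \<in> ball z0 r" for k z
  proof (cases "k = k0")
    case False
    define d where "d = norm (k - k0)"
    have d: "d > 0" "d < r/2" using False k by (auto simp: d_def dist_norm norm_minus_commute)
    \<comment> \<open>The dependence on \<open>k\<close> is estimated along the complex line through
      \<open>k0\<close> and \<open>k\<close>: there \<open>D\<close> is a bounded function of one
      variable on a disc of radius \<open>r / d > 2\<close>, so its derivative on the unit disc is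
      controlled by Cauchy.\<close>
    define \<phi> where "\<phi> x = D (k0 + x *s (k - k0)) z" for x
    have nv: "norm (x *s (k - k0)) = norm x * d" for x :: complex
    proof -
      have "norm (x *s (k - k0)) = norm x * norm (k - k0)"
        unfolding norm_vec_def L2_set_def vector_smult_component norm_mult power_mult_distrib
          sum_distrib_left[symmetric] real_sqrt_mult by simp
      then show ?thesis by (simp add: d_def)
    qed
    have inb: "k0 + x *s (k - k0) \<in> ball k0 r" if "x \<in> ball 0 (r / d)" for x
    proof -
      have "dist k0 (k0 + x *s (k - k0)) = norm x * d"
        unfolding nv[symmetric] dist_norm by (metis add_diff_cancel_left' norm_minus_commute)
      then show ?thesis using that d by (simp add: field_simps)
    qed
    have h\<phi>: "\<phi> holomorphic_on ball 0 (r / d)"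
      unfolding \<phi>_def
      by (rule hol[unfolded curve_hol_def, rule_format])
        (use z inb in \<open>auto simp: curve_def intro!: holomorphic_intros\<close>)
    have b\<phi>: "norm (\<phi> x) \<le> B" if "x \<in> ball 0 (r / d)" for x
      unfolding \<phi>_def by (rule bd[OF inb[OF that] z])
    have rd: "r / d > 2" using d r by (simp add: field_simps)
    define \<rho> where "\<rho> = r / (2 * d)"
    have \<rho>: "\<rho> > 1" "r / d = 2 * \<rho>" using rd by (simp_all add: \<rho>_def field_simps)
    have dphi: "norm (deriv \<phi> y) \<le> B / \<rho>" if y: "y \<in> cball 0 1" for y
    proof -
      have c: "ball y \<rho> \<subseteq> ball 0 (r / d)" and cc: "cball y (\<rho>) \<subseteq> ball 0 (r / d)"
      proof -
        show "cball y (\<rho>) \<subseteq> ball 0 (r / d)"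
        proof
          fix v assume "v \<in> cball y \<rho>"
          then have "norm v \<le> norm y + \<rho>" using norm_triangle_ineq[of y "v - y"] by (auto simp: dist_norm norm_minus_commute)
          then show "v \<in> ball 0 (r / d)" using y \<rho> by auto
        qed
        then show "ball y \<rho> \<subseteq> ball 0 (r / d)" by auto
      qed
      have "norm ((deriv ^^ 1) \<phi> y) \<le> fact 1 * B / \<rho> ^ 1"
        by (rule Cauchy_inequality[OF holomorphic_on_subset[OF h\<phi> c]
              holomorphic_on_imp_continuous_on[OF holomorphic_on_subset[OF h\<phi> cc]]])
          (use \<rho> cc in \<open>auto intro!: b\<phi> simp: dist_norm\<close>)
      then show ?thesis by simp
    qed
    have cb: "cball 0 1 \<subseteq> ball (0::complex) (r / d)" using rd by auto
    have "norm (\<phi> 1 - \<phi> 0) \<le> B / \<rho> * norm (1 - 0 :: complex)"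
      by (rule field_differentiable_bound[of "cball 0 1" \<phi> "deriv \<phi>"])
        (use cb in \<open>auto intro!: dphi DERIV_subset[OF holomorphic_derivI[OF h\<phi>]]\<close>)
    also have "\<dots> \<le> 4 * B / r * d"
      using r d B0 by (simp add: \<rho>_def field_simps)
    finally show ?thesis by (simp add: \<phi>_def d_def)
  qed (use z r B0 in auto)
  \<comment> \<open>Cauchy's estimate on circles of radius \<open>r / 4\<close> transfers the
    Lipschitz bound in \<open>k\<close> from \<open>D\<close> to its derivative in
    \<open>z\<close>.\<close>
  have ddiff: "norm (deriv (D k) z - deriv (D k0) z) \<le> (4 * B / r * norm (k - k0)) / (r / 4)"
    if k: "k \<in> ball k0 (r/2)" and z: "z \<in> ball z0 (r/2)" for k z
  proof -
    have kr: "k \<in> ball k0 r" "k0 \<in> ball k0 r" using k r by auto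
    have sub: "cball z (r/4) \<subseteq> ball z0 r"
    proof
      fix v assume "v \<in> cball z (r/4)"
      then show "v \<in> ball z0 r" using z r dist_triangle[of z0 v z] by auto
    qed
    have sub': "ball z (r/4) \<subseteq> ball z0 r" using sub by auto
    have zz: "z \<in> ball z0 r" using z r by auto
    have h: "(\<lambda>z. D k z - D k0 z) holomorphic_on ball z0 r"
      using holz[OF kr(1)] holz[OF kr(2)] by (intro holomorphic_intros)
    have nof: "norm (D k x - D k0 x) \<le> 4 * B / r * norm (k - k0)" if "norm (z - x) = r/4" for x
      by (rule diffk[OF k]) (use that sub in \<open>auto simp: dist_norm\<close>)
    have "norm ((deriv ^^ 1) (\<lambda>z. D k z - D k0 z) z) \<le> fact 1 * (4 * B / r * norm (k - k0)) / (r/4) ^ 1"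
      by (rule Cauchy_inequality[OF holomorphic_on_subset[OF h sub']
            holomorphic_on_imp_continuous_on[OF holomorphic_on_subset[OF h sub]]])
        (use r nof in auto)
    moreover have "deriv (\<lambda>z. D k z - D k0 z) z = deriv (D k) z - deriv (D k0) z"
      by (rule deriv_diff) (rule holomorphic_on_imp_differentiable_at[OF holz[OF kr(1)] open_ball zz]
          holomorphic_on_imp_differentiable_at[OF holz[OF kr(2)] open_ball zz])+
    ultimately show ?thesis by simp
  qed
  have na: "norm a > 0" using a by simp
  have k0r: "k0 \<in> ball k0 r" using r by simp
  have contd: "isCont (deriv (D k0)) z0"
    using holomorphic_deriv[OF holz[OF k0r]] r
    by (metis centre_in_ball continuous_on_eq_continuous_at holomorphic_on_imp_continuous_on open_ball)
  obtain r1 where r1: "r1 > 0" "\<And>z. dist z z0 < r1 \<Longrightarrow> norm (deriv (D k0) z - a) < norm a / 4"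
    using contd na a(1) unfolding continuous_at_eps_delta dist_norm by (metis divide_pos_pos zero_less_numeral)
  define \<sigma> where "\<sigma> = min (r1 / 2) (r / 4)"
  have \<sigma>: "\<sigma> > 0" "\<sigma> < r1" "\<sigma> < r/2" using r1 r by (auto simp: \<sigma>_def)
  \<comment> \<open>The second entry keeps \<open>deriv (D k)\<close> within
    \<open>norm a / 4\<close> of its value at \<open>k0\<close>, which with \<open>r1\<close> gives
    the contraction factor 1/2; the third makes the first Newton step at most
    \<open>\<sigma> / 4\<close>, so the iterates stay in the disc. \<open>B + 1\<close> avoids a
    division by zero when \<open>B = 0\<close>.\<close>
  define \<rho> where "\<rho> = min (r/2) (min (norm a * r\<^sup>2 / (64 * (B + 1))) (norm a * \<sigma> * r / (16 * (B + 1))))"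
  have \<rho>: "\<rho> > 0" "\<rho> \<le> r/2" "16 * (B + 1) * \<rho> \<le> norm a * r\<^sup>2 / 4" "4 * (B + 1) * \<rho> \<le> norm a * \<sigma> * r / 4"
  proof -
    have "\<rho> \<le> norm a * r\<^sup>2 / (64 * (B + 1))" "\<rho> \<le> norm a * \<sigma> * r / (16 * (B + 1))" by (auto simp: \<rho>_def)
    then show "16 * (B + 1) * \<rho> \<le> norm a * r\<^sup>2 / 4" "4 * (B + 1) * \<rho> \<le> norm a * \<sigma> * r / 4"
      using B0 by (simp_all add: field_simps)
    show "\<rho> > 0" using na r \<sigma> B0 by (simp add: \<rho>_def)
    show "\<rho> \<le> r/2" unfolding \<rho>_def by (rule min.cobounded1)
  qed
  have kr: "k \<in> ball k0 (r/2)" "k \<in> ball k0 r" if "k \<in> ball k0 \<rho>" for k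
    using that \<rho> r by auto
  have cb: "cball z0 \<sigma> \<subseteq> ball z0 (r/2)" "cball z0 \<sigma> \<subseteq> ball z0 r" using \<sigma> r by auto
  define T where "T k z = z - D k z / a" for k z
  have derivbd: "norm (1 - deriv (D k) z / a) \<le> 1/2" if k: "k \<in> ball k0 \<rho>" and z: "z \<in> cball z0 \<sigma>" for k z
  proof -
    have "norm (deriv (D k) z - deriv (D k0) z) \<le> 16 * B * norm (k - k0) / r\<^sup>2"
      using ddiff[OF kr(1)[OF k]] z cb r by (auto simp: field_simps power2_eq_square)
    also have "\<dots> \<le> 16 * (B + 1) * \<rho> / r\<^sup>2"
      using k B0 by (intro divide_right_mono mult_mono) (auto simp: dist_norm norm_minus_commute)
    also have "\<dots> \<le> (norm a * r\<^sup>2 / 4) / r\<^sup>2" using \<rho> by (intro divide_right_mono) auto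
    also have "\<dots> = norm a / 4" using r by simp
    finally have 1: "norm (deriv (D k) z - deriv (D k0) z) \<le> norm a / 4" .
    have 2: "norm (deriv (D k0) z - a) < norm a / 4"
      by (rule r1(2)) (use z \<sigma> in \<open>auto simp: dist_commute\<close>)
    have "norm (a - deriv (D k) z) \<le> norm a / 2"
      using 1 2 norm_triangle_ineq[of "deriv (D k) z - deriv (D k0) z" "deriv (D k0) z - a"]
      by (simp add: norm_minus_commute)
    then have "norm ((a - deriv (D k) z) / a) \<le> 1/2"
      using na by (simp add: norm_divide field_simps)
    then show ?thesis using a by (simp add: diff_divide_distrib)
  qed
  have lip: "norm (T k z - T k z') \<le> 1/2 * norm (z - z')"
    if k: "k \<in> ball k0 \<rho>" and z: "z \<in> cball z0 \<sigma>" "z' \<in> cball z0 \<sigma>" for k z z'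
  proof (rule field_differentiable_bound[of "cball z0 \<sigma>" "T k" "\<lambda>z. 1 - deriv (D k) z / a"])
    fix w assume w: "w \<in> cball z0 \<sigma>"
    show "(T k has_field_derivative 1 - deriv (D k) w / a) (at w within cball z0 \<sigma>)"
      unfolding T_def
      by (rule DERIV_subset[where s=UNIV])
        (use holomorphic_derivI[OF holz[OF kr(2)[OF k]] open_ball, of w] w cb a in \<open>auto intro!: derivative_eq_intros\<close>)
    show "norm (1 - deriv (D k) w / a) \<le> 1/2" by (rule derivbd[OF k w])
  qed (use z in auto)
  have T0: "norm (T k z0 - z0) \<le> \<sigma> / 4" if k: "k \<in> ball k0 \<rho>" for k
  proof -
    have "norm (D k z0) \<le> 4 * B / r * norm (k - k0)"
      using diffk[OF kr(1)[OF k], of z0] r D0 by simp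
    also have "\<dots> \<le> 4 * (B + 1) / r * \<rho>"
      using k B0 r by (intro mult_mono divide_right_mono) (auto simp: dist_norm norm_minus_commute)
    also have "\<dots> \<le> norm a * \<sigma> / 4" using \<rho>(4) r by (simp add: field_simps)
    finally have "norm (D k z0) \<le> norm a * \<sigma> / 4" .
    then show ?thesis using na by (simp add: T_def norm_divide field_simps)
  qed
  define Z where "Z k n = (T k ^^ n) z0" for k n
  have Zs: "Z k (Suc n) = T k (Z k n)" "Z k 0 = z0" for k n by (simp_all add: Z_def)
  have Zin: "Z k n \<in> cball z0 \<sigma>" if k: "k \<in> ball k0 \<rho>" for k n
  proof (induction n)
    case (Suc n)
    have "norm (T k (Z k n) - T k z0) \<le> 1/2 * norm (Z k n - z0)" using lip[OF k Suc] \<sigma> by auto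
    moreover have "norm (Z k n - z0) \<le> \<sigma>" using Suc by (simp add: dist_norm norm_minus_commute)
    ultimately have "norm (T k (Z k n) - z0) \<le> \<sigma>"
      using T0[OF k] norm_triangle_ineq[of "T k (Z k n) - T k z0" "T k z0 - z0"] \<sigma> by simp
    then show ?case by (simp add: Zs dist_norm norm_minus_commute)
  qed (use \<sigma> in \<open>simp add: Zs\<close>)
  have step: "norm (Z k (Suc n) - Z k n) \<le> \<sigma> / 4 * (1/2) ^ n" if k: "k \<in> ball k0 \<rho>" for k n
  proof (induction n)
    case 0 then show ?case using T0[OF k] by (simp add: Zs)
  next
    case (Suc n)
    have "norm (Z k (Suc (Suc n)) - Z k (Suc n)) \<le> 1/2 * norm (Z k (Suc n) - Z k n)"
      unfolding Zs(1)[of k "Suc n"] Zs(1)[of k n, symmetric] using lip[OF k Zin[OF k] Zin[OF k], of "Suc n" n] by (simp add: Zs)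
    then show ?case using Suc by simp
  qed
  define \<epsilon> where "\<epsilon> k = z0 + (\<Sum>n. Z k (Suc n) - Z k n)" for k
  have part: "z0 + (\<Sum>n<m. Z k (Suc n) - Z k n) = Z k m" for k m
    unfolding sum_lessThan_telescope by (simp add: Zs(2))
  have ul: "uniform_limit (ball k0 \<rho>) (\<lambda>m k. Z k m) \<epsilon> sequentially"
  proof -
    have "uniform_limit (ball k0 \<rho>) (\<lambda>m k. \<Sum>n<m. Z k (Suc n) - Z k n) (\<lambda>k. \<Sum>n. Z k (Suc n) - Z k n) sequentially"
      by (rule Weierstrass_m_test[where M="\<lambda>n. \<sigma> / 4 * (1/2) ^ n"])
        (use step in \<open>auto intro!: summable_mult summable_geometric\<close>)
    then have "uniform_limit (ball k0 \<rho>) (\<lambda>m k. z0 + (\<Sum>n<m. Z k (Suc n) - Z k n)) \<epsilon> sequentially"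
      unfolding \<epsilon>_def[abs_def] by (intro uniform_limit_intros)
    then show ?thesis by (simp add: part)
  qed
  have pl: "(\<lambda>m. Z k m) \<longlonglongrightarrow> \<epsilon> k" if "k \<in> ball k0 \<rho>" for k
    using tendsto_uniform_limitI[OF ul that] .
  have ein: "\<epsilon> k \<in> cball z0 \<sigma>" if k: "k \<in> ball k0 \<rho>" for k
    by (rule closed_sequentially[OF closed_cball Zin[OF k] pl[OF k]])
  have fix': "D k (\<epsilon> k) = 0" if k: "k \<in> ball k0 \<rho>" for k
  proof -
    have "isCont (D k) (\<epsilon> k)"
      using holz[OF kr(2)[OF k]] ein[OF k] cb
      by (metis continuous_on_eq_continuous_at holomorphic_on_imp_continuous_on open_ball subset_iff)
    then have "isCont (T k) (\<epsilon> k)" unfolding T_def using a by (intro continuous_intros) auto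
    then have "(\<lambda>m. T k (Z k m)) \<longlonglongrightarrow> T k (\<epsilon> k)" using pl[OF k] by (rule isCont_tendsto_compose)
    moreover have "(\<lambda>m. T k (Z k m)) \<longlonglongrightarrow> \<epsilon> k"
      using LIMSEQ_Suc[OF pl[OF k]] by (simp add: Zs)
    ultimately have "T k (\<epsilon> k) = \<epsilon> k" by (rule LIMSEQ_unique)
    then show ?thesis using a by (simp add: T_def)
  qed
  have eA: "\<epsilon> k \<in> A" if k: "k \<in> ball k0 \<rho>" "k \<in> X" for k
  proof (rule closed_sequentially[OF closedA(1) _ pl[OF k(1)]])
    fix n show "Z k n \<in> A"
    proof (induction n)
      case (Suc n)
      then show ?case using A[OF k(2) Suc kr(2)[OF k(1)]] Zin[OF k(1), of n] cb by (auto simp: Zs T_def)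
    qed (use closedA in \<open>simp add: Zs\<close>)
  qed
  have hole: "(\<lambda>x. \<epsilon> (\<gamma> x)) holomorphic_on U"
    if U: "open U" and cv: "curve U \<gamma>" and g: "\<forall>x\<in>U. \<gamma> x \<in> ball k0 \<rho>" for U \<gamma>
  proof (rule holomorphic_uniform_sequence[OF U])
    show "(\<lambda>x. Z (\<gamma> x) n) holomorphic_on U" for n
    proof (induction n)
      case (Suc n)
      have "(\<lambda>x. D (\<gamma> x) (Z (\<gamma> x) n)) holomorphic_on U"
        by (rule hol[unfolded curve_hol_def, rule_format, OF U cv Suc])
          (use g kr(2) Zin cb in blast)
      then show ?case using Suc a by (auto simp: Zs T_def intro!: holomorphic_intros)
    qed (simp add: Zs)
    fix x assume "x \<in> U"
    then obtain d where d: "d > 0" "cball x d \<subseteq> U" using U open_contains_cball by metis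
    have "uniform_limit (cball x d) (\<lambda>m x. Z (\<gamma> x) m) (\<lambda>x. \<epsilon> (\<gamma> x)) sequentially"
      by (rule uniform_limit_compose'[OF ul]) (use d g in auto)
    with d show "\<exists>d>0. cball x d \<subseteq> U \<and> uniform_limit (cball x d) (\<lambda>n x. Z (\<gamma> x) n) (\<lambda>x. \<epsilon> (\<gamma> x)) sequentially" by blast
  qed
  show ?thesis
    using \<rho>(1) ein cb(2) fix' eA hole by (intro exI[of _ \<rho>] conjI exI[of _ \<epsilon>]) blast+
qed

subsection \<open>Haar measure on the torus\<close>

definition lat :: "int^'n \<Rightarrow> real^'n" where
  "lat k = (\<chi> i. 2 * pi * of_int (k $ i))"

text \<open>The ceiling, rather than the floor, fits the half-open cube: a coordinate equal to
  \<open>pi\<close> stays, and \<open>- pi\<close> is moved to \<open>pi\<close>.\<close>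

definition wrap :: "real^'n \<Rightarrow> real^'n" where
  "wrap x = x + lat (\<chi> i. - \<lceil>(x $ i - pi) / (2 * pi)\<rceil>)"

text \<open>Haar measure realised as a probability measure on all of \<open>real^'n\<close> that is
  concentrated on the cube, so integrands can remain periodic functions on the whole space.\<close>

definition eta :: "(real^'n) measure" where
  "eta = density lborel (\<lambda>x. ennreal (1 / (2 * pi) ^ CARD('n)) * indicator Tcube x)"

lemma lat_nth [simp]: "lat k $ i = 2 * pi * of_int (k $ i)"
  by (simp add: lat_def)

lemma lat_minus: "lat (- k) = - lat k"
  by (simp add: vec_eq_iff)

lemma wrap_Tcube [simp]: "wrap x \<in> Tcube"
proof -
  have "- pi < x $ i - 2 * pi * of_int \<lceil>(x $ i - pi) / (2 * pi)\<rceil> \<and>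
      x $ i - 2 * pi * of_int \<lceil>(x $ i - pi) / (2 * pi)\<rceil> \<le> pi" for i
  proof -
    define y where "y = (x $ i - pi) / (2 * pi)"
    have x: "x $ i = 2 * pi * y + pi" by (simp add: y_def)
    have "y \<le> of_int \<lceil>y\<rceil>" "of_int \<lceil>y\<rceil> < y + 1" by linarith+
    then have "2 * pi * y \<le> 2 * pi * of_int \<lceil>y\<rceil>" "2 * pi * of_int \<lceil>y\<rceil> < 2 * pi * (y + 1)"
      by (auto intro: mult_left_mono mult_strict_left_mono)
    then show ?thesis unfolding y_def[symmetric] x by (simp add: algebra_simps)
  qed
  then show ?thesis by (auto simp: Tcube_def wrap_def)
qed

lemma ex1_lat_Tcube: "\<exists>!k. z + lat k \<in> Tcube"
proof
  show "z + lat (\<chi> i. - \<lceil>(z $ i - pi) / (2 * pi)\<rceil>) \<in> Tcube"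
    using wrap_Tcube[of z] by (simp add: wrap_def)
  fix k assume k: "z + lat k \<in> Tcube"
  have "\<lceil>(z $ i - pi) / (2 * pi)\<rceil> = - k $ i" for i
  proof (rule ceiling_unique)
    show "of_int (- k $ i) - 1 < (z $ i - pi) / (2 * pi)" "(z $ i - pi) / (2 * pi) \<le> of_int (- k $ i)"
      using k by (auto simp: Tcube_def field_simps dest!: spec[of _ i])
  qed
  then show "k = (\<chi> i. - \<lceil>(z $ i - pi) / (2 * pi)\<rceil>)"
    by (simp add: vec_eq_iff)
qed

lemma Tcube_borel [measurable]: "Tcube \<in> sets borel"
proof -
  have "(Tcube :: (real^'n) set) = (\<Inter>i. {x. - pi < x $ i} \<inter> {x. x $ i \<le> pi})"
    by (auto simp: Tcube_def)
  also have "\<dots> \<in> sets borel"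
    by (intro sets.countable_INT' sets.Int borel_open borel_closed open_Collect_less closed_Collect_le continuous_intros)
       auto
  finally show ?thesis .
qed

lemma measurable_vec_lambda [measurable (raw)]:
  fixes f :: "'a \<Rightarrow> 'n::finite \<Rightarrow> 'b::euclidean_space"
  assumes "\<And>i. (\<lambda>x. f x i) \<in> borel_measurable M"
  shows "(\<lambda>x. \<chi> i. f x i) \<in> borel_measurable M"
proof (subst borel_measurable_euclidean_space, intro ballI)
  fix b :: "'b^'n" assume "b \<in> Basis"
  have "(\<lambda>x. (\<chi> i. f x i) \<bullet> b) = (\<lambda>x. \<Sum>i\<in>UNIV. f x i \<bullet> (b $ i))" by (simp add: inner_vec_def)
  also have "\<dots> \<in> borel_measurable M" using assms by measurable
  finally show "(\<lambda>x. (\<chi> i. f x i) \<bullet> b) \<in> borel_measurable M" .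
qed

lemma measurable_vec_nth [measurable (raw)]:
  fixes f :: "'a \<Rightarrow> 'b::euclidean_space^'n"
  assumes "f \<in> borel_measurable M"
  shows "(\<lambda>x. f x $ i) \<in> borel_measurable M"
  by (rule measurable_compose[OF assms borel_measurable_continuous_onI])
    (intro continuous_intros)

lemma wrap_measurable [measurable]: "wrap \<in> borel_measurable borel"
  unfolding wrap_def[abs_def] lat_def by simp measurable

lemma sets_eta [simp, measurable_cong]: "sets eta = sets borel"
  by (simp add: eta_def)

lemma space_eta [simp]: "space eta = UNIV"
  by (simp add: eta_def)

lemma emeasure_Tcube: "emeasure lborel (Tcube :: (real^'n) set) = ennreal ((2 * pi) ^ CARD('n))"
proof -
  define l u :: "real^'n" where "l = (\<chi> i. - pi)" and "u = (\<chi> i. pi)"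
  have ib: "l \<bullet> b = - pi" "u \<bullet> b = pi" if "b \<in> Basis" for b
    using that by (auto simp: l_def u_def Basis_vec_def inner_axis)
  have le: "l \<bullet> b \<le> u \<bullet> b" if "b \<in> Basis" for b
    using ib[OF that] by simp
  have "(\<Prod>b\<in>Basis. (u - l) \<bullet> b) = (\<Prod>b\<in>(Basis :: (real^'n) set). 2 * pi)"
    by (intro prod.cong refl) (simp add: inner_diff_left ib)
  then have pr: "(\<Prod>b\<in>Basis. (u - l) \<bullet> b) = (2 * pi) ^ CARD('n)" by simp
  \<comment> \<open>The half-open cube is squeezed between the open and the closed box, whose
    volumes agree.\<close>
  have "box l u \<subseteq> Tcube" "Tcube \<subseteq> cbox l u"
    by (auto simp: mem_box_cart Tcube_def l_def u_def less_imp_le)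
  note sub = this
  have "emeasure lborel (box l u) \<le> emeasure lborel (Tcube :: (real^'n) set)"
    by (rule emeasure_mono[OF sub(1)]) simp
  moreover have "emeasure lborel (Tcube :: (real^'n) set) \<le> emeasure lborel (cbox l u)"
    by (rule emeasure_mono[OF sub(2)]) simp
  moreover have "emeasure lborel (box l u) = ennreal ((2 * pi) ^ CARD('n))"
    unfolding pr[symmetric] by (rule emeasure_lborel_box) (rule le)
  moreover have "emeasure lborel (cbox l u) = ennreal ((2 * pi) ^ CARD('n))"
    unfolding pr[symmetric] by (rule emeasure_lborel_cbox) (rule le)
  ultimately show ?thesis by (metis order_antisym)
qed

lemma emeasure_eta:
  assumes [measurable]: "A \<in> sets borel"
  shows "emeasure eta A = ennreal (1 / (2 * pi) ^ CARD('n)) * emeasure lborel (A \<inter> Tcube :: (real^'n) set)"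
proof -
  have "emeasure eta A = (\<integral>\<^sup>+x. ennreal (1 / (2 * pi) ^ CARD('n)) * indicator Tcube x * indicator A x \<partial>lborel)"
    unfolding eta_def by (subst emeasure_density) auto
  also have "\<dots> = (\<integral>\<^sup>+x. ennreal (1 / (2 * pi) ^ CARD('n)) * indicator (A \<inter> Tcube) x \<partial>lborel)"
    by (intro nn_integral_cong) (auto simp: indicator_def)
  also have "\<dots> = ennreal (1 / (2 * pi) ^ CARD('n)) * emeasure lborel (A \<inter> Tcube)"
    by (subst nn_integral_cmult_indicator) auto
  finally show ?thesis .
qed

lemma emeasure_eta_UNIV [simp]: "emeasure eta (UNIV :: (real^'n) set) = 1"
  by (subst emeasure_eta) (auto simp: emeasure_Tcube ennreal_mult[symmetric])

interpretation eta: finite_measure "eta :: (real^'n) measure"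
  by standard simp

interpretation eta2: pair_sigma_finite "eta :: (real^'n) measure" "eta :: (real^'n) measure" ..

interpretation eta2: finite_measure "eta \<Otimes>\<^sub>M eta :: ((real^'n) \<times> (real^'n)) measure"
  by (rule finite_measure_pair_measure) unfold_locales

lemma measure_eta_UNIV [simp]: "measure eta (UNIV :: (real^'n) set) = 1"
  by (simp add: measure_def)

text \<open>Invariance of Haar measure under translation and reflection. The cube is cut into
  countably many pieces \<open>S k\<close> according to the lattice vector that brings the image
  back; each piece is moved by one affine isometry onto \<open>S' k\<close>, and the
  \<open>S' k\<close> partition the target because that lattice vector is unique.\<close>

lemma distr_eta_wrap:
  fixes a :: "real^'n"
  assumes \<sigma>: "\<sigma> = 1 \<or> \<sigma> = (-1::real)"
  shows "distr eta borel (\<lambda>t. wrap (a + \<sigma> *\<^sub>R t)) = eta"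
proof (rule measure_eqI)
  fix A :: "(real^'n) set" assume "A \<in> sets (distr eta borel (\<lambda>t. wrap (a + \<sigma> *\<^sub>R t)))"
  then have A[measurable]: "A \<in> sets borel" by simp
  define A' where "A' = A \<inter> Tcube"
  have [measurable]: "A' \<in> sets borel" unfolding A'_def by measurable
  define S where "S k = {t \<in> Tcube. (a + lat k) + \<sigma> *\<^sub>R t \<in> A'}" for k
  define S' where "S' k = {y \<in> A'. \<sigma> *\<^sub>R (y - (a + lat k)) \<in> Tcube}" for k
  have Sm[measurable]: "S k \<in> sets borel" and S'm[measurable]: "S' k \<in> sets borel" for k
  proof -
    have "S k = Tcube \<inter> (\<lambda>t. (a + lat k) + \<sigma> *\<^sub>R t) -` A' \<inter> space borel" by (auto simp: S_def)
    also have "\<dots> = Tcube \<inter> ((\<lambda>t. (a + lat k) + \<sigma> *\<^sub>R t) -` A' \<inter> space borel)" by auto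
    also have "\<dots> \<in> sets borel"
      by (intro sets.Int Tcube_borel measurable_sets[of _ borel borel]) auto
    finally show "S k \<in> sets borel" .
    have "S' k = A' \<inter> ((\<lambda>y. \<sigma> *\<^sub>R (y - (a + lat k))) -` Tcube \<inter> space borel)" by (auto simp: S'_def)
    also have "\<dots> \<in> sets borel"
      by (intro sets.Int measurable_sets[of _ borel borel] Tcube_borel) auto
    finally show "S' k \<in> sets borel" .
  qed
  have \<sigma>0: "\<sigma> \<noteq> 0" "\<sigma> * \<sigma> = 1" using \<sigma> by auto
  have eqm: "emeasure lborel (S k) = emeasure lborel (S' k)" for k
  proof -
    let ?f = "\<lambda>t. (a + lat k) + \<sigma> *\<^sub>R t"
    have "lborel = density (distr lborel borel ?f) (\<lambda>_. \<bar>\<sigma>\<bar> ^ DIM(real^'n))"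
      by (rule lborel_affine[OF \<sigma>0(1)])
    then have "lborel = distr lborel borel ?f" using \<sigma> by (auto simp: density_1)
    then have "emeasure lborel (S' k) = emeasure (distr lborel borel ?f) (S' k)" by simp
    also have "\<dots> = emeasure lborel (?f -` S' k \<inter> space lborel)"
      by (subst emeasure_distr) auto
    also have "?f -` S' k \<inter> space lborel = S k"
      using \<sigma>0 by (auto simp: S_def S'_def)
    finally show ?thesis ..
  qed
  have wk: "wrap z \<in> A \<longleftrightarrow> (\<exists>k. z + lat k \<in> A')" for z
  proof
    assume "wrap z \<in> A"
    then have "wrap z \<in> A'" using wrap_Tcube[of z] by (simp add: A'_def)
    then show "\<exists>k. z + lat k \<in> A'" unfolding wrap_def by blast
  next
    assume "\<exists>k. z + lat k \<in> A'"
    then obtain k where k: "z + lat k \<in> A'" by blast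
    then have "z + lat k = wrap z"
      using ex1_lat_Tcube[of z] wrap_Tcube[of z] unfolding wrap_def A'_def by (metis IntD2)
    then show "wrap z \<in> A" using k by (simp add: A'_def)
  qed
  have U1: "{t. wrap (a + \<sigma> *\<^sub>R t) \<in> A} \<inter> Tcube = (\<Union>k. S k)"
    unfolding wk S_def by (auto simp: algebra_simps)
  have d1: "disjoint_family S"
    unfolding disjoint_family_on_def
  proof (intro ballI impI)
    fix k l :: "int^'n" assume "k \<noteq> l"
    show "S k \<inter> S l = {}"
    proof (rule ccontr)
      assume "S k \<inter> S l \<noteq> {}"
      then obtain t where "(a + \<sigma> *\<^sub>R t) + lat k \<in> Tcube" "(a + \<sigma> *\<^sub>R t) + lat l \<in> Tcube"
        by (auto simp: S_def A'_def algebra_simps)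
      then show False using ex1_lat_Tcube[of "a + \<sigma> *\<^sub>R t"] \<open>k \<noteq> l\<close> by blast
    qed
  qed
  have ex1: "\<exists>!k. \<sigma> *\<^sub>R (y - (a + lat k)) \<in> Tcube" for y
  proof -
    obtain m where m: "\<sigma> *\<^sub>R (y - a) + lat m \<in> Tcube" "\<And>m'. \<sigma> *\<^sub>R (y - a) + lat m' \<in> Tcube \<Longrightarrow> m' = m"
      using ex1_lat_Tcube[of "\<sigma> *\<^sub>R (y - a)"] by blast
    show ?thesis
    proof (cases "\<sigma> = 1")
      case True
      show ?thesis
      proof (rule ex1I[of _ "- m"])
        show "\<sigma> *\<^sub>R (y - (a + lat (- m))) \<in> Tcube" using m(1) True by (simp add: lat_minus algebra_simps)
        show "k = - m" if "\<sigma> *\<^sub>R (y - (a + lat k)) \<in> Tcube" for k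
          using m(2)[of "- k"] that True by (auto simp: lat_minus algebra_simps)
      qed
    next
      case False
      then have "\<sigma> = -1" using \<sigma> by auto
      then have "\<sigma> *\<^sub>R (y - (a + lat k)) = \<sigma> *\<^sub>R (y - a) + lat k" for k
        by (simp add: algebra_simps)
      then show ?thesis using ex1_lat_Tcube[of "\<sigma> *\<^sub>R (y - a)"] by simp
    qed
  qed
  have U2: "A' = (\<Union>k. S' k)" using ex1 unfolding S'_def by blast
  have d2: "disjoint_family S'"
    unfolding disjoint_family_on_def S'_def using ex1 by blast
  have "emeasure (distr eta borel (\<lambda>t. wrap (a + \<sigma> *\<^sub>R t))) A = emeasure eta {t. wrap (a + \<sigma> *\<^sub>R t) \<in> A}"
    by (subst emeasure_distr) (auto simp: vimage_def)
  also have "\<dots> = ennreal (1 / (2 * pi) ^ CARD('n)) * emeasure lborel ({t. wrap (a + \<sigma> *\<^sub>R t) \<in> A} \<inter> Tcube)"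
    by (subst emeasure_eta) auto
  also have "emeasure lborel ({t. wrap (a + \<sigma> *\<^sub>R t) \<in> A} \<inter> Tcube) = (\<integral>\<^sup>+k. emeasure lborel (S k) \<partial>count_space UNIV)"
    unfolding U1 by (rule emeasure_UN_countable) (auto simp: d1)
  also have "\<dots> = (\<integral>\<^sup>+k. emeasure lborel (S' k) \<partial>count_space UNIV)" by (simp add: eqm)
  also have "\<dots> = emeasure lborel A'"
    by (subst U2, rule emeasure_UN_countable[symmetric]) (auto simp: d2)
  finally show "emeasure (distr eta borel (\<lambda>t. wrap (a + \<sigma> *\<^sub>R t))) A = emeasure eta A"
    by (subst emeasure_eta) (auto simp: A'_def)
qed simp

lemma per1_lat:
  fixes g :: "real^'n \<Rightarrow> 'b"
  assumes "per1 g"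
  shows "g (x + lat k) = g x"
proof -
  have nat_shift: "g (x + real m *\<^sub>R shiftv i) = g x" for m x and i :: 'n
  proof (induction m arbitrary: x)
    case (Suc m)
    have "g (x + real (Suc m) *\<^sub>R shiftv i) = g ((x + real m *\<^sub>R shiftv i) + shiftv i)"
      by (simp add: algebra_simps)
    also have "\<dots> = g (x + real m *\<^sub>R shiftv i)" using assms by (simp only: per1_def)
    finally show ?case using Suc by simp
  qed simp
  have int_shift: "g (x + real_of_int m *\<^sub>R shiftv i) = g x" for m x and i :: 'n
  proof (cases "m \<ge> 0")
    case True
    then show ?thesis using nat_shift[of x "nat m" i] by simp
  next
    case False
    then have "real (nat (- m)) = - real_of_int m" by simp
    then show ?thesis using nat_shift[of "x + real_of_int m *\<^sub>R shiftv i" "nat (- m)" i] by simp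
  qed
  have "g (x + (\<Sum>i\<in>I. real_of_int (k $ i) *\<^sub>R shiftv i)) = g x" if "finite I" for I
    using that
  proof (induction I)
    case (insert i I)
    then show ?case
      using int_shift[of "x + (\<Sum>i\<in>I. real_of_int (k $ i) *\<^sub>R shiftv i)" "k $ i" i] by (simp add: add_ac)
  qed simp
  moreover have "lat k = (\<Sum>i\<in>UNIV. real_of_int (k $ i) *\<^sub>R shiftv i)"
    unfolding vec_eq_iff
  proof
    fix i
    have "(\<Sum>j\<in>UNIV. real_of_int (k $ j) *\<^sub>R shiftv j) $ i = (\<Sum>j\<in>UNIV. if j = i then 2 * pi * real_of_int (k $ j) else 0)"
      unfolding sum_component by (intro sum.cong) (auto simp: axis_def shiftv_def)
    then show "lat k $ i = (\<Sum>j\<in>UNIV. real_of_int (k $ j) *\<^sub>R shiftv j) $ i" by simp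
  qed
  ultimately show ?thesis by simp
qed

lemma per1_wrap: "per1 g \<Longrightarrow> g (wrap x) = g x"
  unfolding wrap_def by (rule per1_lat)

lemma eta_integral_affine:
  fixes g :: "real^'n \<Rightarrow> 'b::{banach, second_countable_topology}"
  assumes per: "per1 g" and [measurable]: "g \<in> borel_measurable borel" and \<sigma>: "\<sigma> = 1 \<or> \<sigma> = (-1::real)"
  shows "(\<integral>t. g (a + \<sigma> *\<^sub>R t) \<partial>eta) = (\<integral>t. g t \<partial>eta)"
proof -
  have "(\<integral>t. g t \<partial>eta) = (\<integral>t. g t \<partial>distr eta borel (\<lambda>t. wrap (a + \<sigma> *\<^sub>R t)))"
    by (simp add: distr_eta_wrap[OF \<sigma>])
  also have "\<dots> = (\<integral>t. g (wrap (a + \<sigma> *\<^sub>R t)) \<partial>eta)"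
    by (subst integral_distr) auto
  finally show ?thesis by (simp add: per1_wrap[OF per])
qed

lemma eta_nn_integral_affine:
  fixes g :: "real^'n \<Rightarrow> ennreal"
  assumes per: "per1 g" and [measurable]: "g \<in> borel_measurable borel" and \<sigma>: "\<sigma> = 1 \<or> \<sigma> = (-1::real)"
  shows "(\<integral>\<^sup>+t. g (a + \<sigma> *\<^sub>R t) \<partial>eta) = (\<integral>\<^sup>+t. g t \<partial>eta)"
proof -
  have "(\<integral>\<^sup>+t. g t \<partial>eta) = (\<integral>\<^sup>+t. g t \<partial>distr eta borel (\<lambda>t. wrap (a + \<sigma> *\<^sub>R t)))"
    by (simp add: distr_eta_wrap[OF \<sigma>])
  also have "\<dots> = (\<integral>\<^sup>+t. g (wrap (a + \<sigma> *\<^sub>R t)) \<partial>eta)"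
    by (subst nn_integral_distr) auto
  finally show ?thesis by (simp add: per1_wrap[OF per])
qed

abbreviation eta2 :: "((real^'n) \<times> (real^'n)) measure" where
  "eta2 \<equiv> eta \<Otimes>\<^sub>M eta"

lemma sets_eta2 [measurable_cong]: "sets (eta2 :: ((real^'n) \<times> (real^'n)) measure) = sets borel"
proof -
  have "sets (eta2 :: ((real^'n) \<times> (real^'n)) measure) = sets (borel \<Otimes>\<^sub>M borel)"
    by (intro sets_pair_measure_cong) auto
  then show ?thesis by (simp only: borel_prod)
qed

text \<open>Turns the Lebesgue integrals in \<open>sqnorm\<close> and \<open>ip\<close> into
  integrals against a product of probability measures, where Fubini is at hand.\<close>

lemma eta2_density: "(eta2 :: ((real^'n) \<times> (real^'n)) measure) =
  density lborel (\<lambda>z. ennreal (1 / (2 * pi) ^ (2 * CARD('n))) * indicator (Tcube \<times> Tcube) z)"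
proof -
  have c: "ennreal (1 / (2 * pi) ^ CARD('n)) * ennreal (1 / (2 * pi) ^ CARD('n)) = ennreal (1 / (2 * pi) ^ (2 * CARD('n)))"
  proof -
    have *: "ennreal (1 / x ^ m) * ennreal (1 / x ^ m) = ennreal (1 / x ^ (2 * m))" if "x > 0" for x :: real and m :: nat
      using that by (simp add: ennreal_mult[symmetric] mult_2 power_add)
    show ?thesis by (rule *) simp
  qed
  have sf: "sigma_finite_measure (density lborel (\<lambda>x::real^'n. ennreal (1 / (2 * pi) ^ CARD('n)) * indicator Tcube x))"
    using eta.sigma_finite_measure_axioms unfolding eta_def .
  let ?f = "\<lambda>x::real^'n. ennreal (1 / (2 * pi) ^ CARD('n)) * indicator Tcube x"
  have "(eta2 :: ((real^'n) \<times> (real^'n)) measure) = density (lborel \<Otimes>\<^sub>M lborel) (\<lambda>(x, y). ?f x * ?f y)"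
    unfolding eta_def by (rule pair_measure_density[OF _ _ lborel.sigma_finite_measure_axioms sf]) measurable
  also have "(\<lambda>(x, y). ?f x * ?f y) = (\<lambda>z. ennreal (1 / (2 * pi) ^ (2 * CARD('n))) * indicator (Tcube \<times> Tcube) z)"
    unfolding c[symmetric] by (simp add: fun_eq_iff indicator_def del: power_mult)
  finally show ?thesis unfolding lborel_prod .
qed

lemma integral_density_indicator:
  fixes g :: "'a \<Rightarrow> 'b::{banach, second_countable_topology}"
  assumes [measurable]: "g \<in> borel_measurable M" "A \<in> sets M" and c: "c \<ge> 0"
  shows "(\<integral>x. g x \<partial>density M (\<lambda>x. ennreal c * indicator A x)) = c *\<^sub>R set_lebesgue_integral M A g"
proof -
  have "density M (\<lambda>x. ennreal c * indicator A x) = density M (\<lambda>x. ennreal (c * indicator A x))"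
    by (intro arg_cong2[where f=density] refl ext) (auto simp: indicator_def)
  then have "(\<integral>x. g x \<partial>density M (\<lambda>x. ennreal c * indicator A x)) = (\<integral>x. (c * indicator A x) *\<^sub>R g x \<partial>M)"
    using c by (simp add: integral_density)
  also have "\<dots> = (\<integral>x. c *\<^sub>R (indicator A x *\<^sub>R g x) \<partial>M)" by simp
  finally show ?thesis unfolding set_lebesgue_integral_def by (simp only: integral_scaleR_right)
qed

lemma eta_int_eq:
  fixes g :: "real^'n \<Rightarrow> complex"
  assumes [measurable]: "g \<in> borel_measurable borel"
  shows "eta_int g = (\<integral>t. g t \<partial>eta)"
  unfolding eta_def eta_int_def by (subst integral_density_indicator) auto

lemma sqnorm_eq:
  fixes f :: "real^'n \<Rightarrow> real^'n \<Rightarrow> complex"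
  assumes [measurable]: "(\<lambda>z. f (fst z) (snd z)) \<in> borel_measurable borel"
  shows "sqnorm f = (\<integral>\<^sup>+z. ennreal ((cmod (f (fst z) (snd z)))\<^sup>2) \<partial>eta2)"
proof -
  have m[measurable]: "Tcube \<times> Tcube \<in> sets (borel :: ((real^'n) \<times> (real^'n)) measure)"
    unfolding borel_prod[symmetric] by measurable
  have "(\<integral>\<^sup>+z. ennreal ((cmod (f (fst z) (snd z)))\<^sup>2) \<partial>eta2) =
     (\<integral>\<^sup>+z. (ennreal (1 / (2 * pi) ^ (2 * CARD('n))) * indicator (Tcube \<times> Tcube) z) * ennreal ((cmod (f (fst z) (snd z)))\<^sup>2) \<partial>lborel)"
    unfolding eta2_density by (subst nn_integral_density) auto
  also have "\<dots> = (\<integral>\<^sup>+z. ennreal (1 / (2 * pi) ^ (2 * CARD('n))) * (ennreal ((cmod (f (fst z) (snd z)))\<^sup>2) * indicator (Tcube \<times> Tcube) z) \<partial>lborel)"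
    by (simp add: mult_ac)
  also have "\<dots> = sqnorm f"
    unfolding sqnorm_def by (subst nn_integral_cmult) auto
  finally show ?thesis by simp
qed

lemma measurable_cnj [measurable (raw)]:
  "f \<in> borel_measurable M \<Longrightarrow> (\<lambda>x. cnj (f x)) \<in> borel_measurable M"
  by (rule measurable_compose[OF _ borel_measurable_continuous_onI]) (auto intro!: continuous_intros)

lemma ip_eq:
  fixes f g :: "real^'n \<Rightarrow> real^'n \<Rightarrow> complex"
  assumes [measurable]: "(\<lambda>z. f (fst z) (snd z)) \<in> borel_measurable borel" "(\<lambda>z. g (fst z) (snd z)) \<in> borel_measurable borel"
  shows "ip f g = (\<integral>z. f (fst z) (snd z) * cnj (g (fst z) (snd z)) \<partial>eta2)"
proof -
  have m[measurable]: "Tcube \<times> Tcube \<in> sets (borel :: ((real^'n) \<times> (real^'n)) measure)"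
    unfolding borel_prod[symmetric] by measurable
  show ?thesis
    unfolding eta2_density ip_def by (subst integral_density_indicator) auto
qed

lemma AE_eta2I:
  assumes "AE z in lborel. P z"
  shows "AE z in (eta2 :: ((real^'n) \<times> (real^'n)) measure). P z"
proof -
  have m[measurable]: "Tcube \<times> Tcube \<in> sets (borel :: ((real^'n) \<times> (real^'n)) measure)"
    unfolding borel_prod[symmetric] by measurable
  show ?thesis unfolding eta2_density using assms by (subst AE_density) auto
qed

subsection \<open>The Faddeev kernel with real or complex parameters\<close>

definition cv :: "real^'n \<Rightarrow> ('a::{real_normed_field,euclidean_space})^'n" where
  "cv x = (\<chi> i. of_real (x $ i))"

lemma cv_nth [simp]: "cv x $ i = of_real (x $ i)"
  by (simp add: cv_def)

lemma cv_real [simp]: "cv x = (x :: real^'n)"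
  by (simp add: vec_eq_iff)

lemma cv_measurable [measurable]: "cv \<in> borel_measurable borel"
  unfolding cv_def[abs_def] by measurable

lemma eta_bounded:
  fixes f :: "real^'n \<Rightarrow> 'a::{banach, second_countable_topology}"
  assumes [measurable]: "f \<in> borel_measurable borel" and B: "\<And>t. norm (f t) \<le> B"
  shows "integrable eta f" "norm (\<integral>t. f t \<partial>eta) \<le> B"
proof -
  show i: "integrable eta f"
    by (rule eta.integrable_const_bound[where B=B]) (use B in auto)
  have "norm (\<integral>t. f t \<partial>eta) \<le> (\<integral>t. norm (f t) \<partial>(eta :: (real^'n) measure))"
    by (rule integral_norm_bound)
  also have "\<dots> \<le> (\<integral>t. B \<partial>(eta :: (real^'n) measure))"
    by (rule integral_mono) (use i B in \<open>auto intro: integrable_norm\<close>)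
  finally show "norm (\<integral>t. f t \<partial>eta) \<le> B" by simp
qed

lemma eta_mono:
  fixes f g :: "real^'n \<Rightarrow> real"
  assumes "f \<in> borel_measurable borel" "g \<in> borel_measurable borel"
    and "\<And>t. norm (f t) \<le> B" "\<And>t. norm (g t) \<le> B'" and "\<And>t. f t \<le> g t"
  shows "(\<integral>t. f t \<partial>eta) \<le> (\<integral>t. g t \<partial>eta)"
  using assms(5) by (intro integral_mono eta_bounded(1)[OF assms(1,3)] eta_bounded(1)[OF assms(2,4)])

text \<open>A number above the range of \<open>\<plusminus>Etot K\<close>: subtracting \<open>1 / (Mtop - z)\<close> from the resolvent keeps the
  kernel \<open>b\<close> below strictly positive.\<close>

definition Mtop :: "'n::finite itself \<Rightarrow> real" where
  "Mtop _ = 13 * real CARD('n)"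

text \<open>Both signs of the coupling are treated at once: \<open>s = 1\<close> for \<open>\<mu> < 0\<close> and \<open>s = -1\<close> for \<open>\<mu> > 0\<close>, with
  \<open>\<mu> = - s * \<kappa>\<close>, so that \<open>s\<close> times the Hamiltonian is \<open>W - \<kappa> * Vop\<close>. The constants below are polymorphic so that
  one definition serves real arguments and their complex neighbourhoods; the integration
  variable always runs over the real torus, embedded by \<open>cv\<close>.\<close>

locale boson =
  fixes s \<kappa> :: real
  assumes s: "s = 1 \<or> s = -1" and \<kappa>: "\<kappa> > 0"
begin

definition W :: "('a::{real_normed_field,euclidean_space})^'n \<Rightarrow> 'a^'n \<Rightarrow> 'a^'n \<Rightarrow> 'a" where
  "W k p t = of_real (2 * s) * (\<Sum>i\<in>UNIV. 3 - cos (k $ i - p $ i - t $ i) - cos (p $ i) - cos (t $ i))"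

text \<open>The free resolvent kernel. The next function, \<open>Dl\<close>, is the Fredholm
  determinant of the channel in which two particles interact while the third has quasi-momentum
  \<open>p\<close>.\<close>

definition R :: "('a::{real_normed_field,euclidean_space})^'n \<Rightarrow> 'a \<Rightarrow> 'a^'n \<Rightarrow> 'a^'n \<Rightarrow> 'a" where
  "R k z p t = 1 / (W k p t - z)"

definition Dl :: "('a::{real_normed_field,euclidean_space})^'n \<Rightarrow> 'a \<Rightarrow> 'a^'n \<Rightarrow> 'a" where
  "Dl k z p = 1 - of_real \<kappa> * (\<integral>t. R k z p (cv t) \<partial>eta)"

definition u :: "('a::{real_normed_field,euclidean_space})^'n \<Rightarrow> 'a \<Rightarrow> 'a^'n \<Rightarrow> 'a" where
  "u k z p = of_real (2 * \<kappa>) / Dl k z p"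

definition b :: "('a::{real_normed_field,euclidean_space})^'n \<Rightarrow> 'a \<Rightarrow> 'a^'n \<Rightarrow> 'a^'n \<Rightarrow> 'a" where
  "b k z p t = u k z p * (R k z p t - 1 / (of_real (Mtop TYPE('n)) - z))"

primrec h :: "('a::{real_normed_field,euclidean_space})^'n \<Rightarrow> 'a \<Rightarrow> nat \<Rightarrow> 'a^'n \<Rightarrow> 'a" where
  "h k z 0 p = u k z p"
| "h k z (Suc n) p = (\<integral>t. b k z p (cv t) * h k z n (cv t) \<partial>eta)"

lemma W_measurable [measurable (raw)]:
  fixes k :: "('a::{real_normed_field,euclidean_space})^'n"
  assumes [measurable]: "f \<in> borel_measurable N" "g \<in> borel_measurable N"
  shows "(\<lambda>x. W k (f x) (g x)) \<in> borel_measurable N"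
  unfolding W_def by measurable

lemma R_measurable [measurable (raw)]:
  fixes k :: "('a::{real_normed_field,euclidean_space})^'n"
  assumes [measurable]: "f \<in> borel_measurable N" "g \<in> borel_measurable N"
  shows "(\<lambda>x. R k z (f x) (g x)) \<in> borel_measurable N"
  unfolding R_def by measurable

lemma Dl_measurable [measurable (raw)]:
  fixes k :: "('a::{real_normed_field,euclidean_space})^'n"
  assumes [measurable]: "f \<in> borel_measurable N"
  shows "(\<lambda>x. Dl k z (f x)) \<in> borel_measurable N"
  unfolding Dl_def by measurable

lemma u_measurable [measurable (raw)]:
  fixes k :: "('a::{real_normed_field,euclidean_space})^'n"
  assumes [measurable]: "f \<in> borel_measurable N"
  shows "(\<lambda>x. u k z (f x)) \<in> borel_measurable N"
  unfolding u_def by measurable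

lemma b_measurable [measurable (raw)]:
  fixes k :: "('a::{real_normed_field,euclidean_space})^'n"
  assumes [measurable]: "f \<in> borel_measurable N" "g \<in> borel_measurable N"
  shows "(\<lambda>x. b k z (f x) (g x)) \<in> borel_measurable N"
  unfolding b_def by measurable

lemma h_measurable_borel: "h k z n \<in> borel_measurable borel"
proof (induction n)
  case 0
  show ?case by (simp add: fun_eq_iff[symmetric]) measurable
next
  case (Suc n)
  note [measurable] = Suc
  have "(\<lambda>p. \<integral>t. b k z p (cv t) * h k z n (cv t) \<partial>eta) \<in> borel_measurable borel" by measurable
  then show ?case by (simp add: fun_eq_iff)
qed

lemma h_measurable [measurable (raw)]:
  fixes k :: "('a::{real_normed_field,euclidean_space})^'n"
  assumes [measurable]: "f \<in> borel_measurable N"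
  shows "(\<lambda>x. h k z n (f x)) \<in> borel_measurable N"
  using measurable_compose[OF assms h_measurable_borel] .

text \<open>First of a chain up to \<open>h_cv\<close>: on embedded real arguments the complex
  instances are the embedded real ones. Through these equations holomorphy of the complex functions
  becomes information on the real ones.\<close>

lemma W_cv: "W (cv K) (cv p) (cv t) = (of_real (W K p t) :: complex)"
  by (simp add: W_def cos_of_real[symmetric] del: cos_of_real)

lemma R_cv: "R (cv K) (of_real z) (cv p) (cv t) = (of_real (R K z p t) :: complex)"
  by (simp add: R_def W_cv)

lemma Dl_cv: "Dl (cv K) (of_real z) (cv p) = (of_real (Dl K z p) :: complex)"
  by (simp add: Dl_def R_cv)

lemma u_cv: "u (cv K) (of_real z) (cv p) = (of_real (u K z p) :: complex)"
  by (simp add: u_def Dl_cv)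

lemma b_cv: "b (cv K) (of_real z) (cv p) (cv t) = (of_real (b K z p t) :: complex)"
  by (simp add: b_def u_cv R_cv)

lemma h_cv: "h (cv K) (of_real z) n (cv p) = (of_real (h K z n p) :: complex)"
proof (induction n arbitrary: p)
  case (Suc n)
  have "h (cv K) (of_real z) (Suc n) (cv p) = (\<integral>t. of_real (b K z p t * h K z n t) \<partial>eta :: complex)"
    by (simp add: Suc b_cv)
  also have "\<dots> = of_real (h K z (Suc n) p)" by (simp del: of_real_mult)
  finally show ?case .
qed (simp add: u_cv)

lemma W_eq_Etot: "W K p t = s * Etot K p t"
proof -
  have "Etot K p t = 2 * (\<Sum>i\<in>UNIV. 3 - cos (K $ i - p $ i - t $ i) - cos (p $ i) - cos (t $ i))"
    unfolding Etot_def eps_def distrib_left[symmetric] sum.distrib[symmetric]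
    by (intro arg_cong[where f="(*) 2"] sum.cong) auto
  then show ?thesis by (simp add: W_def)
qed

lemma W_swap: "W k p t = W k t p"
  unfolding W_def by (intro arg_cong2[where f="(*)"] sum.cong) (auto simp: algebra_simps)

text \<open>Exchange of the second and the third particle. With Haar invariance it makes two of the
  three terms in the mean of \<open>f\<close> equal, which is the origin of the factor 2 in
  \<open>u\<close>.\<close>

lemma W_third: "W k p (k - p - t) = W k p t"
  unfolding W_def by (intro arg_cong2[where f="(*)"] sum.cong) (auto simp: algebra_simps)

lemma abs_W_le: "\<bar>W (K :: real^'n) p t\<bar> \<le> 12 * real CARD('n)"
proof -
  have "0 \<le> 3 - cos (K $ i - p $ i - t $ i) - cos (p $ i) - cos (t $ i) \<and>
     3 - cos (K $ i - p $ i - t $ i) - cos (p $ i) - cos (t $ i) \<le> 6" for i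
    using cos_le_one[of "K $ i - p $ i - t $ i"] cos_le_one[of "p $ i"] cos_le_one[of "t $ i"]
      cos_ge_minus_one[of "K $ i - p $ i - t $ i"] cos_ge_minus_one[of "p $ i"] cos_ge_minus_one[of "t $ i"]
    by linarith
  then have "\<bar>\<Sum>i\<in>UNIV. 3 - cos (K $ i - p $ i - t $ i) - cos (p $ i) - cos (t $ i)\<bar> \<le> (\<Sum>i\<in>(UNIV :: 'n set). 6)"
    by (intro order_trans[OF sum_abs] sum_mono) (simp add: abs_le_iff)
  then show ?thesis using s by (auto simp: W_def)
qed

text \<open>The reason for the factor 13: \<open>12 * CARD('n)\<close> bounds the symbol, and one
  more \<open>CARD('n)\<close> leaves a gap of at least 1 under \<open>Mtop\<close>.\<close>

lemma W_less_Mtop: "W (K :: real^'n) p t \<le> Mtop TYPE('n) - 1"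
proof -
  have "1 \<le> real CARD('n)" by (simp add: Suc_leI)
  then show ?thesis using abs_W_le[of K p t] unfolding Mtop_def by linarith
qed

lemma cos_two_pi_shift: "cos (x + 2 * pi) = cos x" "cos (x - 2 * pi) = cos x" for x :: real
  using cos_periodic[of x] cos_periodic[of "x - 2 * pi"] by simp_all

lemma shiftv_nth: "shiftv i $ j = (if i = j then 2 * pi else 0)"
  by (simp add: shiftv_def axis_def)

lemma W_periodic:
  "W (K + shiftv i) p t = W K p t" "W K (p + shiftv i) t = W K p t" "W K p (t + shiftv i) = W K p t"
proof -
  have *: "cos (x + shiftv i $ j) = cos x" "cos (x - shiftv i $ j) = cos x" for x :: real and j
    by (auto simp: shiftv_nth cos_two_pi_shift)
  have 1: "K $ j + shiftv i $ j - p $ j - t $ j = (K $ j - p $ j - t $ j) + shiftv i $ j" for j by simp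
  have 2: "K $ j - (p $ j + shiftv i $ j) - t $ j = (K $ j - p $ j - t $ j) - shiftv i $ j" for j by simp
  have 3: "K $ j - p $ j - (t $ j + shiftv i $ j) = (K $ j - p $ j - t $ j) - shiftv i $ j" for j by simp
  show "W (K + shiftv i) p t = W K p t" "W K (p + shiftv i) t = W K p t" "W K p (t + shiftv i) = W K p t"
    unfolding W_def vector_add_component 1 2 3 * by simp_all
qed

text \<open>Sufficient for \<open>s * z\<close> to lie strictly beyond the essential spectrum.\<close>

definition valid :: "real^'n \<Rightarrow> real \<Rightarrow> bool" where
  "valid K z \<longleftrightarrow> (\<exists>c>0. (\<forall>p t. c \<le> W K p t - z) \<and> (\<forall>p. c \<le> Dl K z p))"

section \<open>Uniform perturbation of the symbol and the kernels under small complex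
  displacements\<close>

lemma inverse_close:
  fixes A A0 :: complex
  assumes c: "c > 0" "c \<le> norm A0" and d: "norm (A - A0) \<le> c / 2" "norm (A - A0) \<le> e * c\<^sup>2 / 2"
  shows "A \<noteq> 0" "norm (1 / A - 1 / A0) \<le> e"
proof -
  have A: "norm A \<ge> c / 2" using d(1) c(2) norm_triangle_ineq2[of A0 A] by (simp add: norm_minus_commute)
  then show A0: "A \<noteq> 0" using c by auto
  have nz: "A0 \<noteq> 0" using c by auto
  have "norm (1 / A - 1 / A0) = norm (A - A0) / (norm A * norm A0)"
    using A0 nz by (simp add: diff_frac_eq norm_divide norm_mult norm_minus_commute)
  also have "\<dots> \<le> (e * c\<^sup>2 / 2) / (c / 2 * c)"
    by (intro frac_le d mult_mono A c mult_pos_pos) (use c order_trans[OF norm_ge_zero d(2)] in auto)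
  also have "\<dots> = e" using c by (simp add: power2_eq_square)
  finally show "norm (1 / A - 1 / A0) \<le> e" .
qed

text \<open>By the addition theorem only \<open>cos w - 1\<close> and \<open>sin w\<close> of the
  displacement \<open>w\<close> matter, multiplied by cosines and sines of real numbers, which are
  at most 1. Hence one radius serves all real base points, although these form an unbounded
  set.\<close>

lemma W_close:
  assumes e: "e > 0"
  shows "\<exists>r>0. \<forall>(k :: complex^'n) P Q K p q. dist k (cv K) < r \<longrightarrow> dist P (cv p) < r \<longrightarrow> dist Q (cv q) < r \<longrightarrow>
    norm (W k P Q - of_real (W K p q)) \<le> e"
proof -
  \<comment> \<open>Three cosines per coordinate, each off by at most \<open>2 * e'\<close>, times
    the prefactor 2 of the symbol.\<close>
  define e' where "e' = e / (12 * real CARD('n))"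
  have e': "e' > 0" using e by (simp add: e'_def)
  obtain r1 where r1: "r1 > 0" "\<And>w::complex. norm w < r1 \<Longrightarrow> norm (cos w - 1) < e'"
    using isCont_cos[of "0::complex"] e' unfolding continuous_at_eps_delta by (auto simp: dist_norm)
  obtain r2 where r2: "r2 > 0" "\<And>w::complex. norm w < r2 \<Longrightarrow> norm (sin w) < e'"
    using isCont_sin[of "0::complex"] e' unfolding continuous_at_eps_delta by (auto simp: dist_norm)
  have cosd: "norm (cos (of_real y + w) - cos (complex_of_real y)) \<le> 2 * e'" if "norm w < r1" "norm w < r2" for w and y :: real
  proof -
    define x where "x = complex_of_real y"
    have nx: "norm (cos x) \<le> 1" "norm (sin x) \<le> 1"
      unfolding x_def cos_of_real sin_of_real by simp_all
    have "cos (x + w) - cos x = cos x * (cos w - 1) - sin x * sin w"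
      by (simp add: cos_add algebra_simps)
    also have "norm \<dots> \<le> norm (cos x) * norm (cos w - 1) + norm (sin x) * norm (sin w)"
      by (metis norm_mult norm_triangle_ineq4)
    also have "\<dots> \<le> 1 * e' + 1 * e'"
      using r1(2)[OF that(1)] r2(2)[OF that(2)] nx by (intro add_mono mult_mono) auto
    finally show ?thesis by (simp add: x_def)
  qed
  \<comment> \<open>The argument of the first cosine collects three displacements.\<close>
  define r where "r = min r1 r2 / 3"
  have r: "r > 0" "3 * r \<le> r1" "3 * r \<le> r2" using r1 r2 by (auto simp: r_def)
  have "norm (W k P Q - of_real (W K p q)) \<le> e"
    if k: "dist k (cv K) < r" and P: "dist P (cv p) < r" and Q: "dist Q (cv q) < r"
    for k P Q :: "complex^'n" and K p q
  proof -
    let ?f = "\<lambda>i. 3 - cos (k $ i - P $ i - Q $ i) - cos (P $ i) - cos (Q $ i)"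
    let ?g = "\<lambda>i. 3 - cos (complex_of_real (K $ i) - of_real (p $ i) - of_real (q $ i)) - cos (complex_of_real (p $ i)) - cos (complex_of_real (q $ i))"
    have "norm (?f i - ?g i) \<le> 6 * e'" for i
    proof -
      have ki: "norm (k $ i - of_real (K $ i)) < r" and Pi: "norm (P $ i - of_real (p $ i)) < r" and Qi: "norm (Q $ i - of_real (q $ i)) < r"
        using k P Q Finite_Cartesian_Product.norm_nth_le[of "k - cv K" i] Finite_Cartesian_Product.norm_nth_le[of "P - cv p" i] Finite_Cartesian_Product.norm_nth_le[of "Q - cv q" i]
        by (auto simp: dist_norm)
      define w where "w = (k $ i - of_real (K $ i)) - (P $ i - of_real (p $ i)) - (Q $ i - of_real (q $ i))"
      have w: "norm w < 3 * r"
        using ki Pi Qi norm_triangle_ineq4[of "k $ i - of_real (K $ i)" "P $ i - of_real (p $ i)"]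
          norm_triangle_ineq4[of "(k $ i - of_real (K $ i)) - (P $ i - of_real (p $ i))" "Q $ i - of_real (q $ i)"]
        unfolding w_def by linarith
      have 1: "norm (cos ((of_real (K $ i) - of_real (p $ i) - of_real (q $ i)) + w) - cos (complex_of_real (K $ i) - of_real (p $ i) - of_real (q $ i))) \<le> 2 * e'"
        using cosd[of w "K $ i - p $ i - q $ i"] w r by simp
      have 2: "norm (cos (of_real (p $ i) + (P $ i - of_real (p $ i))) - cos (complex_of_real (p $ i))) \<le> 2 * e'"
        by (rule cosd) (use Pi r in auto)
      have 3: "norm (cos (of_real (q $ i) + (Q $ i - of_real (q $ i))) - cos (complex_of_real (q $ i))) \<le> 2 * e'"
        by (rule cosd) (use Qi r in auto)
      have a: "(of_real (K $ i) - of_real (p $ i) - of_real (q $ i)) + w = k $ i - P $ i - Q $ i"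
        by (simp add: w_def)
      have eq: "?f i - ?g i = - (cos (k $ i - P $ i - Q $ i) - cos (complex_of_real (K $ i) - of_real (p $ i) - of_real (q $ i)))
         - (cos (P $ i) - cos (complex_of_real (p $ i))) - (cos (Q $ i) - cos (complex_of_real (q $ i)))" by simp
      have nt: "norm (- x - y - v) \<le> norm x + norm y + norm v" for x y v :: complex
        using norm_triangle_ineq4[of "- x - y" v] norm_triangle_ineq4[of "- x" y] by simp
      note 1 = 1[unfolded a]
      show ?thesis unfolding eq
        using order_trans[OF nt add_mono[OF add_mono[OF 1 2] 3]] by simp
    qed
    then have bd: "norm (\<Sum>i\<in>UNIV. ?f i - ?g i) \<le> (\<Sum>i\<in>(UNIV::'n set). 6 * e')" by (intro sum_norm_le)
    have c: "(\<Sum>i\<in>(UNIV::'n set). 6 * e') = 6 * e' * real CARD('n)" by simp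
    have S: "norm ((\<Sum>i\<in>UNIV. ?f i) - (\<Sum>i\<in>UNIV. ?g i)) \<le> 6 * e' * real CARD('n)"
      using bd unfolding c sum_subtractf[of ?f ?g] .
    have "W k P Q - of_real (W K p q) = of_real (2 * s) * ((\<Sum>i\<in>UNIV. ?f i) - (\<Sum>i\<in>UNIV. ?g i))"
      unfolding W_cv[symmetric] by (simp add: W_def right_diff_distrib)
    then have "norm (W k P Q - of_real (W K p q)) = 2 * norm ((\<Sum>i\<in>UNIV. ?f i) - (\<Sum>i\<in>UNIV. ?g i))"
      using s by (auto simp: norm_mult)
    also have "\<dots> \<le> e" using S by (simp add: e'_def)
    finally show ?thesis .
  qed
  then show ?thesis using r(1) by blast
qed

definition near :: "real \<Rightarrow> real^'n \<Rightarrow> real \<Rightarrow> complex^'n \<Rightarrow> complex \<Rightarrow> bool" where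
  "near r K0 z0 k z \<longleftrightarrow> dist k (cv K0) < r \<and> dist z (of_real z0) < r"

lemma near_mono: "near r K0 z0 k z \<Longrightarrow> r \<le> r' \<Longrightarrow> near r' K0 z0 k z"
  by (auto simp: near_def)

lemma R_close:
  fixes K0 :: "real^'n"
  assumes c: "c > 0" "\<And>p t. c \<le> W K0 p t - z0" and e: "e > 0"
  shows "\<exists>r>0. \<forall>k z P Q p q. near r K0 z0 k z \<longrightarrow> dist P (cv p) < r \<longrightarrow> dist Q (cv q) < r \<longrightarrow>
    W k P Q \<noteq> z \<and> norm (R k z P Q - of_real (R K0 z0 p q)) \<le> e"
proof -
  define d where "d = min (c / 2) (e * c\<^sup>2 / 2)"
  have d: "d > 0" "d \<le> c / 2" "d \<le> e * c\<^sup>2 / 2" using c e by (auto simp: d_def)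
  obtain r1 where r1: "r1 > 0" "\<And>(k :: complex^'n) P Q K p q. dist k (cv K) < r1 \<Longrightarrow> dist P (cv p) < r1 \<Longrightarrow> dist Q (cv q) < r1 \<Longrightarrow>
    norm (W k P Q - of_real (W K p q)) \<le> d / 2"
    using W_close[of "d/2"] d by (metis half_gt_zero)
  define r where "r = min r1 (d / 2)"
  have "W k P Q \<noteq> z \<and> norm (R k z P Q - of_real (R K0 z0 p q)) \<le> e"
    if n: "near r K0 z0 k z" and P: "dist P (cv p) < r" and Q: "dist Q (cv q) < r" for k z P Q p q
  proof -
    have "norm (W k P Q - of_real (W K0 p q)) \<le> d / 2"
      by (rule r1(2)) (use n P Q in \<open>auto simp: r_def near_def\<close>)
    moreover have "norm (z - of_real z0) \<le> d / 2" using n by (auto simp: near_def dist_norm r_def)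
    ultimately have nd: "norm ((W k P Q - z) - of_real (W K0 p q - z0)) \<le> d"
      using norm_triangle_ineq4[of "W k P Q - of_real (W K0 p q)" "z - of_real z0"]
      by (simp add: algebra_simps)
    have c0: "c \<le> norm (complex_of_real (W K0 p q - z0))"
      using c(2)[of p q] by (metis abs_ge_self norm_of_real order_trans)
    have "W k P Q - z \<noteq> 0" "norm (1 / (W k P Q - z) - 1 / of_real (W K0 p q - z0)) \<le> e"
      by (fact inverse_close[OF c(1) c0 order_trans[OF nd d(2)] order_trans[OF nd d(3)]])+
    then show ?thesis by (simp add: R_def)
  qed
  moreover have "r > 0" using r1 d by (simp add: r_def)
  ultimately show ?thesis by blast
qed

lemma Dl_close:
  fixes K0 :: "real^'n"
  assumes c: "c > 0" "\<And>p t. c \<le> W K0 p t - z0" and e: "e > 0"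
  shows "\<exists>r>0. \<forall>k z P p. near r K0 z0 k z \<longrightarrow> dist P (cv p) < r \<longrightarrow>
    norm (Dl k z P - of_real (Dl K0 z0 p)) \<le> e"
proof -
  obtain r where r: "r > 0" "\<And>k z P Q p q. near r K0 z0 k z \<Longrightarrow> dist P (cv p) < r \<Longrightarrow> dist Q (cv q) < r \<Longrightarrow>
    norm (R k z P Q - of_real (R K0 z0 p q)) \<le> e / \<kappa>"
    using R_close[OF c, of "e / \<kappa>"] e \<kappa> by (metis divide_pos_pos)
  have "norm (Dl k z P - of_real (Dl K0 z0 p)) \<le> e" if n: "near r K0 z0 k z" and P: "dist P (cv p) < r" for k z P p
  proof -
    have bd: "norm (R k z P (cv t) - of_real (R K0 z0 p t)) \<le> e / \<kappa>" for t
      by (rule r(2)[OF n P]) (use r(1) in simp)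
    have "\<bar>R K0 z0 p t\<bar> \<le> 1 / c" for t
      using c(2)[of p t] c(1) by (simp add: R_def divide_simps)
    then have i2: "integrable eta (\<lambda>t. of_real (R K0 z0 p t) :: complex)"
      by (intro eta_bounded(1)[where B="1 / c"]) auto
    have i3: "integrable eta (\<lambda>t. R k z P (cv t) - of_real (R K0 z0 p t))"
      by (rule eta_bounded(1)[OF _ bd]) measurable
    have i1: "integrable eta (\<lambda>t. R k z P (cv t))"
      using Bochner_Integration.integrable_add[OF i3 i2] by simp
    have "Dl k z P - of_real (Dl K0 z0 p) = - (of_real \<kappa> * (\<integral>t. R k z P (cv t) - of_real (R K0 z0 p t) \<partial>eta))"
      using i1 i2 by (simp add: Dl_def algebra_simps)
    also have "norm \<dots> = \<kappa> * norm (\<integral>t. R k z P (cv t) - of_real (R K0 z0 p t) \<partial>eta)"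
      using \<kappa> by (simp add: norm_mult)
    also have "\<dots> \<le> \<kappa> * (e / \<kappa>)"
      using \<kappa> by (intro mult_left_mono eta_bounded(2)[OF _ bd]) auto
    finally show ?thesis using \<kappa> by simp
  qed
  then show ?thesis using r(1) by blast
qed

lemma valid_less: "valid K z \<Longrightarrow> z < Mtop TYPE('n) - 1" for K :: "real^'n"
proof -
  assume "valid K z"
  then obtain c where "c > 0" "c \<le> W K 0 0 - z" by (auto simp: valid_def)
  then show ?thesis using W_less_Mtop[of K 0 0] by simp
qed

lemma kernel_close:
  fixes K0 :: "real^'n"
  assumes v: "valid K0 z0" and e: "e > 0"
  shows "\<exists>r>0. \<forall>k z P Q p q. near r K0 z0 k z \<longrightarrow> dist P (cv p) < r \<longrightarrow> dist Q (cv q) < r \<longrightarrow>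
    W k P Q \<noteq> z \<and> Dl k z P \<noteq> 0 \<and> of_real (Mtop TYPE('n)) - z \<noteq> 0 \<and>
    norm (R k z P Q - of_real (R K0 z0 p q)) \<le> e \<and>
    norm (u k z P - of_real (u K0 z0 p)) \<le> e \<and> norm (b k z P Q - of_real (b K0 z0 p q)) \<le> e"
proof -
  obtain c where c: "c > 0" "\<And>p t. c \<le> W K0 p t - z0" "\<And>p. c \<le> Dl K0 z0 p"
    using v by (auto simp: valid_def)
  \<comment> \<open>Product rule for \<open>b = u * x\<close>: the factor \<open>x\<close> is at
    most \<open>2 / c + 2\<close> and errs by \<open>2 * e1\<close>, the factor \<open>u\<close> is
    at most \<open>2 * \<kappa> / c\<close> and errs by \<open>e1\<close>, so the total error is
    below \<open>2 * X * e1\<close>.\<close>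
  define X where "X = (2 / c + 2) + 2 * \<kappa> / c + 1"
  have "0 \<le> 2 / c" "0 \<le> 2 * \<kappa> / c" using c \<kappa> by auto
  then have X: "X \<ge> 1" "X > 0" unfolding X_def by linarith+
  define e1 where "e1 = min 1 (e / (2 * X))"
  have e1: "e1 > 0" "e1 \<le> 1" "2 * X * e1 \<le> e" using e X
    by (auto simp: e1_def min_def field_simps)
  have e1e: "e1 \<le> e" using e1 X by (smt (verit) mult_le_cancel_right1)
  obtain r1 where r1: "r1 > 0" "\<And>k z P Q p q. near r1 K0 z0 k z \<Longrightarrow> dist P (cv p) < r1 \<Longrightarrow> dist Q (cv q) < r1 \<Longrightarrow>
    W k P Q \<noteq> z \<and> norm (R k z P Q - of_real (R K0 z0 p q)) \<le> e1"
    using R_close[OF c(1,2) e1(1)] by blast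
  define d where "d = min (c / 2) (e1 / (2 * \<kappa>) * c\<^sup>2 / 2)"
  have d: "d > 0" "d \<le> c / 2" "d \<le> e1 / (2 * \<kappa>) * c\<^sup>2 / 2" using c e1 \<kappa> by (auto simp: d_def)
  obtain r2 where r2: "r2 > 0" "\<And>k z P p. near r2 K0 z0 k z \<Longrightarrow> dist P (cv p) < r2 \<Longrightarrow>
    norm (Dl k z P - of_real (Dl K0 z0 p)) \<le> d"
    using Dl_close[OF c(1,2) d(1)] by blast
  define d' where "d' = min (c / 2) (e1 * c\<^sup>2 / 2)"
  have d': "d' > 0" "d' \<le> c / 2" "d' \<le> e1 * c\<^sup>2 / 2" using c e1 by (auto simp: d'_def)
  define r where "r = min r1 (min r2 d')"
  have r: "r > 0" "r \<le> r1" "r \<le> r2" "r \<le> d'" using r1 r2 d' by (auto simp: r_def)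
  have "W k P Q \<noteq> z \<and> Dl k z P \<noteq> 0 \<and> of_real (Mtop TYPE('n)) - z \<noteq> 0 \<and>
    norm (R k z P Q - of_real (R K0 z0 p q)) \<le> e \<and>
    norm (u k z P - of_real (u K0 z0 p)) \<le> e \<and> norm (b k z P Q - of_real (b K0 z0 p q)) \<le> e"
    if n: "near r K0 z0 k z" and P: "dist P (cv p) < r" and Q: "dist Q (cv q) < r" for k z P Q p q
  proof -
    have 1: "W k P Q \<noteq> z" "norm (R k z P Q - of_real (R K0 z0 p q)) \<le> e1"
      using r1(2)[OF near_mono[OF n r(2)], of P p Q q] P Q r by auto
    have nD: "norm (Dl k z P - of_real (Dl K0 z0 p)) \<le> d"
      using r2(2)[OF near_mono[OF n r(3)], of P p] P r by auto
    have cD: "c \<le> norm (complex_of_real (Dl K0 z0 p))"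
      using c(3)[of p] by (metis abs_ge_self norm_of_real order_trans)
    have 2: "Dl k z P \<noteq> 0" "norm (1 / Dl k z P - 1 / of_real (Dl K0 z0 p)) \<le> e1 / (2 * \<kappa>)"
      by (fact inverse_close[OF c(1) cD order_trans[OF nD d(2)] order_trans[OF nD d(3)]])+
    have 3: "norm (u k z P - of_real (u K0 z0 p)) \<le> e1"
    proof -
      have "u k z P - of_real (u K0 z0 p) = of_real (2 * \<kappa>) * (1 / Dl k z P - 1 / of_real (Dl K0 z0 p))"
        by (simp add: u_def right_diff_distrib)
      then have "norm (u k z P - of_real (u K0 z0 p)) = 2 * \<kappa> * norm (1 / Dl k z P - 1 / of_real (Dl K0 z0 p))"
        using \<kappa> by (simp add: norm_mult)
      also have "\<dots> \<le> 2 * \<kappa> * (e1 / (2 * \<kappa>))" using \<kappa> by (intro mult_left_mono 2) auto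
      finally show ?thesis using \<kappa> by simp
    qed
    let ?M = "Mtop TYPE('n)"
    have Mc: "c \<le> ?M - z0" using c(2)[of 0 0] W_less_Mtop[of K0 0 0] by simp
    have cM: "c \<le> norm (complex_of_real (?M - z0))" using Mc by (metis abs_ge_self norm_of_real order_trans)
    have nM: "norm ((of_real ?M - z) - of_real (?M - z0)) \<le> d'"
      using n r by (auto simp: near_def dist_norm norm_minus_commute)
    have 4: "of_real ?M - z \<noteq> 0" "norm (1 / (of_real ?M - z) - 1 / of_real (?M - z0)) \<le> e1"
      by (fact inverse_close[OF c(1) cM order_trans[OF nM d'(2)] order_trans[OF nM d'(3)]])+
    define x where "x = R k z P Q - 1 / (of_real ?M - z)"
    define x0 where "x0 = R K0 z0 p q - 1 / (?M - z0)"
    have xd: "norm (x - of_real x0) \<le> 2 * e1"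
    proof -
      have "x - of_real x0 = (R k z P Q - of_real (R K0 z0 p q)) - (1 / (of_real ?M - z) - 1 / of_real (?M - z0))"
        by (simp add: x_def x0_def)
      then show ?thesis using order_trans[OF norm_triangle_ineq4 add_mono[OF 1(2) 4(2)]] by simp
    qed
    have x0b: "\<bar>x0\<bar> \<le> 2 / c"
    proof -
      have "\<bar>R K0 z0 p q\<bar> \<le> 1 / c" using c(2)[of p q] c(1) by (simp add: R_def divide_simps)
      moreover have "\<bar>1 / (?M - z0)\<bar> \<le> 1 / c" using Mc c(1) by (simp add: divide_simps)
      ultimately show ?thesis
        unfolding x0_def using order_trans[OF abs_triangle_ineq4 add_mono] by fastforce
    qed
    have xb: "norm x \<le> 2 / c + 2"
      using xd x0b e1(2) norm_triangle_ineq2[of x "of_real x0"] by simp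
    have u0b: "\<bar>u K0 z0 p\<bar> \<le> 2 * \<kappa> / c"
      using c(3)[of p] c(1) \<kappa> by (simp add: u_def divide_simps)
    have "b k z P Q - of_real (b K0 z0 p q) = (u k z P - of_real (u K0 z0 p)) * x + of_real (u K0 z0 p) * (x - of_real x0)"
      by (simp add: b_def x_def x0_def algebra_simps)
    then have "norm (b k z P Q - of_real (b K0 z0 p q)) \<le> norm (u k z P - of_real (u K0 z0 p)) * norm x + \<bar>u K0 z0 p\<bar> * norm (x - of_real x0)"
      by (metis norm_mult norm_of_real norm_triangle_ineq)
    also have "\<dots> \<le> e1 * (2 / c + 2) + 2 * \<kappa> / c * (2 * e1)"
      using 3 xb u0b xd c \<kappa> e1 by (intro add_mono mult_mono) auto
    also have "\<dots> \<le> 2 * X * e1"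
    proof -
      have eq: "2 * X * e1 = (e1 * (2 / c + 2) + 2 * \<kappa> / c * (2 * e1)) + (2 / c + 4) * e1"
        unfolding X_def by (simp add: algebra_simps)
      have "0 \<le> (2 / c + 4) * e1" using c e1 by simp
      then show ?thesis unfolding eq by linarith
    qed
    also have "\<dots> \<le> e" by (rule e1)
    finally show ?thesis using 1 2(1) 3 4(1) e1e by auto
  qed
  then show ?thesis using r(1) by blast
qed

end

section \<open>Bounds and holomorphy of the kernels on a complex neighbourhood of the real
  torus\<close>

context boson
begin

definition nearv :: "real \<Rightarrow> complex^'n \<Rightarrow> bool" where
  "nearv r P \<longleftrightarrow> (\<exists>p. dist P (cv p) < r)"

lemma nearv_cv [simp]: "r > 0 \<Longrightarrow> nearv r (cv p)"
  by (auto simp: nearv_def intro!: exI[of _ p])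

lemma nearv_mono: "nearv r P \<Longrightarrow> r \<le> r' \<Longrightarrow> nearv r' P"
  unfolding nearv_def by (meson order_less_le_trans)

text \<open>Collects what holomorphy of all iterates requires: no vanishing denominator and one
  common bound, for parameters near \<open>(K0, z0)\<close> and momenta in a complex strip around
  the real ones.\<close>

definition good :: "real^'n \<Rightarrow> real \<Rightarrow> real \<Rightarrow> real \<Rightarrow> bool" where
  "good K0 z0 r C \<longleftrightarrow> r > 0 \<and> (\<forall>k z P Q. near r K0 z0 k z \<longrightarrow> nearv r P \<longrightarrow> nearv r Q \<longrightarrow>
    W k P Q \<noteq> z \<and> Dl k z P \<noteq> 0 \<and> of_real (Mtop TYPE('n)) - z \<noteq> 0 \<and>
    norm (R k z P Q) \<le> C \<and> norm (u k z P) \<le> C \<and> norm (b k z P Q) \<le> C)"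

lemma good_mono:
  assumes g: "good K0 z0 r' C" and r: "0 < r" "r \<le> r'"
  shows "good K0 z0 r C"
  unfolding good_def
proof (rule conjI[OF r(1)], intro allI impI, goal_cases)
  case (1 k z P Q)
  then show ?case
    using conjunct2[OF g[unfolded good_def], rule_format, of k z P Q] near_mono[OF 1(1) r(2)]
      nearv_mono[OF 1(2) r(2)] nearv_mono[OF 1(3) r(2)] by blast
qed

text \<open>Positivity of the kernel rests on two facts: \<open>R > 0\<close> gives
  \<open>Dl \<le> 1\<close> and so \<open>u \<ge> 2 * \<kappa>\<close>, while
  \<open>W \<le> Mtop\<close> keeps \<open>R\<close> above the subtracted constant.\<close>

lemma real_bounds:
  fixes K :: "real^'n"
  assumes c: "c > 0" "\<And>p t. c \<le> W K p t - z" "\<And>p. c \<le> Dl K z p"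
  shows "0 < R K z p t" "R K z p t \<le> 1 / c" "1 / (Mtop TYPE('n) - z) \<le> R K z p t" "Dl K z p \<le> 1"
    "2 * \<kappa> \<le> u K z p" "u K z p \<le> 2 * \<kappa> / c" "0 \<le> b K z p t" "b K z p t \<le> 2 * \<kappa> / c\<^sup>2"
proof -
  have R: "0 < R K z p t" "R K z p t \<le> 1 / c" for p t
    using c(2)[of p t] c(1) by (auto simp: R_def divide_simps)
  then show "0 < R K z p t" "R K z p t \<le> 1 / c" by auto
  have Mz: "Mtop TYPE('n) - z > 0" using c(1) c(2)[of 0 0] W_less_Mtop[of K 0 0] by simp
  show Rm: "1 / (Mtop TYPE('n) - z) \<le> R K z p t"
    unfolding R_def using c(1) c(2)[of p t] W_less_Mtop[of K p t] by (intro divide_left_mono) auto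
  have "0 \<le> (\<integral>t. R K z p (cv t) \<partial>eta)" using R by (intro Bochner_Integration.integral_nonneg) (auto intro: less_imp_le)
  then show D1: "Dl K z p \<le> 1" using \<kappa> by (simp add: Dl_def)
  have Dp: "Dl K z p > 0" using c(1) c(3)[of p] by linarith
  show u1: "2 * \<kappa> \<le> u K z p" using D1 Dp \<kappa> by (simp add: u_def field_simps)
  show u2: "u K z p \<le> 2 * \<kappa> / c" unfolding u_def using c(1) c(3)[of p] \<kappa> by (simp add: frac_le)
  show "0 \<le> b K z p t" unfolding b_def using u1 \<kappa> Rm by (intro mult_nonneg_nonneg) auto
  have "b K z p t \<le> (2 * \<kappa> / c) * (1 / c)" unfolding b_def
  proof (rule mult_mono)
    show "R K z p t - 1 / (of_real (Mtop TYPE('n)) - z) \<le> 1 / c"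
      using R(2)[of p t] Mz by (simp add: order_trans[OF diff_le_self])
        (smt (verit) divide_nonneg_pos)
  qed (use u2 \<kappa> c Rm in auto)
  then show "b K z p t \<le> 2 * \<kappa> / c\<^sup>2" by (simp add: power2_eq_square)
qed

lemma good_exists:
  fixes K0 :: "real^'n"
  assumes v: "valid K0 z0"
  shows "\<exists>r C. good K0 z0 r C"
proof -
  obtain c where c: "c > 0" "\<And>p t. c \<le> W K0 p t - z0" "\<And>p. c \<le> Dl K0 z0 p"
    using v by (auto simp: valid_def)
  note rb = real_bounds[OF c]
  obtain r where r: "r > 0" "\<And>k z P Q p q. near r K0 z0 k z \<Longrightarrow> dist P (cv p) < r \<Longrightarrow> dist Q (cv q) < r \<Longrightarrow>
    W k P Q \<noteq> z \<and> Dl k z P \<noteq> 0 \<and> of_real (Mtop TYPE('n)) - z \<noteq> 0 \<and>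
    norm (R k z P Q - of_real (R K0 z0 p q)) \<le> 1 \<and>
    norm (u k z P - of_real (u K0 z0 p)) \<le> 1 \<and> norm (b k z P Q - of_real (b K0 z0 p q)) \<le> 1"
    using kernel_close[OF v, of 1] by auto
  define C where "C = 1 + max (1 / c) (max (2 * \<kappa> / c) (2 * \<kappa> / c\<^sup>2))"
  have tri: "norm x \<le> C" if "norm (x - of_real y) \<le> 1" "0 \<le> y" "y \<le> C - 1" for x :: complex and y
    using that norm_triangle_ineq2[of x "of_real y"] by simp
  have "good K0 z0 r C"
    unfolding good_def
  proof (intro conjI allI impI)
    fix k z and P Q :: "complex^'n" assume n: "near r K0 z0 k z" and "nearv r P" "nearv r Q"
    then obtain p q where pq: "dist P (cv p) < r" "dist Q (cv q) < r" by (auto simp: nearv_def)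
    note * = r(2)[OF n pq]
    show "W k P Q \<noteq> z" "Dl k z P \<noteq> 0" "of_real (Mtop TYPE('n)) - z \<noteq> 0" using * by auto
    show "norm (R k z P Q) \<le> C"
      by (rule tri[of _ "R K0 z0 p q"]) (use * rb(1,2)[of p q] in \<open>auto simp: C_def\<close>)
    show "norm (u k z P) \<le> C"
      by (rule tri[of _ "u K0 z0 p"]) (use * rb(5,6)[of p] \<kappa> in \<open>auto simp: C_def\<close>)
    show "norm (b k z P Q) \<le> C"
      by (rule tri[of _ "b K0 z0 p q"]) (use * rb(7,8)[of p q] in \<open>auto simp: C_def\<close>)
  qed (rule r)
  then show ?thesis by blast
qed

lemma good_pos: "good K0 z0 r C \<Longrightarrow> r > 0"
  by (simp add: good_def)

lemma goodD:
  fixes K0 :: "real^'n"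
  assumes "good K0 z0 r C" "near r K0 z0 k z" "nearv r P" "nearv r Q"
  shows "W k P Q \<noteq> z" "Dl k z P \<noteq> 0" "of_real (Mtop TYPE('n)) - z \<noteq> 0"
    "norm (R k z P Q) \<le> C" "norm (u k z P) \<le> C" "norm (b k z P Q) \<le> C"
  using assms unfolding good_def by blast+

lemma good_C_nonneg:
  assumes "good K0 z0 r C" "near r K0 z0 k z"
  shows "C \<ge> 0"
proof -
  have "norm (u k z (cv 0)) \<le> C"
    by (rule goodD(5)[OF assms, where Q="cv 0"]) (use good_pos[OF assms(1)] in auto)
  then show ?thesis by (rule order_trans[OF norm_ge_zero])
qed

text \<open>No convergence is claimed; for fixed \<open>n\<close> this is the majorant that makes
  the integral defining the next iterate holomorphic.\<close>

lemma h_crude_bound: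
  assumes gd: "good K0 z0 r C" and n: "near r K0 z0 k z" and P: "nearv r P"
  shows "norm (h k z n P) \<le> C ^ Suc n"
  using P
proof (induction n arbitrary: P)
  case 0
  then show ?case using goodD(5)[OF gd n 0 0] by simp
next
  case (Suc n)
  have "norm (b k z P (cv t) * h k z n (cv t)) \<le> C * C ^ Suc n" for t
    unfolding norm_mult using good_pos[OF gd] good_C_nonneg[OF gd n]
    by (intro mult_mono goodD(6)[OF gd n Suc.prems] Suc.IH) auto
  then show ?case unfolding h.simps power_Suc[of C "Suc n"] by (intro eta_bounded(2)) measurable
qed

lemma holomorphic_W:
  assumes "curve U \<gamma>" "curve U \<pi>" "curve U \<rho>"
  shows "(\<lambda>x. W (\<gamma> x) (\<pi> x) (\<rho> x)) holomorphic_on U"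
  using assms unfolding W_def curve_def by (intro holomorphic_intros) auto

context
  fixes K0 :: "real^'n" and z0 r C :: real and U :: "complex set" and \<gamma> :: "complex \<Rightarrow> complex^'n" and \<zeta>
  assumes gd: "good K0 z0 r C" and U: "open U" and c\<gamma>: "curve U \<gamma>" and h\<zeta>: "\<zeta> holomorphic_on U"
    and nr: "\<And>x. x \<in> U \<Longrightarrow> near r K0 z0 (\<gamma> x) (\<zeta> x)"
begin

private lemma r_pos: "r > 0" by (rule good_pos[OF gd])

lemma holomorphic_R:
  assumes "curve U \<pi>" "\<And>x. x \<in> U \<Longrightarrow> nearv r (\<pi> x)" "curve U \<rho>" "\<And>x. x \<in> U \<Longrightarrow> nearv r (\<rho> x)"
  shows "(\<lambda>x. R (\<gamma> x) (\<zeta> x) (\<pi> x) (\<rho> x)) holomorphic_on U"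
  unfolding R_def
  by (intro holomorphic_intros holomorphic_W c\<gamma> h\<zeta> assms(1,3)) (use goodD(1)[OF gd nr assms(2) assms(4)] in auto)

lemma holomorphic_Dl:
  assumes p: "curve U \<pi>" "\<And>x. x \<in> U \<Longrightarrow> nearv r (\<pi> x)"
  shows "(\<lambda>x. Dl (\<gamma> x) (\<zeta> x) (\<pi> x)) holomorphic_on U"
proof -
  have "(\<lambda>x. \<integral>t. R (\<gamma> x) (\<zeta> x) (\<pi> x) (cv t) \<partial>(eta :: (real^'n) measure)) holomorphic_on U"
  proof (rule holomorphic_parametric_integral[OF U])
    show "finite_measure (eta :: (real^'n) measure)" by unfold_locales
    show "(\<lambda>x. R (\<gamma> x) (\<zeta> x) (\<pi> x) (cv t)) holomorphic_on U" for t
      by (rule holomorphic_R[OF p]) (use r_pos in auto)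
    show "norm (R (\<gamma> x) (\<zeta> x) (\<pi> x) (cv t)) \<le> C" if "x \<in> U" for x t
      by (rule goodD(4)[OF gd nr[OF that] p(2)[OF that]]) (use r_pos in auto)
    show "(\<lambda>t. R (\<gamma> x) (\<zeta> x) (\<pi> x) (cv t)) \<in> borel_measurable eta" for x
      by measurable
  qed
  then show ?thesis unfolding Dl_def by (intro holomorphic_intros)
qed

lemma holomorphic_u:
  assumes p: "curve U \<pi>" "\<And>x. x \<in> U \<Longrightarrow> nearv r (\<pi> x)"
  shows "(\<lambda>x. u (\<gamma> x) (\<zeta> x) (\<pi> x)) holomorphic_on U"
proof -
  have "Dl (\<gamma> x) (\<zeta> x) (\<pi> x) \<noteq> 0" if "x \<in> U" for x
    by (rule goodD(2)[OF gd nr[OF that] p(2)[OF that] p(2)[OF that]])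
  then show ?thesis unfolding u_def by (intro holomorphic_intros holomorphic_Dl p)
qed

lemma holomorphic_b:
  assumes "curve U \<pi>" "\<And>x. x \<in> U \<Longrightarrow> nearv r (\<pi> x)" "curve U \<rho>" "\<And>x. x \<in> U \<Longrightarrow> nearv r (\<rho> x)"
  shows "(\<lambda>x. b (\<gamma> x) (\<zeta> x) (\<pi> x) (\<rho> x)) holomorphic_on U"
proof -
  have "of_real (Mtop TYPE('n)) - \<zeta> x \<noteq> 0" if "x \<in> U" for x
    by (rule goodD(3)[OF gd nr[OF that] assms(2)[OF that] assms(4)[OF that]])
  then show ?thesis unfolding b_def
    by (intro holomorphic_intros holomorphic_u holomorphic_R h\<zeta> assms)
qed

lemma holomorphic_h:
  assumes p: "curve U \<pi>" "\<And>x. x \<in> U \<Longrightarrow> nearv r (\<pi> x)"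
  shows "(\<lambda>x. h (\<gamma> x) (\<zeta> x) n (\<pi> x)) holomorphic_on U"
  using p
proof (induction n arbitrary: \<pi>)
  case 0
  then show ?case by (simp add: holomorphic_u)
next
  case (Suc n)
  show ?case unfolding h.simps
  proof (rule holomorphic_parametric_integral[OF U])
    show "finite_measure (eta :: (real^'n) measure)" by unfold_locales
    show "(\<lambda>x. b (\<gamma> x) (\<zeta> x) (\<pi> x) (cv t) * h (\<gamma> x) (\<zeta> x) n (cv t)) holomorphic_on U" for t
      by (intro holomorphic_intros holomorphic_b Suc) (use r_pos in auto)
    show "norm (b (\<gamma> x) (\<zeta> x) (\<pi> x) (cv t) * h (\<gamma> x) (\<zeta> x) n (cv t)) \<le> C * C ^ Suc n" if "x \<in> U" for x t
      unfolding norm_mult using r_pos nr[OF that] good_C_nonneg[OF gd nr[OF that]]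
      by (intro mult_mono goodD(6)[OF gd] h_crude_bound[OF gd] Suc.prems that) auto
    show "(\<lambda>t. b (\<gamma> x) (\<zeta> x) (\<pi> x) (cv t) * h (\<gamma> x) (\<zeta> x) n (cv t)) \<in> borel_measurable eta" for x
      by measurable
  qed
qed

end

subsection \<open>The Neumann series\<close>

definition G :: "('a::{real_normed_field,euclidean_space})^'n \<Rightarrow> 'a \<Rightarrow> 'a^'n \<Rightarrow> 'a" where
  "G k z p = (\<Sum>n. h k z n p)"

text \<open>The sum \<open>G\<close> solves \<open>G = b G + u\<close>; it solves the Faddeev equation \<open>Dl * G = 2 * \<kappa> * \<integral> R G\<close> exactly
  when \<open>Dd = 1\<close>.\<close>

definition Dd :: "('a::{real_normed_field,euclidean_space})^'n \<Rightarrow> 'a \<Rightarrow> 'a" where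
  "Dd k z = (\<integral>t. G k z (cv t) \<partial>eta) / (of_real (Mtop TYPE('n)) - z)"

definition neumann :: "real^'n \<Rightarrow> real \<Rightarrow> real \<Rightarrow> real \<Rightarrow> real \<Rightarrow> bool" where
  "neumann K0 z0 r A \<theta> \<longleftrightarrow> 0 \<le> \<theta> \<and> \<theta> < 1 \<and> A \<ge> 0 \<and> (\<forall>k z P n. near r K0 z0 k z \<longrightarrow> nearv r P \<longrightarrow>
     norm (h k z n P) \<le> A * \<theta> ^ n)"

text \<open>A strict supersolution of the real kernel makes every nearby complex kernel a contraction in
  the weighted sup norm.\<close>

lemma neumann_near:
  fixes K0 :: "real^'n"
  assumes v: "valid K0 z0"
    and [measurable]: "g \<in> borel_measurable borel"
    and c0: "c0 > 0" "\<And>p. c0 \<le> u K0 z0 p" and gC: "\<And>p. g p \<le> Cg"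
    and fixg: "\<And>p. g p = (\<integral>t. b K0 z0 p t * g t \<partial>eta) + u K0 z0 p" and g0: "\<And>p. 0 \<le> g p"
  shows "\<exists>r A \<theta> C. good K0 z0 r C \<and> neumann K0 z0 r A \<theta>"
proof -
  obtain c where c: "c > 0" "\<And>p t. c \<le> W K0 p t - z0" "\<And>p. c \<le> Dl K0 z0 p"
    using v by (auto simp: valid_def)
  note rb = real_bounds[OF c]
  have Ig: "integrable eta (\<lambda>t. b K0 z0 p t * g t)" for p
  proof (rule eta_bounded(1)[where B="(2 * \<kappa> / c\<^sup>2) * Cg"])
    show "norm (b K0 z0 p t * g t) \<le> 2 * \<kappa> / c\<^sup>2 * Cg" for t
      unfolding norm_mult using rb(7,8)[of p t] g0[of t] gC[of t] \<kappa> by (intro mult_mono) auto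
  qed measurable
  have ig: "integrable eta g" by (rule eta_bounded(1)[where B=Cg]) (use g0 gC in auto)
  have gl: "c0 \<le> g p" for p
  proof -
    have "0 \<le> (\<integral>t. b K0 z0 p t * g t \<partial>eta)" using rb(7) g0 by (intro Bochner_Integration.integral_nonneg) auto
    then show ?thesis using fixg[of p] c0(2)[of p] by linarith
  qed
  have Cg: "Cg \<ge> c0" "Cg > 0" using gl[of 0] gC[of 0] c0 by auto
  \<comment> \<open>Since \<open>u \<ge> c0 \<ge> (c0 / Cg) * g\<close>, the equation for
    \<open>g\<close> says that the kernel maps \<open>g\<close> below
    \<open>\<theta>0 * g\<close>.\<close>
  define \<theta>0 where "\<theta>0 = 1 - c0 / Cg"
  have \<theta>0: "0 \<le> \<theta>0" "\<theta>0 < 1" using Cg c0 by (auto simp: \<theta>0_def)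
  have Bg: "(\<integral>t. b K0 z0 p t * g t \<partial>eta) \<le> \<theta>0 * g p" for p
  proof -
    have "c0 / Cg * g p \<le> c0 / Cg * Cg" using gC c0 Cg by (intro mult_left_mono) auto
    then have "c0 / Cg * g p \<le> c0" using Cg by simp
    then show ?thesis using fixg[of p] c0(2)[of p] by (simp add: \<theta>0_def left_diff_distrib)
  qed
  have half_less: "x > 0 \<Longrightarrow> x / 2 < x" for x :: real by simp
  \<comment> \<open>The perturbation raises the factor by \<open>e * Cg / c0\<close>; the second
    entry makes this at most half of the margin \<open>1 - \<theta>0 = c0 / Cg\<close>. The first
    entry serves the base case below.\<close>
  define e where "e = min c0 (c0 / Cg * c0 / (2 * Cg))"
  have e: "e > 0" "e \<le> c0" "e \<le> c0 / Cg * c0 / (2 * Cg)" using c0 Cg by (auto simp: e_def)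
  define \<theta> where "\<theta> = \<theta>0 + e * Cg / c0"
  have \<theta>: "0 \<le> \<theta>" "\<theta> < 1"
  proof -
    show "0 \<le> \<theta>" using \<theta>0 e c0 Cg by (simp add: \<theta>_def)
    have "e * Cg / c0 \<le> (c0 / Cg * c0 / (2 * Cg)) * Cg / c0" using e c0 Cg by (intro divide_right_mono mult_right_mono) auto
    also have "\<dots> = c0 / Cg / 2" using c0 Cg by (simp add: field_simps)
    also have "\<dots> < c0 / Cg" using divide_pos_pos[OF c0(1) Cg(2)] by (rule half_less)
    finally show "\<theta> < 1" by (simp add: \<theta>_def \<theta>0_def)
  qed
  obtain r1 where r1: "r1 > 0" "\<And>k z P Q p q. near r1 K0 z0 k z \<Longrightarrow> dist P (cv p) < r1 \<Longrightarrow> dist Q (cv q) < r1 \<Longrightarrow>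
    norm (u k z P - of_real (u K0 z0 p)) \<le> e \<and> norm (b k z P Q - of_real (b K0 z0 p q)) \<le> e"
    using kernel_close[OF v e(1)] by blast
  obtain r2 C where r2: "good K0 z0 r2 C" using good_exists[OF v] by blast
  define r where "r = min r1 r2"
  have r: "r > 0" "r \<le> r1" "r \<le> r2" using r1 r2 by (auto simp: r_def good_def)
  have gd: "good K0 z0 r C"
    using good_mono[OF r2 r(1,3)] .
  \<comment> \<open>Induction in the sup norm weighted by \<open>g\<close>. The 2 absorbs the
    perturbed source: \<open>u + e \<le> 2 * g\<close>, as \<open>u\<close> and \<open>e\<close> are
    both at most \<open>g\<close>.\<close>
  have main: "norm (h k z n P) \<le> 2 * \<theta> ^ n * g p" if n: "near r K0 z0 k z" and P: "dist P (cv p) < r" for k z n P p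
    using P
  proof (induction n arbitrary: P p)
    case 0
    have "norm (u k z P - of_real (u K0 z0 p)) \<le> e"
      using r1(2)[OF near_mono[OF n r(2)], of P p P p] 0 r by auto
    then have "norm (u k z P) \<le> u K0 z0 p + e"
      using norm_triangle_ineq2[of "u k z P" "of_real (u K0 z0 p)"] c0(2)[of p] c0(1) by simp
    moreover have "u K0 z0 p \<le> g p"
      using fixg[of p] Bochner_Integration.integral_nonneg[of "eta :: (real^'n) measure" "\<lambda>t. b K0 z0 p t * g t"] rb(7) g0 by auto
    ultimately show ?case using e(2) gl[of p] by simp
  next
    case (Suc n)
    have bb: "norm (b k z P (cv t)) \<le> b K0 z0 p t + e" for t
    proof -
      have "norm (b k z P (cv t) - of_real (b K0 z0 p t)) \<le> e"
        using r1(2)[OF near_mono[OF n r(2)], of P p "cv t" t] Suc.prems r r1 by auto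
      then show ?thesis
        using norm_triangle_ineq2[of "b k z P (cv t)" "of_real (b K0 z0 p t)"] rb(7)[of p t] by simp
    qed
    have hh: "norm (h k z n (cv t)) \<le> 2 * \<theta> ^ n * g t" for t by (rule Suc.IH) (use r in simp)
    have "norm (\<integral>t. b k z P (cv t) * h k z n (cv t) \<partial>eta) \<le> (\<integral>t. norm (b k z P (cv t) * h k z n (cv t)) \<partial>eta)"
      by (rule integral_norm_bound)
    also have "\<dots> \<le> (\<integral>t. 2 * \<theta> ^ n * (b K0 z0 p t * g t + e * g t) \<partial>eta)"
    proof (rule integral_mono')
      show "integrable eta (\<lambda>t. 2 * \<theta> ^ n * (b K0 z0 p t * g t + e * g t))"
        using Ig ig by (intro integrable_mult_right Bochner_Integration.integrable_add) auto
      show "norm (b k z P (cv t) * h k z n (cv t)) \<le> 2 * \<theta> ^ n * (b K0 z0 p t * g t + e * g t)" for t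
      proof -
        have "norm (b k z P (cv t) * h k z n (cv t)) \<le> (b K0 z0 p t + e) * (2 * \<theta> ^ n * g t)"
          unfolding norm_mult using bb hh rb(7)[of p t] e by (intro mult_mono) auto
        then show ?thesis by (simp add: algebra_simps)
      qed
      show "0 \<le> 2 * \<theta> ^ n * (b K0 z0 p t * g t + e * g t)" for t
        using \<theta> rb(7)[of p t] g0[of t] e by (intro mult_nonneg_nonneg add_nonneg_nonneg) auto
    qed
    also have "\<dots> = 2 * \<theta> ^ n * ((\<integral>t. b K0 z0 p t * g t \<partial>eta) + e * (\<integral>t. g t \<partial>eta))"
      using Ig ig by simp
    also have "\<dots> \<le> 2 * \<theta> ^ n * (\<theta>0 * g p + e * Cg)"
    proof -
      have "(\<integral>t. g t \<partial>eta) \<le> Cg" using eta_bounded(2)[of g Cg] g0 gC by (auto simp: abs_le_iff)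
      then show ?thesis using \<theta> e Bg by (intro mult_left_mono add_mono) auto
    qed
    also have "\<dots> \<le> 2 * \<theta> ^ n * (\<theta> * g p)"
    proof -
      have "e * Cg = e * Cg / c0 * c0" using c0 by simp
      also have "\<dots> \<le> e * Cg / c0 * g p" using gl e Cg c0 by (intro mult_left_mono) auto
      finally have "\<theta>0 * g p + e * Cg \<le> \<theta> * g p" by (simp add: \<theta>_def distrib_right)
      then show ?thesis using \<theta> by (intro mult_left_mono) auto
    qed
    finally show ?case by (simp add: mult_ac)
  qed
  have "neumann K0 z0 r (2 * Cg) \<theta>"
    unfolding neumann_def
  proof (intro conjI allI impI)
    fix k z n and P :: "complex^'n" assume n: "near r K0 z0 k z" and "nearv r P"
    then obtain p where "dist P (cv p) < r" by (auto simp: nearv_def)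
    then have "norm (h k z n P) \<le> 2 * \<theta> ^ n * g p" by (rule main[OF n])
    also have "\<dots> \<le> 2 * \<theta> ^ n * Cg" using \<theta> gC by (intro mult_left_mono) auto
    finally show "norm (h k z n P) \<le> 2 * Cg * \<theta> ^ n" by (simp add: mult_ac)
  qed (use \<theta> Cg in auto)
  then show ?thesis using gd by blast
qed

lemma neumann_summable:
  assumes nm: "neumann K0 z0 r A \<theta>" and n: "near r K0 z0 k z" and P: "nearv r P"
  shows "summable (\<lambda>n. norm (h k z n P))" "summable (\<lambda>n. h k z n P)" "norm (G k z P) \<le> A / (1 - \<theta>)"
proof -
  have b: "norm (h k z n P) \<le> A * \<theta> ^ n" for n using nm n P by (auto simp: neumann_def)
  have th: "0 \<le> \<theta>" "\<theta> < 1" using nm by (auto simp: neumann_def)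
  have sg: "(\<lambda>n. A * \<theta> ^ n) sums (A * (1 / (1 - \<theta>)))" using th by (intro sums_mult geometric_sums) auto
  show s: "summable (\<lambda>n. norm (h k z n P))"
    by (rule summable_comparison_test'[OF sums_summable[OF sg]]) (use b in auto)
  then show "summable (\<lambda>n. h k z n P)" by (rule summable_norm_cancel)
  have "norm (G k z P) \<le> (\<Sum>n. A * \<theta> ^ n)"
    unfolding G_def by (rule norm_suminf_le[OF b sums_summable[OF sg]])
  then show "norm (G k z P) \<le> A / (1 - \<theta>)" using sums_unique[OF sg] by simp
qed

lemma G_measurable [measurable (raw)]:
  fixes k :: "('a::{real_normed_field,euclidean_space})^'n"
  assumes [measurable]: "f \<in> borel_measurable N"
  shows "(\<lambda>x. G k z (f x)) \<in> borel_measurable N"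
  unfolding G_def by measurable

lemma holomorphic_G:
  fixes K0 :: "real^'n"
  assumes gd: "good K0 z0 r C" and nm: "neumann K0 z0 r A \<theta>" and U: "open U" and c\<gamma>: "curve U \<gamma>" and h\<zeta>: "\<zeta> holomorphic_on U"
    and nr: "\<And>x. x \<in> U \<Longrightarrow> near r K0 z0 (\<gamma> x) (\<zeta> x)"
    and p: "curve U \<pi>" "\<And>x. x \<in> U \<Longrightarrow> nearv r (\<pi> x)"
  shows "(\<lambda>x. G (\<gamma> x) (\<zeta> x) (\<pi> x)) holomorphic_on U"
proof (rule holomorphic_uniform_sequence[OF U])
  show "(\<lambda>x. \<Sum>n<m. h (\<gamma> x) (\<zeta> x) n (\<pi> x)) holomorphic_on U" for m
    by (intro holomorphic_intros holomorphic_h[OF gd U c\<gamma> h\<zeta> nr p])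
  fix x assume "x \<in> U"
  then obtain d where d: "d > 0" "cball x d \<subseteq> U" using U open_contains_cball by metis
  have "uniform_limit U (\<lambda>m x. \<Sum>n<m. h (\<gamma> x) (\<zeta> x) n (\<pi> x)) (\<lambda>x. G (\<gamma> x) (\<zeta> x) (\<pi> x)) sequentially"
    unfolding G_def
    by (rule Weierstrass_m_test[where M="\<lambda>n. A * \<theta> ^ n"])
      (use nm nr p(2) in \<open>auto simp: neumann_def intro!: summable_mult summable_geometric\<close>)
  then show "\<exists>d>0. cball x d \<subseteq> U \<and> uniform_limit (cball x d) (\<lambda>m x. \<Sum>n<m. h (\<gamma> x) (\<zeta> x) n (\<pi> x)) (\<lambda>x. G (\<gamma> x) (\<zeta> x) (\<pi> x)) sequentially"
    using d uniform_limit_on_subset by blast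
qed

lemma holomorphic_Dd:
  fixes K0 :: "real^'n"
  assumes gd: "good K0 z0 r C" and nm: "neumann K0 z0 r A \<theta>" and U: "open U" and c\<gamma>: "curve U \<gamma>" and h\<zeta>: "\<zeta> holomorphic_on U"
    and nr: "\<And>x. x \<in> U \<Longrightarrow> near r K0 z0 (\<gamma> x) (\<zeta> x)"
  shows "(\<lambda>x. Dd (\<gamma> x) (\<zeta> x)) holomorphic_on U"
proof -
  have r: "r > 0" using gd by (simp add: good_def)
  have "(\<lambda>x. \<integral>t. G (\<gamma> x) (\<zeta> x) (cv t) \<partial>(eta :: (real^'n) measure)) holomorphic_on U"
  proof (rule holomorphic_parametric_integral[OF U])
    show "finite_measure (eta :: (real^'n) measure)" by unfold_locales
    show "(\<lambda>x. G (\<gamma> x) (\<zeta> x) (cv t)) holomorphic_on U" for t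
      by (rule holomorphic_G[OF gd nm U c\<gamma> h\<zeta> nr]) (use r in auto)
    show "norm (G (\<gamma> x) (\<zeta> x) (cv t)) \<le> A / (1 - \<theta>)" if "x \<in> U" for x t
      by (rule neumann_summable(3)[OF nm nr[OF that]]) (use r in auto)
    show "(\<lambda>t. G (\<gamma> x) (\<zeta> x) (cv t)) \<in> borel_measurable eta" for x by measurable
  qed
  moreover have "of_real (Mtop TYPE('n)) - \<zeta> x \<noteq> 0" if "x \<in> U" for x
    using goodD(3)[OF gd nr[OF that], of "cv 0" "cv 0"] r by simp
  ultimately show ?thesis unfolding Dd_def by (intro holomorphic_intros h\<zeta>) auto
qed

lemma G_cv:
  fixes K :: "real^'n"
  assumes "summable (\<lambda>n. h K z n p)"
  shows "G (cv K) (of_real z) (cv p) = (of_real (G K z p) :: complex)"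
  unfolding G_def h_cv by (rule suminf_of_real[OF assms, symmetric])

end

subsection \<open>Divergence of the resolvent integral in dimension at most two\<close>

text \<open>The side length over \<open>2 * pi\<close> is below 1, so in dimension at most 2 the
  volume is at least its square. In this bound the boxes shrink by a factor 4 per step, which
  exactly compensates the growth \<open>4 ^ k\<close> of an inverse quadratic function.\<close>

lemma dyadic_box_measure:
  assumes d: "CARD('n::finite) \<le> 2"
  defines "B \<equiv> \<lambda>k. box (\<chi> i. (1/2) ^ Suc k) (\<chi> i. (1/2) ^ k) :: (real^'n) set"
  shows "measure eta (B k) \<ge> ((1/2) ^ Suc k / (2 * pi))\<^sup>2"
proof -
  define l v :: "real^'n" where "l = (\<chi> i. (1/2) ^ Suc k)" and "v = (\<chi> i. (1/2) ^ k)"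
  have p1: "(1/2::real) ^ k \<le> 1" by (simp add: power_le_one)
  have sub: "box l v \<subseteq> Tcube"
  proof
    fix x assume x: "x \<in> box l v"
    have "- pi < x $ i \<and> x $ i \<le> pi" for i
    proof -
      have "(1/2) ^ Suc k < x $ i" "x $ i < (1/2) ^ k" using x by (auto simp: mem_box_cart l_def v_def)
      moreover have "(0::real) < (1/2) ^ Suc k" by simp
      ultimately show ?thesis using p1 pi_gt3 by linarith
    qed
    then show "x \<in> Tcube" by (auto simp: Tcube_def)
  qed
  have ib: "l \<bullet> b = (1/2) ^ Suc k" "v \<bullet> b = (1/2) ^ k" if "b \<in> Basis" for b
    using that by (auto simp: l_def v_def Basis_vec_def inner_axis)
  have le: "l \<bullet> b \<le> v \<bullet> b" if "b \<in> Basis" for b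
    unfolding ib[OF that] by (rule power_decreasing) auto
  have pr: "(\<Prod>b\<in>Basis. (v - l) \<bullet> b) = (\<Prod>b\<in>(Basis :: (real^'n) set). (1/2) ^ Suc k)"
    by (intro prod.cong refl) (simp add: inner_diff_left ib)
  have "emeasure lborel (box l v) = ennreal (\<Prod>b\<in>Basis. (v - l) \<bullet> b)"
    by (rule emeasure_lborel_box) (rule le)
  then have "emeasure lborel (box l v) = ennreal (((1/2) ^ Suc k) ^ CARD('n))"
    unfolding pr by simp
  then have "emeasure eta (box l v) = ennreal (1 / (2 * pi) ^ CARD('n)) * ennreal (((1/2) ^ Suc k) ^ CARD('n))"
    using sub by (subst emeasure_eta) (auto simp: Int_absorb2)
  also have "\<dots> = ennreal (1 / (2 * pi) ^ CARD('n) * ((1/2) ^ Suc k) ^ CARD('n))"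
    by (rule ennreal_mult[symmetric]) auto
  finally have "measure eta (box l v) = 1 / (2 * pi) ^ CARD('n) * ((1/2) ^ Suc k) ^ CARD('n)"
    unfolding measure_def by (simp del: power_Suc)
  also have "\<dots> = ((1/2) ^ Suc k / (2 * pi)) ^ CARD('n)"
  proof -
    have "1 / x ^ n * y ^ n = (y / x) ^ n" for x y :: real and n by (simp add: power_divide)
    then show ?thesis .
  qed
  also have "\<dots> \<ge> ((1/2) ^ Suc k / (2 * pi))\<^sup>2"
  proof (rule power_decreasing[OF d])
    show "0 \<le> (1/2) ^ Suc k / (2 * pi)" by simp
    have "(1/2::real) ^ Suc k \<le> 1" by (rule power_le_one) auto
    then have "(1/2) ^ Suc k \<le> 2 * pi" using pi_gt3 by linarith
    then show "(1/2) ^ Suc k / (2 * pi) \<le> 1" by (simp add: divide_le_eq_1 del: power_Suc)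
  qed
  finally show ?thesis by (simp add: B_def l_def v_def)
qed

text \<open>Every dyadic box near the zero of the quadratic majorant contributes at least the same
  amount \<open>a\<close>, as long as \<open>\<delta>\<close> is smaller than the quadratic term on
  it. Taking \<open>m\<close> boxes gives \<open>m * a\<close>, and Haar invariance moves the zero
  to \<open>x0\<close>.\<close>

lemma resolvent_integral_diverges:
  fixes \<phi> :: "real^'n \<Rightarrow> real"
  assumes d: "CARD('n) \<le> 2"
    and per: "per1 \<phi>" and [measurable]: "\<phi> \<in> borel_measurable borel"
    and pos: "\<And>x. 0 \<le> \<phi> x" and C: "C > 0" "\<And>y. \<phi> (x0 + y) \<le> C * (norm y)\<^sup>2"
  shows "\<exists>\<delta>0>0. \<forall>\<delta>. 0 < \<delta> \<and> \<delta> \<le> \<delta>0 \<longrightarrow> N \<le> (\<integral>x. 1 / (\<phi> x + \<delta>) \<partial>eta)"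
proof -
  define B where "B k = (box (\<chi> i. (1/2) ^ Suc k) (\<chi> i. (1/2) ^ k) :: (real^'n) set)" for k :: nat
  have [measurable]: "B k \<in> sets borel" for k by (simp add: B_def)
  have indB: "integrable eta (indicator (B k) :: _ \<Rightarrow> real)" for k
    by (rule eta_bounded(1)[where B=1]) (auto simp: indicator_def)
  \<comment> \<open>This is the product of the height \<open>4 ^ k / (3 * C)\<close> and the volume
    bound \<open>((1/2) ^ Suc k / (2 * pi))\<^sup>2\<close>, where \<open>k\<close> cancels.\<close>
  define a where "a = 1 / (12 * C * (2 * pi)\<^sup>2)"
  have a: "a > 0" using C by (simp add: a_def)
  obtain m :: nat where m: "N \<le> real m * a"
    using reals_Archimedean3[OF a, rule_format, of N] by (auto intro: less_imp_le)
  \<comment> \<open>Keeps \<open>\<delta>\<close> below \<open>C * (1/4) ^ k\<close> on each of the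
    first \<open>m\<close> boxes.\<close>
  define \<delta>0 where "\<delta>0 = C * (1/4) ^ m"
  have disj: "j = k" if "x \<in> B j" "x \<in> B k" for x j k
  proof (rule ccontr)
    have *: False if "x \<in> B j" "x \<in> B k" "j < k" for j k
    proof -
      fix i :: 'n
      have "(1/2) ^ Suc j < x $ (SOME i. True)" "x $ (SOME i. True) < (1/2) ^ k"
        using that by (auto simp: B_def mem_box_cart)
      moreover have "(1/2::real) ^ k \<le> (1/2) ^ Suc j" by (rule power_decreasing) (use that in auto)
      ultimately show False by linarith
    qed
    assume "j \<noteq> k"
    then show False using * that by (meson linorder_neqE_nat)
  qed
  have "N \<le> (\<integral>x. 1 / (\<phi> x + \<delta>) \<partial>eta)" if \<delta>: "0 < \<delta>" "\<delta> \<le> \<delta>0" for \<delta>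
  proof -
    \<comment> \<open>On box \<open>k\<close> the squared norm is at most
      \<open>2 * (1/4) ^ k\<close> by the bound on the dimension; with the share of
      \<open>\<delta>\<close> this gives the denominator \<open>3 * C * (1/4) ^ k\<close>.\<close>
    define \<psi> where "\<psi> y = (\<Sum>k<m. 4 ^ k / (3 * C) * indicator (B k) y)" for y
    have le: "\<psi> y \<le> 1 / (\<phi> (x0 + y) + \<delta>)" for y
    proof (cases "\<exists>k<m. y \<in> B k")
      case True
      then obtain k where k: "k < m" "y \<in> B k" by blast
      have "\<psi> y = (\<Sum>j<m. if j = k then 4 ^ k / (3 * C) else 0)"
        unfolding \<psi>_def by (intro sum.cong) (use k disj in \<open>auto simp: indicator_def\<close>)
      then have eq: "\<psi> y = 4 ^ k / (3 * C)" using k by simp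
      have yi: "\<bar>y $ i\<bar> \<le> (1/2) ^ k" for i
      proof -
        have "(1/2) ^ Suc k < y $ i" "y $ i < (1/2) ^ k" using k by (auto simp: B_def mem_box_cart)
        moreover have "(0::real) < (1/2) ^ Suc k" by simp
        ultimately show ?thesis by linarith
      qed
      have "(norm y)\<^sup>2 = (\<Sum>i\<in>UNIV. (y $ i)\<^sup>2)"
        by (simp add: norm_vec_def L2_set_def sum_nonneg)
      also have "\<dots> \<le> (\<Sum>i\<in>(UNIV::'n set). (1/4) ^ k)"
      proof (rule sum_mono)
        fix i
        have "(y $ i)\<^sup>2 \<le> ((1/2) ^ k)\<^sup>2" using power_mono[OF yi[of i], of 2] by simp
        also have "((1/2::real) ^ k)\<^sup>2 = (1/4) ^ k" by (simp add: power2_eq_square power_mult_distrib[symmetric])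
        finally show "(y $ i)\<^sup>2 \<le> (1/4) ^ k" .
      qed
      also have "\<dots> \<le> 2 * (1/4) ^ k" using d by simp
      finally have ny: "(norm y)\<^sup>2 \<le> 2 * (1/4) ^ k" .
      have "(1/4::real) ^ m \<le> (1/4) ^ k" by (rule power_decreasing) (use k in auto)
      then have "\<delta> \<le> C * (1/4) ^ k" using \<delta>(2) C(1) unfolding \<delta>0_def by (meson mult_left_mono less_imp_le order_trans)
      moreover have "\<phi> (x0 + y) \<le> C * (2 * (1/4) ^ k)"
        using C(2)[of y] ny C(1) by (meson mult_left_mono less_imp_le order_trans)
      ultimately have "\<phi> (x0 + y) + \<delta> \<le> 3 * C * (1/4) ^ k" by linarith
      then have "1 / (3 * C * (1/4) ^ k) \<le> 1 / (\<phi> (x0 + y) + \<delta>)"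
        using pos[of "x0 + y"] \<delta> C by (intro divide_left_mono) auto
      then show ?thesis unfolding eq by (simp add: power_divide)
    next
      case False
      then have "\<psi> y = 0" unfolding \<psi>_def by (intro sum.neutral) (auto simp: indicator_def)
      then show ?thesis using pos[of "x0 + y"] \<delta> by simp
    qed
    have "real m * a \<le> (\<Sum>k<m. 4 ^ k / (3 * C) * measure eta (B k))"
    proof -
      have "a \<le> 4 ^ k / (3 * C) * measure eta (B k)" for k
      proof -
        have "a = 4 ^ k / (3 * C) * ((1/2) ^ Suc k / (2 * pi))\<^sup>2"
        proof -
          have "((1/2::real) ^ Suc k)\<^sup>2 = (1/4) ^ k / 4"
            by (simp add: power2_eq_square power_mult_distrib[symmetric])
          then show ?thesis using C by (simp add: a_def power_divide field_simps)
        qed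
        also have "\<dots> \<le> 4 ^ k / (3 * C) * measure eta (B k)"
          using dyadic_box_measure[OF d, of k] C by (intro mult_left_mono) (auto simp: B_def)
        finally show ?thesis .
      qed
      then have "(\<Sum>k<m. a) \<le> (\<Sum>k<m. 4 ^ k / (3 * C) * measure eta (B k))" by (intro sum_mono)
      then show ?thesis by simp
    qed
    also have "\<dots> = (\<integral>y. \<psi> y \<partial>eta)"
      unfolding \<psi>_def
      by (subst Bochner_Integration.integral_sum) (intro integrable_mult_right indB, simp)
    also have "\<dots> \<le> (\<integral>y. 1 / (\<phi> (x0 + 1 *\<^sub>R y) + \<delta>) \<partial>eta)"
    proof (rule integral_mono)
      show "integrable eta \<psi>" unfolding \<psi>_def by (intro Bochner_Integration.integrable_sum integrable_mult_right indB)
      show "integrable eta (\<lambda>y. 1 / (\<phi> (x0 + 1 *\<^sub>R y) + \<delta>))"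
      proof (rule eta_bounded(1))
        show "norm (1 / (\<phi> (x0 + 1 *\<^sub>R y) + \<delta>)) \<le> 1 / \<delta>" for y
          using pos[of "x0 + y"] \<delta> by (simp add: divide_simps)
      qed measurable
      show "\<psi> y \<le> 1 / (\<phi> (x0 + 1 *\<^sub>R y) + \<delta>)" for y using le by simp
    qed
    also have "\<dots> = (\<integral>x. 1 / (\<phi> x + \<delta>) \<partial>eta)"
      by (rule eta_integral_affine[of "\<lambda>x. 1 / (\<phi> x + \<delta>)"]) (use per in \<open>auto simp: per1_def\<close>)
    finally show ?thesis using m by linarith
  qed
  then show ?thesis using C(1) by (intro exI[of _ \<delta>0]) (auto simp: \<delta>0_def)
qed

subsection \<open>Second differences of the dispersion relation\<close>

lemma cos_first_difference: "\<bar>cos (x + h) - cos x\<bar> \<le> \<bar>h\<bar>" for x h :: real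
proof -
  have "norm (cos (x + h) - cos x) \<le> 1 * norm (x + h - x)"
    by (rule field_differentiable_bound[of UNIV cos "\<lambda>x. - sin x"])
      (auto intro!: DERIV_cos has_field_derivative_at_within)
  then show ?thesis by simp
qed

lemma cos_second_difference: "\<bar>cos (x + h) + cos (x - h) - 2 * cos x\<bar> \<le> h\<^sup>2" for x h :: real
proof -
  have "cos (x + h) + cos (x - h) - 2 * cos x = 2 * cos x * (cos h - 1)"
    by (simp add: cos_add cos_diff algebra_simps)
  also have "cos h = 1 - 2 * (sin (h / 2))\<^sup>2" using cos_double_sin[of "h / 2"] by simp
  finally have "\<bar>cos (x + h) + cos (x - h) - 2 * cos x\<bar> = 4 * (\<bar>cos x\<bar> * (sin (h / 2))\<^sup>2)"
    by (simp add: abs_mult)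
  also have "\<dots> \<le> 4 * (1 * (h / 2)\<^sup>2)"
    by (intro mult_left_mono mult_mono abs_cos_le_one abs_le_square_iff[THEN iffD1] abs_sin_x_le_abs_x) auto
  finally show ?thesis by (simp add: power2_eq_square)
qed

context boson
begin

lemma abs_minus_two_s: "\<bar>- 2 * s * x\<bar> = 2 * \<bar>x\<bar>" for x :: real
  using s by (auto simp: abs_mult)

lemma W_first_difference:
  fixes K :: "real^'n"
  shows "\<bar>W K (p + y) t - W K p t\<bar> \<le> 4 * real CARD('n) * norm y"
proof -
  define f where "f p i = 3 - cos (K $ i - p $ i - t $ i) - cos (p $ i) - cos (t $ i)" for p i
  have W: "W K p t = 2 * s * (\<Sum>i\<in>UNIV. f p i)" for p by (simp add: W_def f_def)
  have "W K (p + y) t - W K p t = 2 * s * (\<Sum>i\<in>UNIV. f (p + y) i - f p i)"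
    unfolding W sum_subtractf by (simp add: right_diff_distrib)
  also have "(\<Sum>i\<in>UNIV. f (p + y) i - f p i) = (\<Sum>i\<in>UNIV. - ((cos ((K $ i - p $ i - t $ i) + - y $ i) - cos (K $ i - p $ i - t $ i)) + (cos (p $ i + y $ i) - cos (p $ i))))"
    by (intro sum.cong refl) (simp add: f_def algebra_simps)
  also have "2 * s * \<dots> = - 2 * s * (\<Sum>i\<in>UNIV. (cos ((K $ i - p $ i - t $ i) + - y $ i) - cos (K $ i - p $ i - t $ i)) + (cos (p $ i + y $ i) - cos (p $ i)))"
    unfolding sum_negf by simp
  finally have eq: "W K (p + y) t - W K p t = - 2 * s * (\<Sum>i\<in>UNIV. (cos ((K $ i - p $ i - t $ i) + - y $ i) - cos (K $ i - p $ i - t $ i)) + (cos (p $ i + y $ i) - cos (p $ i)))" .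
  have "\<bar>W K (p + y) t - W K p t\<bar> = 2 * \<bar>\<Sum>i\<in>UNIV. (cos ((K $ i - p $ i - t $ i) + - y $ i) - cos (K $ i - p $ i - t $ i)) + (cos (p $ i + y $ i) - cos (p $ i))\<bar>"
    unfolding eq by (rule abs_minus_two_s)
  also have "\<dots> \<le> 2 * (\<Sum>i\<in>(UNIV :: 'n set). norm y + norm y)"
  proof (rule mult_left_mono, rule order_trans[OF sum_abs], rule sum_mono, rule order_trans[OF abs_triangle_ineq], rule add_mono)
    fix i
    show "\<bar>cos ((K $ i - p $ i - t $ i) + - y $ i) - cos (K $ i - p $ i - t $ i)\<bar> \<le> norm y"
      using order_trans[OF cos_first_difference, of "- y $ i" "norm y" "K $ i - p $ i - t $ i"] component_le_norm_cart[of y i] by simp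
    show "\<bar>cos (p $ i + y $ i) - cos (p $ i)\<bar> \<le> norm y"
      using order_trans[OF cos_first_difference, of "y $ i" "norm y" "p $ i"] component_le_norm_cart[of y i] by simp
  qed simp
  finally show ?thesis by simp
qed

text \<open>At a minimum the value at \<open>p - y\<close> is no smaller than at \<open>p\<close>,
  so the symmetric difference already dominates the increment towards \<open>p + y\<close>. This
  yields quadratic vanishing without derivatives, for \<open>W\<close> and, by way of
  \<open>R\<close>, for \<open>Dl\<close>.\<close>

lemma W_second_difference:
  fixes K :: "real^'n"
  shows "\<bar>W K (p + y) t + W K (p - y) t - 2 * W K p t\<bar> \<le> 4 * (norm y)\<^sup>2"
proof -
  let ?D = "\<lambda>x h. cos (x + h) + cos (x - h) - 2 * cos x"
  define f where "f p i = 3 - cos (K $ i - p $ i - t $ i) - cos (p $ i) - cos (t $ i)" for p i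
  have W: "W K p t = 2 * s * (\<Sum>i\<in>UNIV. f p i)" for p by (simp add: W_def f_def)
  have "W K (p + y) t + W K (p - y) t - 2 * W K p t = 2 * s * (\<Sum>i\<in>UNIV. f (p + y) i + f (p - y) i - 2 * f p i)"
    unfolding W sum.distrib sum_subtractf sum_distrib_left[symmetric] by (simp add: algebra_simps)
  also have "(\<Sum>i\<in>UNIV. f (p + y) i + f (p - y) i - 2 * f p i) =
      (\<Sum>i\<in>UNIV. - (?D (K $ i - p $ i - t $ i) (- y $ i) + ?D (p $ i) (y $ i)))"
    by (intro sum.cong refl) (simp add: f_def algebra_simps)
  also have "2 * s * \<dots> = - 2 * s * (\<Sum>i\<in>UNIV. ?D (K $ i - p $ i - t $ i) (- y $ i) + ?D (p $ i) (y $ i))"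
    unfolding sum_negf by simp
  finally have eq: "W K (p + y) t + W K (p - y) t - 2 * W K p t = - 2 * s * (\<Sum>i\<in>UNIV. ?D (K $ i - p $ i - t $ i) (- y $ i) + ?D (p $ i) (y $ i))" .
  have "\<bar>W K (p + y) t + W K (p - y) t - 2 * W K p t\<bar> = 2 * \<bar>\<Sum>i\<in>UNIV. ?D (K $ i - p $ i - t $ i) (- y $ i) + ?D (p $ i) (y $ i)\<bar>"
    unfolding eq by (rule abs_minus_two_s)
  also have "\<dots> \<le> 2 * (\<Sum>i\<in>UNIV. (- y $ i)\<^sup>2 + (y $ i)\<^sup>2)"
  proof (rule mult_left_mono, rule order_trans[OF sum_abs], rule sum_mono, rule order_trans[OF abs_triangle_ineq], rule add_mono)
  qed (rule cos_second_difference | simp)+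
  also have "\<dots> = 4 * (norm y)\<^sup>2"
    by (simp add: norm_vec_def L2_set_def sum_nonneg sum_distrib_left)
  finally show ?thesis .
qed

text \<open>From the exact identity \<open>1 / v = 1 / m + (m - v) / m\<^sup>2 + (m - v)\<^sup>2 /
  (m\<^sup>2 * v)\<close>: the linear terms combine to the second difference of the denominators,
  and the remainders are squares of first differences.\<close>

lemma inverse_second_difference:
  fixes x y m :: real
  assumes c: "c > 0" "c \<le> x" "c \<le> y" "c \<le> m"
  shows "\<bar>1 / x + 1 / y - 2 / m\<bar> \<le> \<bar>x + y - 2 * m\<bar> / c\<^sup>2 + ((m - x)\<^sup>2 + (m - y)\<^sup>2) / c ^ 3"
proof -
  have e: "1 / v - 1 / m = (m - v) / m\<^sup>2 + (m - v)\<^sup>2 / (m\<^sup>2 * v)" if "c \<le> v" for v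
    using c that by (simp add: divide_simps power2_eq_square) (simp add: algebra_simps)
  have "1 / x + 1 / y - 2 / m = (1 / x - 1 / m) + (1 / y - 1 / m)" by simp
  also have "\<dots> = (- (x + y - 2 * m)) / m\<^sup>2 + ((m - x)\<^sup>2 / (m\<^sup>2 * x) + (m - y)\<^sup>2 / (m\<^sup>2 * y))"
    unfolding e[OF c(2)] e[OF c(3)] by (simp add: diff_divide_distrib add_divide_distrib)
  finally have eq: "1 / x + 1 / y - 2 / m = (- (x + y - 2 * m)) / m\<^sup>2 + ((m - x)\<^sup>2 / (m\<^sup>2 * x) + (m - y)\<^sup>2 / (m\<^sup>2 * y))" .
  have m2: "c\<^sup>2 \<le> m\<^sup>2" using c by (intro power_mono) auto
  have q: "\<bar>(m - v)\<^sup>2 / (m\<^sup>2 * v)\<bar> \<le> (m - v)\<^sup>2 / c ^ 3" if "c \<le> v" for v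
  proof -
    have "c ^ 3 \<le> m\<^sup>2 * v" unfolding power3_eq_cube power2_eq_square[symmetric]
      using m2 that c by (intro mult_mono) (auto simp: power2_eq_square)
    then show ?thesis using c that by (simp add: abs_mult divide_left_mono)
  qed
  have A: "\<bar>(- (x + y - 2 * m)) / m\<^sup>2\<bar> \<le> \<bar>x + y - 2 * m\<bar> / c\<^sup>2"
    unfolding abs_divide abs_minus_cancel using m2 c by (simp add: divide_left_mono)
  show ?thesis unfolding eq add_divide_distrib[of "(m - x)\<^sup>2"]
    by (rule order_trans[OF abs_triangle_ineq add_mono[OF A order_trans[OF abs_triangle_ineq add_mono[OF q[OF c(2)] q[OF c(3)]]]]])
qed

lemma R_first_difference:
  fixes K :: "real^'n"
  assumes c: "c > 0" "\<And>p t. c \<le> W K p t - z"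
  shows "\<bar>R K z (p + y) t - R K z p t\<bar> \<le> 4 * real CARD('n) / c\<^sup>2 * norm y"
proof -
  have p: "0 < W K (p + y) t - z" "0 < W K p t - z" using c by (meson less_le_trans)+
  have "\<bar>R K z (p + y) t - R K z p t\<bar> = \<bar>W K (p + y) t - W K p t\<bar> / ((W K (p + y) t - z) * (W K p t - z))"
    using p by (simp add: R_def diff_frac_eq abs_mult abs_minus_commute)
  also have "\<dots> \<le> (4 * real CARD('n) * norm y) / (c * c)"
    using c p by (intro frac_le mult_mono W_first_difference) auto
  finally show ?thesis by (simp add: power2_eq_square)
qed

lemma R_second_difference:
  fixes K :: "real^'n"
  assumes c: "c > 0" "\<And>p t. c \<le> W K p t - z"
  shows "\<bar>R K z (p + y) t + R K z (p - y) t - 2 * R K z p t\<bar> \<le> (4 / c\<^sup>2 + 32 * (real CARD('n))\<^sup>2 / c ^ 3) * (norm y)\<^sup>2"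
proof -
  have "\<bar>R K z (p + y) t + R K z (p - y) t - 2 * R K z p t\<bar> \<le>
     \<bar>(W K (p + y) t - z) + (W K (p - y) t - z) - 2 * (W K p t - z)\<bar> / c\<^sup>2 +
     (((W K p t - z) - (W K (p + y) t - z))\<^sup>2 + ((W K p t - z) - (W K (p - y) t - z))\<^sup>2) / c ^ 3"
    using inverse_second_difference[OF c(1) c(2) c(2) c(2), of "p + y" t "p - y" t p t] by (simp add: R_def)
  also have "\<dots> \<le> (4 * (norm y)\<^sup>2) / c\<^sup>2 + ((4 * real CARD('n) * norm y)\<^sup>2 + (4 * real CARD('n) * norm y)\<^sup>2) / c ^ 3"
  proof (intro add_mono divide_right_mono)
    have *: "((W K p t - z) - (W K (p + y) t - z))\<^sup>2 \<le> (4 * real CARD('n) * norm y)\<^sup>2" for y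
      using W_first_difference[of K p y t] by (simp add: abs_le_square_iff[symmetric] abs_minus_commute abs_mult)
    show "((W K p t - z) - (W K (p + y) t - z))\<^sup>2 \<le> (4 * real CARD('n) * norm y)\<^sup>2" by (rule *)
    show "((W K p t - z) - (W K (p - y) t - z))\<^sup>2 \<le> (4 * real CARD('n) * norm y)\<^sup>2" using *[of "- y"] by simp
    show "\<bar>(W K (p + y) t - z) + (W K (p - y) t - z) - 2 * (W K p t - z)\<bar> \<le> 4 * (norm y)\<^sup>2"
      using W_second_difference[of K p y t] by (simp add: algebra_simps)
  qed (use c in auto)
  also have "\<dots> = (4 / c\<^sup>2 + 32 * (real CARD('n))\<^sup>2 / c ^ 3) * (norm y)\<^sup>2"
    by (simp add: power_mult_distrib distrib_right)
  finally show ?thesis .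
qed

end

context boson
begin

subsection \<open>Monotonicity in the spectral parameter\<close>

lemma R_mono:
  fixes K :: "real^'n"
  assumes "z' \<le> z" "z < W K p t"
  shows "R K z' p t \<le> R K z p t"
  unfolding R_def using assms by (intro divide_left_mono) auto

lemma R_lipschitz:
  fixes K :: "real^'n"
  assumes c: "c > 0" "c \<le> W K p t - z" and z: "z' \<le> z"
  shows "R K z p t - R K z' p t \<le> (z - z') / c\<^sup>2"
proof -
  have "R K z p t - R K z' p t = (z - z') / ((W K p t - z) * (W K p t - z'))"
    using c z by (simp add: R_def diff_frac_eq)
  also have "\<dots> \<le> (z - z') / (c * c)"
    using c z by (intro divide_left_mono mult_mono) auto
  finally show ?thesis by (simp add: power2_eq_square)
qed

lemma R_integrable:
  fixes K :: "real^'n"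
  assumes c: "c > 0" "\<And>t. c \<le> W K p t - z"
  shows "integrable eta (R K z p)" "0 \<le> R K z p t" "R K z p t \<le> 1 / c"
proof -
  show b: "0 \<le> R K z p t" "R K z p t \<le> 1 / c" for t
    using c(2)[of t] c(1) by (auto simp: R_def divide_simps)
  show "integrable eta (R K z p)"
    by (rule eta_bounded(1)[where B="1 / c"]) (use b in auto)
qed

lemma Dl_mono:
  fixes K :: "real^'n"
  assumes c: "c > 0" "\<And>t. c \<le> W K p t - z" and z: "z' \<le> z"
  shows "Dl K z p \<le> Dl K z' p" "Dl K z' p - Dl K z p \<le> \<kappa> * (z - z') / c\<^sup>2"
proof -
  have c': "c \<le> W K p t - z'" for t using c(2)[of t] z by linarith
  note i = R_integrable(1)[OF c] R_integrable(1)[OF c(1) c']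
  have "(\<integral>t. R K z' p t \<partial>eta) \<le> (\<integral>t. R K z p t \<partial>eta)"
  proof (rule integral_mono[OF i(2,1)])
    show "R K z' p t \<le> R K z p t" for t using c(2)[of t] c(1) z by (intro R_mono) auto
  qed
  then show "Dl K z p \<le> Dl K z' p" using \<kappa> by (simp add: Dl_def)
  have "(\<integral>t. R K z p t \<partial>eta) - (\<integral>t. R K z' p t \<partial>eta) = (\<integral>t. R K z p t - R K z' p t \<partial>eta)"
    using i by simp
  also have "\<dots> \<le> (\<integral>t. (z - z') / c\<^sup>2 \<partial>(eta :: (real^'n) measure))"
    using i R_lipschitz[OF c(1) c(2) z] by (intro integral_mono) auto
  finally have "(\<integral>t. R K z p t \<partial>eta) - (\<integral>t. R K z' p t \<partial>eta) \<le> (z - z') / c\<^sup>2" by simp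
  then have "\<kappa> * ((\<integral>t. R K z p t \<partial>eta) - (\<integral>t. R K z' p t \<partial>eta)) \<le> \<kappa> * ((z - z') / c\<^sup>2)"
    using \<kappa> by (intro mult_left_mono) auto
  then show "Dl K z' p - Dl K z p \<le> \<kappa> * (z - z') / c\<^sup>2"
    by (simp add: Dl_def right_diff_distrib)
qed

lemma valid_mono:
  fixes K :: "real^'n"
  assumes "valid K z" "z' \<le> z"
  shows "valid K z'"
proof -
  obtain c where c: "c > 0" "\<And>p t. c \<le> W K p t - z" "\<And>p. c \<le> Dl K z p"
    using assms(1) by (auto simp: valid_def)
  have "c \<le> W K p t - z'" for p t using c(2)[of p t] assms(2) by linarith
  then show ?thesis unfolding valid_def
    using c(1) order_trans[OF c(3) Dl_mono(1)[OF c(1) c(2) assms(2)]] by blast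
qed

lemma valid_open:
  fixes K :: "real^'n"
  assumes "valid K z"
  shows "\<exists>\<delta>>0. valid K (z + \<delta>)"
proof -
  obtain c where c: "c > 0" "\<And>p t. c \<le> W K p t - z" "\<And>p. c \<le> Dl K z p"
    using assms(1) by (auto simp: valid_def)
  \<comment> \<open>Half of the gap is sacrificed: the first entry protects \<open>W - z\<close>,
    and the second protects \<open>Dl\<close>, whose Lipschitz constant in \<open>z\<close> is
    \<open>\<kappa> / (c / 2)\<^sup>2\<close>.\<close>
  define \<delta> where "\<delta> = min (c / 2) ((c / 2)\<^sup>2 * (c / 2) / \<kappa>)"
  have \<delta>: "\<delta> > 0" "\<delta> \<le> c / 2" "\<delta> \<le> (c / 2)\<^sup>2 * (c / 2) / \<kappa>" using c \<kappa> by (auto simp: \<delta>_def)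
  have g: "c / 2 \<le> W K p t - (z + \<delta>)" for p t using c(2)[of p t] \<delta> by linarith
  have "c / 2 \<le> Dl K (z + \<delta>) p" for p
  proof -
    have "Dl K z p - Dl K (z + \<delta>) p \<le> \<kappa> * ((z + \<delta>) - z) / (c / 2)\<^sup>2"
      by (rule Dl_mono(2)) (use c g \<delta> in auto)
    also have "\<dots> = \<kappa> * \<delta> / (c / 2)\<^sup>2" by simp
    also have "\<dots> \<le> \<kappa> * ((c / 2)\<^sup>2 * (c / 2) / \<kappa>) / (c / 2)\<^sup>2"
      using \<delta>(3) \<kappa> by (intro divide_right_mono mult_left_mono) auto
    also have "\<dots> = c / 2" using c \<kappa> by (simp add: field_simps)
    finally show ?thesis using c(3)[of p] by linarith
  qed
  then show ?thesis using \<delta>(1) g c(1) unfolding valid_def by (intro exI[of _ \<delta>] conjI exI[of _ "c/2"]) auto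
qed

lemma valid_bounds:
  fixes K :: "real^'n"
  assumes "valid K z"
  obtains C where "C > 0" "\<And>p. 2 * \<kappa> \<le> u K z p" "\<And>p. u K z p \<le> C" "\<And>p t. 0 \<le> b K z p t" "\<And>p t. b K z p t \<le> C"
    "z < Mtop TYPE('n)"
proof -
  obtain c where c: "c > 0" "\<And>p t. c \<le> W K p t - z" "\<And>p. c \<le> Dl K z p"
    using assms(1) by (auto simp: valid_def)
  note rb = real_bounds[OF c]
  show ?thesis
  proof (rule that[of "max (2 * \<kappa> / c) (2 * \<kappa> / c\<^sup>2)"])
    show "u K z p \<le> max (2 * \<kappa> / c) (2 * \<kappa> / c\<^sup>2)" for p using rb(6)[of p] by simp
    show "b K z p t \<le> max (2 * \<kappa> / c) (2 * \<kappa> / c\<^sup>2)" for p t using rb(8)[of p t] by simp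
    show "z < Mtop TYPE('n)" using valid_less[OF assms] by simp
  qed (use rb c \<kappa> in \<open>auto simp: less_max_iff_disj\<close>)
qed

lemma h_nonneg_bounded:
  fixes K :: "real^'n"
  assumes "valid K z"
  shows "0 \<le> h K z n p" "integrable eta (h K z n)" "integrable eta (\<lambda>t. b K z p t * h K z n t)"
proof -
  obtain C where C: "C > 0" "\<And>p. 2 * \<kappa> \<le> u K z p" "\<And>p. u K z p \<le> C" "\<And>p t. 0 \<le> b K z p t" "\<And>p t. b K z p t \<le> C"
    using valid_bounds[OF assms] by metis
  have *: "0 \<le> h K z n p \<and> h K z n p \<le> C ^ Suc n" for n p
  proof (induction n arbitrary: p)
    case 0
    have "0 \<le> u K z p" using C(2)[of p] \<kappa> by linarith
    then show ?case using C(3) by simp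
  next
    case (Suc n)
    have nb: "norm (b K z p t * h K z n t) \<le> C * C ^ Suc n" for t
      unfolding norm_mult using C Suc by (intro mult_mono) auto
    have "norm (\<integral>t. b K z p t * h K z n t \<partial>eta) \<le> C * C ^ Suc n"
      by (rule eta_bounded(2)[OF _ nb]) measurable
    moreover have "0 \<le> (\<integral>t. b K z p t * h K z n t \<partial>eta)"
      using C Suc by (intro Bochner_Integration.integral_nonneg) auto
    ultimately show ?case by simp
  qed
  then show "0 \<le> h K z n p" by blast
  show "integrable eta (h K z n)"
    by (rule eta_bounded(1)[where B="C ^ Suc n"]) (use * in \<open>auto simp del: power_Suc\<close>)
  show "integrable eta (\<lambda>t. b K z p t * h K z n t)"
  proof (rule eta_bounded(1)[where B="C * C ^ Suc n"])
    show "norm (b K z p t * h K z n t) \<le> C * C ^ Suc n" for t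
      unfolding norm_mult using C * by (intro mult_mono) auto
  qed measurable
qed

text \<open>The subtracted constant also grows with \<open>z\<close>, but more slowly than
  \<open>R\<close>, because its denominator \<open>Mtop - z\<close> is larger than
  \<open>W - z\<close>. Hence \<open>b\<close> increases, and with it every iterate.\<close>

lemma h_mono:
  fixes K :: "real^'n"
  assumes v: "valid K z" and z: "z' \<le> z"
  shows "h K z' n p \<le> h K z n p"
proof -
  have v': "valid K z'" by (rule valid_mono[OF v z])
  obtain c where c: "c > 0" "\<And>p t. c \<le> W K p t - z" "\<And>p. c \<le> Dl K z p"
    using v by (auto simp: valid_def)
  have um: "u K z' p \<le> u K z p" for p
    unfolding u_def using c(1) c(3)[of p] \<kappa> order_trans[OF c(3)[of p] Dl_mono(1)[OF c(1) c(2) z]]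
    by (intro divide_left_mono Dl_mono(1)[OF c(1) c(2) z]) auto
  have bm: "b K z' p t \<le> b K z p t" for p t
  proof -
    let ?M = "Mtop TYPE('n)"
    have M: "W K p t \<le> ?M" using W_less_Mtop[of K p t] by simp
    have gap: "0 < W K p t - z" using c(1) c(2)[of p t] by linarith
    have "1 / (?M - z) - 1 / (?M - z') = (z - z') / ((?M - z) * (?M - z'))"
      using gap M z by (simp add: diff_frac_eq)
    also have "\<dots> \<le> (z - z') / ((W K p t - z) * (W K p t - z'))"
      using gap M z by (intro divide_left_mono mult_mono) auto
    also have "\<dots> = R K z p t - R K z' p t" using gap z by (simp add: R_def diff_frac_eq)
    finally have "R K z' p t - 1 / (?M - z') \<le> R K z p t - 1 / (?M - z)" by linarith
    moreover have "1 / (?M - z') \<le> R K z' p t" using real_bounds(3)[of c K z'] c v'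
      unfolding R_def using gap z M by (intro divide_left_mono) auto
    moreover have "0 \<le> u K z p" using real_bounds(5)[OF c, of p] \<kappa> by linarith
    ultimately show ?thesis unfolding b_def using um[of p] by (intro mult_mono) auto
  qed
  show ?thesis
  proof (induction n arbitrary: p)
    case 0 then show ?case using um by simp
  next
    case (Suc n)
    obtain C where C: "\<And>p t. 0 \<le> b K z p t" using valid_bounds[OF v] by metis
    show ?case unfolding h.simps cv_real
      by (rule integral_mono[OF h_nonneg_bounded(3)[OF v'] h_nonneg_bounded(3)[OF v]])
        (intro mult_mono bm Suc C h_nonneg_bounded(1)[OF v'])
  qed
qed

text \<open>Equivalently \<open>Dd K z \<le> 1\<close>, stated through partial sums since \<open>G\<close> need not converge a priori.\<close>

definition subcritical :: "real^'n \<Rightarrow> real \<Rightarrow> bool" where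
  "subcritical K z \<longleftrightarrow> valid K z \<and> (\<forall>N. (\<Sum>n<N. \<integral>t. h K z n t \<partial>eta) \<le> Mtop TYPE('n) - z)"

lemma subcritical_mono:
  fixes K :: "real^'n"
  assumes "subcritical K z" "z' \<le> z"
  shows "subcritical K z'"
proof -
  have v: "valid K z" using assms by (simp add: subcritical_def)
  have v': "valid K z'" by (rule valid_mono[OF v assms(2)])
  have "(\<Sum>n<N. \<integral>t. h K z' n t \<partial>eta) \<le> Mtop TYPE('n) - z'" for N
  proof -
    have "(\<Sum>n<N. \<integral>t. h K z' n t \<partial>eta) \<le> (\<Sum>n<N. \<integral>t. h K z n t \<partial>eta)"
      by (intro sum_mono integral_mono h_nonneg_bounded(2)[OF v] h_nonneg_bounded(2)[OF v'] h_mono[OF v assms(2)])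
    then show ?thesis using assms by (force simp: subcritical_def intro: order_trans)
  qed
  then show ?thesis using v' by (simp add: subcritical_def)
qed

text \<open>Far below the symbol everything is small. At distance
  \<open>L \<ge> 8 * \<kappa>\<close> one has \<open>Dl \<ge> 1 / 2\<close>,
  \<open>u \<le> 4 * \<kappa>\<close> and \<open>b \<le> 1 / 2\<close>; the iterates decay
  geometrically and their integrals add up to at most \<open>8 * \<kappa>\<close>, less than
  \<open>Mtop - z\<close>.\<close>

lemma subcritical_exists: "\<exists>z. subcritical K z" for K :: "real^'n"
proof -
  define z where "z = - 12 * real CARD('n) - (10 * \<kappa> + 1)"
  define L where "L = 10 * \<kappa> + 1"
  have L: "L > 0" "8 * \<kappa> \<le> L" "2 * \<kappa> \<le> L" using \<kappa> by (auto simp: L_def)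
  have g: "L \<le> W K p t - z" for p t using abs_W_le[of K p t] by (simp add: z_def L_def)
  have D: "1 / 2 \<le> Dl K z p" for p
  proof -
    have "(\<integral>t. R K z p t \<partial>eta) \<le> 1 / L"
      using eta_bounded(2)[of "R K z p" "1 / L"] R_integrable(2,3)[OF L(1) g, where p=p] by (auto simp: abs_le_iff)
    then have "\<kappa> * (\<integral>t. R K z p t \<partial>eta) \<le> \<kappa> * (1 / L)" using \<kappa> by (intro mult_left_mono) auto
    also have "\<dots> \<le> 1 / 2" using L by (simp add: field_simps)
    finally show ?thesis by (simp add: Dl_def)
  qed
  have v: "valid K z" unfolding valid_def
    by (rule exI[of _ "min L (1/2)"]) (use g D L in \<open>auto intro: min.coboundedI1 min.coboundedI2\<close>)
  have ub: "u K z p \<le> 4 * \<kappa>" for p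
  proof -
    have "u K z p \<le> 2 * \<kappa> / (1 / 2)" unfolding u_def using D[of p] \<kappa> by (simp only: of_real_eq_id id_apply) (intro divide_left_mono, auto)
    then show ?thesis by simp
  qed
  obtain C where C: "\<And>p t. 0 \<le> b K z p t" "\<And>p. 2 * \<kappa> \<le> u K z p" "z < Mtop TYPE('n)" using valid_bounds[OF v] by metis
  have bb: "b K z p t \<le> 1 / 2" for p t
  proof -
    have "b K z p t \<le> 4 * \<kappa> * (1 / L)" unfolding b_def
    proof (rule mult_mono)
      show "R K z p t - 1 / (of_real (Mtop TYPE('n)) - z) \<le> 1 / L"
        using R_integrable(3)[OF L(1) g, where p=p and t=t] C(3) by (simp add: le_diff_eq add_increasing2 diff_le_eq)
      show "0 \<le> R K z p t - 1 / (of_real (Mtop TYPE('n)) - z)"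
        using real_bounds(3)[of "min L (1/2)" K z p t] L g D by (simp add: min.coboundedI1 min.coboundedI2)
    qed (use ub \<kappa> in auto)
    also have "\<dots> \<le> 1 / 2" using L by (simp add: field_simps)
    finally show ?thesis .
  qed
  have hb: "h K z n p \<le> 4 * \<kappa> * (1/2) ^ n" for n p
  proof (induction n arbitrary: p)
    case 0 then show ?case using ub by simp
  next
    case (Suc n)
    have "h K z (Suc n) p \<le> (\<integral>t. 1 / 2 * (4 * \<kappa> * (1/2) ^ n) \<partial>(eta :: (real^'n) measure))"
      unfolding h.simps cv_real
      using Suc bb C h_nonneg_bounded(1)[OF v] \<kappa>
      by (intro integral_mono[OF h_nonneg_bounded(3)[OF v]] mult_mono) auto
    then show ?case by simp
  qed
  have "(\<Sum>n<N. \<integral>t. h K z n t \<partial>eta) \<le> Mtop TYPE('n) - z" for N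
  proof -
    have "(\<integral>t. h K z n t \<partial>eta) \<le> (\<integral>t. 4 * \<kappa> * (1/2) ^ n \<partial>(eta :: (real^'n) measure))" for n
      by (rule integral_mono[OF h_nonneg_bounded(2)[OF v]]) (use hb in auto)
    then have "(\<Sum>n<N. \<integral>t. h K z n t \<partial>eta) \<le> (\<Sum>n<N. 4 * \<kappa> * (1/2) ^ n)" by (intro sum_mono) simp
    also have "\<dots> = 4 * \<kappa> * (2 * (1 - (1/2) ^ N))"
      unfolding sum_distrib_left[symmetric] by (simp add: sum_gp_strict)
    also have "\<dots> \<le> 4 * \<kappa> * (2 * 1)" using \<kappa> by (intro mult_left_mono) auto
    also have "\<dots> \<le> Mtop TYPE('n) - z" using \<kappa> by (simp add: Mtop_def z_def)
    finally show ?thesis .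
  qed
  then show ?thesis using v by (auto simp: subcritical_def)
qed

section \<open>Periodicity, continuity and minima on the torus\<close>

lemma R_per1: "per1 (R K z p)" for K :: "real^'n"
  by (simp add: per1_def R_def W_periodic)

lemma Dl_per1: "per1 (Dl K z)" for K :: "real^'n"
  by (simp add: per1_def Dl_def R_def W_periodic)

lemma Dl_continuous:
  fixes K :: "real^'n"
  assumes c: "c > 0" "\<And>p t. c \<le> W K p t - z"
  shows "continuous_on UNIV (Dl K z)"
proof -
  define L where "L = \<kappa> * (4 * real CARD('n) / c\<^sup>2)"
  have L: "L > 0" using \<kappa> c by (simp add: L_def)
  have lip: "\<bar>Dl K z q - Dl K z p\<bar> \<le> L * norm (q - p)" for p q
  proof -
    note i = R_integrable(1)[OF c(1) c(2)]
    have "\<bar>Dl K z q - Dl K z p\<bar> = \<kappa> * \<bar>\<integral>t. R K z q t - R K z p t \<partial>eta\<bar>"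
      using i[of q] i[of p] \<kappa> by (simp add: Dl_def abs_mult right_diff_distrib[symmetric] abs_minus_commute)
    also have "\<dots> \<le> \<kappa> * (4 * real CARD('n) / c\<^sup>2 * norm (q - p))"
    proof -
      have "norm (\<integral>t. R K z q t - R K z p t \<partial>eta) \<le> 4 * real CARD('n) / c\<^sup>2 * norm (q - p)"
        by (rule eta_bounded(2)) (use R_first_difference[OF c, of p "q - p"] in \<open>auto\<close>)
      then show ?thesis using \<kappa> by (intro mult_left_mono) auto
    qed
    finally show ?thesis by (simp add: L_def)
  qed
  show ?thesis unfolding continuous_on_iff dist_real_def
  proof (intro ballI allI impI)
    fix p :: "real^'n" and e :: real assume e: "e > 0"
    show "\<exists>d>0. \<forall>q\<in>UNIV. dist q p < d \<longrightarrow> \<bar>Dl K z q - Dl K z p\<bar> < e"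
      using lip L e by (intro exI[of _ "e / L"]) (auto simp: dist_norm field_simps intro: le_less_trans)
  qed
qed

text \<open>The half-open cube is not compact, so the minimum is taken over the closed cube and
  carried to all points by periodicity.\<close>

lemma torus_attains_min:
  fixes f :: "real^'n \<Rightarrow> real"
  assumes "continuous_on UNIV f" "per1 f"
  obtains p0 where "\<And>p. f p0 \<le> f p"
proof -
  let ?S = "cbox (\<chi> i. - pi) (\<chi> i. pi) :: (real^'n) set"
  have ne: "0 \<in> ?S" by (simp add: mem_box_cart)
  obtain p0 where p0: "\<And>q. q \<in> ?S \<Longrightarrow> f p0 \<le> f q"
    using continuous_attains_inf[OF compact_cbox _ continuous_on_subset[OF assms(1)], of "\<chi> i. - pi" "\<chi> i. pi"] ne by blast
  have "f p0 \<le> f p" for p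
  proof -
    have "wrap p \<in> ?S" using wrap_Tcube[of p] by (auto simp: Tcube_def mem_box_cart less_imp_le)
    then show ?thesis using p0 per1_wrap[OF assms(2)] by metis
  qed
  then show ?thesis using that by blast
qed

end

lemma holomorphic_ball_isCont: "f holomorphic_on ball a r \<Longrightarrow> r > 0 \<Longrightarrow> isCont f a"
  by (rule field_differentiable_imp_continuous_at)
    (rule holomorphic_on_imp_differentiable_at[OF _ open_ball], auto)

context boson
begin

lemma validD:
  assumes "valid K z"
  shows "z < W K p t" "0 < Dl K z p"
proof -
  obtain c where c: "c > 0" "\<And>p t. c \<le> W K p t - z" "\<And>p. c \<le> Dl K z p"
    using assms by (auto simp: valid_def)
  show "z < W K p t" "0 < Dl K z p" using c(1) c(2)[of p t] c(3)[of p] by linarith+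
qed

subsection \<open>Failure of the supersolution condition near the two-particle threshold\<close>

text \<open>Validity must break down at the supremum \<open>z0\<close> of valid parameters. It
  cannot break down at the range of \<open>W\<close>, since \<open>Dl\<close> would turn nonpositive
  earlier; so the minimum of \<open>Dl\<close> at \<open>z0\<close> is exactly 0, attained
  quadratically. Slightly below \<open>z0\<close> the source \<open>h 0 = u\<close> alone then
  integrates to more than \<open>Mtop - z\<close>.\<close>

lemma valid_not_subcritical:
  fixes K :: "real^'n"
  assumes d: "CARD('n) \<le> 2"
  shows "\<exists>z. valid K z \<and> \<not> subcritical K z"
proof -
  define V where "V = {z. valid K z}"
  obtain zv where zv: "valid K zv" using subcritical_exists[of K] by (auto simp: subcritical_def)
  have W2: "W K p t = W K t p" for p t by (rule W_swap)
  have wlip: "\<bar>W K q t - W K p t\<bar> \<le> 4 * real CARD('n) * norm (q - p)" for p q t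
    using W_first_difference[of K p "q - p" t] by simp
  \<comment> \<open>The minimum over two torus variables is found by minimising over
    \<open>t\<close> first; the resulting function of \<open>p\<close> is continuous because
    \<open>W\<close> is Lipschitz in \<open>p\<close> uniformly in \<open>t\<close>.\<close>
  obtain pm tm where m: "\<And>p t. W K pm tm \<le> W K p t"
  proof -
    have "\<exists>tm. \<forall>t. W K p tm \<le> W K p t" for p
    proof -
      have "continuous_on UNIV (\<lambda>t. W K p t)" unfolding W_def by (intro continuous_intros)
      moreover have "per1 (W K p)" by (simp add: per1_def W_periodic)
      ultimately obtain t0 where "\<And>t. W K p t0 \<le> W K p t"
        using torus_attains_min[of "W K p"] by blast
      then show ?thesis by blast
    qed
    then obtain T where T: "\<And>p t. W K p (T p) \<le> W K p t" by metis
    have "continuous_on UNIV (\<lambda>p. W K p (T p))"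
      unfolding continuous_on_iff dist_real_def
    proof (intro ballI allI impI)
      fix p :: "real^'n" and e :: real assume e: "e > 0"
      let ?L = "4 * real CARD('n)"
      have "\<bar>W K q (T q) - W K p (T p)\<bar> \<le> ?L * norm (q - p)" for q
        using wlip[of q "T p" p] wlip[of q "T q" p] T[of q "T p"] T[of p "T q"] by linarith
      then show "\<exists>d>0. \<forall>q\<in>UNIV. dist q p < d \<longrightarrow> \<bar>W K q (T q) - W K p (T p)\<bar> < e"
        using e by (intro exI[of _ "e / ?L"]) (auto simp: dist_norm field_simps intro: le_less_trans)
    qed
    moreover have "per1 (\<lambda>p. W K p (T p))"
      unfolding per1_def
    proof (intro allI)
      fix p i
      show "W K (p + shiftv i) (T (p + shiftv i)) = W K p (T p)"
        using T[of p "T (p + shiftv i)"] T[of "p + shiftv i" "T p"] by (simp add: W_periodic)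
    qed
    ultimately obtain p0 where "\<And>p. W K p0 (T p0) \<le> W K p (T p)"
      using torus_attains_min[of "\<lambda>p. W K p (T p)"] by blast
    then show ?thesis using T that[of p0 "T p0"] by (meson order_trans)
  qed
  define m where "m = W K pm tm"
  have vm: "z < m" if "valid K z" for z
    unfolding m_def by (rule validD(1)[OF that])
  \<comment> \<open>The value \<open>1 / \<kappa>\<close> is the one at which
    \<open>\<kappa> * \<integral> R\<close> reaches 1, that is, \<open>Dl\<close> at
    \<open>pm\<close> becomes nonpositive.\<close>
  obtain \<delta>0 where \<delta>0: "\<delta>0 > 0" "\<And>\<delta>. 0 < \<delta> \<Longrightarrow> \<delta> \<le> \<delta>0 \<Longrightarrow> 1 / \<kappa> \<le> (\<integral>x. 1 / ((W K pm x - m) + \<delta>) \<partial>eta)"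
  proof -
    have "\<exists>\<delta>0>0. \<forall>\<delta>. 0 < \<delta> \<and> \<delta> \<le> \<delta>0 \<longrightarrow> 1 / \<kappa> \<le> (\<integral>x. 1 / ((W K pm x - m) + \<delta>) \<partial>eta)"
    proof (rule resolvent_integral_diverges[OF d, of _ 4 tm])
      show "per1 (\<lambda>x. W K pm x - m)" by (simp add: per1_def W_periodic)
      show "W K pm (tm + y) - m \<le> 4 * (norm y)\<^sup>2" for y
        using W_second_difference[of K tm y pm] m[of pm "tm - y"]
        unfolding W2[of pm] m_def W2[of pm tm] by (auto simp: W2[of _ pm])
      show "0 \<le> W K pm x - m" for x using m by (simp add: m_def)
    qed auto
    then show ?thesis using that by blast
  qed
  have vgap: "z < m - \<delta>0" if v: "valid K z" for z
  proof (rule ccontr)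
    assume "\<not> z < m - \<delta>0"
    then have "1 / \<kappa> \<le> (\<integral>x. 1 / ((W K pm x - m) + (m - z)) \<partial>eta)" using vm[OF v] by (intro \<delta>0(2)) auto
    then have "1 / \<kappa> \<le> (\<integral>x. R K z pm x \<partial>eta)" by (simp add: R_def)
    then have "\<kappa> * (1 / \<kappa>) \<le> \<kappa> * (\<integral>x. R K z pm x \<partial>eta)" using \<kappa> by (intro mult_left_mono) auto
    then have "Dl K z pm \<le> 0" using \<kappa> by (simp add: Dl_def)
    then show False using validD(2)[OF v, of pm] by simp
  qed
  have bdd: "bdd_above V" by (rule bdd_aboveI[of _ m]) (use vm in \<open>auto simp: V_def less_imp_le\<close>)
  define z0 where "z0 = Sup V"
  have z0m: "z0 \<le> m - \<delta>0"
    unfolding z0_def by (rule cSup_least) (use zv vgap in \<open>auto simp: V_def less_imp_le\<close>)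
  have vz0: "valid K z" if z: "z < z0" for z
  proof -
    have "V \<noteq> {}" using zv by (auto simp: V_def)
    then obtain y where "y \<in> V" "z < y" using less_cSup_iff[of V z] bdd z by (auto simp: z0_def)
    then show ?thesis using valid_mono[of K y z] by (auto simp: V_def)
  qed
  have z0v: "\<not> valid K z0"
  proof
    assume "valid K z0"
    then obtain \<delta> where "\<delta> > 0" "z0 + \<delta> \<in> V" using valid_open by (auto simp: V_def)
    then show False using cSup_upper[OF _ bdd, of "z0 + \<delta>"] by (simp add: z0_def)
  qed
  have gap: "\<delta>0 \<le> W K p t - z0" for p t using m[of p t] z0m by (simp add: m_def)
  have Dl_up: "Dl K z p \<le> Dl K z0 p + \<kappa> * (z0 - z) / \<delta>0\<^sup>2" if "z \<le> z0" for z p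
    using Dl_mono(2)[OF \<delta>0(1) gap that, of p] by linarith
  have Dpos: "0 \<le> Dl K z0 p" for p
  proof (rule field_le_epsilon)
    fix e :: real assume e: "e > 0"
    \<comment> \<open>Chosen so that the Lipschitz error in \<open>Dl_up\<close> equals
      \<open>e\<close>.\<close>
    define z where "z = z0 - e * \<delta>0\<^sup>2 / \<kappa>"
    have "z < z0" using e \<kappa> \<delta>0 by (simp add: z_def)
    then have "0 < Dl K z p" using validD(2)[OF vz0[of z]] by simp
    also have "\<dots> \<le> Dl K z0 p + \<kappa> * (z0 - z) / \<delta>0\<^sup>2" using \<open>z < z0\<close> by (intro Dl_up) simp
    also have "\<kappa> * (z0 - z) / \<delta>0\<^sup>2 = e" using \<kappa> \<delta>0 by (simp add: z_def)
    finally show "0 \<le> Dl K z0 p + e" by simp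
  qed
  obtain p0 where p0: "\<And>p. Dl K z0 p0 \<le> Dl K z0 p"
    using torus_attains_min[OF Dl_continuous[OF \<delta>0(1) gap] Dl_per1] by blast
  have D0: "Dl K z0 p0 = 0"
  proof (rule ccontr)
    assume "Dl K z0 p0 \<noteq> 0"
    then have "Dl K z0 p0 > 0" using Dpos[of p0] by simp
    then have "valid K z0"
      unfolding valid_def using p0 gap \<delta>0(1)
      by (intro exI[of _ "min (Dl K z0 p0) \<delta>0"]) (auto intro: min.coboundedI1 min.coboundedI2)
    then show False using z0v by blast
  qed
  define C where "C = \<kappa> * (4 / \<delta>0\<^sup>2 + 32 * (real CARD('n))\<^sup>2 / \<delta>0 ^ 3)"
  have C: "C > 0" using \<kappa> \<delta>0 by (auto simp: C_def intro!: mult_pos_pos add_pos_nonneg)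
  \<comment> \<open>\<open>Dl\<close> vanishes at \<open>p0\<close> and is nonnegative at
    \<open>p0 - y\<close>, so its value at \<open>p0 + y\<close> is at most its second
    difference.\<close>
  have quad: "Dl K z0 (p0 + y) \<le> C * (norm y)\<^sup>2" for y
  proof -
    note i = R_integrable(1)[OF \<delta>0(1) gap]
    have "Dl K z0 (p0 + y) \<le> Dl K z0 (p0 + y) + Dl K z0 (p0 - y) - 2 * Dl K z0 p0" using D0 Dpos[of "p0 - y"] by simp
    also have "\<dots> = \<kappa> * - (\<integral>t. R K z0 (p0 + y) t + R K z0 (p0 - y) t - 2 * R K z0 p0 t \<partial>eta)"
    proof -
      have J: "(\<integral>t. R K z0 (p0 + y) t + R K z0 (p0 - y) t - 2 * R K z0 p0 t \<partial>eta) =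
          (\<integral>t. R K z0 (p0 + y) t \<partial>eta) + (\<integral>t. R K z0 (p0 - y) t \<partial>eta) - 2 * (\<integral>t. R K z0 p0 t \<partial>eta)"
        using i[of "p0 + y"] i[of "p0 - y"] i[of p0] by simp
      show ?thesis unfolding J Dl_def cv_real of_real_eq_id id_apply by (simp add: algebra_simps)
    qed
    also have "\<dots> \<le> \<kappa> * \<bar>\<integral>t. R K z0 (p0 + y) t + R K z0 (p0 - y) t - 2 * R K z0 p0 t \<partial>eta\<bar>"
      using \<kappa> by (intro mult_left_mono abs_ge_minus_self) simp
    also have "\<dots> \<le> \<kappa> * ((4 / \<delta>0\<^sup>2 + 32 * (real CARD('n))\<^sup>2 / \<delta>0 ^ 3) * (norm y)\<^sup>2)"
    proof -
      have "norm (\<integral>t. R K z0 (p0 + y) t + R K z0 (p0 - y) t - 2 * R K z0 p0 t \<partial>eta) \<le> (4 / \<delta>0\<^sup>2 + 32 * (real CARD('n))\<^sup>2 / \<delta>0 ^ 3) * (norm y)\<^sup>2"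
        by (rule eta_bounded(2)) (use R_second_difference[OF \<delta>0(1) gap, of p0 y] in auto)
      then show ?thesis using \<kappa> by (intro mult_left_mono) auto
    qed
    finally show ?thesis by (simp add: C_def)
  qed
  let ?M = "Mtop TYPE('n)"
  \<comment> \<open>Aims at \<open>2 * \<kappa> * N = ?M - z0 + 2\<close>, which exceeds
    \<open>?M - z\<close> for every \<open>z\<close> within distance 1 below
    \<open>z0\<close>.\<close>
  define N where "N = (?M - z0 + 2) / (2 * \<kappa>)"
  have "\<exists>\<delta>1>0. \<forall>\<delta>. 0 < \<delta> \<and> \<delta> \<le> \<delta>1 \<longrightarrow> N \<le> (\<integral>x. 1 / (Dl K z0 x + \<delta>) \<partial>eta)"
    by (rule resolvent_integral_diverges[OF d, of _ C p0])
      (use Dl_per1 Dpos C quad in auto)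
  then obtain \<delta>1 where \<delta>1: "\<delta>1 > 0" "\<And>\<delta>. 0 < \<delta> \<Longrightarrow> \<delta> \<le> \<delta>1 \<Longrightarrow> N \<le> (\<integral>x. 1 / (Dl K z0 x + \<delta>) \<partial>eta)" by blast
  define z where "z = z0 - min 1 (\<delta>1 * \<delta>0\<^sup>2 / \<kappa>)"
  have z: "z < z0" "z0 - z \<le> 1" "z0 - z \<le> \<delta>1 * \<delta>0\<^sup>2 / \<kappa>" using \<delta>0 \<delta>1 \<kappa> by (auto simp: z_def)
  define \<delta> where "\<delta> = \<kappa> * (z0 - z) / \<delta>0\<^sup>2"
  have "\<kappa> * (z0 - z) \<le> \<kappa> * (\<delta>1 * \<delta>0\<^sup>2 / \<kappa>)" using z \<kappa> by (intro mult_left_mono) auto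
  then have "\<kappa> * (z0 - z) \<le> \<delta>1 * \<delta>0\<^sup>2" using \<kappa> by simp
  then have \<delta>: "0 < \<delta>" "\<delta> \<le> \<delta>1"
    using z \<kappa> \<delta>0 by (auto simp: \<delta>_def divide_le_eq)
  have v: "valid K z" by (rule vz0[OF z(1)])
  obtain c where c: "c > 0" "\<And>p. c \<le> Dl K z p" using v by (auto simp: valid_def)
  have "?M - z0 + 2 = 2 * \<kappa> * N" using \<kappa> by (simp add: N_def)
  also have "\<dots> \<le> 2 * \<kappa> * (\<integral>x. 1 / (Dl K z0 x + \<delta>) \<partial>eta)" using \<kappa> \<delta>1(2)[OF \<delta>] by (intro mult_left_mono) auto
  also have "\<dots> = (\<integral>x. 2 * \<kappa> * (1 / (Dl K z0 x + \<delta>)) \<partial>eta)"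
    by (rule Bochner_Integration.integral_mult_right_zero[symmetric])
  also have "\<dots> \<le> (\<integral>x. h K z 0 x \<partial>eta)"
  proof (rule integral_mono)
    show "integrable eta (\<lambda>x. 2 * \<kappa> * (1 / (Dl K z0 x + \<delta>)))"
    proof (intro integrable_mult_right eta_bounded(1))
      show "norm (1 / (Dl K z0 x + \<delta>)) \<le> 1 / \<delta>" for x
        using Dpos[of x] \<delta> by (simp add: divide_simps)
    qed measurable
    show "integrable eta (h K z 0)" by (rule h_nonneg_bounded(2)[OF v])
    show "2 * \<kappa> * (1 / (Dl K z0 x + \<delta>)) \<le> h K z 0 x" for x
    proof -
      have "2 * \<kappa> / (Dl K z0 x + \<delta>) \<le> 2 * \<kappa> / Dl K z x"
        using Dl_up[of z x] z(1) c(1) c(2)[of x] \<kappa> \<delta> Dpos[of x] by (intro divide_left_mono) (auto simp: \<delta>_def)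
      then show ?thesis by (simp add: u_def)
    qed
  qed
  finally have "?M - z0 + 2 \<le> (\<integral>x. h K z 0 x \<partial>eta)" .
  \<comment> \<open>The partial sum with the single term \<open>n = 0\<close> is already too
    large.\<close>
  then have "\<not> subcritical K z" using z(2) unfolding subcritical_def by (auto intro!: exI[of _ "Suc 0"] simp del: h.simps)
  then show ?thesis using v by blast
qed

subsection \<open>The ground state energy for a fixed total quasi-momentum\<close>

text \<open>Subcriticality controls only the integrals of the iterates, but \<open>b \<le> C\<close>
  turns the integral of \<open>h n\<close> into a bound on \<open>h (Suc n)\<close> that is uniform
  in \<open>p\<close>. Pointwise convergence, boundedness of \<open>G\<close> and the exchange of
  sum and integral all follow from this.\<close>

lemma subcritical_Neumann:
  fixes K :: "real^'n"
  assumes P: "subcritical K z"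
  shows "summable (\<lambda>n. h K z n p)" "(\<integral>t. G K z t \<partial>eta) = (\<Sum>n. \<integral>t. h K z n t \<partial>eta)"
    "summable (\<lambda>n. \<integral>t. h K z n t \<partial>eta)"
    "G K z p = (\<integral>t. b K z p t * G K z t \<partial>eta) + u K z p" "u K z p \<le> G K z p"
    "\<exists>C. \<forall>p. G K z p \<le> C"
proof -
  have v: "valid K z" using P by (simp add: subcritical_def)
  obtain C where C: "C > 0" "\<And>p. 2 * \<kappa> \<le> u K z p" "\<And>p. u K z p \<le> C" "\<And>p t. 0 \<le> b K z p t" "\<And>p t. b K z p t \<le> C"
    using valid_bounds[OF v] by metis
  note hn = h_nonneg_bounded[OF v]
  let ?I = "\<lambda>n. \<integral>t. h K z n t \<partial>eta"
  have I0: "0 \<le> ?I n" for n using hn(1) by (intro Bochner_Integration.integral_nonneg) auto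
  show sI: "summable ?I"
    by (rule summableI_nonneg_bounded[OF I0]) (use P in \<open>auto simp: subcritical_def\<close>)
  have hle: "h K z (Suc n) p \<le> C * ?I n" for n p
  proof -
    have "h K z (Suc n) p \<le> (\<integral>t. C * h K z n t \<partial>eta)"
      unfolding h.simps cv_real using hn C by (intro integral_mono) (auto intro: mult_right_mono)
    then show ?thesis by simp
  qed
  have sS: "summable (\<lambda>n. h K z (Suc n) p)" for p
    by (rule summable_comparison_test'[OF summable_mult[OF sI, of C]]) (use hle hn(1) in \<open>auto simp del: h.simps\<close>)
  show sh: "summable (\<lambda>n. h K z n p)" for p using sS summable_Suc_iff by blast
  have G: "G K z p = (\<Sum>n. h K z (Suc n) p) + u K z p" for p
    unfolding G_def using suminf_split_head[OF sh[of p]] by simp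
  show "u K z p \<le> G K z p" unfolding G using suminf_nonneg[OF sS] hn(1) by (simp del: h.simps)
  show "\<exists>C. \<forall>p. G K z p \<le> C"
  proof (intro exI allI)
    fix p
    have "(\<Sum>n. h K z (Suc n) p) \<le> (\<Sum>n. C * ?I n)"
      by (rule suminf_le[OF hle sS summable_mult[OF sI]])
    then show "G K z p \<le> (\<Sum>n. C * ?I n) + C" unfolding G using C(3)[of p] by linarith
  qed
  have nI: "summable (\<lambda>n. \<integral>t. norm (h K z n t) \<partial>eta)" using sI hn(1) by simp
  show "(\<integral>t. G K z t \<partial>eta) = (\<Sum>n. ?I n)"
    unfolding G_def by (rule integral_suminf) (use hn sh nI in auto)
  have "(\<integral>t. b K z p t * G K z t \<partial>eta) = (\<integral>t. (\<Sum>n. b K z p t * h K z n t) \<partial>eta)"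
    unfolding G_def by (simp add: suminf_mult[OF sh])
  also have "\<dots> = (\<Sum>n. \<integral>t. b K z p t * h K z n t \<partial>eta)"
  proof (rule integral_suminf)
    have e: "(\<integral>t. norm (b K z p t * h K z n t) \<partial>eta) = h K z (Suc n) p" for n
      using C(4) hn(1) by simp
    show "summable (\<lambda>n. \<integral>t. norm (b K z p t * h K z n t) \<partial>eta)" unfolding e by (rule sS)
    have "summable (\<lambda>n. norm (b K z p t * h K z n t))" for t
      using summable_mult[OF sh[of t], of "b K z p t"] C(4) hn(1) by (simp add: abs_mult)
    then show "AE t in eta. summable (\<lambda>n. norm (b K z p t * h K z n t))" by simp
  qed (rule hn)
  finally show "G K z p = (\<integral>t. b K z p t * G K z t \<partial>eta) + u K z p" unfolding G by simp
qed

lemma neumann_if_subcritical: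
  fixes K :: "real^'n"
  assumes P: "subcritical K z"
  shows "\<exists>r A \<theta> C. good K z r C \<and> neumann K z r A \<theta>"
proof -
  have v: "valid K z" using P by (simp add: subcritical_def)
  obtain c where c: "\<And>p. 2 * \<kappa> \<le> u K z p" using valid_bounds[OF v] by metis
  obtain C where C: "\<And>p. G K z p \<le> C" using subcritical_Neumann(6)[OF P] by blast
  show ?thesis
  proof (rule neumann_near[OF v, of "G K z" "2 * \<kappa>" C])
    show "0 \<le> G K z p" for p using subcritical_Neumann(5)[OF P, of p] c[of p] \<kappa> by linarith
    show "G K z \<in> borel_measurable borel" by measurable
    show "G K z p = (\<integral>t. b K z p t * G K z t \<partial>eta) + u K z p" for p by (rule subcritical_Neumann(4)[OF P])
  qed (use \<kappa> c C in auto)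
qed

section \<open>Passage between real and complex parameters\<close>

lemma near_real:
  fixes K :: "real^'n"
  assumes v: "valid K0 z0"
  shows "\<exists>r>0. \<forall>K z. near r K0 z0 (cv K) (of_real z) \<longrightarrow> valid (K :: real^'n) z"
proof -
  obtain c where c: "c > 0" "\<And>p t. c \<le> W K0 p t - z0" "\<And>p. c \<le> Dl K0 z0 p"
    using v by (auto simp: valid_def)
  obtain r1 where r1: "r1 > 0" "\<And>(k :: complex^'n) P Q K p q. dist k (cv K) < r1 \<Longrightarrow> dist P (cv p) < r1 \<Longrightarrow> dist Q (cv q) < r1 \<Longrightarrow>
    norm (W k P Q - of_real (W K p q)) \<le> c / 4"
    using W_close[of "c / 4"] c(1) by (metis divide_pos_pos zero_less_numeral)
  have "c / 2 > 0" using c(1) by simp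
  then obtain r2 where r2: "r2 > 0" "\<And>k z P p. near r2 K0 z0 k z \<Longrightarrow> dist P (cv p) < r2 \<Longrightarrow>
    norm (Dl k z P - of_real (Dl K0 z0 p)) \<le> c / 2"
    using Dl_close[OF c(1,2)] by blast
  define r where "r = min (c / 4) (min r1 r2)"
  have r: "r > 0" "r \<le> c / 4" "r \<le> r1" "r \<le> r2" using c r1 r2 by (auto simp: r_def)
  have "valid K z" if n: "near r K0 z0 (cv K) (of_real z)" for K z
    unfolding valid_def
  proof (rule exI[of _ "c / 2"], intro conjI allI)
    fix p t
    have "norm (W (cv K) (cv p) (cv t) - complex_of_real (W K0 p t)) \<le> c / 4"
      by (rule r1(2)) (use n r r1(1) in \<open>auto simp: near_def\<close>)
    then have "\<bar>W K p t - W K0 p t\<bar> \<le> c / 4"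
      unfolding W_cv of_real_diff[symmetric] norm_of_real .
    moreover have "\<bar>z - z0\<bar> < c / 4" using n r by (simp add: near_def dist_real_def dist_of_real)
    ultimately show "c / 2 \<le> W K p t - z" using c(2)[of p t] by linarith
    have "norm (Dl (cv K) (of_real z) (cv p) - complex_of_real (Dl K0 z0 p)) \<le> c / 2"
      by (rule r2(2)[OF near_mono[OF n r(4)]]) (use r2(1) in simp)
    then have "\<bar>Dl K z p - Dl K0 z0 p\<bar> \<le> c / 2"
      unfolding Dl_cv of_real_diff[symmetric] norm_of_real .
    then show "c / 2 \<le> Dl K z p" using c(3)[of p] by linarith
  qed (use c in auto)
  then show ?thesis using r(1) by blast
qed

lemma near_self [simp]: "r > 0 \<Longrightarrow> near r K z (cv K) (of_real z)"
  by (simp add: near_def)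

lemma near_of_real: "near r K0 z0 (cv K0) (of_real z) \<longleftrightarrow> \<bar>z - z0\<bar> < r" if "r > 0"
  using that by (simp add: near_def dist_of_real dist_real_def)

lemma neumann_real:
  fixes K :: "real^'n"
  assumes nm: "neumann K0 z0 r A \<theta>" and n: "near r K0 z0 (cv K) (of_real z)" and r: "r > 0"
  shows "summable (\<lambda>n. h K z n p)" "\<bar>G K z p\<bar> \<le> A / (1 - \<theta>)"
    "G (cv K) (of_real z) (cv p) = (of_real (G K z p) :: complex)"
    "Dd (cv K) (of_real z) = (of_real (Dd K z) :: complex)"
proof -
  have s: "summable (\<lambda>n. h K z n p)" for p
  proof -
    have "norm (h (cv K) (complex_of_real z) n (cv p)) = \<bar>h K z n p\<bar>" for n
      by (simp only: h_cv norm_of_real)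
    then have "summable (\<lambda>n. \<bar>h K z n p\<bar>)"
      using neumann_summable(1)[OF nm n nearv_cv[OF r, of p]] by (simp only:)
    then show ?thesis by (rule summable_rabs_cancel)
  qed
  show "summable (\<lambda>n. h K z n p)" by (rule s)
  show g: "G (cv K) (of_real z) (cv p) = (of_real (G K z p) :: complex)" for p by (rule G_cv[OF s])
  show "\<bar>G K z p\<bar> \<le> A / (1 - \<theta>)"
    using neumann_summable(3)[OF nm n nearv_cv[OF r, of p]] by (simp only: g norm_of_real)
  show "Dd (cv K) (of_real z) = (of_real (Dd K z) :: complex)"
    unfolding Dd_def g by simp
qed

text \<open>Converse of \<open>Dd_le_1\<close> wherever the series is known to converge: partial
  sums of nonnegative terms stay below the full sum. It serves to step beyond a supposed supremum
  and to recognise a root of \<open>Dd = 1\<close> as the energy.\<close>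

lemma subcritical_if_Dd_le_1:
  fixes K :: "real^'n"
  assumes nm: "neumann K0 z0 r A \<theta>" and n: "near r K0 z0 (cv K) (of_real z)" and r: "r > 0"
    and v: "valid K z" and D: "Dd K z \<le> 1"
  shows "subcritical K z"
  unfolding subcritical_def
proof (intro conjI allI)
  fix N
  note nr = neumann_real[OF nm n r]
  note hn = h_nonneg_bounded[OF v]
  have "(\<Sum>n<N. \<integral>t. h K z n t \<partial>eta) = (\<integral>t. (\<Sum>n<N. h K z n t) \<partial>eta)"
    using hn by (simp add: Bochner_Integration.integral_sum)
  also have "\<dots> \<le> (\<integral>t. G K z t \<partial>eta)"
  proof (rule integral_mono)
    show "integrable eta (G K z)" by (rule eta_bounded(1)) (use nr(2) in auto)
    show "(\<Sum>n<N. h K z n t) \<le> G K z t" for t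
      unfolding G_def by (rule sum_le_suminf[OF nr(1)]) (use hn(1) in auto)
  qed (use hn in auto)
  also have "\<dots> \<le> Mtop TYPE('n) - z"
    using D valid_less[OF v] by (simp add: Dd_def divide_le_eq)
  finally show "(\<Sum>n<N. \<integral>t. h K z n t \<partial>eta) \<le> Mtop TYPE('n) - z" .
qed (rule v)

lemma integral_h_isCont:
  fixes K :: "real^'n"
  assumes v: "valid K z"
  shows "isCont (\<lambda>z. \<integral>t. h K z n t \<partial>eta) z"
proof -
  obtain r C where gd: "good K z r C" using good_exists[OF v] by blast
  have r: "r > 0" using gd by (simp add: good_def)
  let ?U = "ball (complex_of_real z) r"
  have nr: "near r K z (cv K) x" if "x \<in> ?U" for x using that r by (auto simp: near_def dist_commute)
  have "(\<lambda>x. \<integral>t. h (cv K) x n (cv t) \<partial>(eta :: (real^'n) measure)) holomorphic_on ?U"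
  proof (rule holomorphic_parametric_integral)
    show "finite_measure (eta :: (real^'n) measure)" by unfold_locales
    show "(\<lambda>x. h (cv K) x n (cv t)) holomorphic_on ?U" for t
      by (rule holomorphic_h[OF gd open_ball curve_const holomorphic_on_ident nr]) (use r in auto)
    show "norm (h (cv K) x n (cv t)) \<le> C ^ Suc n" if "x \<in> ?U" for x t
      by (rule h_crude_bound[OF gd nr[OF that]]) (use r in auto)
    show "(\<lambda>t. h (cv K) x n (cv t)) \<in> borel_measurable eta" for x :: complex by measurable
  qed (rule open_ball)
  then have "isCont (\<lambda>x. \<integral>t. h (cv K) x n (cv t) \<partial>(eta :: (real^'n) measure)) (complex_of_real z)"
    by (rule holomorphic_ball_isCont) (rule r)
  then have "isCont (\<lambda>y. \<integral>t. h (cv K) (complex_of_real y) n (cv t) \<partial>(eta :: (real^'n) measure)) z"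
    by (rule isCont_o2[rotated]) (intro continuous_intros)
  then have "isCont (\<lambda>y. complex_of_real (\<integral>t. h K y n t \<partial>eta)) z" by (simp add: h_cv)
  then have "isCont (\<lambda>y. Re (complex_of_real (\<integral>t. h K y n t \<partial>eta))) z" by (rule isCont_Re)
  then show ?thesis by simp
qed

text \<open>A supremum because subcriticality is inherited by smaller \<open>z\<close>. That it is
  reached with \<open>Dd = 1\<close>, and not by leaving the valid range, is where the dimension
  matters.\<close>

definition eK :: "real^'n \<Rightarrow> real" where
  "eK K = Sup {z. subcritical K z}"

lemma subcritical_bdd:
  fixes K :: "real^'n"
  assumes d: "CARD('n) \<le> 2"
  shows "bdd_above {z. subcritical K z}" "valid K (eK K)"
proof -
  obtain z2 where z2: "valid K z2" "\<not> subcritical K z2" using valid_not_subcritical[OF d] by blast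
  have le: "z \<le> z2" if "subcritical K z" for z using subcritical_mono[OF that, of z2] z2 by force
  then show "bdd_above {z. subcritical K z}" by (intro bdd_aboveI[of _ z2]) auto
  have "eK K \<le> z2" unfolding eK_def by (rule cSup_least) (use le subcritical_exists[of K] in auto)
  then show "valid K (eK K)" using valid_mono z2 by blast
qed

text \<open>Each partial sum is continuous at the supremum, whereas nothing is known there about
  \<open>G\<close> yet; so the inequality is passed to the limit from the left for every
  \<open>N\<close> separately.\<close>

lemma subcritical_eK:
  fixes K :: "real^'n"
  assumes d: "CARD('n) \<le> 2"
  shows "subcritical K (eK K)"
  unfolding subcritical_def
proof (intro conjI allI)
  show v: "valid K (eK K)" by (rule subcritical_bdd[OF d])
  fix N
  have lt: "subcritical K z" if "z < eK K" for z
  proof -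
    have "{z. subcritical K z} \<noteq> {}" using subcritical_exists[of K] by auto
    then have "\<exists>y\<in>{z. subcritical K z}. z < y"
      using that less_cSup_iff[OF _ subcritical_bdd(1)[OF d, of K]] unfolding eK_def by blast
    then obtain y where "subcritical K y" "z < y" by blast
    then show ?thesis using subcritical_mono[of K y z] by simp
  qed
  have "isCont (\<lambda>z. (\<Sum>n<N. \<integral>t. h K z n t \<partial>eta) - (Mtop TYPE('n) - z)) (eK K)"
    using integral_h_isCont[OF v] by (intro continuous_intros)
  then have "((\<lambda>z. (\<Sum>n<N. \<integral>t. h K z n t \<partial>eta) - (Mtop TYPE('n) - z)) \<longlongrightarrow> (\<Sum>n<N. \<integral>t. h K (eK K) n t \<partial>eta) - (Mtop TYPE('n) - eK K)) (at_left (eK K))"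
    unfolding isCont_def using tendsto_within_subset[of _ _ _ UNIV "{..<eK K}"] by blast
  moreover have "eventually (\<lambda>z. (\<Sum>n<N. \<integral>t. h K z n t \<partial>eta) - (Mtop TYPE('n) - z) \<le> 0) (at_left (eK K))"
    using lt by (auto simp: eventually_at_filter subcritical_def)
  ultimately have "(\<Sum>n<N. \<integral>t. h K (eK K) n t \<partial>eta) - (Mtop TYPE('n) - eK K) \<le> 0"
    by (rule tendsto_upperbound) simp
  then show "(\<Sum>n<N. \<integral>t. h K (eK K) n t \<partial>eta) \<le> Mtop TYPE('n) - eK K" by simp
qed

lemma Dd_le_1:
  fixes K :: "real^'n"
  assumes P: "subcritical K z"
  shows "Dd K z \<le> 1"
proof -
  have v: "valid K z" using P by (simp add: subcritical_def)
  have "(\<Sum>n. \<integral>t. h K z n t \<partial>eta) \<le> Mtop TYPE('n) - z"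
    by (rule suminf_le_const[OF subcritical_Neumann(3)[OF P]]) (use P in \<open>auto simp: subcritical_def\<close>)
  then show ?thesis using valid_less[OF v] by (simp add: Dd_def subcritical_Neumann(2)[OF P])
qed

text \<open>Even with \<open>\<integral> G\<close> frozen, the factor \<open>1 / (Mtop - z)\<close>
  increases, and \<open>\<integral> G\<close> is at least \<open>2 * \<kappa>\<close>. The
  quantitative form gives uniqueness of the root as well as a nonzero derivative for the implicit
  function argument.\<close>

lemma Dd_diff:
  fixes K :: "real^'n"
  assumes P: "subcritical K z" and z: "z' \<le> z"
  shows "2 * \<kappa> * (z - z') / ((Mtop TYPE('n) - z) * (Mtop TYPE('n) - z')) \<le> Dd K z - Dd K z'"
proof -
  let ?M = "Mtop TYPE('n)"
  have P': "subcritical K z'" by (rule subcritical_mono[OF P z])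
  have v: "valid K z" "valid K z'" using P P' by (auto simp: subcritical_def)
  have M: "?M - z > 0" "?M - z' > 0" using valid_less[OF v(1)] valid_less[OF v(2)] by auto
  have le: "(\<integral>t. G K z' t \<partial>eta) \<le> (\<integral>t. G K z t \<partial>eta)"
    unfolding subcritical_Neumann(2)[OF P] subcritical_Neumann(2)[OF P']
    by (intro suminf_le subcritical_Neumann(3)[OF P] subcritical_Neumann(3)[OF P'] integral_mono h_nonneg_bounded(2) v h_mono z)
  obtain C where C: "\<And>p. G K z' p \<le> C" using subcritical_Neumann(6)[OF P'] by blast
  obtain c where c: "\<And>p. 2 * \<kappa> \<le> u K z' p" using valid_bounds[OF v(2)] by metis
  have gl: "2 * \<kappa> \<le> G K z' p" for p using subcritical_Neumann(5)[OF P', of p] c[of p] by linarith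
  have "(\<integral>t. 2 * \<kappa> \<partial>(eta :: (real^'n) measure)) \<le> (\<integral>t. G K z' t \<partial>eta)"
  proof (rule integral_mono)
    show "integrable eta (G K z')"
      by (rule eta_bounded(1)[where B=C]) (use C gl \<kappa> in \<open>auto simp: abs_le_iff intro: order_trans[OF _ C]\<close>,
          smt (verit) C gl \<kappa>)
  qed (use gl in auto)
  then have S: "2 * \<kappa> \<le> (\<integral>t. G K z' t \<partial>eta)" by simp
  have "2 * \<kappa> * (z - z') / ((?M - z) * (?M - z')) = 2 * \<kappa> * (1 / (?M - z) - 1 / (?M - z'))"
    using M by (simp add: diff_frac_eq)
  also have "\<dots> \<le> (\<integral>t. G K z' t \<partial>eta) * (1 / (?M - z) - 1 / (?M - z'))"
    using S M z by (intro mult_right_mono) (auto simp: frac_le)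
  also have "\<dots> \<le> (\<integral>t. G K z t \<partial>eta) / (?M - z) - (\<integral>t. G K z' t \<partial>eta) / (?M - z')"
    using le M by (simp add: right_diff_distrib divide_right_mono)
  finally show ?thesis by (simp add: Dd_def)
qed

text \<open>If the value were below 1, then geometric convergence near \<open>eK K\<close> would
  make \<open>Dd\<close> continuous there, and a slightly larger \<open>z\<close> would still be
  valid with \<open>Dd < 1\<close>, hence subcritical, against the supremum.\<close>

lemma Dd_eK:
  fixes K :: "real^'n"
  assumes d: "CARD('n) \<le> 2"
  shows "Dd K (eK K) = 1"
proof (rule ccontr)
  assume "Dd K (eK K) \<noteq> 1"
  have P: "subcritical K (eK K)" by (rule subcritical_eK[OF d])
  then have lt: "Dd K (eK K) < 1" using Dd_le_1[OF P] \<open>Dd K (eK K) \<noteq> 1\<close> by simp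
  have v: "valid K (eK K)" using P by (simp add: subcritical_def)
  obtain r A \<theta> C where gd: "good K (eK K) r C" and nm: "neumann K (eK K) r A \<theta>" using neumann_if_subcritical[OF P] by blast
  have r: "r > 0" using gd by (simp add: good_def)
  let ?U = "ball (complex_of_real (eK K)) r"
  have "(\<lambda>x. Dd (cv K) x) holomorphic_on ?U"
    by (rule holomorphic_Dd[OF gd nm open_ball curve_const holomorphic_on_ident]) (use r in \<open>auto simp: near_def dist_commute\<close>)
  then have "isCont (\<lambda>x. Dd (cv K) x) (complex_of_real (eK K))"
    by (rule holomorphic_ball_isCont) (rule r)
  then have "isCont (\<lambda>y. Dd (cv K) (complex_of_real y)) (eK K)"
    by (rule isCont_o2[rotated]) (intro continuous_intros)
  then have "isCont (\<lambda>y. Re (Dd (cv K) (complex_of_real y))) (eK K)" by (rule isCont_Re)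
  moreover have "Re (Dd (cv K) (complex_of_real (eK K))) < 1"
    using neumann_real(4)[OF nm near_self[OF r] r] lt by simp
  ultimately have "eventually (\<lambda>y. Re (Dd (cv K) (complex_of_real y)) < 1) (at (eK K))"
    unfolding isCont_def by (rule order_tendstoD)
  then obtain d1 where d1: "d1 > 0" "\<And>y. y \<noteq> eK K \<Longrightarrow> dist y (eK K) < d1 \<Longrightarrow> Re (Dd (cv K) (complex_of_real y)) < 1"
    unfolding eventually_at by auto
  obtain \<delta> where \<delta>: "\<delta> > 0" "valid K (eK K + \<delta>)" using valid_open[OF v] by blast
  \<comment> \<open>Three constraints: stay valid, stay within the radius of convergence, and stay
    where \<open>Dd < 1\<close>.\<close>
  define y where "y = eK K + min \<delta> (min (r / 2) (d1 / 2))"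
  have y: "y > eK K" "y \<le> eK K + \<delta>" "\<bar>y - eK K\<bar> < r" "\<bar>y - eK K\<bar> < d1"
    using \<delta> r d1 by (auto simp: y_def)
  have n: "near r K (eK K) (cv K) (of_real y)" using near_of_real[OF r] y by blast
  have vy: "valid K y" by (rule valid_mono[OF \<delta>(2) y(2)])
  have "Re (Dd (cv K) (complex_of_real y)) < 1" by (rule d1(2)) (use y in \<open>auto simp: dist_real_def\<close>)
  then have "Dd K y \<le> 1" unfolding neumann_real(4)[OF nm n r] by simp
  then have "subcritical K y" by (rule subcritical_if_Dd_le_1[OF nm n r vy])
  then have "y \<le> eK K" unfolding eK_def by (intro cSup_upper subcritical_bdd(1)[OF d]) simp
  then show False using y by simp
qed

lemma eK_unique:
  fixes K :: "real^'n"
  assumes d: "CARD('n) \<le> 2" and P: "subcritical K z" and D: "Dd K z = 1"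
  shows "z = eK K"
proof (rule ccontr)
  assume ne: "z \<noteq> eK K"
  have "z \<le> eK K" unfolding eK_def using P by (intro cSup_upper subcritical_bdd(1)[OF d]) simp
  then have zl: "z < eK K" using ne by simp
  have Pe: "subcritical K (eK K)" by (rule subcritical_eK[OF d])
  have "0 < 2 * \<kappa> * (eK K - z) / ((Mtop TYPE('n) - eK K) * (Mtop TYPE('n) - z))"
    using zl \<kappa> valid_less[of K z] valid_less[of K "eK K"] P Pe by (auto simp: subcritical_def intro!: divide_pos_pos mult_pos_pos)
  also have "\<dots> \<le> Dd K (eK K) - Dd K z" by (rule Dd_diff[OF Pe]) (use zl in simp)
  finally show False using D Dd_eK[OF d] by simp
qed

end

subsection \<open>From separate holomorphy to real analyticity\<close>

lemma real_analytic_scaleR: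
  assumes "real_analytic f"
  shows "real_analytic (\<lambda>x. a *\<^sub>R f x)"
  unfolding real_analytic_def
proof
  fix x
  have "ra_at f x" using assms by (simp add: real_analytic_def)
  then obtain r c where r: "r > 0" and hs: "\<And>y. y \<in> ball x r \<Longrightarrow>
      ((\<lambda>\<alpha>. (\<Prod>b\<in>Basis. ((y - x) \<bullet> b) ^ \<alpha> b) *\<^sub>R c \<alpha>) has_sum f y) {\<alpha>. \<forall>b. b \<notin> Basis \<longrightarrow> \<alpha> b = 0}"
    unfolding ra_at_def by blast
  have "((\<lambda>\<alpha>. (\<Prod>b\<in>Basis. ((y - x) \<bullet> b) ^ \<alpha> b) *\<^sub>R (a *\<^sub>R c \<alpha>)) has_sum a *\<^sub>R f y) {\<alpha>. \<forall>b. b \<notin> Basis \<longrightarrow> \<alpha> b = 0}"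
    if "y \<in> ball x r" for y
    using has_sum_bounded_linear[OF bounded_linear_scaleR_right hs[OF that], of a] by (simp add: o_def mult.commute)
  then show "ra_at (\<lambda>x. a *\<^sub>R f x) x" unfolding ra_at_def using r
    by (intro exI[of _ r] conjI exI[of _ "\<lambda>\<alpha>. a *\<^sub>R c \<alpha>"]) auto
qed

text \<open>A one-point parameter space, for power series without parameter.\<close>

definition unit_param :: "unit measure" where
  "unit_param = count_space UNIV"

lemma ra_at_if_separately_holomorphic:
  fixes f :: "'a::euclidean_space \<Rightarrow> complex" and \<Phi> :: "('a \<Rightarrow> complex) \<Rightarrow> complex"
  assumes r: "r > 0"
    and B: "\<And>w. w \<in> poly_disc Basis r \<Longrightarrow> norm (\<Phi> w) \<le> B"
    and hol: "\<And>w i. w \<in> poly_disc Basis r \<Longrightarrow> i \<in> Basis \<Longrightarrow> (\<lambda>x. \<Phi> (w(i := x))) holomorphic_on ball 0 r"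
    and f: "\<And>y. y \<in> ball x r \<Longrightarrow> f y = \<Phi> (\<lambda>b. if b \<in> Basis then of_real ((y - x) \<bullet> b) else 0)"
  shows "ra_at f x"
proof -
  obtain c where c: "\<And>w. w \<in> poly_disc Basis r \<Longrightarrow>
      ((\<lambda>\<alpha>. (\<Prod>i\<in>Basis. w i ^ \<alpha> i) * c \<alpha>) has_sum \<Phi> w) (multi_idx Basis)"
  proof -
    have "\<exists>c. (\<forall>\<alpha>\<in>multi_idx Basis. c \<alpha> \<in> borel_measurable unit_param) \<and>
      (\<forall>s\<in>space unit_param. \<forall>\<alpha>\<in>multi_idx Basis. norm (c \<alpha> s) \<le> B / (\<Prod>i\<in>Basis. r ^ \<alpha> i)) \<and>
      (\<forall>s\<in>space unit_param. \<forall>w\<in>poly_disc Basis r. ((\<lambda>\<alpha>. (\<Prod>i\<in>Basis. w i ^ \<alpha> i) * c \<alpha> s) has_sum \<Phi> w) (multi_idx Basis))"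
      by (rule osgood_power_series[OF finite_Basis r, where f="\<lambda>_. \<Phi>"]) (auto simp: unit_param_def intro: B hol)
    then obtain c where "\<forall>s\<in>space unit_param. \<forall>w\<in>poly_disc Basis r. ((\<lambda>\<alpha>. (\<Prod>i\<in>Basis. w i ^ \<alpha> i) * c \<alpha> s) has_sum \<Phi> w) (multi_idx Basis)"
      by blast
    then show ?thesis using that[of "\<lambda>\<alpha>. c \<alpha> ()"] by (simp add: unit_param_def)
  qed
  show ?thesis
    unfolding ra_at_def
  proof (intro exI[of _ r] conjI exI[of _ c] ballI)
    fix y assume y: "y \<in> ball x r"
    define w where "w = (\<lambda>b. if b \<in> Basis then complex_of_real ((y - x) \<bullet> b) else 0)"
    have "\<bar>(y - x) \<bullet> b\<bar> < r" if "b \<in> Basis" for b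
      using Basis_le_norm[OF that, of "y - x"] y by (simp add: dist_norm norm_minus_commute)
    then have w: "w \<in> poly_disc Basis r" by (auto simp: poly_disc_def w_def simp del: of_real_inner_1)
    have eq: "(\<Prod>i\<in>Basis. w i ^ \<alpha> i) * c \<alpha> = (\<Prod>b\<in>Basis. ((y - x) \<bullet> b) ^ \<alpha> b) *\<^sub>R c \<alpha>" for \<alpha>
    proof -
      have "(\<Prod>i\<in>Basis. w i ^ \<alpha> i) = (\<Prod>b\<in>Basis. complex_of_real (((y - x) \<bullet> b) ^ \<alpha> b))"
        by (intro prod.cong) (auto simp: w_def)
      then show ?thesis by (simp add: scaleR_conv_of_real)
    qed
    have "f y = \<Phi> w" using f[OF y] by (simp add: w_def)
    then show "((\<lambda>\<alpha>. (\<Prod>b\<in>Basis. ((y - x) \<bullet> b) ^ \<alpha> b) *\<^sub>R c \<alpha>) has_sum f y) {\<alpha>. \<forall>b. b \<notin> Basis \<longrightarrow> \<alpha> b = 0}"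
      using c[OF w] unfolding eq by (simp add: multi_idx_def)
  qed (rule r)
qed

lemma ra_at_of_real_imp:
  fixes f :: "'a::euclidean_space \<Rightarrow> real"
  assumes "ra_at (\<lambda>x. complex_of_real (f x)) x"
  shows "ra_at f x"
proof -
  obtain r c where r: "r > 0" and c: "\<And>y. y \<in> ball x r \<Longrightarrow>
    ((\<lambda>\<alpha>. (\<Prod>b\<in>Basis. ((y - x) \<bullet> b) ^ \<alpha> b) *\<^sub>R c \<alpha>) has_sum complex_of_real (f y)) {\<alpha>. \<forall>b. b \<notin> Basis \<longrightarrow> \<alpha> b = 0}"
    using assms unfolding ra_at_def by blast
  show ?thesis
    unfolding ra_at_def
  proof (intro exI[of _ r] conjI exI[of _ "\<lambda>\<alpha>. Re (c \<alpha>)"] ballI)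
    fix y assume "y \<in> ball x r"
    from has_sum_bounded_linear[OF bounded_linear_Re c[OF this]]
    show "((\<lambda>\<alpha>. (\<Prod>b\<in>Basis. ((y - x) \<bullet> b) ^ \<alpha> b) *\<^sub>R Re (c \<alpha>)) has_sum f y) {\<alpha>. \<forall>b. b \<notin> Basis \<longrightarrow> \<alpha> b = 0}"
      by (simp add: o_def)
  qed (rule r)
qed

text \<open>The bound involves the majorant alone, so it is uniform in any parameter that
  \<open>f\<close> may carry. This turns pointwise expansions of the ground state into an expansion
  in norm.\<close>

lemma has_sum_remainder_le:
  fixes f :: "'i \<Rightarrow> complex" and g :: "'i \<Rightarrow> real"
  assumes f: "(f has_sum a) UNIV" and g: "(g has_sum S) UNIV" and le: "\<And>i. norm (f i) \<le> g i" and A: "finite A"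
  shows "norm (a - sum f A) \<le> S - sum g A"
proof -
  have lf: "((\<lambda>F. norm (sum f F - sum f A)) \<longlongrightarrow> norm (a - sum f A)) (finite_subsets_at_top UNIV)"
    using f unfolding has_sum_def by (intro tendsto_intros)
  have lg: "((\<lambda>F. sum g F - sum g A) \<longlongrightarrow> S - sum g A) (finite_subsets_at_top UNIV)"
    using g unfolding has_sum_def by (intro tendsto_intros)
  have ev: "\<forall>\<^sub>F F in finite_subsets_at_top UNIV. norm (sum f F - sum f A) \<le> sum g F - sum g A"
    unfolding eventually_finite_subsets_at_top
  proof (intro exI[of _ A] conjI allI impI)
    fix F assume F: "finite F \<and> A \<subseteq> F \<and> F \<subseteq> UNIV"
    then have "sum f F - sum f A = sum f (F - A)" "sum g F - sum g A = sum g (F - A)"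
      by (simp_all add: sum_diff)
    then show "norm (sum f F - sum f A) \<le> sum g F - sum g A"
      using sum_norm_le[of "F - A" f g] le by simp
  qed (use A in auto)
  show ?thesis by (rule tendsto_le[OF _ lg lf ev]) simp
qed

lemma norm_vec_le_sum: "norm (x :: complex^'n) \<le> (\<Sum>i\<in>UNIV. norm (x $ i))"
  unfolding norm_vec_def by (rule L2_set_le_sum) simp

lemma cv_diff: "cv x - cv y = cv (x - y)"
  by (simp add: vec_eq_iff)

context boson
begin

lemma neumann_mono: "neumann K0 z0 r' A \<theta> \<Longrightarrow> r \<le> r' \<Longrightarrow> neumann K0 z0 r A \<theta>"
  unfolding neumann_def using near_mono nearv_mono by blast

subsection \<open>Holomorphic extension of the ground state\<close>

definition ground_state :: "real^'n \<Rightarrow> real^'n \<Rightarrow> real^'n \<Rightarrow> real" where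
  "ground_state K p q = \<kappa> * (G K (eK K) p + G K (eK K) q + G K (eK K) (K - p - q)) * R K (eK K) p q"

text \<open>Common source of the three analyticity statements. The energy extends by the implicit
  function argument for \<open>Dd - 1\<close>, whose derivative is nonzero by
  \<open>Dd_diff\<close>; at real vectors the root is real, valid and subcritical, so by uniqueness
  it is \<open>eK\<close>. The eigenfunction extends by inserting the extended energy into its
  formula.\<close>

lemma ground_state_extension:
  fixes K0 :: "real^'n"
  assumes d: "CARD('n) \<le> 2"
  shows "\<exists>\<rho>>0. \<exists>B \<epsilon>. \<exists>Ft :: complex^'n \<Rightarrow> complex^'n \<Rightarrow> complex^'n \<Rightarrow> complex.
    (\<forall>K. dist (cv K) (cv K0 :: complex^'n) < \<rho> \<longrightarrow> \<epsilon> (cv K) = of_real (eK K) \<and> (\<forall>p q. Ft (cv K) (cv p) (cv q) = of_real (ground_state K p q))) \<and>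
    (\<forall>k P Q. dist k (cv K0) < \<rho> \<longrightarrow> nearv \<rho> P \<longrightarrow> nearv \<rho> Q \<longrightarrow> norm (\<epsilon> k) \<le> B \<and> norm (Ft k P Q) \<le> B) \<and>
    (\<forall>U \<gamma>. open U \<longrightarrow> curve U \<gamma> \<longrightarrow> (\<forall>x\<in>U. dist (\<gamma> x) (cv K0) < \<rho>) \<longrightarrow> (\<lambda>x. \<epsilon> (\<gamma> x)) holomorphic_on U) \<and>
    (\<forall>U \<gamma> \<pi> \<xi>. open U \<longrightarrow> curve U \<gamma> \<longrightarrow> curve U \<pi> \<longrightarrow> curve U \<xi> \<longrightarrow>
       (\<forall>x\<in>U. dist (\<gamma> x) (cv K0) < \<rho> \<and> nearv \<rho> (\<pi> x) \<and> nearv \<rho> (\<xi> x)) \<longrightarrow> (\<lambda>x. Ft (\<gamma> x) (\<pi> x) (\<xi> x)) holomorphic_on U) \<and>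
    (\<forall>k. (\<lambda>z. Ft k (cv (fst z)) (cv (snd z))) \<in> borel_measurable borel)"
proof -
  let ?M = "Mtop TYPE('n)"
  define e0 where "e0 = eK K0"
  have P0: "subcritical K0 e0" unfolding e0_def by (rule subcritical_eK[OF d])
  have v0: "valid K0 e0" using P0 by (simp add: subcritical_def)
  obtain r1 A \<theta> C where g1: "good K0 e0 r1 C" and n1: "neumann K0 e0 r1 A \<theta>" using neumann_if_subcritical[OF P0] by blast
  obtain r2 where r2: "r2 > 0" "\<And>K z. near r2 K0 e0 (cv K) (of_real z) \<Longrightarrow> valid (K :: real^'n) z"
    using near_real[OF v0] by blast
  have Me: "?M - e0 > 1" using valid_less[OF v0] by simp
  \<comment> \<open>With \<open>r \<le> 1/2\<close> and \<open>?M - e0 > 1\<close> the denominator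
    \<open>?M - z\<close> of \<open>Dd\<close> keeps modulus at least 1/2.\<close>
  define r where "r = min 1 (min r1 r2) / 2"
  have r: "r > 0" "r \<le> 1/2" "r \<le> r1" "r \<le> r2" using r2(1) good_pos[OF g1] by (auto simp: r_def)
  have gd: "good K0 e0 r C" by (rule good_mono[OF g1 r(1,3)])
  have nm: "neumann K0 e0 r A \<theta>" by (rule neumann_mono[OF n1 r(3)])
  have nr: "near r K0 e0 k z" if "k \<in> ball (cv K0) r" "z \<in> ball (of_real e0) r" for k z
    using that by (simp add: near_def dist_commute)
  define D where "D k z = Dd k z - 1" for k :: "complex^'n" and z
  have chol: "curve_hol (ball (cv K0) r \<times> ball (of_real e0) r) D"
    unfolding curve_hol_def D_def
  proof (intro allI impI)
    fix U and \<gamma> :: "complex \<Rightarrow> complex^'n" and \<zeta>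
    assume U: "open U" "curve U \<gamma>" "\<zeta> holomorphic_on U" and in': "\<forall>x\<in>U. (\<gamma> x, \<zeta> x) \<in> ball (cv K0) r \<times> ball (complex_of_real e0) r"
    have "(\<lambda>x. Dd (\<gamma> x) (\<zeta> x)) holomorphic_on U"
      by (rule holomorphic_Dd[OF gd nm U]) (use in' nr in blast)
    then show "(\<lambda>x. Dd (\<gamma> x) (\<zeta> x) - 1) holomorphic_on U" by (intro holomorphic_intros)
  qed
  have th: "0 \<le> \<theta>" "\<theta> < 1" "A \<ge> 0" using nm by (auto simp: neumann_def)
  define GB where "GB = A / (1 - \<theta>)"
  have GB: "GB \<ge> 0" using th by (simp add: GB_def)
  have Gb: "norm (G k z P) \<le> GB" if "near r K0 e0 k z" "nearv r P" for k z P
    unfolding GB_def by (rule neumann_summable(3)[OF nm that])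
  have Dbd: "norm (D k z) \<le> 2 * GB + 1" if k: "k \<in> ball (cv K0) r" and z: "z \<in> ball (of_real e0) r" for k z
  proof -
    have "norm (of_real ?M - of_real e0 :: complex) = ?M - e0" 
      unfolding of_real_diff[symmetric] norm_of_real using Me by simp
    moreover have "norm (z - of_real e0) < 1/2" using z r by (simp add: dist_norm norm_minus_commute)
    ultimately have Mz: "norm (of_real ?M - z) \<ge> 1/2"
      using Me norm_triangle_ineq2[of "of_real ?M - of_real e0" "z - of_real e0"] by simp
    have "norm (\<integral>t. G k z (cv t) \<partial>eta) \<le> GB"
      by (rule eta_bounded(2)) (use Gb[OF nr[OF k z]] r in auto)
    then have "norm (Dd k z) \<le> GB / (1/2)"
      unfolding Dd_def norm_divide using Mz GB by (intro frac_le) auto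
    then show ?thesis unfolding D_def using norm_triangle_ineq4[of "Dd k z" 1] by simp
  qed
  have real_Dd: "Dd (cv K) (of_real z) = complex_of_real (Dd K z)" if "near r K0 e0 (cv K) (of_real z)" for K z
    by (rule neumann_real(4)[OF nm that r(1)])
  have D0: "D (cv K0) (of_real e0) = 0"
    using real_Dd[OF near_self[OF r(1)]] Dd_eK[OF d, of K0] by (simp add: D_def e0_def)
  define a where "a = deriv (D (cv K0)) (of_real e0)"
  have "D (cv K0) holomorphic_on ball (of_real e0) r"
    using chol[unfolded curve_hol_def, rule_format, of "ball (of_real e0) r" "\<lambda>_. cv K0" "\<lambda>x. x"] r by auto
  then have hd: "(D (cv K0) has_field_derivative a) (at (of_real e0))"
    unfolding a_def by (rule holomorphic_derivI[OF _ open_ball]) (use r in simp)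
  \<comment> \<open>The derivative is read off along a sequence from below, since
    \<open>Dd_diff\<close> compares only parameters up to a subcritical one.\<close>
  define y where "y n = e0 - r / real (n + 2)" for n :: nat
  have y: "y n < e0" "e0 - y n < r" for n
    using r by (auto simp: y_def divide_less_eq)
  have ylim: "y \<longlonglongrightarrow> e0"
  proof -
    have "(\<lambda>n. e0 - r * inverse (real (Suc (Suc n)))) \<longlonglongrightarrow> e0 - r * 0"
      by (intro tendsto_intros LIMSEQ_Suc[OF LIMSEQ_inverse_real_of_nat])
    then show ?thesis by (simp add: y_def[abs_def] divide_inverse)
  qed
  define Qt where "Qt n = (Dd K0 (y n) - Dd K0 e0) / (y n - e0)" for n
  have Qlim: "(\<lambda>n. complex_of_real (Qt n)) \<longlonglongrightarrow> a"
  proof -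
    have "(\<lambda>n. (D (cv K0) (of_real (y n)) - D (cv K0) (of_real e0)) / (of_real (y n) - of_real e0)) \<longlonglongrightarrow> a"
    proof -
      have "(\<lambda>n. complex_of_real (y n)) \<longlonglongrightarrow> of_real e0" using ylim by (rule tendsto_of_real)
      moreover have "\<forall>n. complex_of_real (y n) \<in> UNIV - {of_real e0}" using y(1) by (auto simp: less_le)
      ultimately show ?thesis
        using hd[unfolded has_field_derivative_iff tendsto_at_iff_sequentially, rule_format, of "\<lambda>n. of_real (y n)"]
        by (simp add: o_def)
    qed
    moreover have "(D (cv K0) (of_real (y n)) - D (cv K0) (of_real e0)) / (of_real (y n) - of_real e0) = of_real (Qt n)" for n
    proof -
      have "near r K0 e0 (cv K0) (of_real (y n))" using near_of_real[OF r(1), of K0 e0 "y n"] y[of n] by simp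
      then show ?thesis using real_Dd near_self[OF r(1), of K0 e0] by (simp add: D_def Qt_def)
    qed
    ultimately show ?thesis by simp
  qed
  have areal: "a \<in> \<real>"
    by (rule closed_sequentially[OF closed_complex_Reals _ Qlim]) simp
  \<comment> \<open>A lower bound for all difference quotients at once, because
    \<open>?M - y n\<close> never exceeds \<open>?M - e0 + r\<close>.\<close>
  define m where "m = 2 * \<kappa> / ((?M - e0) * (?M - e0 + r))"
  have m: "m > 0" using \<kappa> Me r by (simp add: m_def)
  have Qm: "m \<le> Qt n" for n
  proof -
    have pos: "0 < e0 - y n" using y by simp
    have "2 * \<kappa> * (e0 - y n) / ((?M - e0) * (?M - y n)) \<le> Dd K0 e0 - Dd K0 (y n)"
      by (rule Dd_diff[OF P0]) (use y(1) in \<open>simp add: less_imp_le\<close>)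
    then have "2 * \<kappa> * (e0 - y n) / ((?M - e0) * (?M - y n)) / (e0 - y n) \<le> (Dd K0 e0 - Dd K0 (y n)) / (e0 - y n)"
      using pos by (intro divide_right_mono) auto
    moreover have "(Dd K0 e0 - Dd K0 (y n)) / (e0 - y n) = Qt n"
      unfolding Qt_def by (metis minus_diff_eq minus_divide_divide)
    moreover have "2 * \<kappa> * (e0 - y n) / ((?M - e0) * (?M - y n)) / (e0 - y n) = 2 * \<kappa> / ((?M - e0) * (?M - y n))"
      using pos by simp
    moreover have "m \<le> 2 * \<kappa> / ((?M - e0) * (?M - y n))"
      unfolding m_def using \<kappa> Me y[of n] by (intro divide_left_mono mult_left_mono mult_pos_pos) auto
    ultimately show ?thesis by linarith
  qed
  have a0: "a \<noteq> 0"
  proof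
    assume "a = 0"
    then have "(\<lambda>n. Re (complex_of_real (Qt n))) \<longlonglongrightarrow> Re 0" using tendsto_Re[OF Qlim] by simp
    then have "Qt \<longlonglongrightarrow> 0" by simp
    then have "m \<le> 0" using Qm by (intro LIMSEQ_le_const) auto
    then show False using m by simp
  qed
  have "\<exists>\<rho>>0. \<exists>\<epsilon>. (\<forall>k\<in>ball (cv K0) \<rho>. \<epsilon> k \<in> ball (of_real e0) r \<and> D k (\<epsilon> k) = 0 \<and> (k \<in> range cv \<longrightarrow> \<epsilon> k \<in> \<real>)) \<and>
    (\<forall>U \<gamma>. open U \<longrightarrow> curve U \<gamma> \<longrightarrow> (\<forall>x\<in>U. \<gamma> x \<in> ball (cv K0) \<rho>) \<longrightarrow> (\<lambda>x. \<epsilon> (\<gamma> x)) holomorphic_on U)"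
  proof (rule implicit_curve_hol[OF r(1) chol Dbd D0 a_def[symmetric] a0 closed_complex_Reals])
    \<comment> \<open>The invariant set is the real line: at real arguments \<open>Dd\<close> is
      real, and so is the slope \<open>a\<close> as a limit of real quotients.\<close>
    fix k :: "complex^'n" and z :: complex assume k: "k \<in> range cv" "z \<in> \<real>" "k \<in> ball (cv K0) r" "z \<in> ball (of_real e0) r"
    then obtain K x where Kx: "k = cv K" "z = of_real x" by (auto elim!: Reals_cases)
    have "Dd k z \<in> \<real>" using real_Dd nr[OF k(3,4)] unfolding Kx by simp
    then show "z - D k z / a \<in> \<real>" unfolding D_def using k(2) areal by (intro Reals_diff Reals_divide) auto
  qed (simp_all)
  then obtain \<rho>0 \<epsilon> where \<rho>0: "\<rho>0 > 0"
    and e1: "\<forall>k\<in>ball (cv K0) \<rho>0. \<epsilon> k \<in> ball (of_real e0) r \<and> D k (\<epsilon> k) = 0 \<and> (k \<in> range cv \<longrightarrow> \<epsilon> k \<in> \<real>)"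
    and e2: "\<forall>U \<gamma>. open U \<longrightarrow> curve U \<gamma> \<longrightarrow> (\<forall>x\<in>U. \<gamma> x \<in> ball (cv K0) \<rho>0) \<longrightarrow> (\<lambda>x. \<epsilon> (\<gamma> x)) holomorphic_on U"
    by (elim exE conjE) (rule that)
  have \<epsilon>: "\<epsilon> k \<in> ball (of_real e0) r" "D k (\<epsilon> k) = 0" "k \<in> range cv \<Longrightarrow> \<epsilon> k \<in> \<real>" if "k \<in> ball (cv K0) \<rho>0" for k
    using bspec[OF e1 that] by simp_all
  have \<epsilon>4: "(\<lambda>x. \<epsilon> (\<gamma> x)) holomorphic_on U"
    if "open U" "curve U \<gamma>" "\<And>x. x \<in> U \<Longrightarrow> \<gamma> x \<in> ball (cv K0) \<rho>0" for U \<gamma>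
    using e2[rule_format, OF that(1,2)] that(3) by simp
  \<comment> \<open>The third momentum \<open>k - P - Q\<close> accumulates three displacements and
    must remain in the strip of width \<open>r\<close>.\<close>
  define \<rho> where "\<rho> = min \<rho>0 (r / 3)"
  have \<rho>: "\<rho> > 0" "\<rho> \<le> \<rho>0" "3 * \<rho> \<le> r" "\<rho> \<le> r" using \<rho>0 r by (auto simp: \<rho>_def)
  have inb: "k \<in> ball (cv K0) \<rho>0" "k \<in> ball (cv K0) r" if "dist k (cv K0) < \<rho>" for k
    using that \<rho> by (auto simp: dist_commute)
  have ne: "near r K0 e0 k (\<epsilon> k)" if "dist k (cv K0) < \<rho>" for k
    by (rule nr[OF inb(2)[OF that] \<epsilon>(1)[OF inb(1)[OF that]]])
  have eps_real: "\<epsilon> (cv K) = of_real (eK K)" if K: "dist (cv K) (cv K0 :: complex^'n) < \<rho>" for K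
  proof -
    obtain w where w: "\<epsilon> (cv K) = of_real w" using \<epsilon>(3)[OF inb(1)[OF K]] by (auto elim!: Reals_cases)
    have nw: "near r K0 e0 (cv K) (of_real w)" using ne[OF K] w by simp
    have "Dd (cv K) (of_real w) = (1 :: complex)" using \<epsilon>(2)[OF inb(1)[OF K]] by (simp add: w D_def)
    then have D1: "Dd K w = 1" using real_Dd[OF nw] by simp
    have "valid K w" by (rule r2(2)[OF near_mono[OF nw r(4)]])
    then have "subcritical K w" by (rule subcritical_if_Dd_le_1[OF nm nw r(1)]) (simp add: D1)
    then have "w = eK K" by (rule eK_unique[OF d _ D1])
    then show ?thesis using w by simp
  qed
  define Ft where "Ft k P Q = of_real \<kappa> * (G k (\<epsilon> k) P + G k (\<epsilon> k) Q + G k (\<epsilon> k) (k - P - Q)) * R k (\<epsilon> k) P Q" for k P Q :: "complex^'n"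
  have third: "nearv r (k - P - Q)" if k: "dist k (cv K0) < \<rho>" and P: "nearv \<rho> P" and Q: "nearv \<rho> Q" for k P Q
  proof -
    obtain p q where pq: "dist P (cv p) < \<rho>" "dist Q (cv q) < \<rho>" using P Q by (auto simp: nearv_def)
    have eq: "k - P - Q - cv (K0 - p - q) = (k - cv K0) - (P - cv p) - (Q - cv q)"
      by (simp add: vec_eq_iff)
    have "norm (k - P - Q - cv (K0 - p - q)) \<le> norm (k - cv K0) + norm (P - cv p) + norm (Q - cv q)"
      using norm_triangle_ineq4[of "(k - cv K0) - (P - cv p)" "Q - cv q"] norm_triangle_ineq4[of "k - cv K0" "P - cv p"]
      unfolding eq by linarith
    then have "dist (k - P - Q) (cv (K0 - p - q)) < r" using k pq \<rho>(3) by (simp add: dist_norm)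
    then show ?thesis by (auto simp: nearv_def)
  qed
  have nvr: "nearv r P" if "nearv \<rho> P" for P :: "complex^'n" by (rule nearv_mono[OF that \<rho>(4)])
  have Ft_real: "Ft (cv K) (cv p) (cv q) = of_real (ground_state K p q)" if K: "dist (cv K) (cv K0 :: complex^'n) < \<rho>" for K p q
  proof -
    have n: "near r K0 e0 (cv K) (of_real (eK K))" using ne[OF K] eps_real[OF K] by simp
    show ?thesis
      unfolding Ft_def ground_state_def eps_real[OF K] cv_diff neumann_real(3)[OF nm n r(1)] R_cv by simp
  qed
  define B where "B = (\<bar>e0\<bar> + r) + \<kappa> * (3 * GB) * C"
  have C0: "C \<ge> 0" by (rule good_C_nonneg[OF gd near_self[OF r(1)]])
  have bound: "norm (\<epsilon> k) \<le> B \<and> norm (Ft k P Q) \<le> B" if k: "dist k (cv K0) < \<rho>" and P: "nearv \<rho> P" and Q: "nearv \<rho> Q" for k P Q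
  proof
    have "norm (\<epsilon> k - of_real e0) < r" using \<epsilon>(1)[OF inb(1)[OF k]] by (simp add: dist_norm norm_minus_commute)
    then have "norm (\<epsilon> k) \<le> \<bar>e0\<bar> + r" using norm_triangle_ineq2[of "\<epsilon> k" "of_real e0"] by simp
    moreover have "0 \<le> \<kappa> * (3 * GB) * C" using \<kappa> GB C0 by simp
    ultimately show "norm (\<epsilon> k) \<le> B" unfolding B_def by linarith
    let ?G = "G k (\<epsilon> k)"
    have "norm (?G P + ?G Q + ?G (k - P - Q)) \<le> GB + GB + GB"
      using Gb[OF ne[OF k] nvr[OF P]] Gb[OF ne[OF k] nvr[OF Q]] Gb[OF ne[OF k] third[OF k P Q]]
      by (intro order_trans[OF norm_triangle_ineq add_mono[OF order_trans[OF norm_triangle_ineq add_mono]]])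
    then have "norm (?G P + ?G Q + ?G (k - P - Q)) \<le> 3 * GB" by simp
    moreover have "norm (R k (\<epsilon> k) P Q) \<le> C" by (rule goodD(4)[OF gd ne[OF k] nvr[OF P] nvr[OF Q]])
    ultimately have "norm (Ft k P Q) \<le> \<kappa> * (3 * GB) * C"
      unfolding Ft_def norm_mult using \<kappa> GB by (intro mult_mono) auto
    then show "norm (Ft k P Q) \<le> B" using r(1) unfolding B_def by linarith
  qed
  have hol\<epsilon>: "(\<lambda>x. \<epsilon> (\<gamma> x)) holomorphic_on U"
    if "open U" "curve U \<gamma>" "\<And>x. x \<in> U \<Longrightarrow> dist (\<gamma> x) (cv K0) < \<rho>" for U \<gamma>
    by (rule \<epsilon>4[OF that(1,2)]) (rule inb(1)[OF that(3)])
  have holF: "(\<lambda>x. Ft (\<gamma> x) (\<pi> x) (\<xi> x)) holomorphic_on U"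
    if U: "open U" and c: "curve U \<gamma>" "curve U \<pi>" "curve U \<xi>"
      and i: "\<And>x. x \<in> U \<Longrightarrow> dist (\<gamma> x) (cv K0) < \<rho>" "\<And>x. x \<in> U \<Longrightarrow> nearv \<rho> (\<pi> x)" "\<And>x. x \<in> U \<Longrightarrow> nearv \<rho> (\<xi> x)"
    for U \<gamma> \<pi> \<xi>
  proof -
    have h\<epsilon>: "(\<lambda>x. \<epsilon> (\<gamma> x)) holomorphic_on U" by (rule hol\<epsilon>[OF U c(1) i(1)])
    have n: "near r K0 e0 (\<gamma> x) (\<epsilon> (\<gamma> x))" if "x \<in> U" for x by (rule ne[OF i(1)[OF that]])
    have c3: "curve U (\<lambda>x. \<gamma> x - \<pi> x - \<xi> x)" using c by (auto simp: curve_def intro!: holomorphic_intros)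
    have hG: "(\<lambda>x. G (\<gamma> x) (\<epsilon> (\<gamma> x)) (\<pi>' x)) holomorphic_on U"
      if "curve U \<pi>'" "\<And>x. x \<in> U \<Longrightarrow> nearv r (\<pi>' x)" for \<pi>'
      by (rule holomorphic_G[OF gd nm U c(1) h\<epsilon> n that])
    have hR: "(\<lambda>x. R (\<gamma> x) (\<epsilon> (\<gamma> x)) (\<pi> x) (\<xi> x)) holomorphic_on U"
      by (rule holomorphic_R[OF gd U c(1) h\<epsilon> n c(2) _ c(3)]) (auto intro: nvr i)
    show ?thesis unfolding Ft_def
      by (intro holomorphic_on_mult holomorphic_on_add holomorphic_on_const hR hG c(2,3) c3 nvr i third)
  qed
  have meas: "(\<lambda>z. Ft k (cv (fst z)) (cv (snd z))) \<in> borel_measurable borel" for k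
  proof -
    have [measurable]: "(\<lambda>z::(real^'n) \<times> (real^'n). (cv (fst z) :: complex^'n)) \<in> borel_measurable borel"
      "(\<lambda>z::(real^'n) \<times> (real^'n). (cv (snd z) :: complex^'n)) \<in> borel_measurable borel"
      by (rule measurable_compose[OF borel_measurable_continuous_onI cv_measurable], intro continuous_intros)+
    show ?thesis unfolding Ft_def by measurable
  qed
  have a1: "\<forall>K. dist (cv K) (cv K0 :: complex^'n) < \<rho> \<longrightarrow> \<epsilon> (cv K) = of_real (eK K) \<and> (\<forall>p q. Ft (cv K) (cv p) (cv q) = of_real (ground_state K p q))"
    using eps_real Ft_real by simp
  have a2: "\<forall>k P Q. dist k (cv K0) < \<rho> \<longrightarrow> nearv \<rho> P \<longrightarrow> nearv \<rho> Q \<longrightarrow> norm (\<epsilon> k) \<le> B \<and> norm (Ft k P Q) \<le> B"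
    using bound by simp
  have a3: "\<forall>U \<gamma>. open U \<longrightarrow> curve U \<gamma> \<longrightarrow> (\<forall>x\<in>U. dist (\<gamma> x) (cv K0) < \<rho>) \<longrightarrow> (\<lambda>x. \<epsilon> (\<gamma> x)) holomorphic_on U"
    by (intro allI impI, rule hol\<epsilon>) simp_all
  have a4: "\<forall>U \<gamma> \<pi> \<xi>. open U \<longrightarrow> curve U \<gamma> \<longrightarrow> curve U \<pi> \<longrightarrow> curve U \<xi> \<longrightarrow>
       (\<forall>x\<in>U. dist (\<gamma> x) (cv K0) < \<rho> \<and> nearv \<rho> (\<pi> x) \<and> nearv \<rho> (\<xi> x)) \<longrightarrow> (\<lambda>x. Ft (\<gamma> x) (\<pi> x) (\<xi> x)) holomorphic_on U"
    by (intro allI impI, rule holF) simp_all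
  show ?thesis
    by (rule exI[of _ \<rho>], rule conjI[OF \<rho>(1)], rule exI[of _ B], rule exI[of _ \<epsilon>], rule exI[of _ Ft])
      (rule conjI[OF a1 conjI[OF a2 conjI[OF a3 conjI[OF a4 allI[OF meas]]]]])
qed

end

text \<open>The normalised measure has total mass 1, so a sup bound is an \<open>L2\<close> bound
  with the same constant.\<close>

lemma l2norm_le:
  fixes f :: "real^'n \<Rightarrow> real^'n \<Rightarrow> complex"
  assumes m: "(\<lambda>z. f (fst z) (snd z)) \<in> borel_measurable borel" and b: "\<And>p q. norm (f p q) \<le> b"
  shows "l2norm f \<le> b" "L2fn f"
proof -
  have b0: "b \<ge> 0" using b[of 0 0] norm_ge_zero order_trans by blast
  have u: "emeasure (eta2 :: ((real^'n) \<times> (real^'n)) measure) UNIV = 1"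
  proof -
    have "emeasure (eta2 :: ((real^'n) \<times> (real^'n)) measure) (UNIV \<times> UNIV) = emeasure (eta :: (real^'n) measure) UNIV * emeasure (eta :: (real^'n) measure) UNIV"
      by (rule eta.emeasure_pair_measure_Times) auto
    then show ?thesis by simp
  qed
  have "sqnorm f \<le> (\<integral>\<^sup>+z. ennreal (b\<^sup>2) \<partial>(eta2 :: ((real^'n) \<times> (real^'n)) measure))"
    unfolding sqnorm_eq[OF m] by (intro nn_integral_mono ennreal_leI power_mono b) auto
  also have "\<dots> = ennreal (b\<^sup>2)" using u by (simp add: space_pair_measure)
  finally have s: "sqnorm f \<le> ennreal (b\<^sup>2)" .
  then show "L2fn f" unfolding L2fn_def using m by (auto intro: le_less_trans)
  have "enn2real (sqnorm f) \<le> b\<^sup>2" using s by (intro enn2real_leI) auto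
  then show "l2norm f \<le> b" unfolding l2norm_def using b0 by (simp add: real_le_lsqrt)
qed

lemma holomorphic_fun_upd [holomorphic_intros]: "(\<lambda>x. (w(i := x)) j) holomorphic_on U"
  by (cases "j = i") simp_all

lemma multi_idx_UNIV [simp]: "multi_idx UNIV = UNIV"
  by (simp add: multi_idx_def)

section \<open>Analyticity of the energy, and of the ground state in the momenta and as an
  \<open>L2\<close>-valued map\<close>

context boson
begin

lemma real_analytic_eK:
  assumes d: "CARD('n::finite) \<le> 2"
  shows "real_analytic (eK :: real^'n \<Rightarrow> real)"
  unfolding real_analytic_def
proof
  fix K0 :: "real^'n"
  obtain \<rho> B \<epsilon> Ft where \<rho>: "\<rho> > 0"
    and a1: "\<forall>K. dist (cv K) (cv K0 :: complex^'n) < \<rho> \<longrightarrow> \<epsilon> (cv K) = complex_of_real (eK K) \<and> (\<forall>p q. Ft (cv K) (cv p) (cv q) = complex_of_real (ground_state K p q))"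
    and a2: "\<forall>k P Q. dist k (cv K0) < \<rho> \<longrightarrow> nearv \<rho> P \<longrightarrow> nearv \<rho> Q \<longrightarrow> norm (\<epsilon> k) \<le> B \<and> norm (Ft k P Q) \<le> B"
    and a3: "\<forall>U \<gamma>. open U \<longrightarrow> curve U \<gamma> \<longrightarrow> (\<forall>x\<in>U. dist (\<gamma> x) (cv K0) < \<rho>) \<longrightarrow> (\<lambda>x. \<epsilon> (\<gamma> x)) holomorphic_on U"
    using ground_state_extension[OF d, of K0] by (elim exE conjE) (rule that)
  \<comment> \<open>Coordinates bounded by \<open>r\<close> add up to a norm below
    \<open>\<rho>\<close>.\<close>
  define r where "r = \<rho> / real CARD('n)"
  have r: "r > 0" using \<rho> by (simp add: r_def)
  define k where "k w = (\<chi> i. of_real (K0 $ i) + w (axis i 1))" for w :: "real^'n \<Rightarrow> complex"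
  have ax: "axis i 1 \<in> (Basis :: (real^'n) set)" for i by (auto simp: Basis_vec_def)
  have near_k: "dist (k w) (cv K0) < \<rho>" if "\<And>b. b \<in> Basis \<Longrightarrow> norm (w b) < r" for w
  proof -
    have "norm (k w - cv K0) \<le> (\<Sum>i\<in>UNIV. norm ((k w - cv K0) $ i))" by (rule norm_vec_le_sum)
    also have "\<dots> < (\<Sum>i\<in>(UNIV::'n set). r)"
      by (rule sum_strict_mono) (auto simp: k_def intro: that ax)
    finally show ?thesis by (simp add: dist_norm r_def)
  qed
  have "ra_at (\<lambda>K. complex_of_real (eK K)) K0"
  proof (rule ra_at_if_separately_holomorphic[where \<Phi>="\<lambda>w. \<epsilon> (k w)", OF r])
    fix w :: "real^'n \<Rightarrow> complex" assume w: "w \<in> poly_disc Basis r"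
    have "dist (k w) (cv K0) < \<rho>" by (rule near_k) (use w in \<open>auto simp: poly_disc_def\<close>)
    then show "norm (\<epsilon> (k w)) \<le> B" using a2[rule_format, of "k w" "cv 0" "cv 0"] nearv_cv[OF \<rho>] by blast
    fix b :: "real^'n" assume b: "b \<in> Basis"
    show "(\<lambda>x. \<epsilon> (k (w(b := x)))) holomorphic_on ball 0 r"
    proof (rule a3[rule_format, OF open_ball])
      show "curve (ball 0 r) (\<lambda>x. k (w(b := x)))"
        unfolding curve_def k_def vec_lambda_beta by (intro allI holomorphic_intros)+
      show "dist (k (w(b := x))) (cv K0) < \<rho>" if "x \<in> ball 0 r" for x
        by (rule near_k) (use w that in \<open>auto simp: poly_disc_def\<close>)
    qed
  next
    fix y assume y: "y \<in> ball K0 r"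
    define w where "w = (\<lambda>b. if b \<in> Basis then complex_of_real ((y - K0) \<bullet> b) else 0)"
    have kw: "k w = cv y"
      by (simp add: vec_eq_iff k_def w_def ax inner_axis del: of_real_inner_1)
    have "dist (k w) (cv K0) < \<rho>"
    proof (rule near_k)
      fix b :: "real^'n" assume b: "b \<in> Basis"
      show "norm (w b) < r" using Basis_le_norm[OF b, of "y - K0"] y b
        by (simp add: w_def dist_norm norm_minus_commute del: of_real_inner_1)
    qed
    then show "complex_of_real (eK y) = \<epsilon> (k (\<lambda>b. if b \<in> Basis then complex_of_real ((y - K0) \<bullet> b) else 0))"
      using a1[rule_format, of y] unfolding w_def[symmetric] kw by simp
  qed
  then show "ra_at eK K0" by (rule ra_at_of_real_imp)
qed

lemma real_analytic_ground_state:
  fixes K :: "real^'n"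
  assumes d: "CARD('n) \<le> 2"
  shows "real_analytic (\<lambda>z. complex_of_real (ground_state K (fst z) (snd z)))"
  unfolding real_analytic_def
proof
  fix z0 :: "(real^'n) \<times> (real^'n)"
  obtain \<rho> B \<epsilon> Ft where \<rho>: "\<rho> > 0"
    and a1: "\<forall>K'. dist (cv K') (cv K :: complex^'n) < \<rho> \<longrightarrow> \<epsilon> (cv K') = complex_of_real (eK K') \<and> (\<forall>p q. Ft (cv K') (cv p) (cv q) = complex_of_real (ground_state K' p q))"
    and a2: "\<forall>k P Q. dist k (cv K) < \<rho> \<longrightarrow> nearv \<rho> P \<longrightarrow> nearv \<rho> Q \<longrightarrow> norm (\<epsilon> k) \<le> B \<and> norm (Ft k P Q) \<le> B"
    and a4: "\<forall>U \<gamma> \<pi> \<xi>. open U \<longrightarrow> curve U \<gamma> \<longrightarrow> curve U \<pi> \<longrightarrow> curve U \<xi> \<longrightarrow>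
       (\<forall>x\<in>U. dist (\<gamma> x) (cv K) < \<rho> \<and> nearv \<rho> (\<pi> x) \<and> nearv \<rho> (\<xi> x)) \<longrightarrow> (\<lambda>x. Ft (\<gamma> x) (\<pi> x) (\<xi> x)) holomorphic_on U"
    using ground_state_extension[OF d, of K] by (elim exE conjE) (rule that)
  define r where "r = \<rho> / real CARD('n)"
  have r: "r > 0" using \<rho> by (simp add: r_def)
  define P where "P w = (\<chi> i. of_real (fst z0 $ i) + w (axis i 1, 0))" for w :: "(real^'n) \<times> (real^'n) \<Rightarrow> complex"
  define Q where "Q w = (\<chi> i. of_real (snd z0 $ i) + w (0, axis i 1))" for w :: "(real^'n) \<times> (real^'n) \<Rightarrow> complex"
  have ax: "(axis i 1, 0) \<in> (Basis :: ((real^'n) \<times> (real^'n)) set)" "(0, axis i 1) \<in> (Basis :: ((real^'n) \<times> (real^'n)) set)" for i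
    by (auto simp: Basis_vec_def Basis_prod_def)
  have nearP: "nearv \<rho> (P w)" and nearQ: "nearv \<rho> (Q w)" if "\<And>b. b \<in> Basis \<Longrightarrow> norm (w b) < r" for w
  proof -
    have "norm (P w - cv (fst z0)) \<le> (\<Sum>i\<in>UNIV. norm ((P w - cv (fst z0)) $ i))" by (rule norm_vec_le_sum)
    also have "\<dots> < (\<Sum>i\<in>(UNIV::'n set). r)"
      by (rule sum_strict_mono) (auto simp: P_def intro: that ax)
    finally have "dist (P w) (cv (fst z0)) < \<rho>" by (simp add: dist_norm r_def)
    then show "nearv \<rho> (P w)" by (auto simp: nearv_def)
    have "norm (Q w - cv (snd z0)) \<le> (\<Sum>i\<in>UNIV. norm ((Q w - cv (snd z0)) $ i))" by (rule norm_vec_le_sum)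
    also have "\<dots> < (\<Sum>i\<in>(UNIV::'n set). r)"
      by (rule sum_strict_mono) (auto simp: Q_def intro: that ax)
    finally have "dist (Q w) (cv (snd z0)) < \<rho>" by (simp add: dist_norm r_def)
    then show "nearv \<rho> (Q w)" by (auto simp: nearv_def)
  qed
  have k0: "dist (cv K) (cv K :: complex^'n) < \<rho>" using \<rho> by simp
  show "ra_at (\<lambda>z. complex_of_real (ground_state K (fst z) (snd z))) z0"
  proof (rule ra_at_if_separately_holomorphic[where \<Phi>="\<lambda>w. Ft (cv K) (P w) (Q w)", OF r])
    fix w :: "(real^'n) \<times> (real^'n) \<Rightarrow> complex" assume w: "w \<in> poly_disc Basis r"
    have wb: "norm (w b) < r" if "b \<in> Basis" for b using w that by (auto simp: poly_disc_def)
    show "norm (Ft (cv K) (P w) (Q w)) \<le> B"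
    proof -
      have "nearv \<rho> (P w)" "nearv \<rho> (Q w)" by (rule nearP nearQ, rule wb, assumption)+
      then show ?thesis using a2 k0 by blast
    qed
    fix b :: "(real^'n) \<times> (real^'n)" assume b: "b \<in> Basis"
    show "(\<lambda>x. Ft (cv K) (P (w(b := x))) (Q (w(b := x)))) holomorphic_on ball 0 r"
    proof (rule a4[rule_format, OF open_ball curve_const])
      show "curve (ball 0 r) (\<lambda>x. P (w(b := x)))" "curve (ball 0 r) (\<lambda>x. Q (w(b := x)))"
        unfolding curve_def P_def Q_def vec_lambda_beta by (intro allI holomorphic_intros)+
      fix x :: complex assume x: "x \<in> ball 0 r"
      have "norm ((w(b := x)) b') < r" if "b' \<in> Basis" for b' using wb[OF that] x by simp
      then show "dist (cv K) (cv K :: complex^'n) < \<rho> \<and> nearv \<rho> (P (w(b := x))) \<and> nearv \<rho> (Q (w(b := x)))"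
        using k0 nearP nearQ by blast
    qed
  next
    fix y assume y: "y \<in> ball z0 r"
    define w where "w = (\<lambda>b. if b \<in> Basis then complex_of_real ((y - z0) \<bullet> b) else 0)"
    have "P w = cv (fst y)" "Q w = cv (snd y)"
      by (simp_all add: vec_eq_iff P_def Q_def w_def ax inner_axis inner_prod_def del: of_real_inner_1)
    then show "complex_of_real (ground_state K (fst y) (snd y)) = Ft (cv K) (P (\<lambda>b. if b \<in> Basis then complex_of_real ((y - z0) \<bullet> b) else 0)) (Q (\<lambda>b. if b \<in> Basis then complex_of_real ((y - z0) \<bullet> b) else 0))"
      using a1[rule_format, OF k0] unfolding w_def[symmetric] by simp
  qed
qed

text \<open>The momenta play the part of the measurable parameter in
  \<open>osgood_power_series\<close>: the expansion in \<open>K\<close> is pointwise in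
  \<open>(p, q)\<close>, its coefficients are measurable and bounded, hence in \<open>L2\<close>,
  and a geometric majorant independent of \<open>(p, q)\<close> makes the convergence
  uniform.\<close>

lemma L2_analytic_ground_state:
  assumes d: "CARD('n::finite) \<le> 2"
  shows "L2_analytic (\<lambda>(K :: real^'n) p q. complex_of_real (ground_state K p q))"
  unfolding L2_analytic_def
proof
  fix K0 :: "real^'n"
  obtain \<rho> B \<epsilon> Ft where \<rho>: "\<rho> > 0"
    and a1: "\<forall>K. dist (cv K) (cv K0 :: complex^'n) < \<rho> \<longrightarrow> \<epsilon> (cv K) = complex_of_real (eK K) \<and> (\<forall>p q. Ft (cv K) (cv p) (cv q) = complex_of_real (ground_state K p q))"
    and a2: "\<forall>k P Q. dist k (cv K0) < \<rho> \<longrightarrow> nearv \<rho> P \<longrightarrow> nearv \<rho> Q \<longrightarrow> norm (\<epsilon> k) \<le> B \<and> norm (Ft k P Q) \<le> B"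
    and a4: "\<forall>U \<gamma> \<pi> \<xi>. open U \<longrightarrow> curve U \<gamma> \<longrightarrow> curve U \<pi> \<longrightarrow> curve U \<xi> \<longrightarrow>
       (\<forall>x\<in>U. dist (\<gamma> x) (cv K0) < \<rho> \<and> nearv \<rho> (\<pi> x) \<and> nearv \<rho> (\<xi> x)) \<longrightarrow> (\<lambda>x. Ft (\<gamma> x) (\<pi> x) (\<xi> x)) holomorphic_on U"
    and a5: "\<forall>k. (\<lambda>z. Ft k (cv (fst z)) (cv (snd z))) \<in> borel_measurable borel"
    using ground_state_extension[OF d, of K0] by (elim exE conjE) (rule that)
  define r where "r = \<rho> / real CARD('n)"
  have r: "r > 0" using \<rho> by (simp add: r_def)
  define k where "k w = (\<chi> i. of_real (K0 $ i) + w i)" for w :: "'n \<Rightarrow> complex"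
  have near_k: "dist (k w) (cv K0) < \<rho>" if "\<And>i. norm (w i) < r" for w
  proof -
    have "norm (k w - cv K0) \<le> (\<Sum>i\<in>UNIV. norm ((k w - cv K0) $ i))" by (rule norm_vec_le_sum)
    also have "\<dots> < (\<Sum>i\<in>(UNIV::'n set). r)"
      by (rule sum_strict_mono) (auto simp: k_def intro: that)
    finally show ?thesis by (simp add: dist_norm r_def)
  qed
  let ?f = "\<lambda>z w. Ft (k w) (cv (fst z)) (cv (snd z))"
  let ?I = "UNIV :: 'n set"
  have "\<exists>c. (\<forall>\<alpha>\<in>multi_idx ?I. c \<alpha> \<in> borel_measurable borel) \<and>
    (\<forall>z\<in>space borel. \<forall>\<alpha>\<in>multi_idx ?I. norm (c \<alpha> z) \<le> B / (\<Prod>i\<in>?I. r ^ \<alpha> i)) \<and>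
    (\<forall>z\<in>space borel. \<forall>w\<in>poly_disc ?I r. ((\<lambda>\<alpha>. (\<Prod>i\<in>?I. w i ^ \<alpha> i) * c \<alpha> z) has_sum ?f z w) (multi_idx ?I))"
  proof (rule osgood_power_series[OF finite r])
    fix z :: "(real^'n) \<times> (real^'n)" and w :: "'n \<Rightarrow> complex" assume w: "w \<in> poly_disc ?I r"
    have wb: "norm (w b) < r" for b using w by (auto simp: poly_disc_def)
    show "norm (?f z w) \<le> B"
    proof -
      have "dist (k w) (cv K0) < \<rho>" by (rule near_k) (rule wb)
      then show ?thesis using a2 nearv_cv[OF \<rho>] by blast
    qed
    fix i :: 'n
    show "(\<lambda>x. ?f z (w(i := x))) holomorphic_on ball 0 r"
    proof (rule a4[rule_format, OF open_ball _ curve_const curve_const])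
      show "curve (ball 0 r) (\<lambda>x. k (w(i := x)))"
        unfolding curve_def k_def vec_lambda_beta by (intro allI holomorphic_intros)+
      fix x :: complex assume x: "x \<in> ball 0 r"
      have "norm ((w(i := x)) b) < r" for b using wb x by simp
      then show "dist (k (w(i := x))) (cv K0) < \<rho> \<and> nearv \<rho> (cv (fst z)) \<and> nearv \<rho> (cv (snd z))"
        using near_k nearv_cv[OF \<rho>] by blast
    qed
  next
    show "(\<lambda>z. ?f z w) \<in> borel_measurable borel" for w by (rule a5[rule_format])
  qed
  then obtain c where cc: "\<forall>\<alpha>\<in>multi_idx ?I. c \<alpha> \<in> borel_measurable borel"
    "\<forall>z\<in>space borel. \<forall>\<alpha>\<in>multi_idx ?I. norm (c \<alpha> z) \<le> B / (\<Prod>i\<in>?I. r ^ \<alpha> i)"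
    "\<forall>z\<in>space borel. \<forall>w\<in>poly_disc ?I r. ((\<lambda>\<alpha>. (\<Prod>i\<in>?I. w i ^ \<alpha> i) * c \<alpha> z) has_sum ?f z w) (multi_idx ?I)"
    by (elim exE conjE) (rule that)
  have c: "\<And>\<alpha>. c \<alpha> \<in> borel_measurable borel" "\<And>\<alpha> z. norm (c \<alpha> z) \<le> B / (\<Prod>i\<in>?I. r ^ \<alpha> i)"
    "\<And>z w. w \<in> poly_disc ?I r \<Longrightarrow> ((\<lambda>\<alpha>. (\<Prod>i\<in>?I. w i ^ \<alpha> i) * c \<alpha> z) has_sum ?f z w) UNIV"
    using cc unfolding space_borel multi_idx_UNIV by blast+
  define G where "G \<alpha> p q = c \<alpha> (p, q)" for \<alpha> p q
  have Gm: "(\<lambda>z. G \<alpha> (fst z) (snd z)) \<in> borel_measurable borel" for \<alpha> using c(1) by (simp add: G_def)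
  have Gb: "norm (G \<alpha> p q) \<le> B / (\<Prod>i\<in>?I. r ^ \<alpha> i)" for \<alpha> p q using c(2) by (simp add: G_def)
  have B0: "B \<ge> 0"
    using a2[rule_format, of "cv K0" "cv 0" "cv 0"] \<rho> nearv_cv[OF \<rho>] order_trans[OF norm_ge_zero] by auto
  \<comment> \<open>Coefficients are at most \<open>B / r ^ \<alpha>\<close> per coordinate, so on
    the ball of half the radius the terms are at most powers of 1/2.\<close>
  define g where "g \<alpha> = B * (\<Prod>i\<in>?I. (1/2::real) ^ \<alpha> i)" for \<alpha> :: "'n \<Rightarrow> nat"
  define S where "S = B * (\<Prod>i\<in>?I. 1 / (1 - 1/2 :: real))"
  have gS: "(g has_sum S) UNIV"
    unfolding g_def S_def using geometric_multi_idx[of ?I "\<lambda>_. 1/2"] by (intro has_sum_cmult_right) (simp add: multi_idx_def)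
  show "\<exists>r>0. \<exists>G. (\<forall>\<alpha>. L2fn (G \<alpha>)) \<and> (\<forall>K\<in>ball K0 r.
     (\<lambda>\<alpha>. \<bar>mono K0 K \<alpha>\<bar> * l2norm (G \<alpha>)) summable_on UNIV \<and>
     (\<forall>e>0. \<exists>A0. finite A0 \<and> (\<forall>A. finite A \<and> A0 \<subseteq> A \<longrightarrow>
        l2norm (\<lambda>p q. complex_of_real (ground_state K p q) - (\<Sum>\<alpha>\<in>A. complex_of_real (mono K0 K \<alpha>) * G \<alpha> p q)) < e)))"
  proof (rule exI[of _ "r/2"], rule conjI, use r in simp, rule exI[of _ G], intro conjI allI ballI)
    show "L2fn (G \<alpha>)" for \<alpha> by (rule l2norm_le(2)[OF Gm Gb])
    fix K assume K: "K \<in> ball K0 (r/2)"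
    have Ki: "\<bar>K $ i - K0 $ i\<bar> \<le> r / 2" for i
      using K component_le_norm_cart[of "K - K0" i] by (simp add: dist_norm norm_minus_commute)
    have mb: "\<bar>mono K0 K \<alpha>\<bar> * (B / (\<Prod>i\<in>?I. r ^ \<alpha> i)) \<le> g \<alpha>" for \<alpha>
    proof -
      have "\<bar>mono K0 K \<alpha>\<bar> \<le> (\<Prod>i\<in>?I. (r / 2) ^ \<alpha> i)"
        unfolding mono_def abs_prod power_abs by (intro prod_mono conjI power_mono Ki) auto
      then have "\<bar>mono K0 K \<alpha>\<bar> * (B / (\<Prod>i\<in>?I. r ^ \<alpha> i)) \<le> (\<Prod>i\<in>?I. (r / 2) ^ \<alpha> i) * (B / (\<Prod>i\<in>?I. r ^ \<alpha> i))"
        using B0 r by (intro mult_right_mono divide_nonneg_nonneg prod_nonneg) auto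
      also have "\<dots> = B * ((\<Prod>i\<in>?I. (r / 2) ^ \<alpha> i) / (\<Prod>i\<in>?I. r ^ \<alpha> i))" by simp
      also have "\<dots> = g \<alpha>"
        unfolding g_def prod_dividef[symmetric] using r by (simp add: power_divide)
      finally show ?thesis .
    qed
    show "(\<lambda>\<alpha>. \<bar>mono K0 K \<alpha>\<bar> * l2norm (G \<alpha>)) summable_on UNIV"
    proof (rule summable_on_comparison_test)
      show "g summable_on UNIV" using gS by (auto simp: summable_on_def)
      show "\<bar>mono K0 K \<alpha>\<bar> * l2norm (G \<alpha>) \<le> g \<alpha>" for \<alpha>
        using l2norm_le(1)[OF Gm Gb, of \<alpha>] by (intro order_trans[OF mult_left_mono mb]) auto
      show "0 \<le> \<bar>mono K0 K \<alpha>\<bar> * l2norm (G \<alpha>)" for \<alpha> by (simp add: l2norm_def)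
    qed
    define w where "w i = complex_of_real (K $ i - K0 $ i)" for i
    have wr: "norm (w i) < r" for i using Ki[of i] r unfolding w_def norm_of_real by linarith
    have w: "w \<in> poly_disc ?I r" using wr by (auto simp: poly_disc_def)
    have kw: "k w = cv K" by (simp add: vec_eq_iff k_def w_def)
    have real_val: "?f z w = complex_of_real (ground_state K (fst z) (snd z))" for z
    proof -
      have "dist (k w) (cv K0) < \<rho>" by (rule near_k) (rule wr)
      then show ?thesis using a1[rule_format, of K] unfolding kw by simp
    qed
    have mono_eq: "(\<Prod>i\<in>?I. w i ^ \<alpha> i) = complex_of_real (mono K0 K \<alpha>)" for \<alpha>
      by (simp add: w_def mono_def)
    have hs: "((\<lambda>\<alpha>. complex_of_real (mono K0 K \<alpha>) * G \<alpha> p q) has_sum complex_of_real (ground_state K p q)) UNIV" for p q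
      using c(3)[OF w, of "(p, q)"] unfolding mono_eq real_val G_def by simp
    have nb: "norm (complex_of_real (mono K0 K \<alpha>) * G \<alpha> p q) \<le> g \<alpha>" for \<alpha> p q
      unfolding norm_mult norm_of_real by (rule order_trans[OF mult_left_mono[OF Gb] mb]) simp
    fix e :: real
    show "e > 0 \<longrightarrow> (\<exists>A0. finite A0 \<and> (\<forall>A. finite A \<and> A0 \<subseteq> A \<longrightarrow>
        l2norm (\<lambda>p q. complex_of_real (ground_state K p q) - (\<Sum>\<alpha>\<in>A. complex_of_real (mono K0 K \<alpha>) * G \<alpha> p q)) < e))"
    proof
      assume e: "e > 0"
      have "\<forall>\<^sub>F A in finite_subsets_at_top UNIV. dist (sum g A) S < e"
        using gS e unfolding has_sum_def by (rule tendstoD)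
      then obtain A0 where A0: "finite A0" "\<And>A. finite A \<Longrightarrow> A0 \<subseteq> A \<Longrightarrow> dist (sum g A) S < e"
        unfolding eventually_finite_subsets_at_top by auto
      show "\<exists>A0. finite A0 \<and> (\<forall>A. finite A \<and> A0 \<subseteq> A \<longrightarrow>
        l2norm (\<lambda>p q. complex_of_real (ground_state K p q) - (\<Sum>\<alpha>\<in>A. complex_of_real (mono K0 K \<alpha>) * G \<alpha> p q)) < e)"
      proof (intro exI[of _ A0] conjI allI impI A0(1))
        fix A assume A: "finite A \<and> A0 \<subseteq> A"
        have "l2norm (\<lambda>p q. complex_of_real (ground_state K p q) - (\<Sum>\<alpha>\<in>A. complex_of_real (mono K0 K \<alpha>) * G \<alpha> p q)) \<le> S - sum g A"
        proof (rule l2norm_le(1))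
          show "norm (complex_of_real (ground_state K p q) - (\<Sum>\<alpha>\<in>A. complex_of_real (mono K0 K \<alpha>) * G \<alpha> p q)) \<le> S - sum g A" for p q
            by (rule has_sum_remainder_le[OF hs gS nb]) (use A in simp)
          have [measurable]: "(\<lambda>z. complex_of_real (ground_state K (fst z) (snd z))) \<in> borel_measurable borel"
            using a5[rule_format, of "k w"] unfolding real_val .
          note [measurable] = Gm
          show "(\<lambda>z. complex_of_real (ground_state K (fst z) (snd z)) - (\<Sum>\<alpha>\<in>A. complex_of_real (mono K0 K \<alpha>) * G \<alpha> (fst z) (snd z))) \<in> borel_measurable borel"
            by measurable
        qed
        also have "\<dots> < e" using A0(2)[of A] A by (auto simp: dist_real_def)
        finally show "l2norm (\<lambda>p q. complex_of_real (ground_state K p q) - (\<Sum>\<alpha>\<in>A. complex_of_real (mono K0 K \<alpha>) * G \<alpha> p q)) < e" .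
      qed
    qed
  qed
qed

subsection \<open>Periodicity of the ground state\<close>

lemma per1_minus: "per1 g \<Longrightarrow> g (x - shiftv i) = g x"
  unfolding per1_def by (metis diff_add_cancel)

text \<open>In all these quantities \<open>K\<close> enters only through \<open>W\<close>, so
  periodicity of the symbol passes down the chain of definitions.\<close>

lemma shift_K_eq:
  fixes K :: "real^'n"
  shows "W (K + shiftv i) = W K" "R (K + shiftv i) = R K" "Dl (K + shiftv i) = Dl K" "u (K + shiftv i) = u K"
    "b (K + shiftv i) = b K" "h (K + shiftv i) = h K" "G (K + shiftv i) = G K" "eK (K + shiftv i) = eK K"
proof -
  show W: "W (K + shiftv i) = W K" by (intro ext) (simp add: W_periodic)
  show R: "R (K + shiftv i) = R K" by (intro ext) (simp add: R_def W)
  show Dl: "Dl (K + shiftv i) = Dl K" by (intro ext) (simp add: Dl_def R)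
  show u: "u (K + shiftv i) = u K" by (intro ext) (simp add: u_def Dl)
  show b: "b (K + shiftv i) = b K" by (intro ext) (simp add: b_def u R)
  have "h (K + shiftv i) z n p = h K z n p" for z n p
    by (induction n arbitrary: p) (simp_all add: u b)
  then show h: "h (K + shiftv i) = h K" by (intro ext)
  show "G (K + shiftv i) = G K" by (intro ext) (simp add: G_def h)
  show "eK (K + shiftv i) = eK K" by (simp add: eK_def subcritical_def valid_def h W Dl)
qed

lemma h_per1: "per1 (h K z n)" for K :: "real^'n"
proof -
  have Rp: "R K z (p + shiftv i) = R K z p" for p i by (intro ext) (simp add: R_def W_periodic)
  have Dp: "Dl K z (p + shiftv i) = Dl K z p" for p i by (simp add: Dl_def Rp)
  have up: "u K z (p + shiftv i) = u K z p" for p i by (simp add: u_def Dp)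
  have bp: "b K z (p + shiftv i) = b K z p" for p i by (intro ext) (simp add: b_def up Rp)
  show ?thesis by (cases n) (simp_all add: per1_def up bp)
qed

lemma G_per1: "per1 (G K z)" for K :: "real^'n"
  using h_per1[of K z] by (simp add: per1_def G_def)

lemma ground_state_periodic:
  fixes K :: "real^'n"
  shows "ground_state (K + shiftv i) p q = ground_state K p q" "ground_state K (p + shiftv i) q = ground_state K p q" "ground_state K p (q + shiftv i) = ground_state K p q"
proof -
  have G1: "G K z (x + shiftv i) = G K z x" "G K z (x - shiftv i) = G K z x" for z x
    using G_per1[of K z] per1_minus[OF G_per1[of K z]] by (simp_all add: per1_def)
  have e: "K + shiftv i - p - q = (K - p - q) + shiftv i" "K - (p + shiftv i) - q = (K - p - q) - shiftv i"
    "K - p - (q + shiftv i) = (K - p - q) - shiftv i" by simp_all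
  show "ground_state (K + shiftv i) p q = ground_state K p q" "ground_state K (p + shiftv i) q = ground_state K p q" "ground_state K p (q + shiftv i) = ground_state K p q"
    unfolding ground_state_def shift_K_eq e G1 by (simp_all add: R_def W_periodic)
qed

end

subsection \<open>Square integrable functions on the torus\<close>

lemma fst_borel_measurable [measurable]: "fst \<in> borel_measurable (borel :: ((real^'n) \<times> (real^'n)) measure)"
  and snd_borel_measurable [measurable]: "snd \<in> borel_measurable (borel :: ((real^'n) \<times> (real^'n)) measure)"
  by (rule borel_measurable_continuous_onI, intro continuous_intros)+

lemma norm_add3_power2: "(norm (a + b + c :: complex))\<^sup>2 \<le> 3 * ((norm a)\<^sup>2 + (norm b)\<^sup>2 + (norm c)\<^sup>2)"
proof -
  have "(norm (a + b + c))\<^sup>2 \<le> (norm a + norm b + norm c)\<^sup>2"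
    by (intro power_mono order_trans[OF norm_triangle_ineq add_mono[OF norm_triangle_ineq]]) auto
  also have "\<dots> \<le> 3 * ((norm a)\<^sup>2 + (norm b)\<^sup>2 + (norm c)\<^sup>2)"
    using sum_squares_ge_zero[of "norm a - norm b" "norm b - norm c"] zero_le_power2[of "norm a - norm c"]
    by (simp add: power2_eq_square algebra_simps)
  finally show ?thesis .
qed

lemma norm_add_power2: "(norm (a + b :: complex))\<^sup>2 \<le> 2 * ((norm a)\<^sup>2 + (norm b)\<^sup>2)"
proof -
  have "(norm (a + b))\<^sup>2 \<le> (norm a + norm b)\<^sup>2"
    by (intro power_mono norm_triangle_ineq) auto
  also have "\<dots> \<le> 2 * ((norm a)\<^sup>2 + (norm b)\<^sup>2)"
    using zero_le_power2[of "norm a - norm b"] by (simp add: power2_eq_square algebra_simps)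
  finally show ?thesis .
qed

lemma integrable_if_square:
  fixes f :: "'a \<Rightarrow> complex"
  assumes "finite_measure M" "f \<in> borel_measurable M" "integrable M (\<lambda>x. (norm (f x))\<^sup>2)"
  shows "integrable M f"
proof -
  interpret finite_measure M by fact
  show ?thesis
  proof (rule Bochner_Integration.integrable_bound[of M "\<lambda>x. 1 + (norm (f x))\<^sup>2"])
    have "norm (f x) \<le> 1 + (norm (f x))\<^sup>2" for x
      using zero_le_power2[of "norm (f x) - 1/2"] by (simp add: power2_eq_square algebra_simps)
    then show "AE x in M. norm (f x) \<le> norm (1 + (norm (f x))\<^sup>2)"
      by (intro AE_I2) (metis abs_ge_self order_trans real_norm_def)
  qed (use assms in auto)
qed

lemma integrable_mult_if_square:
  fixes f g :: "'a \<Rightarrow> complex"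
  assumes "f \<in> borel_measurable M" "integrable M (\<lambda>x. (norm (f x))\<^sup>2)"
    and "g \<in> borel_measurable M" "integrable M (\<lambda>x. (norm (g x))\<^sup>2)"
  shows "integrable M (\<lambda>x. f x * g x)"
proof (rule Bochner_Integration.integrable_bound[of M "\<lambda>x. (norm (f x))\<^sup>2 + (norm (g x))\<^sup>2"])
  have "norm (f x * g x) \<le> (norm (f x))\<^sup>2 + (norm (g x))\<^sup>2" for x
  proof -
    have "2 * (norm (f x) * norm (g x)) \<le> (norm (f x))\<^sup>2 + (norm (g x))\<^sup>2"
      using zero_le_power2[of "norm (f x) - norm (g x)"] by (simp add: power2_eq_square algebra_simps)
    moreover have "0 \<le> norm (f x) * norm (g x)" by simp
    ultimately show ?thesis unfolding norm_mult by linarith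
  qed
  then show "AE x in M. norm (f x * g x) \<le> norm ((norm (f x))\<^sup>2 + (norm (g x))\<^sup>2)"
    by (intro AE_I2) (metis abs_ge_self order_trans real_norm_def)
qed (use assms in auto)

text \<open>Jensen's inequality for a probability measure, from the nonnegative variance of
  \<open>norm (f t)\<close>; an infinite right-hand side is trivial.\<close>

lemma norm_integral_square_le:
  fixes f :: "real^'n \<Rightarrow> complex"
  assumes [measurable]: "f \<in> borel_measurable borel"
  shows "ennreal ((norm (\<integral>t. f t \<partial>eta))\<^sup>2) \<le> (\<integral>\<^sup>+t. ennreal ((norm (f t))\<^sup>2) \<partial>eta)"
proof (cases "(\<integral>\<^sup>+t. ennreal ((norm (f t))\<^sup>2) \<partial>eta) = \<infinity>")
  case False
  then have i2: "integrable eta (\<lambda>t. (norm (f t))\<^sup>2)"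
    by (intro integrableI_bounded) (auto simp: top.not_eq_extremum)
  have i1: "integrable eta f" by (rule integrable_if_square) (use i2 in \<open>auto intro: eta.finite_measure_axioms\<close>)
  define a where "a = (\<integral>t. norm (f t) \<partial>eta)"
  have "0 \<le> (\<integral>t. (norm (f t) - a)\<^sup>2 \<partial>eta)" by simp
  also have "\<dots> = (\<integral>t. (norm (f t))\<^sup>2 - 2 * a * norm (f t) + a\<^sup>2 \<partial>eta)"
    by (simp add: power2_eq_square algebra_simps)
  also have "\<dots> = (\<integral>t. (norm (f t))\<^sup>2 \<partial>eta) - 2 * a * a + a\<^sup>2"
    using i1 i2 by (simp add: a_def)
  finally have "a\<^sup>2 \<le> (\<integral>t. (norm (f t))\<^sup>2 \<partial>eta)" by (simp add: power2_eq_square)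
  moreover have "(norm (\<integral>t. f t \<partial>eta))\<^sup>2 \<le> a\<^sup>2"
    unfolding a_def by (intro power_mono integral_norm_bound) auto
  ultimately have "ennreal ((norm (\<integral>t. f t \<partial>eta))\<^sup>2) \<le> ennreal (\<integral>t. (norm (f t))\<^sup>2 \<partial>eta)" by (intro ennreal_leI) linarith
  also have "\<dots> = (\<integral>\<^sup>+t. ennreal ((norm (f t))\<^sup>2) \<partial>eta)"
    using i2 by (intro nn_integral_eq_integral[symmetric]) auto
  finally show ?thesis .
qed simp

definition pmean :: "(real^'n \<Rightarrow> real^'n \<Rightarrow> complex) \<Rightarrow> real^'n \<Rightarrow> complex" where
  "pmean f p = (\<integral>t. f p t \<partial>eta)"

lemma L2sD:
  fixes f :: "real^'n \<Rightarrow> real^'n \<Rightarrow> complex"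
  assumes "L2s f"
  shows "(\<lambda>z. f (fst z) (snd z)) \<in> borel_measurable borel"
    "f p (q + shiftv i) = f p q" "f (p + shiftv i) q = f p q" "f p q = f q p"
    "(\<integral>\<^sup>+z. ennreal ((norm (f (fst z) (snd z)))\<^sup>2) \<partial>eta2) < \<infinity>"
    "integrable eta2 (\<lambda>z. (norm (f (fst z) (snd z)))\<^sup>2)" "integrable eta2 (\<lambda>z. f (fst z) (snd z))"
proof -
  show m[measurable]: "(\<lambda>z. f (fst z) (snd z)) \<in> borel_measurable borel"
    using assms by (simp add: L2s_def L2fn_def)
  show "f p (q + shiftv i) = f p q" "f (p + shiftv i) q = f p q" using assms by (auto simp: L2s_def per2_def)
  show "f p q = f q p" using assms unfolding L2s_def by blast
  show fin: "(\<integral>\<^sup>+z. ennreal ((norm (f (fst z) (snd z)))\<^sup>2) \<partial>eta2) < \<infinity>"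
    using assms unfolding L2s_def L2fn_def sqnorm_eq[OF m] by simp
  have m2: "(\<lambda>z. f (fst z) (snd z)) \<in> borel_measurable eta2" by measurable
  show i: "integrable eta2 (\<lambda>z. (norm (f (fst z) (snd z)))\<^sup>2)"
    by (rule integrableI_bounded) (use fin m2 in \<open>auto intro: borel_measurable_power measurable_compose[OF m2]\<close>)
  show "integrable eta2 (\<lambda>z. f (fst z) (snd z))"
    by (rule integrable_if_square[OF eta2.finite_measure_axioms m2 i])
qed

lemma section_measurable:
  fixes f :: "real^'n \<Rightarrow> real^'n \<Rightarrow> 'b::topological_space"
  assumes "(\<lambda>z. f (fst z) (snd z)) \<in> borel_measurable borel"
  shows "f p \<in> borel_measurable borel"
proof -
  have "(\<lambda>t. (p, t)) \<in> borel \<rightarrow>\<^sub>M (borel :: ((real^'n) \<times> (real^'n)) measure)"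
    by (intro borel_measurable_continuous_onI continuous_intros)
  from measurable_compose[OF this assms] show ?thesis by simp
qed

lemma pmean_measurable:
  fixes f :: "real^'n \<Rightarrow> real^'n \<Rightarrow> complex"
  assumes "(\<lambda>z. f (fst z) (snd z)) \<in> borel_measurable borel"
  shows "pmean f \<in> borel_measurable borel"
proof -
  have "(\<lambda>(p, t). f p t) \<in> borel_measurable (borel \<Otimes>\<^sub>M eta)"
  proof -
    have "sets (borel \<Otimes>\<^sub>M (eta :: (real^'n) measure)) = sets (borel :: ((real^'n) \<times> (real^'n)) measure)"
      unfolding borel_prod[symmetric] by (intro sets_pair_measure_cong) auto
    then show ?thesis using assms by (simp add: split_beta' cong: measurable_cong_sets)
  qed
  then show ?thesis unfolding pmean_def[abs_def] by (rule eta.borel_measurable_lebesgue_integral)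
qed

lemma pmean_square_le:
  fixes f :: "real^'n \<Rightarrow> real^'n \<Rightarrow> complex"
  assumes m: "(\<lambda>z. f (fst z) (snd z)) \<in> borel_measurable borel"
  shows "(\<integral>\<^sup>+p. ennreal ((norm (pmean f p))\<^sup>2) \<partial>eta) \<le> (\<integral>\<^sup>+z. ennreal ((norm (f (fst z) (snd z)))\<^sup>2) \<partial>eta2)"
proof -
  note [measurable] = m
  have "(\<integral>\<^sup>+p. ennreal ((norm (pmean f p))\<^sup>2) \<partial>eta) \<le> (\<integral>\<^sup>+p. (\<integral>\<^sup>+t. ennreal ((norm (f p t))\<^sup>2) \<partial>eta) \<partial>eta)"
    unfolding pmean_def by (intro nn_integral_mono norm_integral_square_le section_measurable m)
  also have "\<dots> = (\<integral>\<^sup>+z. ennreal ((norm (f (fst z) (snd z)))\<^sup>2) \<partial>eta2)"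
  proof -
    have "(\<lambda>z. ennreal ((norm (f (fst z) (snd z)))\<^sup>2)) \<in> borel_measurable eta2" by measurable
    from eta.nn_integral_fst[OF this] show ?thesis by simp
  qed
  finally show ?thesis .
qed

text \<open>For fixed \<open>p\<close> the map sending \<open>q\<close> to \<open>K - p - q\<close>
  is a reflection followed by a translation and preserves Haar measure, so all three momenta are
  equally distributed.\<close>

lemma nn_integral_third:
  fixes g :: "real^'n \<Rightarrow> ennreal"
  assumes [measurable]: "g \<in> borel_measurable borel" and per: "per1 g"
  shows "(\<integral>\<^sup>+z. g (fst z) \<partial>(eta2 :: ((real^'n) \<times> (real^'n)) measure)) = (\<integral>\<^sup>+p. g p \<partial>eta)"
    "(\<integral>\<^sup>+z. g (snd z) \<partial>(eta2 :: ((real^'n) \<times> (real^'n)) measure)) = (\<integral>\<^sup>+p. g p \<partial>eta)"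
    "(\<integral>\<^sup>+z. g (K - fst z - snd z) \<partial>(eta2 :: ((real^'n) \<times> (real^'n)) measure)) = (\<integral>\<^sup>+p. g p \<partial>eta)"
proof -
  have one: "(\<integral>\<^sup>+p. c \<partial>(eta :: (real^'n) measure)) = c" for c by simp
  have "(\<lambda>z. g (fst z)) \<in> borel_measurable (eta2 :: ((real^'n) \<times> (real^'n)) measure)" by measurable
  from eta.nn_integral_fst[OF this]
  show "(\<integral>\<^sup>+z. g (fst z) \<partial>(eta2 :: ((real^'n) \<times> (real^'n)) measure)) = (\<integral>\<^sup>+p. g p \<partial>eta)" by (simp add: one)
  have "(\<lambda>z. g (snd z)) \<in> borel_measurable (eta2 :: ((real^'n) \<times> (real^'n)) measure)" by measurable
  from eta.nn_integral_fst[OF this]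
  show "(\<integral>\<^sup>+z. g (snd z) \<partial>(eta2 :: ((real^'n) \<times> (real^'n)) measure)) = (\<integral>\<^sup>+p. g p \<partial>eta)" by (simp add: one)
  have *: "(\<integral>\<^sup>+q. g (K - p - q) \<partial>eta) = (\<integral>\<^sup>+p. g p \<partial>eta)" for p
    using eta_nn_integral_affine[OF per assms(1), of "-1" "K - p"] by simp
  have "(\<lambda>z. g (K - fst z - snd z)) \<in> borel_measurable (eta2 :: ((real^'n) \<times> (real^'n)) measure)" by measurable
  from eta.nn_integral_fst[OF this]
  show "(\<integral>\<^sup>+z. g (K - fst z - snd z) \<partial>(eta2 :: ((real^'n) \<times> (real^'n)) measure)) = (\<integral>\<^sup>+p. g p \<partial>eta)"
    by (simp add: * one)
qed

lemma pmean_per1: "L2s f \<Longrightarrow> per1 (pmean f)"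
  by (simp add: per1_def pmean_def L2sD(3))

lemma Vop_eq_pmean:
  assumes f: "L2s f"
  shows "Vop K f p q = pmean f p + pmean f q + pmean f (K - p - q)"
proof -
  have "eta_int (\<lambda>t. f t q) = pmean f q" for q
  proof -
    have "(\<lambda>t. f t q) = f q" using L2sD(4)[OF f] by blast
    then show ?thesis unfolding pmean_def by (simp add: eta_int_eq section_measurable[OF L2sD(1)[OF f]])
  qed
  moreover have "eta_int (f p) = pmean f p"
    unfolding pmean_def by (simp add: eta_int_eq section_measurable[OF L2sD(1)[OF f]])
  ultimately show ?thesis by (simp add: Vop_def)
qed

lemma sqnorm_eq_0_iff:
  fixes f :: "real^'n \<Rightarrow> real^'n \<Rightarrow> complex"
  assumes m[measurable]: "(\<lambda>z. f (fst z) (snd z)) \<in> borel_measurable borel"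
  shows "sqnorm f = 0 \<longleftrightarrow> (AE z in eta2. f (fst z) (snd z) = 0)"
proof -
  have "(\<lambda>z. ennreal ((norm (f (fst z) (snd z)))\<^sup>2)) \<in> borel_measurable eta2" by measurable
  then show ?thesis unfolding sqnorm_eq[OF m] by (subst nn_integral_0_iff_AE) auto
qed

lemma emeasure_eta2_UNIV: "emeasure (eta2 :: ((real^'n) \<times> (real^'n)) measure) UNIV = 1"
proof -
  have "emeasure (eta2 :: ((real^'n) \<times> (real^'n)) measure) (UNIV \<times> UNIV) =
      emeasure (eta :: (real^'n) measure) UNIV * emeasure (eta :: (real^'n) measure) UNIV"
    by (rule eta.emeasure_pair_measure_Times) auto
  then show ?thesis by simp
qed

context boson
begin

text \<open>Multiplication by \<open>s\<close> brings both signs of the coupling to one normal form.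
  It holds for every function in the space and so serves eigenfunctions and Weyl sequences
  alike.\<close>

lemma Hop_eq:
  assumes f: "L2s f"
  shows "of_real s * (Hop (- s * \<kappa>) K f p q - of_real (s * z) * f p q) =
    of_real (W K p q - z) * f p q - of_real \<kappa> * (pmean f p + pmean f q + pmean f (K - p - q))"
proof -
  have ss: "complex_of_real s * of_real s = 1" using s by auto
  have "of_real s * (Hop (- s * \<kappa>) K f p q - of_real (s * z) * f p q) =
    (of_real s * of_real (Etot K p q)) * f p q - (of_real s * of_real s) * (of_real z * f p q + of_real \<kappa> * Vop K f p q)"
    by (simp add: Hop_def algebra_simps)
  also have "of_real s * of_real (Etot K p q) = complex_of_real (W K p q)" by (simp add: W_eq_Etot)
  finally show ?thesis unfolding ss Vop_eq_pmean[OF f] by (simp add: algebra_simps)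
qed

subsection \<open>The bound state\<close>

text \<open>\<open>Dd = 1\<close> means that \<open>G\<close> has integral \<open>Mtop - e\<close>,
  and then the fixed point equation of the Neumann series becomes the Faddeev equation. That
  equation identifies the mean of the ground state with \<open>G\<close>, after which the eigenvalue
  equation is immediate. Positivity excludes the zero function.\<close>

lemma is_eigfn_ground_state:
  fixes K :: "real^'n"
  assumes d: "CARD('n) \<le> 2"
  shows "is_eigfn (- s * \<kappa>) K (s * eK K) (\<lambda>p q. complex_of_real (ground_state K p q))"
proof -
  define e where "e = eK K"
  define g where "g = G K e"
  have P: "subcritical K e" unfolding e_def by (rule subcritical_eK[OF d])
  have v: "valid K e" using P by (simp add: subcritical_def)
  obtain c where c: "c > 0" "\<And>p t. c \<le> W K p t - e" "\<And>p. c \<le> Dl K e p"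
    using v by (auto simp: valid_def)
  note rb = real_bounds[OF c]
  obtain C where C: "\<And>p. g p \<le> C" using subcritical_Neumann(6)[OF P] unfolding g_def by blast
  have gl: "2 * \<kappa> \<le> g p" for p using subcritical_Neumann(5)[OF P, of p] rb(5)[of p] unfolding g_def by linarith
  have gp: "0 < g p" for p using gl[of p] \<kappa> by linarith
  have gm[measurable]: "g \<in> borel_measurable borel" unfolding g_def by measurable
  have gper: "per1 g" unfolding g_def by (rule G_per1)
  have ground_state: "ground_state K p q = \<kappa> * (g p + g q + g (K - p - q)) * R K e p q" for p q
    by (simp add: ground_state_def g_def e_def)
  have gspos: "0 < ground_state K p q" for p q
    unfolding ground_state using \<kappa> gp[of p] gp[of q] gp[of "K - p - q"] rb(1)[of p q] by simp
  have C0: "0 \<le> C" using gp[of 0] C[of 0] by linarith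
  have gsb: "ground_state K p q \<le> \<kappa> * (C + C + C) * (1 / c)" for p q
    unfolding ground_state using \<kappa> gp[of p] gp[of q] gp[of "K - p - q"] rb(1,2)[of p q] C C0
    by (intro mult_mono add_mono mult_nonneg_nonneg add_nonneg_nonneg) (auto intro: less_imp_le)
  have gsm: "(\<lambda>z. complex_of_real (ground_state K (fst z) (snd z))) \<in> borel_measurable borel"
    unfolding ground_state by measurable
  have sym: "ground_state K p q = ground_state K q p" for p q
  proof -
    have "K - p - q = K - q - p" by simp
    then have "g (K - p - q) = g (K - q - p)" by (rule arg_cong)
    then show ?thesis unfolding ground_state R_def W_swap[of K p q] by simp
  qed
  let ?F = "\<lambda>p q. complex_of_real (ground_state K p q)"
  have L2: "L2fn ?F"
    by (rule l2norm_le(2)[OF gsm, where b="\<kappa> * (C + C + C) * (1 / c)"]) (use gspos gsb in \<open>simp add: less_imp_le\<close>)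
  have L2s: "L2s ?F"
    unfolding L2s_def per2_def ground_state_periodic using L2 arg_cong[OF sym, of complex_of_real] by blast
  have bi: "integrable eta (\<lambda>t. \<phi> t * R K e p t)" if "\<phi> \<in> borel_measurable borel" "\<And>t. \<bar>\<phi> t\<bar> \<le> B" for \<phi> B p
  proof (rule eta_bounded(1)[where B="B * (1 / c)"])
    show "norm (\<phi> t * R K e p t) \<le> B * (1 / c)" for t
      unfolding norm_mult using that(2)[of t] rb(1,2)[of p t] order_trans[OF abs_ge_zero that(2)[of t]] by (intro mult_mono) auto
    show "(\<lambda>t. \<phi> t * R K e p t) \<in> borel_measurable borel" using that(1) by measurable
  qed
  have gabs: "\<bar>g t\<bar> \<le> C" for t using gp[of t] C[of t] by simp
  have Faddeev: "Dl K e p * g p = 2 * \<kappa> * (\<integral>t. g t * R K e p t \<partial>eta)" for p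
  proof -
    let ?M = "Mtop TYPE('n)"
    have M: "?M - e > 0" using valid_less[OF v] by simp
    have Ig: "(\<integral>t. g t \<partial>eta) = ?M - e" using Dd_eK[OF d, of K] M by (simp add: Dd_def g_def e_def)
    have ig: "integrable eta g" by (rule eta_bounded(1)[OF gm]) (use gabs in simp)
    have "g p = (\<integral>t. b K e p t * g t \<partial>eta) + u K e p" using subcritical_Neumann(4)[OF P, of p] by (simp add: g_def)
    also have "(\<integral>t. b K e p t * g t \<partial>eta) = (\<integral>t. u K e p * (g t * R K e p t) - u K e p / (?M - e) * g t \<partial>eta)"
      by (intro Bochner_Integration.integral_cong refl) (simp add: b_def algebra_simps)
    also have "\<dots> = u K e p * (\<integral>t. g t * R K e p t \<partial>eta) - u K e p / (?M - e) * (\<integral>t. g t \<partial>eta)"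
      using bi[OF gm gabs, of p] ig by simp
    also have "\<dots> = u K e p * (\<integral>t. g t * R K e p t \<partial>eta) - u K e p" unfolding Ig using M by simp
    finally have "g p = u K e p * (\<integral>t. g t * R K e p t \<partial>eta)" by simp
    then show ?thesis using c(1) c(3)[of p] by (simp add: u_def field_simps)
  qed
  \<comment> \<open>The first summand contributes \<open>(1 - Dl) * g p\<close>; the other two agree
    by exchange of particles and together give \<open>Dl * g p\<close> by the Faddeev
    equation.\<close>
  have mean: "pmean ?F p = of_real (g p)" for p
  proof -
    have third: "(\<integral>t. g (K - p - t) * R K e p t \<partial>eta) = (\<integral>t. g t * R K e p t \<partial>eta)"
    proof -
      have "per1 (\<lambda>t. g t * R K e p t)" using gper R_per1[of K e p] by (simp add: per1_def)
      from eta_integral_affine[OF this, of "-1" "K - p"]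
      show ?thesis by (simp add: R_def W_third)
    qed
    have i1: "integrable eta (\<lambda>t. R K e p t)" using bi[of "\<lambda>_. 1" 1 p] by simp
    have i2: "integrable eta (\<lambda>t. g t * R K e p t)" by (rule bi[OF gm gabs])
    have i3: "integrable eta (\<lambda>t. g (K - p - t) * R K e p t)" by (rule bi[of _ C]) (use gabs in auto)
    have "(\<integral>t. ground_state K p t \<partial>eta) = (\<integral>t. \<kappa> * (g p * R K e p t) + \<kappa> * (g t * R K e p t) + \<kappa> * (g (K - p - t) * R K e p t) \<partial>eta)"
      unfolding ground_state by (intro Bochner_Integration.integral_cong refl) (simp add: algebra_simps)
    also have "\<dots> = \<kappa> * (g p * (\<integral>t. R K e p t \<partial>eta)) + \<kappa> * (\<integral>t. g t * R K e p t \<partial>eta) + \<kappa> * (\<integral>t. g (K - p - t) * R K e p t \<partial>eta)"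
      using i1 i2 i3 by simp
    also have "\<dots> = g p * (\<kappa> * (\<integral>t. R K e p t \<partial>eta)) + 2 * \<kappa> * (\<integral>t. g t * R K e p t \<partial>eta)"
      unfolding third by simp
    also have "\<dots> = g p" unfolding Faddeev[symmetric] by (simp add: Dl_def algebra_simps)
    finally show ?thesis by (simp add: pmean_def)
  qed
  have eq: "Hop (- s * \<kappa>) K ?F p q = of_real (s * e) * ?F p q" for p q
  proof -
    have "(W K p q - e) * ground_state K p q - \<kappa> * (g p + g q + g (K - p - q)) = 0"
      unfolding ground_state R_def using c(1) c(2)[of p q] by simp
    then have "complex_of_real ((W K p q - e) * ground_state K p q - \<kappa> * (g p + g q + g (K - p - q))) = 0" by (simp only: of_real_0)
    then have "of_real s * (Hop (- s * \<kappa>) K ?F p q - of_real (s * e) * ?F p q) = 0"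
      unfolding Hop_eq[OF L2s] mean by simp
    then show ?thesis using s by auto
  qed
  have "sqnorm ?F \<noteq> 0"
  proof
    assume "sqnorm ?F = 0"
    then have "AE z in (eta2 :: ((real^'n) \<times> (real^'n)) measure). complex_of_real (ground_state K (fst z) (snd z)) = 0"
      using sqnorm_eq_0_iff[OF gsm] by simp
    then have "AE z in (eta2 :: ((real^'n) \<times> (real^'n)) measure). False"
      using gspos by (simp add: less_le)
    then obtain X where X: "{x \<in> space (eta2 :: ((real^'n) \<times> (real^'n)) measure). \<not> False} \<subseteq> X"
      "emeasure (eta2 :: ((real^'n) \<times> (real^'n)) measure) X = 0" by (rule AE_E)
    have "X = UNIV" using X(1) by (auto simp: space_pair_measure)
    then have "emeasure (eta2 :: ((real^'n) \<times> (real^'n)) measure) UNIV = 0" using X(2) by simp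
    then show False using emeasure_eta2_UNIV[where 'n='n] by simp
  qed
  then show ?thesis unfolding is_eigfn_def using L2s eq by (simp add: e_def)
qed

subsection \<open>Absence of bound states on the repulsive side\<close>

lemma no_eigenvalue_above:
  fixes K :: "real^'n"
  assumes z: "\<And>p q. W K p q \<le> w0" "w0 < z"
  shows "\<not> is_eigenvalue (- s * \<kappa>) K (s * z)"
proof
  assume "is_eigenvalue (- s * \<kappa>) K (s * z)"
  then obtain f where f: "L2s f" "sqnorm f \<noteq> 0"
    and AE0: "AE x in lborel. Hop (- s * \<kappa>) K f (fst x) (snd x) = of_real (s * z) * f (fst x) (snd x)"
    unfolding is_eigenvalue_def is_eigfn_def by blast
  note fD = L2sD[OF f(1)]
  note [measurable] = fD(1) pmean_measurable[OF fD(1)]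
  define v where "v = pmean f"
  have [measurable]: "v \<in> borel_measurable borel" by (simp add: v_def)
  have vper: "per1 v" unfolding v_def by (rule pmean_per1[OF f(1)])
  define N where "N p q = v p + v q + v (K - p - q)" for p q
  define \<rho> where "\<rho> p q = 1 / (z - W K p q)" for p q
  have \<rho>: "0 < \<rho> p q" "\<rho> p q \<le> 1 / (z - w0)" for p q
    using z(1)[of p q] z(2) by (auto simp: \<rho>_def intro!: divide_left_mono mult_pos_pos)
  have [measurable]: "(\<lambda>x. N (fst x) (snd x)) \<in> borel_measurable borel" "(\<lambda>x. \<rho> (fst x) (snd x)) \<in> borel_measurable borel"
    unfolding N_def \<rho>_def by measurable
  \<comment> \<open>A representative of \<open>f\<close> given by a formula at every point: the
    exchange symmetry in the third momentum holds for it exactly, while for \<open>f\<close> only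
    the symmetry in \<open>p\<close> and \<open>q\<close> is given.\<close>
  define F where "F p q = - of_real (\<kappa> * \<rho> p q) * N p q" for p q
  have [measurable]: "(\<lambda>x. F (fst x) (snd x)) \<in> borel_measurable borel" unfolding F_def by measurable
  have AEf: "AE x in eta2. f (fst x) (snd x) = F (fst x) (snd x)"
    using AE_eta2I[OF AE0]
  proof eventually_elim
    case (elim x)
    obtain p q where x: "x = (p, q)" by (cases x)
    have "of_real (W K p q - z) * f p q - of_real \<kappa> * N p q = 0"
      using Hop_eq[OF f(1), of K p q z] elim unfolding x N_def v_def by simp
    then have "of_real (z - W K p q) * f p q = - of_real \<kappa> * N p q" by (simp add: algebra_simps)
    moreover have "complex_of_real (z - W K p q) \<noteq> 0" using z(1)[of p q] z(2) by (simp del: of_real_diff)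
    ultimately show ?case unfolding x F_def \<rho>_def by (simp add: field_simps del: of_real_diff)
  qed
  have iv2: "integrable eta (\<lambda>p. (norm (v p))\<^sup>2)"
  proof (rule integrableI_bounded)
    have "(\<integral>\<^sup>+p. ennreal ((norm (v p))\<^sup>2) \<partial>eta) < \<infinity>"
      using le_less_trans[OF pmean_square_le[OF fD(1)] fD(5)] by (simp add: v_def)
    then show "(\<integral>\<^sup>+p. ennreal (norm ((norm (v p))\<^sup>2)) \<partial>eta) < \<infinity>" by simp
  qed measurable
  have fin3: "integrable eta2 (\<lambda>x. (norm (v (h x)))\<^sup>2)"
    if "h \<in> borel \<rightarrow>\<^sub>M borel" "(\<integral>\<^sup>+x. ennreal ((norm (v (h x)))\<^sup>2) \<partial>eta2) = (\<integral>\<^sup>+p. ennreal ((norm (v p))\<^sup>2) \<partial>eta)"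
    for h :: "(real^'n) \<times> (real^'n) \<Rightarrow> real^'n"
  proof (rule integrableI_bounded)
    note [measurable] = that(1)
    show "(\<lambda>x. (norm (v (h x)))\<^sup>2) \<in> borel_measurable eta2" by measurable
    have "(\<integral>\<^sup>+p. ennreal ((norm (v p))\<^sup>2) \<partial>eta) < \<infinity>"
      using le_less_trans[OF pmean_square_le[OF fD(1)] fD(5)] by (simp add: v_def)
    then show "(\<integral>\<^sup>+x. ennreal (norm ((norm (v (h x)))\<^sup>2)) \<partial>eta2) < \<infinity>" using that(2) by simp
  qed
  have vp: "per1 (\<lambda>p. ennreal ((norm (v p))\<^sup>2))" using vper by (simp add: per1_def)
  have i1: "integrable eta2 (\<lambda>x. (norm (v (fst x)))\<^sup>2)" by (rule fin3) (auto intro: nn_integral_third(1)[OF _ vp] simp: vp)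
  have i2: "integrable eta2 (\<lambda>x. (norm (v (snd x)))\<^sup>2)" by (rule fin3) (auto intro: nn_integral_third(2)[OF _ vp] simp: vp)
  have i3: "integrable eta2 (\<lambda>x. (norm (v (K - fst x - snd x)))\<^sup>2)"
    by (rule fin3) (auto intro!: nn_integral_third(3)[OF _ vp])
  have F2: "integrable eta2 (\<lambda>x. (norm (cnj (F (fst x) (snd x))))\<^sup>2)"
  proof -
    have "integrable eta2 (\<lambda>x. (norm (f (fst x) (snd x)))\<^sup>2) \<longleftrightarrow> integrable eta2 (\<lambda>x. (norm (cnj (F (fst x) (snd x))))\<^sup>2)"
      by (rule integrable_cong_AE) (use AEf in \<open>auto elim!: eventually_mono\<close>)
    then show ?thesis using fD(6) by simp
  qed
  have mF: "(\<lambda>x. cnj (F (fst x) (snd x))) \<in> borel_measurable eta2" by measurable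
  have j1: "integrable eta2 (\<lambda>x. v (fst x) * cnj (F (fst x) (snd x)))"
    by (rule integrable_mult_if_square[OF _ i1 mF F2]) measurable
  have j2: "integrable eta2 (\<lambda>x. v (snd x) * cnj (F (fst x) (snd x)))"
    by (rule integrable_mult_if_square[OF _ i2 mF F2]) measurable
  have j3: "integrable eta2 (\<lambda>x. v (K - fst x - snd x) * cnj (F (fst x) (snd x)))"
    by (rule integrable_mult_if_square[OF _ i3 mF F2]) measurable
  have fst_int: "(\<integral>x. v (fst x) * cnj (F (fst x) (snd x)) \<partial>eta2) = of_real (\<integral>p. (norm (v p))\<^sup>2 \<partial>eta)"
  proof -
    have "(\<integral>x. v (fst x) * cnj (F (fst x) (snd x)) \<partial>eta2) = (\<integral>x. v (fst x) * cnj (f (fst x) (snd x)) \<partial>eta2)"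
      by (rule integral_cong_AE) (use AEf in \<open>auto elim!: eventually_mono\<close>)
    also have "\<dots> = (\<integral>p. (\<integral>q. v p * cnj (f p q) \<partial>eta) \<partial>eta)"
    proof -
      have "integrable eta2 (\<lambda>x. v (fst x) * cnj (f (fst x) (snd x)))"
        by (rule integrable_mult_if_square[OF _ i1]) (use fD(6) in \<open>auto\<close>)
      from eta2.integral_fst'[OF this] show ?thesis by simp
    qed
    also have "\<dots> = (\<integral>p. of_real ((norm (v p))\<^sup>2) \<partial>eta)"
      unfolding complex_norm_square by (intro Bochner_Integration.integral_cong refl) (simp add: v_def pmean_def)
    finally show ?thesis by (simp del: of_real_power)
  qed
  have snd_int: "(\<integral>x. v (snd x) * cnj (F (fst x) (snd x)) \<partial>eta2) = of_real (\<integral>p. (norm (v p))\<^sup>2 \<partial>eta)"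
  proof -
    have "(\<integral>x. v (snd x) * cnj (F (fst x) (snd x)) \<partial>eta2) = (\<integral>x. v (snd x) * cnj (f (fst x) (snd x)) \<partial>eta2)"
      by (rule integral_cong_AE) (use AEf in \<open>auto elim!: eventually_mono\<close>)
    also have "\<dots> = (\<integral>q. (\<integral>p. v q * cnj (f p q) \<partial>eta) \<partial>eta)"
    proof -
      have "integrable eta2 (\<lambda>x. v (snd x) * cnj (f (fst x) (snd x)))"
        by (rule integrable_mult_if_square[OF _ i2]) (use fD(6) in \<open>auto\<close>)
      then have "integrable eta2 (\<lambda>(p, q). v q * cnj (f p q))" by (simp add: split_beta')
      from eta2.integral_snd[OF this] show ?thesis by (simp add: split_beta')
    qed
    also have "\<dots> = (\<integral>p. of_real ((norm (v p))\<^sup>2) \<partial>eta)"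
    proof (intro Bochner_Integration.integral_cong refl)
      fix q
      have "(\<integral>p. f p q \<partial>eta) = v q"
        unfolding v_def pmean_def by (intro Bochner_Integration.integral_cong refl fD(4))
      then show "(\<integral>p. v q * cnj (f p q) \<partial>eta) = of_real ((norm (v q))\<^sup>2)"
        unfolding complex_norm_square by simp
    qed
    finally show ?thesis by (simp del: of_real_power)
  qed
  \<comment> \<open>For fixed \<open>p\<close> the substitution of \<open>K - p - q\<close> for
    \<open>q\<close> leaves \<open>F\<close> unchanged and turns the third pairing into the
    second.\<close>
  have third_int: "(\<integral>x. v (K - fst x - snd x) * cnj (F (fst x) (snd x)) \<partial>eta2) = (\<integral>x. v (snd x) * cnj (F (fst x) (snd x)) \<partial>eta2)"
  proof -
    have sw: "(\<integral>q. v (K - p - q) * cnj (F p q) \<partial>eta) = (\<integral>q. v q * cnj (F p q) \<partial>eta)" for p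
    proof -
      have F3: "F p (K - p - q) = F p q" for q
        unfolding F_def N_def \<rho>_def W_third by (simp add: algebra_simps)
      have vs: "v (x + shiftv i) = v x" "v (x - shiftv i) = v x" for x i
        using vper per1_minus[OF vper] by (auto simp: per1_def)
      have e: "K - p - (q + shiftv i) = (K - p - q) - shiftv i" for q i by simp
      have "per1 (\<lambda>q. v q * cnj (F p q))"
        unfolding per1_def F_def N_def \<rho>_def e vs W_periodic by simp
      moreover have "(\<lambda>q. v q * cnj (F p q)) \<in> borel_measurable borel"
        unfolding F_def N_def \<rho>_def by measurable
      ultimately show ?thesis
        using eta_integral_affine[of "\<lambda>q. v q * cnj (F p q)" "-1" "K - p"] by (simp add: F3)
    qed
    show ?thesis using eta2.integral_fst'[OF j3] eta2.integral_fst'[OF j2] sw by simp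
  qed
  have "(\<integral>x. N (fst x) (snd x) * cnj (F (fst x) (snd x)) \<partial>eta2) = of_real (3 * (\<integral>p. (norm (v p))\<^sup>2 \<partial>eta))"
  proof -
    have "(\<integral>x. N (fst x) (snd x) * cnj (F (fst x) (snd x)) \<partial>eta2) =
      (\<integral>x. v (fst x) * cnj (F (fst x) (snd x)) + v (snd x) * cnj (F (fst x) (snd x)) + v (K - fst x - snd x) * cnj (F (fst x) (snd x)) \<partial>eta2)"
      by (simp add: N_def distrib_right)
    also have "\<dots> = of_real (\<integral>p. (norm (v p))\<^sup>2 \<partial>eta) + of_real (\<integral>p. (norm (v p))\<^sup>2 \<partial>eta) + of_real (\<integral>p. (norm (v p))\<^sup>2 \<partial>eta)"
      using j1 j2 j3 fst_int snd_int third_int by simp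
    finally show ?thesis by simp
  qed
  moreover have "(\<integral>x. N (fst x) (snd x) * cnj (F (fst x) (snd x)) \<partial>eta2) = of_real (- \<kappa> * (\<integral>x. \<rho> (fst x) (snd x) * (norm (N (fst x) (snd x)))\<^sup>2 \<partial>eta2))"
  proof -
    have "N p q * cnj (F p q) = complex_of_real (- \<kappa> * (\<rho> p q * (norm (N p q))\<^sup>2))" for p q
    proof -
      have "N p q * cnj (F p q) = - of_real (\<kappa> * \<rho> p q) * (N p q * cnj (N p q))" by (simp add: F_def)
      also have "N p q * cnj (N p q) = of_real ((norm (N p q))\<^sup>2)" by (rule complex_norm_square[symmetric])
      finally show ?thesis by simp
    qed
    then show ?thesis by (simp del: of_real_mult of_real_minus)
  qed
  \<comment> \<open>The left side is at most 0 and the right side at least 0, so both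
    vanish.\<close>
  ultimately have "- \<kappa> * (\<integral>x. \<rho> (fst x) (snd x) * (norm (N (fst x) (snd x)))\<^sup>2 \<partial>eta2) = 3 * (\<integral>p. (norm (v p))\<^sup>2 \<partial>eta)"
    by (simp only: of_real_eq_iff)
  moreover have "0 \<le> (\<integral>p. (norm (v p))\<^sup>2 \<partial>eta)" by simp
  moreover have nn: "0 \<le> \<rho> (fst x) (snd x) * (norm (N (fst x) (snd x)))\<^sup>2" for x using \<rho>(1)[of "fst x" "snd x"] by simp
  moreover have "0 \<le> (\<integral>x. \<rho> (fst x) (snd x) * (norm (N (fst x) (snd x)))\<^sup>2 \<partial>eta2)" using nn by simp
  ultimately have "\<kappa> * (\<integral>x. \<rho> (fst x) (snd x) * (norm (N (fst x) (snd x)))\<^sup>2 \<partial>eta2) = 0"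
    using \<kappa> by (smt (verit) mult_nonneg_nonneg mult_minus_left)
  then have int0: "(\<integral>x. \<rho> (fst x) (snd x) * (norm (N (fst x) (snd x)))\<^sup>2 \<partial>eta2) = 0" using \<kappa> by simp
  \<comment> \<open>A vanishing Bochner integral says something only about integrable functions, the
    integral of all others being 0 by convention.\<close>
  have iN: "integrable eta2 (\<lambda>x. \<rho> (fst x) (snd x) * (norm (N (fst x) (snd x)))\<^sup>2)"
  proof (rule Bochner_Integration.integrable_bound)
    show "integrable eta2 (\<lambda>x. (1 / (z - w0)) * (3 * ((norm (v (fst x)))\<^sup>2 + (norm (v (snd x)))\<^sup>2 + (norm (v (K - fst x - snd x)))\<^sup>2)))"
      using i1 i2 i3 by (intro integrable_mult_right Bochner_Integration.integrable_add)
    show "(\<lambda>x. \<rho> (fst x) (snd x) * (norm (N (fst x) (snd x)))\<^sup>2) \<in> borel_measurable eta2" by measurable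
    show "AE x in eta2. norm (\<rho> (fst x) (snd x) * (norm (N (fst x) (snd x)))\<^sup>2) \<le>
      norm ((1 / (z - w0)) * (3 * ((norm (v (fst x)))\<^sup>2 + (norm (v (snd x)))\<^sup>2 + (norm (v (K - fst x - snd x)))\<^sup>2)))"
    proof (intro AE_I2)
      fix x
      have "\<rho> (fst x) (snd x) * (norm (N (fst x) (snd x)))\<^sup>2 \<le> (1 / (z - w0)) * (3 * ((norm (v (fst x)))\<^sup>2 + (norm (v (snd x)))\<^sup>2 + (norm (v (K - fst x - snd x)))\<^sup>2))"
        unfolding N_def using \<rho>[of "fst x" "snd x"] z(2) by (intro mult_mono norm_add3_power2) auto
      then show "norm (\<rho> (fst x) (snd x) * (norm (N (fst x) (snd x)))\<^sup>2) \<le>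
        norm ((1 / (z - w0)) * (3 * ((norm (v (fst x)))\<^sup>2 + (norm (v (snd x)))\<^sup>2 + (norm (v (K - fst x - snd x)))\<^sup>2)))"
        unfolding real_norm_def abs_of_nonneg[OF nn[of x]] by (rule order_trans[OF _ abs_ge_self])
    qed
  qed
  have "AE x in eta2. \<rho> (fst x) (snd x) * (norm (N (fst x) (snd x)))\<^sup>2 = 0"
    using int0 integral_nonneg_eq_0_iff_AE[OF iN] nn by simp
  then have "AE x in eta2. f (fst x) (snd x) = 0"
    using AEf
  proof eventually_elim
    case (elim x)
    then have "N (fst x) (snd x) = 0" using \<rho>(1)[of "fst x" "snd x"] by simp
    then show ?case using elim by (simp add: F_def)
  qed
  then show False using f(2) sqnorm_eq_0_iff[OF fD(1)] by simp
qed

end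

subsection \<open>Orthonormal sequences converge weakly to zero\<close>

text \<open>Bessel's inequality, obtained by removing one projection at a time: each removal lowers
  the squared norm \<open>Q N\<close> of the remainder by the squared modulus of a coefficient, so
  these squares are summable.\<close>

lemma orthonormal_weak_null:
  fixes \<phi> :: "nat \<Rightarrow> 'a \<Rightarrow> complex"
  assumes [measurable]: "\<And>n. \<phi> n \<in> borel_measurable M" "h \<in> borel_measurable M"
    and i\<phi>: "\<And>n. integrable M (\<lambda>x. (norm (\<phi> n x))\<^sup>2)" and ih: "integrable M (\<lambda>x. (norm (h x))\<^sup>2)"
    and on: "\<And>n m. (\<integral>x. \<phi> n x * cnj (\<phi> m x) \<partial>M) = (if n = m then 1 else 0)"
  shows "(\<lambda>n. \<integral>x. h x * cnj (\<phi> n x) \<partial>M) \<longlonglongrightarrow> 0"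
proof -
  define c where "c n = (\<integral>x. h x * cnj (\<phi> n x) \<partial>M)" for n
  define H where "H N x = h x - (\<Sum>n<N. c n * \<phi> n x)" for N x
  have [measurable]: "H N \<in> borel_measurable M" for N unfolding H_def by measurable
  have HS: "H (Suc N) x = H N x - c N * \<phi> N x" for N x by (simp add: H_def)
  have cnj2: "integrable M (\<lambda>x. (norm (cnj (\<phi> n x)))\<^sup>2)" for n using i\<phi> by simp
  have iH: "integrable M (\<lambda>x. (norm (H N x))\<^sup>2)" for N
  proof (induction N)
    case 0 then show ?case using ih by (simp add: H_def)
  next
    case (Suc N)
    show ?case
    proof (rule Bochner_Integration.integrable_bound)
      show "integrable M (\<lambda>x. 2 * ((norm (H N x))\<^sup>2 + (norm (c N))\<^sup>2 * (norm (\<phi> N x))\<^sup>2))"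
        using Suc i\<phi> by simp
      show "AE x in M. norm ((norm (H (Suc N) x))\<^sup>2) \<le> norm (2 * ((norm (H N x))\<^sup>2 + (norm (c N))\<^sup>2 * (norm (\<phi> N x))\<^sup>2))"
      proof (intro AE_I2)
        fix x
        have "(norm (H (Suc N) x))\<^sup>2 \<le> 2 * ((norm (H N x))\<^sup>2 + (norm (c N))\<^sup>2 * (norm (\<phi> N x))\<^sup>2)"
          using norm_add_power2[of "H N x" "- (c N * \<phi> N x)"] by (simp add: HS norm_mult power_mult_distrib)
        then show "norm ((norm (H (Suc N) x))\<^sup>2) \<le> norm (2 * ((norm (H N x))\<^sup>2 + (norm (c N))\<^sup>2 * (norm (\<phi> N x))\<^sup>2))"
          by simp
      qed
    qed measurable
  qed
  have i1: "integrable M (\<lambda>x. H N x * cnj (\<phi> m x))" for N m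
    by (rule integrable_mult_if_square[OF _ iH _ cnj2]) measurable
  have i2: "integrable M (\<lambda>x. \<phi> n x * cnj (\<phi> m x))" for n m
    by (rule integrable_mult_if_square[OF _ i\<phi> _ cnj2]) measurable
  have Hc: "(\<integral>x. H N x * cnj (\<phi> m x) \<partial>M) = c m" if "N \<le> m" for N m
    using that
  proof (induction N)
    case 0 then show ?case by (simp add: H_def c_def)
  next
    case (Suc N)
    have "(\<integral>x. H (Suc N) x * cnj (\<phi> m x) \<partial>M) = (\<integral>x. H N x * cnj (\<phi> m x) - c N * (\<phi> N x * cnj (\<phi> m x)) \<partial>M)"
      by (simp add: HS algebra_simps)
    also have "\<dots> = c m - c N * (\<integral>x. \<phi> N x * cnj (\<phi> m x) \<partial>M)"
      using i1 i2 Suc by simp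
    finally show ?case using Suc.prems on[of N m] by simp
  qed
  define Q where "Q N = (\<integral>x. (norm (H N x))\<^sup>2 \<partial>M)" for N
  have QS: "Q (Suc N) = Q N - (norm (c N))\<^sup>2" for N
  proof -
    have pt: "complex_of_real ((norm (H (Suc N) x))\<^sup>2) = of_real ((norm (H N x))\<^sup>2) - cnj (c N) * (H N x * cnj (\<phi> N x))
        - c N * cnj (H N x * cnj (\<phi> N x)) + (c N * cnj (c N)) * (\<phi> N x * cnj (\<phi> N x))" for x
      unfolding complex_norm_square HS by (simp add: algebra_simps)
    have icn: "integrable M (\<lambda>x. cnj (H N x * cnj (\<phi> N x)))" using i1 by (rule integrable_cnj)
    have "complex_of_real (Q (Suc N)) = (\<integral>x. complex_of_real ((norm (H (Suc N) x))\<^sup>2) \<partial>M)"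
      unfolding Q_def by (rule integral_complex_of_real[symmetric])
    also have "\<dots> = (\<integral>x. complex_of_real ((norm (H N x))\<^sup>2) \<partial>M) - cnj (c N) * (\<integral>x. H N x * cnj (\<phi> N x) \<partial>M)
        - c N * (\<integral>x. cnj (H N x * cnj (\<phi> N x)) \<partial>M) + (c N * cnj (c N)) * (\<integral>x. \<phi> N x * cnj (\<phi> N x) \<partial>M)"
    proof -
      have iR: "integrable M (\<lambda>x. complex_of_real ((norm (H N x))\<^sup>2))" by (intro integrable_of_real iH)
      note j1 = integrable_mult_right[OF i1[of N N], of "cnj (c N)"]
      note j2 = integrable_mult_right[OF icn, of "c N"]
      note j3 = integrable_mult_right[OF i2[of N N], of "c N * cnj (c N)"]
      show ?thesis unfolding pt
        Bochner_Integration.integral_add[OF Bochner_Integration.integrable_diff[OF Bochner_Integration.integrable_diff[OF iR j1] j2] j3]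
        Bochner_Integration.integral_diff[OF Bochner_Integration.integrable_diff[OF iR j1] j2]
        Bochner_Integration.integral_diff[OF iR j1] by (simp only: integral_mult_right_zero)
    qed
    also have "(\<integral>x. cnj (H N x * cnj (\<phi> N x)) \<partial>M) = cnj (c N)"
      unfolding Bochner_Integration.integral_cnj Hc[OF order_refl] ..
    also have "(\<integral>x. H N x * cnj (\<phi> N x) \<partial>M) = c N" by (rule Hc) simp
    also have "(\<integral>x. complex_of_real ((norm (H N x))\<^sup>2) \<partial>M) = of_real (Q N)"
      unfolding Q_def by (rule integral_complex_of_real)
    finally have "complex_of_real (Q (Suc N)) = of_real (Q N) - c N * cnj (c N)"
      by (simp add: on mult.commute)
    also have "\<dots> = of_real (Q N - (norm (c N))\<^sup>2)" by (simp add: complex_norm_square del: of_real_power)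
    finally show ?thesis by (simp only: of_real_eq_iff)
  qed
  have "Q 0 - (\<Sum>n<N. (norm (c n))\<^sup>2) = Q N" for N by (induction N) (simp_all add: QS)
  moreover have "0 \<le> Q N" for N unfolding Q_def by simp
  ultimately have "(\<Sum>n<N. (norm (c n))\<^sup>2) \<le> Q 0" for N by (metis diff_ge_0_iff_ge)
  then have "summable (\<lambda>n. (norm (c n))\<^sup>2)" by (intro summableI_nonneg_bounded) auto
  then have "(\<lambda>n. (norm (c n))\<^sup>2) \<longlonglongrightarrow> 0" by (rule summable_LIMSEQ_zero)
  then have "(\<lambda>n. sqrt ((norm (c n))\<^sup>2)) \<longlonglongrightarrow> sqrt 0" by (intro tendsto_real_sqrt)
  then have "(\<lambda>n. norm (c n)) \<longlonglongrightarrow> 0" by simp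
  then show ?thesis unfolding c_def by (rule tendsto_norm_zero_cancel)
qed

section \<open>Norm identities for Weyl sequences and for the three-term sum\<close>

lemma l2norm_square:
  fixes f :: "real^'n \<Rightarrow> real^'n \<Rightarrow> complex"
  assumes m: "(\<lambda>z. f (fst z) (snd z)) \<in> borel_measurable borel"
    and fin: "(\<integral>\<^sup>+z. ennreal ((norm (f (fst z) (snd z)))\<^sup>2) \<partial>eta2) < \<infinity>"
  shows "(\<integral>\<^sup>+z. ennreal ((norm (f (fst z) (snd z)))\<^sup>2) \<partial>eta2) = ennreal ((l2norm f)\<^sup>2)"
proof -
  have "(l2norm f)\<^sup>2 = enn2real (sqnorm f)" unfolding l2norm_def by simp
  then show ?thesis using fin unfolding sqnorm_eq[OF m] by (simp add: less_top)
qed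

lemma l2norm_scale: "norm (c :: complex) = 1 \<Longrightarrow> l2norm (\<lambda>p q. c * f p q) = l2norm f"
  by (simp add: l2norm_def sqnorm_def norm_mult)

lemma orthonormal_norm:
  fixes f :: "real^'n \<Rightarrow> real^'n \<Rightarrow> complex"
  assumes f: "L2s f" and 1: "ip f f = 1"
  shows "(\<integral>\<^sup>+z. ennreal ((norm (f (fst z) (snd z)))\<^sup>2) \<partial>eta2) = 1"
proof -
  note fD = L2sD[OF f]
  have "complex_of_real (\<integral>z. (norm (f (fst z) (snd z)))\<^sup>2 \<partial>eta2) = (\<integral>z. complex_of_real ((norm (f (fst z) (snd z)))\<^sup>2) \<partial>eta2)"
    by (rule integral_complex_of_real[symmetric])
  also have "\<dots> = 1" using 1 unfolding ip_eq[OF fD(1) fD(1)] complex_norm_square .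
  finally have "(\<integral>z. (norm (f (fst z) (snd z)))\<^sup>2 \<partial>eta2) = 1" by (simp only: of_real_eq_1_iff)
  moreover have "(\<integral>\<^sup>+z. ennreal ((norm (f (fst z) (snd z)))\<^sup>2) \<partial>eta2) = ennreal (\<integral>z. (norm (f (fst z) (snd z)))\<^sup>2 \<partial>eta2)"
    by (rule nn_integral_eq_integral[OF fD(6)]) simp
  ultimately show ?thesis by simp
qed

text \<open>One factor 3 comes from convexity of the square, the other from the equal distribution
  of the three momenta.\<close>

lemma nn_integral_third_sum_square_le:
  fixes v :: "real^'n \<Rightarrow> complex"
  assumes [measurable]: "v \<in> borel_measurable borel" and per: "per1 v"
  shows "(\<integral>\<^sup>+x. ennreal ((norm (v (fst x) + v (snd x) + v (K - fst x - snd x)))\<^sup>2) \<partial>eta2) \<le> 9 * (\<integral>\<^sup>+p. ennreal ((norm (v p))\<^sup>2) \<partial>eta)"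
proof -
  define V where "V = (\<integral>\<^sup>+p. ennreal ((norm (v p))\<^sup>2) \<partial>eta)"
  have vp: "per1 (\<lambda>p. ennreal ((norm (v p))\<^sup>2))" using per by (simp add: per1_def)
    have "(\<integral>\<^sup>+x. ennreal ((norm (v (fst x) + v (snd x) + v (K - fst x - snd x)))\<^sup>2) \<partial>eta2) \<le>
      (\<integral>\<^sup>+x. 3 * (ennreal ((norm (v (fst x)))\<^sup>2) + ennreal ((norm (v (snd x)))\<^sup>2) + ennreal ((norm (v (K - fst x - snd x)))\<^sup>2)) \<partial>eta2)"
    proof (rule nn_integral_mono)
      fix x
      have "ennreal ((norm (v (fst x) + v (snd x) + v (K - fst x - snd x)))\<^sup>2) \<le> ennreal (3 * ((norm (v (fst x)))\<^sup>2 + (norm (v (snd x)))\<^sup>2 + (norm (v (K - fst x - snd x)))\<^sup>2))"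
        by (intro ennreal_leI norm_add3_power2)
      also have "\<dots> = 3 * (ennreal ((norm (v (fst x)))\<^sup>2) + ennreal ((norm (v (snd x)))\<^sup>2) + ennreal ((norm (v (K - fst x - snd x)))\<^sup>2))"
        by (simp add: ennreal_mult ennreal_plus)
      finally show "ennreal ((norm (v (fst x) + v (snd x) + v (K - fst x - snd x)))\<^sup>2) \<le> 3 * (ennreal ((norm (v (fst x)))\<^sup>2) + ennreal ((norm (v (snd x)))\<^sup>2) + ennreal ((norm (v (K - fst x - snd x)))\<^sup>2))" .
    qed
    also have "\<dots> = 3 * ((\<integral>\<^sup>+x. ennreal ((norm (v (fst x)))\<^sup>2) \<partial>(eta2 :: ((real^'n) \<times> (real^'n)) measure)) +
        (\<integral>\<^sup>+x. ennreal ((norm (v (snd x)))\<^sup>2) \<partial>(eta2 :: ((real^'n) \<times> (real^'n)) measure)) +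
        (\<integral>\<^sup>+x. ennreal ((norm (v (K - fst x - snd x)))\<^sup>2) \<partial>(eta2 :: ((real^'n) \<times> (real^'n)) measure)))"
      by (simp add: nn_integral_cmult nn_integral_add)
    also have "\<dots> = 3 * (V + V + V)"
      unfolding V_def using nn_integral_third[OF _ vp] by simp
    also have "\<dots> = 9 * V"
    proof -
      have three: "x + x + x = (1 + 1 + 1) * x" for x :: ennreal by (simp only: distrib_right mult_1)
      have "(3::ennreal) * (1 + 1 + 1) = 9" by simp
      then show ?thesis unfolding three[of "V"] mult.assoc[symmetric] by (simp only:)
    qed
    finally show ?thesis unfolding V_def .
qed

lemma ennreal_norm_add_power2:
  "ennreal ((norm (a + b :: complex))\<^sup>2) \<le> 2 * (ennreal ((norm a)\<^sup>2) + ennreal ((norm b)\<^sup>2))"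
proof -
  have "ennreal ((norm (a + b))\<^sup>2) \<le> ennreal (2 * ((norm a)\<^sup>2 + (norm b)\<^sup>2))" by (intro ennreal_leI norm_add_power2)
  then show ?thesis by (simp add: ennreal_mult ennreal_plus)
qed

context boson
begin

subsection \<open>Location of the essential spectrum\<close>

text \<open>Compactness is used in this form: in the equation for the means \<open>v n\<close> the
  only term that is not an error is an integral \<open>a n\<close> against a bounded kernel. Weak
  convergence makes it tend to 0 at every point, a uniform bound makes it tend to 0 in norm.
  Absolute values in the hypotheses let the lemma serve both below and above the symbol.\<close>

lemma not_in_ess_spec:
  fixes K :: "real^'n"
  assumes c: "c > 0" "\<And>p t. c \<le> \<bar>W K p t - z\<bar>" "\<And>p. c \<le> \<bar>Dl K z p\<bar>"
  shows "s * z \<notin> ess_spec (- s * \<kappa>) K"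
proof
  assume "s * z \<in> ess_spec (- s * \<kappa>) K"
  then obtain \<phi> where L: "\<And>n. L2s (\<phi> n)" and on: "\<And>n m. ip (\<phi> n) (\<phi> m) = (if n = m then 1 else 0)"
    and lim: "(\<lambda>n. l2norm (\<lambda>p q. Hop (- s * \<kappa>) K (\<phi> n) p q - complex_of_real (s * z) * \<phi> n p q)) \<longlonglongrightarrow> 0"
    unfolding ess_spec_def by blast
  note LD = L2sD[OF L]
  define v where "v n = pmean (\<phi> n)" for n
  have vm[measurable]: "v n \<in> borel_measurable borel" for n unfolding v_def by (rule pmean_measurable[OF LD(1)])
  note m\<phi>[measurable] = LD(1)
  have vper: "per1 (v n)" for n unfolding v_def by (rule pmean_per1[OF L])
  have nrm: "(\<integral>\<^sup>+x. ennreal ((norm (\<phi> n (fst x) (snd x)))\<^sup>2) \<partial>eta2) = 1" for n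
    by (rule orthonormal_norm[OF L]) (simp add: on)
  define V where "V n = (\<integral>\<^sup>+p. ennreal ((norm (v n p))\<^sup>2) \<partial>(eta :: (real^'n) measure))" for n
  have V1: "V n \<le> 1" for n using pmean_square_le[OF LD(1), of n] unfolding V_def v_def nrm .
  define N where "N n p q = v n p + v n q + v n (K - p - q)" for n p q
  define \<psi> where "\<psi> n p q = of_real (W K p q - z) * \<phi> n p q - of_real \<kappa> * N n p q" for n p q
  have [measurable]: "(\<lambda>x. N n (fst x) (snd x)) \<in> borel_measurable borel" for n unfolding N_def by measurable
  have m\<psi>[measurable]: "(\<lambda>x. \<psi> n (fst x) (snd x)) \<in> borel_measurable borel" for n
    unfolding \<psi>_def by measurable
  have N2: "(\<integral>\<^sup>+x. ennreal ((norm (N n (fst x) (snd x)))\<^sup>2) \<partial>eta2) \<le> 9 * V n" for n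
    unfolding N_def V_def by (rule nn_integral_third_sum_square_le[OF vm vper])
  define \<Psi> where "\<Psi> n = (\<integral>\<^sup>+x. ennreal ((norm (\<psi> n (fst x) (snd x)))\<^sup>2) \<partial>eta2)" for n
  define BW where "BW = (12 * real CARD('n) + \<bar>z\<bar>)\<^sup>2"
  \<comment> \<open>\<open>l2norm\<close> passes through \<open>enn2real\<close>, which sends
    infinity to 0; finiteness must therefore be known before a small norm means a small
    integral.\<close>
  have \<Psi>fin: "\<Psi> n < \<infinity>" for n
  proof -
    have "\<Psi> n \<le> (\<integral>\<^sup>+x. 2 * (ennreal BW * ennreal ((norm (\<phi> n (fst x) (snd x)))\<^sup>2) + ennreal (\<kappa>\<^sup>2) * ennreal ((norm (N n (fst x) (snd x)))\<^sup>2)) \<partial>eta2)"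
      unfolding \<Psi>_def
    proof (rule nn_integral_mono)
      fix x :: "(real^'n) \<times> (real^'n)"
      let ?p = "fst x" and ?q = "snd x"
      have w: "\<bar>W K ?p ?q - z\<bar> \<le> 12 * real CARD('n) + \<bar>z\<bar>" using abs_W_le[of K ?p ?q] by linarith
      have "(norm (of_real (W K ?p ?q - z) * \<phi> n ?p ?q))\<^sup>2 \<le> BW * (norm (\<phi> n ?p ?q))\<^sup>2"
        unfolding norm_mult norm_of_real power_mult_distrib BW_def using w by (intro mult_right_mono power_mono) auto
      then have a: "ennreal ((norm (of_real (W K ?p ?q - z) * \<phi> n ?p ?q))\<^sup>2) \<le> ennreal BW * ennreal ((norm (\<phi> n ?p ?q))\<^sup>2)"
        by (simp add: ennreal_mult[symmetric] BW_def ennreal_leI)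
      have b: "ennreal ((norm (- (of_real \<kappa> * N n ?p ?q)))\<^sup>2) = ennreal (\<kappa>\<^sup>2) * ennreal ((norm (N n ?p ?q))\<^sup>2)"
        by (simp add: norm_mult power_mult_distrib ennreal_mult)
      have "ennreal ((norm (\<psi> n ?p ?q))\<^sup>2) \<le> 2 * (ennreal ((norm (of_real (W K ?p ?q - z) * \<phi> n ?p ?q))\<^sup>2) + ennreal ((norm (- (of_real \<kappa> * N n ?p ?q)))\<^sup>2))"
        using ennreal_norm_add_power2[of "of_real (W K ?p ?q - z) * \<phi> n ?p ?q" "- (of_real \<kappa> * N n ?p ?q)"] by (simp add: \<psi>_def)
      also have "\<dots> \<le> 2 * (ennreal BW * ennreal ((norm (\<phi> n ?p ?q))\<^sup>2) + ennreal (\<kappa>\<^sup>2) * ennreal ((norm (N n ?p ?q))\<^sup>2))"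
        unfolding b by (intro mult_left_mono add_mono a) auto
      finally show "ennreal ((norm (\<psi> n ?p ?q))\<^sup>2) \<le> 2 * (ennreal BW * ennreal ((norm (\<phi> n ?p ?q))\<^sup>2) + ennreal (\<kappa>\<^sup>2) * ennreal ((norm (N n ?p ?q))\<^sup>2))" .
    qed
    also have "\<dots> = 2 * (ennreal BW * (\<integral>\<^sup>+x. ennreal ((norm (\<phi> n (fst x) (snd x)))\<^sup>2) \<partial>eta2) + ennreal (\<kappa>\<^sup>2) * (\<integral>\<^sup>+x. ennreal ((norm (N n (fst x) (snd x)))\<^sup>2) \<partial>eta2))"
      by (simp add: nn_integral_cmult nn_integral_add)
    also have "\<dots> \<le> 2 * (ennreal BW * 1 + ennreal (\<kappa>\<^sup>2) * (9 * 1))"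
      using order_trans[OF N2 mult_left_mono[OF V1]] unfolding nrm by (intro mult_left_mono add_mono) auto
    also have "\<dots> < \<infinity>" by (simp add: ennreal_mult_less_top)
    finally show ?thesis .
  qed
  have \<Psi>0: "\<Psi> \<longlonglongrightarrow> 0"
  proof -
    have eq: "l2norm (\<psi> n) = l2norm (\<lambda>p q. Hop (- s * \<kappa>) K (\<phi> n) p q - complex_of_real (s * z) * \<phi> n p q)" for n
    proof -
      have "\<psi> n = (\<lambda>p q. of_real s * (Hop (- s * \<kappa>) K (\<phi> n) p q - complex_of_real (s * z) * \<phi> n p q))"
        by (intro ext) (simp only: Hop_eq[OF L] \<psi>_def N_def v_def)
      moreover have "norm (complex_of_real s) = 1" using s by auto
      ultimately show ?thesis by (simp only: l2norm_scale)
    qed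
    have "\<Psi> = (\<lambda>n. ennreal ((l2norm (\<psi> n))\<^sup>2))"
      using l2norm_square[OF m\<psi>] \<Psi>fin unfolding \<Psi>_def by blast
    moreover have "(\<lambda>n. ennreal ((l2norm (\<psi> n))\<^sup>2)) \<longlonglongrightarrow> ennreal (0\<^sup>2)"
      unfolding eq using lim by (intro tendsto_ennrealI tendsto_power)
    ultimately show ?thesis by simp
  qed
  have Rb: "\<bar>R K z p q\<bar> \<le> 1 / c" for p q
    unfolding R_def abs_divide using c(1) c(2)[of p q] by (simp add: frac_le)
  define a where "a n p = (\<integral>q. of_real (R K z p q) * v n q \<partial>(eta :: (real^'n) measure))" for n p
  define \<omega> where "\<omega> n p = (\<integral>q. of_real (R K z p q) * \<psi> n p q \<partial>(eta :: (real^'n) measure))" for n p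
  have am[measurable]: "a n \<in> borel_measurable borel" for n
    unfolding a_def[abs_def]
    by (rule pmean_measurable[of "\<lambda>p q. of_real (R K z p q) * v n q", unfolded pmean_def[abs_def]]) measurable
  have \<omega>m[measurable]: "\<omega> n \<in> borel_measurable borel" for n
    unfolding \<omega>_def[abs_def]
    by (rule pmean_measurable[of "\<lambda>p q. of_real (R K z p q) * \<psi> n p q", unfolded pmean_def[abs_def]]) measurable
  have iv: "integrable eta (v n)" for n
  proof (rule integrable_if_square[OF eta.finite_measure_axioms])
    show "integrable eta (\<lambda>p. (norm (v n p))\<^sup>2)"
      by (rule integrableI_bounded) (use V1[of n] in \<open>auto simp: V_def intro: le_less_trans\<close>)
  qed measurable
  have Rint: "integrable eta (\<lambda>q. complex_of_real (R K z p q) * f q)" if f: "integrable eta f" for f p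
  proof (rule Bochner_Integration.integrable_bound)
    show "integrable eta (\<lambda>q. (1 / c) * norm (f q))" using f by simp
    show "(\<lambda>q. complex_of_real (R K z p q) * f q) \<in> borel_measurable eta"
      using borel_measurable_integrable[OF f] by measurable
    show "AE q in eta. norm (complex_of_real (R K z p q) * f q) \<le> norm ((1 / c) * norm (f q))"
      using Rb c(1) by (intro AE_I2) (simp add: norm_mult divide_right_mono mult_right_mono del: times_divide_eq_left times_divide_eq_right)
  qed
  \<comment> \<open>Only for almost every \<open>p\<close>, because Fubini provides integrable
    sections of \<open>\<phi> n\<close> only there.\<close>
  have key: "AE p in eta. of_real (Dl K z p) * v n p = of_real (2 * \<kappa>) * a n p + \<omega> n p" for n
    using eta2.AE_integrable_fst'[OF LD(7)[of n]]
  proof eventually_elim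
    case (elim p)
    then have i\<phi>: "integrable eta (\<phi> n p)" by simp
    have ith: "integrable eta (\<lambda>q. v n (K - p - q))"
    proof -
      have "(\<integral>\<^sup>+q. ennreal (norm (v n (K - p - q))) \<partial>eta) = (\<integral>\<^sup>+q. ennreal (norm (v n q)) \<partial>eta)"
        using eta_nn_integral_affine[of "\<lambda>q. ennreal (norm (v n q))" "-1" "K - p"] vper[of n] by (simp add: per1_def)
      also have "\<dots> < \<infinity>" using iv[of n] by (simp add: integrable_iff_bounded)
      finally show ?thesis by (intro integrableI_bounded) auto
    qed
    have W0: "W K p q - z \<noteq> 0" for q using c(1) c(2)[of p q] by auto
    have pt: "\<phi> n p q = of_real \<kappa> * v n p * of_real (R K z p q) + of_real \<kappa> * (of_real (R K z p q) * v n q)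
       + of_real \<kappa> * (of_real (R K z p q) * v n (K - p - q)) + of_real (R K z p q) * \<psi> n p q" for q
    proof -
      have "complex_of_real (R K z p q) * of_real (W K p q - z) = 1"
        unfolding of_real_mult[symmetric] using W0[of q] by (simp add: R_def)
      then have "\<phi> n p q = of_real (R K z p q) * (of_real (W K p q - z) * \<phi> n p q)" by (simp add: mult.assoc[symmetric])
      also have "of_real (W K p q - z) * \<phi> n p q = \<psi> n p q + of_real \<kappa> * N n p q" by (simp add: \<psi>_def)
      finally show ?thesis by (simp add: N_def algebra_simps)
    qed
    have R1: "integrable eta (\<lambda>q. complex_of_real (R K z p q))" using Rint[of "\<lambda>_. 1" p] by simp
    have R2: "integrable eta (\<lambda>q. of_real (R K z p q) * v n q)" by (rule Rint[OF iv])
    have R3: "integrable eta (\<lambda>q. of_real (R K z p q) * v n (K - p - q))" by (rule Rint[OF ith])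
    have R4: "integrable eta (\<lambda>q. of_real (R K z p q) * \<psi> n p q)"
    proof -
      have "integrable eta (\<lambda>q. \<phi> n p q - (of_real \<kappa> * v n p * of_real (R K z p q) + of_real \<kappa> * (of_real (R K z p q) * v n q)
       + of_real \<kappa> * (of_real (R K z p q) * v n (K - p - q))))"
        using i\<phi> R1 R2 R3 by (intro Bochner_Integration.integrable_diff Bochner_Integration.integrable_add integrable_mult_right) auto
      moreover have "\<phi> n p q - (of_real \<kappa> * v n p * of_real (R K z p q) + of_real \<kappa> * (of_real (R K z p q) * v n q)
       + of_real \<kappa> * (of_real (R K z p q) * v n (K - p - q))) = of_real (R K z p q) * \<psi> n p q" for q
        using pt[of q] by (simp add: algebra_simps)
      ultimately show ?thesis by simp
    qed
    have third: "(\<integral>q. of_real (R K z p q) * v n (K - p - q) \<partial>eta) = a n p"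
    proof -
      have "per1 (\<lambda>q. complex_of_real (R K z p q) * v n q)" using vper[of n] R_per1[of K z p] by (simp add: per1_def)
      from eta_integral_affine[OF this, of "-1" "K - p"]
      show ?thesis by (simp add: R_def W_third a_def)
    qed
    have "v n p = (\<integral>q. \<phi> n p q \<partial>eta)" by (simp add: v_def pmean_def)
    also have "\<dots> = (\<integral>q. of_real \<kappa> * v n p * of_real (R K z p q) + of_real \<kappa> * (of_real (R K z p q) * v n q)
       + of_real \<kappa> * (of_real (R K z p q) * v n (K - p - q)) + of_real (R K z p q) * \<psi> n p q \<partial>eta)"
      by (rule Bochner_Integration.integral_cong[OF refl pt])
    also have "\<dots> = of_real \<kappa> * v n p * (\<integral>q. of_real (R K z p q) \<partial>eta) + of_real \<kappa> * a n p + of_real \<kappa> * a n p + \<omega> n p"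
      using R1 R2 R3 R4 third by (simp add: a_def[symmetric] \<omega>_def[symmetric] del: integral_of_real)
    also have "(\<integral>q. complex_of_real (R K z p q) \<partial>eta) = of_real (\<integral>q. R K z p q \<partial>eta)" by (rule integral_complex_of_real)
    finally have "v n p - of_real (\<kappa> * (\<integral>q. R K z p q \<partial>eta)) * v n p = of_real (2 * \<kappa>) * a n p + \<omega> n p"
      by (simp add: algebra_simps)
    then show ?case by (simp add: Dl_def algebra_simps)
  qed
  \<comment> \<open>For fixed \<open>p\<close>, \<open>a n p\<close> is the scalar product of
    \<open>\<phi> n\<close> with the kernel regarded as a function of the first variable
    alone.\<close>
  have a_lim: "(\<lambda>n. a n p) \<longlonglongrightarrow> 0" for p
  proof -
    have hm: "(\<lambda>x::(real^'n) \<times> (real^'n). complex_of_real (R K z p (fst x))) \<in> borel_measurable eta2" by measurable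
    have hi: "integrable eta2 (\<lambda>x::(real^'n) \<times> (real^'n). (norm (complex_of_real (R K z p (fst x))))\<^sup>2)"
    proof (rule eta2.integrable_const_bound[where B="(1 / c)\<^sup>2"])
      show "AE x in eta2. norm ((norm (complex_of_real (R K z p (fst x))))\<^sup>2) \<le> (1 / c)\<^sup>2"
        using power_mono[OF Rb abs_ge_zero, of p _ 2] by (intro AE_I2) (simp del: power_divide)
    qed measurable
    have "(\<lambda>n. \<integral>x. complex_of_real (R K z p (fst x)) * cnj (\<phi> n (fst x) (snd x)) \<partial>eta2) \<longlonglongrightarrow> 0"
    proof (rule orthonormal_weak_null[OF _ hm LD(6) hi])
      show "(\<lambda>x. \<phi> n (fst x) (snd x)) \<in> borel_measurable eta2" for n by measurable
      show "(\<integral>x. \<phi> n (fst x) (snd x) * cnj (\<phi> m (fst x) (snd x)) \<partial>eta2) = (if n = m then 1 else 0)" for n m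
        using on[of n m] unfolding ip_eq[OF LD(1) LD(1)] .
    qed
    then have "(\<lambda>n. cnj (\<integral>x. complex_of_real (R K z p (fst x)) * cnj (\<phi> n (fst x) (snd x)) \<partial>eta2)) \<longlonglongrightarrow> cnj 0"
      by (rule tendsto_cnj)
    moreover have "cnj (\<integral>x. complex_of_real (R K z p (fst x)) * cnj (\<phi> n (fst x) (snd x)) \<partial>eta2) = a n p" for n
    proof -
      have "cnj (\<integral>x. complex_of_real (R K z p (fst x)) * cnj (\<phi> n (fst x) (snd x)) \<partial>eta2) = (\<integral>x. complex_of_real (R K z p (fst x)) * \<phi> n (fst x) (snd x) \<partial>eta2)"
        unfolding Bochner_Integration.integral_cnj[symmetric] by simp
      also have "\<dots> = (\<integral>q. (\<integral>t. complex_of_real (R K z p q) * \<phi> n q t \<partial>eta) \<partial>eta)"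
      proof -
        have "integrable eta2 (\<lambda>x. complex_of_real (R K z p (fst x)) * \<phi> n (fst x) (snd x))"
          by (rule integrable_mult_if_square[OF hm hi _ LD(6)]) measurable
        from eta2.integral_fst'[OF this] show ?thesis by simp
      qed
      also have "\<dots> = a n p" by (simp add: a_def v_def pmean_def)
      finally show ?thesis .
    qed
    ultimately show ?thesis by simp
  qed
  have a_bd: "ennreal ((norm (a n p))\<^sup>2) \<le> ennreal ((1 / c)\<^sup>2)" for n p
  proof -
    have "ennreal ((norm (a n p))\<^sup>2) \<le> (\<integral>\<^sup>+q. ennreal ((norm (of_real (R K z p q) * v n q))\<^sup>2) \<partial>eta)"
      unfolding a_def by (rule norm_integral_square_le) measurable
    also have "\<dots> \<le> (\<integral>\<^sup>+q. ennreal ((1 / c)\<^sup>2) * ennreal ((norm (v n q))\<^sup>2) \<partial>eta)"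
    proof (rule nn_integral_mono)
      fix q
      have "(norm (of_real (R K z p q) * v n q))\<^sup>2 \<le> (1 / c)\<^sup>2 * (norm (v n q))\<^sup>2"
        unfolding norm_mult norm_of_real power_mult_distrib using Rb by (intro mult_right_mono power_mono) auto
      then show "ennreal ((norm (of_real (R K z p q) * v n q))\<^sup>2) \<le> ennreal ((1 / c)\<^sup>2) * ennreal ((norm (v n q))\<^sup>2)"
        by (subst ennreal_mult[symmetric]) (auto intro: ennreal_leI)
    qed
    also have "\<dots> = ennreal ((1 / c)\<^sup>2) * V n" unfolding V_def by (rule nn_integral_cmult) measurable
    also have "\<dots> \<le> ennreal ((1 / c)\<^sup>2) * 1" by (intro mult_left_mono V1) simp
    finally show ?thesis by simp
  qed
  have a2: "(\<lambda>n. \<integral>\<^sup>+p. ennreal ((norm (a n p))\<^sup>2) \<partial>(eta :: (real^'n) measure)) \<longlonglongrightarrow> 0"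
  proof -
    have "(\<lambda>n. \<integral>\<^sup>+p. ennreal ((norm (a n p))\<^sup>2) \<partial>(eta :: (real^'n) measure)) \<longlonglongrightarrow> (\<integral>\<^sup>+p. 0 \<partial>(eta :: (real^'n) measure))"
    proof (rule nn_integral_dominated_convergence[where w="\<lambda>_. ennreal ((1 / c)\<^sup>2)"])
      show "AE p in eta. (\<lambda>n. ennreal ((norm (a n p))\<^sup>2)) \<longlonglongrightarrow> 0"
      proof (intro AE_I2)
        fix p
        have "(\<lambda>n. ennreal ((norm (a n p))\<^sup>2)) \<longlonglongrightarrow> ennreal ((norm (0::complex))\<^sup>2)"
          by (intro tendsto_ennrealI tendsto_power tendsto_norm a_lim)
        then show "(\<lambda>n. ennreal ((norm (a n p))\<^sup>2)) \<longlonglongrightarrow> 0" by simp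
      qed
    qed (use a_bd in auto)
    then show ?thesis by simp
  qed
  have \<omega>2: "(\<integral>\<^sup>+p. ennreal ((norm (\<omega> n p))\<^sup>2) \<partial>(eta :: (real^'n) measure)) \<le> ennreal ((1 / c)\<^sup>2) * \<Psi> n" for n
  proof -
    have "(\<integral>\<^sup>+p. ennreal ((norm (\<omega> n p))\<^sup>2) \<partial>(eta :: (real^'n) measure)) \<le>
       (\<integral>\<^sup>+x. ennreal ((norm (of_real (R K z (fst x) (snd x)) * \<psi> n (fst x) (snd x)))\<^sup>2) \<partial>eta2)"
      unfolding \<omega>_def
      by (rule pmean_square_le[of "\<lambda>p q. of_real (R K z p q) * \<psi> n p q", unfolded pmean_def]) measurable
    also have "\<dots> \<le> (\<integral>\<^sup>+x. ennreal ((1 / c)\<^sup>2) * ennreal ((norm (\<psi> n (fst x) (snd x)))\<^sup>2) \<partial>eta2)"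
    proof (rule nn_integral_mono)
      fix x :: "(real^'n) \<times> (real^'n)"
      have "(norm (of_real (R K z (fst x) (snd x)) * \<psi> n (fst x) (snd x)))\<^sup>2 \<le> (1 / c)\<^sup>2 * (norm (\<psi> n (fst x) (snd x)))\<^sup>2"
        unfolding norm_mult norm_of_real power_mult_distrib using Rb by (intro mult_right_mono power_mono) auto
      then show "ennreal ((norm (of_real (R K z (fst x) (snd x)) * \<psi> n (fst x) (snd x)))\<^sup>2) \<le> ennreal ((1 / c)\<^sup>2) * ennreal ((norm (\<psi> n (fst x) (snd x)))\<^sup>2)"
        by (subst ennreal_mult[symmetric]) (auto intro: ennreal_leI)
    qed
    also have "\<dots> = ennreal ((1 / c)\<^sup>2) * \<Psi> n" unfolding \<Psi>_def by (rule nn_integral_cmult) measurable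
    finally show ?thesis .
  qed
  define Va where "Va n = (\<integral>\<^sup>+p. ennreal ((norm (a n p))\<^sup>2) \<partial>(eta :: (real^'n) measure))" for n
  define cc where "cc = ennreal ((1 / c)\<^sup>2)"
  have Vle: "V n \<le> cc * (2 * (ennreal ((2 * \<kappa>)\<^sup>2) * Va n + cc * \<Psi> n))" for n
  proof -
    have "V n \<le> (\<integral>\<^sup>+p. cc * (2 * (ennreal ((2 * \<kappa>)\<^sup>2) * ennreal ((norm (a n p))\<^sup>2) + ennreal ((norm (\<omega> n p))\<^sup>2))) \<partial>eta)"
      unfolding V_def
    proof (rule nn_integral_mono_AE)
      show "AE p in eta. ennreal ((norm (v n p))\<^sup>2) \<le> cc * (2 * (ennreal ((2 * \<kappa>)\<^sup>2) * ennreal ((norm (a n p))\<^sup>2) + ennreal ((norm (\<omega> n p))\<^sup>2)))"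
        using key[of n]
      proof eventually_elim
        case (elim p)
        have "1 \<le> (1 / c) * \<bar>Dl K z p\<bar>" using c(1) c(3)[of p] by simp
        then have "1 * norm (v n p) \<le> (1 / c) * \<bar>Dl K z p\<bar> * norm (v n p)" by (intro mult_right_mono) auto
        then have "norm (v n p) \<le> (1 / c) * norm (of_real (Dl K z p) * v n p)" by (simp add: norm_mult)
        then have "(norm (v n p))\<^sup>2 \<le> ((1 / c) * norm (of_real (Dl K z p) * v n p))\<^sup>2" by (intro power_mono) auto
        then have "ennreal ((norm (v n p))\<^sup>2) \<le> cc * ennreal ((norm (of_real (Dl K z p) * v n p))\<^sup>2)"
          unfolding cc_def power_mult_distrib by (subst ennreal_mult[symmetric]) (auto intro: ennreal_leI)
        also have "ennreal ((norm (of_real (Dl K z p) * v n p))\<^sup>2) \<le> 2 * (ennreal ((norm (of_real (2 * \<kappa>) * a n p))\<^sup>2) + ennreal ((norm (\<omega> n p))\<^sup>2))"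
          unfolding elim by (rule ennreal_norm_add_power2)
        also have "ennreal ((norm (of_real (2 * \<kappa>) * a n p))\<^sup>2) = ennreal ((2 * \<kappa>)\<^sup>2) * ennreal ((norm (a n p))\<^sup>2)"
          unfolding norm_mult norm_of_real power_mult_distrib power2_abs by (rule ennreal_mult) auto
        finally show ?case by (simp add: mult_left_mono)
      qed
    qed
    also have "\<dots> = cc * (2 * (ennreal ((2 * \<kappa>)\<^sup>2) * Va n + (\<integral>\<^sup>+p. ennreal ((norm (\<omega> n p))\<^sup>2) \<partial>eta)))"
      unfolding Va_def by (simp add: nn_integral_cmult nn_integral_add)
    also have "\<dots> \<le> cc * (2 * (ennreal ((2 * \<kappa>)\<^sup>2) * Va n + cc * \<Psi> n))"
      using \<omega>2[of n] unfolding cc_def by (intro mult_left_mono add_left_mono) auto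
    finally show ?thesis .
  qed
  have Vlim: "V \<longlonglongrightarrow> 0"
  proof (rule tendsto_sandwich[of "\<lambda>_. 0"])
    have "(\<lambda>n. cc * (2 * (ennreal ((2 * \<kappa>)\<^sup>2) * Va n + cc * \<Psi> n))) \<longlonglongrightarrow> cc * (2 * (ennreal ((2 * \<kappa>)\<^sup>2) * 0 + cc * 0))"
      using a2 \<Psi>0 unfolding Va_def[symmetric] cc_def by (intro tendsto_intros ennreal_tendsto_cmult) auto
    then show "(\<lambda>n. cc * (2 * (ennreal ((2 * \<kappa>)\<^sup>2) * Va n + cc * \<Psi> n))) \<longlonglongrightarrow> 0" by simp
  qed (use Vle in auto)
  \<comment> \<open>The normalisation of \<open>\<phi> n\<close> is bounded by quantities that tend
    to 0; this is the contradiction.\<close>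
  have one: "1 \<le> cc * (2 * (\<Psi> n + ennreal (\<kappa>\<^sup>2) * (9 * V n)))" for n
  proof -
    have "1 = (\<integral>\<^sup>+x. ennreal ((norm (\<phi> n (fst x) (snd x)))\<^sup>2) \<partial>eta2)" by (rule nrm[symmetric])
    also have "\<dots> \<le> (\<integral>\<^sup>+x. cc * (2 * (ennreal ((norm (\<psi> n (fst x) (snd x)))\<^sup>2) + ennreal (\<kappa>\<^sup>2) * ennreal ((norm (N n (fst x) (snd x)))\<^sup>2))) \<partial>eta2)"
    proof (rule nn_integral_mono)
      fix x :: "(real^'n) \<times> (real^'n)"
      let ?p = "fst x" and ?q = "snd x"
      have "1 \<le> (1 / c) * \<bar>W K ?p ?q - z\<bar>" using c(1) c(2)[of ?p ?q] by simp
      then have "1 * norm (\<phi> n ?p ?q) \<le> (1 / c) * \<bar>W K ?p ?q - z\<bar> * norm (\<phi> n ?p ?q)" by (intro mult_right_mono) auto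
      moreover have "of_real (W K ?p ?q - z) * \<phi> n ?p ?q = \<psi> n ?p ?q + of_real \<kappa> * N n ?p ?q" by (simp add: \<psi>_def)
      ultimately have "norm (\<phi> n ?p ?q) \<le> (1 / c) * norm (\<psi> n ?p ?q + of_real \<kappa> * N n ?p ?q)"
        by (metis mult.assoc mult_1 norm_mult norm_of_real)
      then have "(norm (\<phi> n ?p ?q))\<^sup>2 \<le> ((1 / c) * norm (\<psi> n ?p ?q + of_real \<kappa> * N n ?p ?q))\<^sup>2" by (intro power_mono) auto
      then have "ennreal ((norm (\<phi> n ?p ?q))\<^sup>2) \<le> cc * ennreal ((norm (\<psi> n ?p ?q + of_real \<kappa> * N n ?p ?q))\<^sup>2)"
        unfolding cc_def power_mult_distrib by (subst ennreal_mult[symmetric]) (auto intro: ennreal_leI)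
      also have "ennreal ((norm (\<psi> n ?p ?q + of_real \<kappa> * N n ?p ?q))\<^sup>2) \<le> 2 * (ennreal ((norm (\<psi> n ?p ?q))\<^sup>2) + ennreal ((norm (of_real \<kappa> * N n ?p ?q))\<^sup>2))"
        by (rule ennreal_norm_add_power2)
      also have "ennreal ((norm (of_real \<kappa> * N n ?p ?q))\<^sup>2) = ennreal (\<kappa>\<^sup>2) * ennreal ((norm (N n ?p ?q))\<^sup>2)"
        unfolding norm_mult norm_of_real power_mult_distrib power2_abs by (rule ennreal_mult) auto
      finally show "ennreal ((norm (\<phi> n ?p ?q))\<^sup>2) \<le> cc * (2 * (ennreal ((norm (\<psi> n ?p ?q))\<^sup>2) + ennreal (\<kappa>\<^sup>2) * ennreal ((norm (N n ?p ?q))\<^sup>2)))"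
        by (simp add: mult_left_mono)
    qed
    also have "\<dots> = cc * (2 * (\<Psi> n + ennreal (\<kappa>\<^sup>2) * (\<integral>\<^sup>+x. ennreal ((norm (N n (fst x) (snd x)))\<^sup>2) \<partial>eta2)))"
      unfolding \<Psi>_def by (simp add: nn_integral_cmult nn_integral_add)
    also have "\<dots> \<le> cc * (2 * (\<Psi> n + ennreal (\<kappa>\<^sup>2) * (9 * V n)))"
      using N2[of n] by (intro mult_left_mono add_left_mono) auto
    finally show ?thesis .
  qed
  have "(\<lambda>n. cc * (2 * (\<Psi> n + ennreal (\<kappa>\<^sup>2) * (9 * V n)))) \<longlonglongrightarrow> cc * (2 * (0 + ennreal (\<kappa>\<^sup>2) * (9 * 0)))"
    using Vlim \<Psi>0 unfolding cc_def by (intro tendsto_intros ennreal_tendsto_cmult) auto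
  then have "(\<lambda>n. cc * (2 * (\<Psi> n + ennreal (\<kappa>\<^sup>2) * (9 * V n)))) \<longlonglongrightarrow> 0" by simp
  then have "(1::ennreal) \<le> 0" by (rule LIMSEQ_le_const) (use one in blast)
  then show False by simp
qed

end

subsection \<open>The range of the symbol lies in the essential spectrum\<close>

text \<open>All coordinate distances from \<open>c\<close>, modulo \<open>2 * pi\<close>, lie
  strictly between \<open>(1/2) ^ Suc n\<close> and \<open>(1/2) ^ n\<close>. The cosine builds in
  the periodicity and reverses the inequalities.\<close>

definition shell :: "real^'n \<Rightarrow> nat \<Rightarrow> (real^'n) set" where
  "shell c n = {x. \<forall>i. cos ((1/2) ^ n) < cos (x $ i - c $ i) \<and> cos (x $ i - c $ i) < cos ((1/2) ^ Suc n)}"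

lemma shell_borel [measurable]: "shell (c :: real^'n) n \<in> sets borel"
  unfolding shell_def by measurable

lemma shell_shift: "x + shiftv i \<in> shell c n \<longleftrightarrow> x \<in> shell c n"
proof -
  have "cos ((x + shiftv i) $ j - c $ j) = cos (x $ j - c $ j)" for j
  proof (cases "j = i")
    case True
    then have "(x + shiftv i) $ j - c $ j = (x $ j - c $ j) + 2 * pi" by (simp add: shiftv_def)
    then show ?thesis by (simp only: cos_periodic)
  next
    case False
    then show ?thesis by (simp add: shiftv_def axis_def)
  qed
  then show ?thesis by (simp add: shell_def)
qed

lemma cos_half_power_le:
  assumes "n \<le> m"
  shows "cos ((1/2) ^ n) \<le> cos ((1/2 :: real) ^ m)"
proof (rule cos_monotone_0_pi_le)
  show "(1/2 :: real) ^ m \<le> (1/2) ^ n" using assms by (simp add: power_decreasing)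
  have "(1/2 :: real) ^ n \<le> 1" by (simp add: power_le_one)
  then show "(1/2 :: real) ^ n \<le> pi" using pi_gt3 by linarith
qed simp

lemma shell_disjoint:
  assumes "n \<noteq> m"
  shows "shell c n \<inter> shell c m = {}"
proof -
  have *: "shell c n \<inter> shell c m = {}" if "n < m" for n m
  proof -
    have "cos ((1/2) ^ Suc n) \<le> cos ((1/2 :: real) ^ m)" using that by (intro cos_half_power_le) simp
    then show ?thesis unfolding shell_def by (fastforce dest: order.strict_trans)
  qed
  show ?thesis using *[of n m] *[of m n] assms by (cases "n < m") auto
qed

lemma measure_shell_eq: "measure eta (shell (c :: real^'n) n) = measure eta (shell (0 :: real^'n) n)"
proof -
  have "measure eta (shell c n) = (\<integral>x. indicator (shell c n) x \<partial>eta)" by simp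
  also have "\<dots> = (\<integral>x. indicator (shell c n) (c + 1 *\<^sub>R x) \<partial>eta)"
    by (rule eta_integral_affine[symmetric]) (auto simp: per1_def indicator_def shell_shift)
  also have "\<dots> = (\<integral>x. indicator (shell (0 :: real^'n) n) x \<partial>eta)"
    by (rule Bochner_Integration.integral_cong) (auto simp: shell_def indicator_def)
  finally show ?thesis by simp
qed

lemma measure_shell_pos:
  assumes "CARD('n::finite) \<le> 2"
  shows "0 < measure eta (shell (c :: real^'n) n)"
proof -
  have "0 < ((1/2) ^ Suc n / (2 * pi))\<^sup>2" by simp
  also have "\<dots> \<le> measure eta (box (\<chi> i. (1/2) ^ Suc n) (\<chi> i. (1/2) ^ n) :: (real^'n) set)"
    by (rule dyadic_box_measure[OF assms])
  also have "\<dots> \<le> measure eta (shell (0 :: real^'n) n)"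
  proof (rule eta.finite_measure_mono)
    show "box (\<chi> i. (1/2) ^ Suc n) (\<chi> i. (1/2) ^ n) \<subseteq> shell (0 :: real^'n) n"
    proof
      fix x :: "real^'n" assume x: "x \<in> box (\<chi> i. (1/2) ^ Suc n) (\<chi> i. (1/2) ^ n)"
      have "(1/2 :: real) ^ n \<le> 1" by (simp add: power_le_one)
      then have pi: "(1/2 :: real) ^ n \<le> pi" using pi_gt3 by linarith
      have b: "(1/2) ^ Suc n < x $ i" "x $ i < (1/2) ^ n" for i using x by (simp_all add: mem_box_cart)
      have p: "0 < (1/2 :: real) ^ Suc n" by simp
      have "0 \<le> x $ i" "x $ i \<le> pi" for i using b[of i] p pi by linarith+
      then show "x \<in> shell 0 n" unfolding shell_def using pi b p
        by (auto intro!: cos_monotone_0_pi simp del: power_Suc)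
    qed
  qed simp
  finally show ?thesis by (simp add: measure_shell_eq[of c])
qed

lemma measure_shell_tendsto_0: "(\<lambda>n. measure eta (shell (c :: real^'n) n)) \<longlonglongrightarrow> 0"
proof -
  have "(\<lambda>n. measure eta (shell c n)) sums measure eta (\<Union>n. shell c n)"
    by (rule eta.finite_measure_UNION) (auto simp: disjoint_family_on_def shell_disjoint)
  then show ?thesis using summable_LIMSEQ_zero sums_summable by blast
qed

text \<open>Triangle inequality on the circle in terms of cosines: a point close to both centres
  would make the cosine of the difference of the centres at least \<open>cos (2 * \<delta>)\<close>,
  which tends to 1 as the shells shrink.\<close>

lemma shells_eventually_disjoint:
  fixes p0 q0 :: "real^'n"
  assumes "cos (p0 $ i - q0 $ i) \<noteq> 1"
  shows "\<exists>N. \<forall>n\<ge>N. \<forall>m\<ge>N. shell p0 n \<inter> shell q0 m = {}"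
proof -
  have "(\<lambda>n. cos (2 * (1/2 :: real) ^ n)) \<longlonglongrightarrow> cos (2 * 0)"
    by (intro tendsto_cos tendsto_mult tendsto_const LIMSEQ_power_zero) simp
  moreover have "cos (p0 $ i - q0 $ i) < cos (2 * (0::real))" using assms cos_le_one[of "p0 $ i - q0 $ i"] by (simp add: less_le)
  ultimately have "\<forall>\<^sub>F n in sequentially. cos (p0 $ i - q0 $ i) < cos (2 * (1/2 :: real) ^ n)" by (rule order_tendstoD)
  then obtain N where N: "cos (p0 $ i - q0 $ i) < cos (2 * (1/2 :: real) ^ N)" unfolding eventually_sequentially by blast
  define \<delta> where "\<delta> = (1/2 :: real) ^ N"
  have d: "0 < \<delta>" "\<delta> \<le> 1" by (auto simp: \<delta>_def power_le_one)
  have cd: "0 < cos \<delta>" using d pi_gt3 by (intro cos_gt_zero) auto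
  have "shell p0 n \<inter> shell q0 m = {}" if nm: "n \<ge> N" "m \<ge> N" for n m
  proof (rule ccontr)
    assume "shell p0 n \<inter> shell q0 m \<noteq> {}"
    then obtain x where x: "x \<in> shell p0 n" "x \<in> shell q0 m" by blast
    define a b where "a = x $ i - p0 $ i" and "b = x $ i - q0 $ i"
    have a: "cos \<delta> < cos a" using x(1) cos_half_power_le[OF nm(1)] unfolding shell_def a_def \<delta>_def by (auto intro: le_less_trans)
    have b: "cos \<delta> < cos b" using x(2) cos_half_power_le[OF nm(2)] unfolding shell_def b_def \<delta>_def by (auto intro: le_less_trans)
    have "(cos \<delta>)\<^sup>2 \<le> (cos a)\<^sup>2" "(cos \<delta>)\<^sup>2 \<le> (cos b)\<^sup>2" using a b cd by (auto intro!: power_mono)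
    then have "(sin a)\<^sup>2 \<le> (sin \<delta>)\<^sup>2" "(sin b)\<^sup>2 \<le> (sin \<delta>)\<^sup>2" by (auto simp: sin_squared_eq)
    then have "\<bar>sin a\<bar> \<le> \<bar>sin \<delta>\<bar>" "\<bar>sin b\<bar> \<le> \<bar>sin \<delta>\<bar>" by (auto simp: abs_le_square_iff)
    then have "\<bar>sin a * sin b\<bar> \<le> \<bar>sin \<delta>\<bar> * \<bar>sin \<delta>\<bar>" unfolding abs_mult by (intro mult_mono) auto
    then have "- (sin \<delta> * sin \<delta>) \<le> sin a * sin b" by (simp add: abs_mult[symmetric])
    moreover have "cos \<delta> * cos \<delta> \<le> cos a * cos b" using a b cd by (intro mult_mono) auto
    ultimately have "cos (2 * \<delta>) \<le> cos (a - b)" by (simp add: cos_double power2_eq_square cos_diff)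
    moreover have "cos (a - b) = cos (p0 $ i - q0 $ i)"
      using cos_minus[of "p0 $ i - q0 $ i"] by (simp add: a_def b_def)
    ultimately show False using N by (simp add: \<delta>_def)
  qed
  then show ?thesis by blast
qed

lemma shell_eq:
  fixes p0 q0 :: "real^'n"
  assumes "\<And>i. cos (p0 $ i - q0 $ i) = 1"
  shows "shell p0 n = shell q0 n"
proof -
  have "cos (x $ i - q0 $ i) = cos (x $ i - p0 $ i)" for x :: "real^'n" and i
  proof -
    have "sin (p0 $ i - q0 $ i) = 0" using assms[of i] sin_cos_squared_add[of "p0 $ i - q0 $ i"] by simp
    then show ?thesis using cos_add[of "x $ i - p0 $ i" "p0 $ i - q0 $ i"] assms[of i] by simp
  qed
  then show ?thesis by (simp add: shell_def)
qed

text \<open>Distances on the circle are measured by chords. Since \<open>cis\<close> is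
  multiplicative, chord lengths add up for sums of angles, which is what the term with
  \<open>K - p - q\<close> needs.\<close>

lemma abs_cos_diff_le:
  assumes "cos \<delta> < cos (x - p)" "\<delta> \<ge> 0"
  shows "\<bar>cos x - cos p\<bar> \<le> \<delta>" "cmod (cis x - cis p) \<le> \<delta>"
proof -
  have "(cmod (cis x - cis p))\<^sup>2 = 2 - 2 * cos (x - p)"
    by (simp add: cmod_power2 cos_diff power2_diff algebra_simps sin_squared_eq)
  also have "\<dots> \<le> 2 - 2 * cos \<delta>" using assms by simp
  also have "\<dots> \<le> \<delta>\<^sup>2"
  proof -
    have "cos \<delta> = 1 - 2 * (sin (\<delta> / 2))\<^sup>2" using cos_double_sin[of "\<delta> / 2"] by simp
    moreover have "\<bar>sin (\<delta> / 2)\<bar> \<le> \<bar>\<delta> / 2\<bar>" by (rule abs_sin_x_le_abs_x)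
    then have "(sin (\<delta> / 2))\<^sup>2 \<le> (\<delta> / 2)\<^sup>2" by (simp only: abs_le_square_iff)
    ultimately show ?thesis by (simp add: power_divide)
  qed
  finally show c: "cmod (cis x - cis p) \<le> \<delta>" using assms(2) by (rule power2_le_imp_le)
  have "\<bar>cos x - cos p\<bar> \<le> cmod (cis x - cis p)" using abs_Re_le_cmod[of "cis x - cis p"] by simp
  then show "\<bar>cos x - cos p\<bar> \<le> \<delta>" using c by linarith
qed

lemma Etot_near:
  fixes p0 q0 :: "real^'n"
  assumes p: "p \<in> shell p0 n" and q: "q \<in> shell q0 n"
  shows "\<bar>Etot K p q - Etot K p0 q0\<bar> \<le> 8 * real CARD('n) * (1/2) ^ n"
proof -
  define \<delta> where "\<delta> = (1/2 :: real) ^ n"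
  have d0: "\<delta> \<ge> 0" by (simp add: \<delta>_def)
  have pc: "cos \<delta> < cos (p $ i - p0 $ i)" and qc: "cos \<delta> < cos (q $ i - q0 $ i)" for i
    using p q by (auto simp: shell_def \<delta>_def)
  have one: "\<bar>cos (K $ i - p0 $ i - q0 $ i) - cos (K $ i - p $ i - q $ i)\<bar> + \<bar>cos (p0 $ i) - cos (p $ i)\<bar> + \<bar>cos (q0 $ i) - cos (q $ i)\<bar> \<le> 4 * \<delta>" for i
  proof -
    have "cis (K $ i - p $ i - q $ i) - cis (K $ i - p0 $ i - q0 $ i) =
        cis (K $ i) * (cnj (cis (p $ i) - cis (p0 $ i)) * cis (- q $ i) + cis (- p0 $ i) * cnj (cis (q $ i) - cis (q0 $ i)))"
      by (simp add: cis_cnj cis_mult algebra_simps)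
    then have "cmod (cis (K $ i - p $ i - q $ i) - cis (K $ i - p0 $ i - q0 $ i)) \<le>
        cmod (cis (p $ i) - cis (p0 $ i)) + cmod (cis (q $ i) - cis (q0 $ i))"
      by (simp only: norm_mult norm_cis mult_1 mult_1_right complex_mod_cnj) (rule order_trans[OF norm_triangle_ineq], simp only: norm_mult norm_cis mult_1 mult_1_right complex_mod_cnj order_refl)
    also have "\<dots> \<le> \<delta> + \<delta>" by (intro add_mono abs_cos_diff_le pc qc d0)
    finally have "\<bar>cos (K $ i - p $ i - q $ i) - cos (K $ i - p0 $ i - q0 $ i)\<bar> \<le> \<delta> + \<delta>"
      using abs_Re_le_cmod[of "cis (K $ i - p $ i - q $ i) - cis (K $ i - p0 $ i - q0 $ i)"] by simp
    moreover have "\<bar>cos (p $ i) - cos (p0 $ i)\<bar> \<le> \<delta>" "\<bar>cos (q $ i) - cos (q0 $ i)\<bar> \<le> \<delta>"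
      using abs_cos_diff_le(1)[OF pc d0] abs_cos_diff_le(1)[OF qc d0] by auto
    ultimately show ?thesis by (simp add: abs_minus_commute)
  qed
  have "Etot K p q - Etot K p0 q0 = 2 * (\<Sum>i\<in>UNIV. (cos (K $ i - p0 $ i - q0 $ i) - cos (K $ i - p $ i - q $ i)) +
     (cos (p0 $ i) - cos (p $ i)) + (cos (q0 $ i) - cos (q $ i)))"
    unfolding Etot_def eps_def by (simp add: sum.distrib sum_subtractf algebra_simps)
  also have "\<bar>\<dots>\<bar> \<le> 2 * (\<Sum>i\<in>(UNIV :: 'n set). 4 * \<delta>)"
    unfolding abs_mult using one by (intro mult_mono order_trans[OF sum_abs] sum_mono) (auto intro: order_trans[OF abs_triangle_ineq] order_trans[OF add_right_mono[OF abs_triangle_ineq]])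
  finally show ?thesis by (simp add: \<delta>_def)
qed

text \<open>Weyl sequence of normalised indicators of disjoint symmetric sets that shrink to
  \<open>(p0, q0)\<close> and \<open>(q0, p0)\<close>. Multiplication by the symbol is nearly
  constant on them, and the interaction disappears for every \<open>\<mu>\<close> because averaging
  a concentrated function over one variable loses its norm.\<close>

lemma Etot_in_ess_spec:
  fixes K p0 q0 :: "real^'n"
  assumes d: "CARD('n) \<le> 2"
  shows "Etot K p0 q0 \<in> ess_spec \<mu> K"
proof -
  \<comment> \<open>If the two centres agree modulo \<open>2 * pi\<close>, the shells around them
    coincide and distinct indices suffice; otherwise the first \<open>N\<close> shells are
    discarded.\<close>
  obtain N where N: "shell p0 n \<inter> shell q0 m = {}" if "n \<ge> N" "m \<ge> N" "n \<noteq> m" for n m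
  proof (cases "\<forall>i. cos (p0 $ i - q0 $ i) = 1")
    case True
    then show ?thesis using that[of 0] shell_eq[of p0 q0] shell_disjoint[of _ _ q0] by simp
  next
    case False
    then show ?thesis using that shells_eventually_disjoint[of p0 _ q0] by metis
  qed
  define A where "A n = shell p0 (n + N)" for n
  define B where "B n = shell q0 (n + N)" for n
  have [measurable]: "A n \<in> sets borel" "B n \<in> sets borel" for n by (auto simp: A_def B_def)
  define m where "m n = measure eta (shell (0 :: real^'n) (n + N))" for n
  have m0: "0 < m n" for n unfolding m_def by (rule measure_shell_pos[OF d])
  have mA: "measure eta (A n) = m n" and mB: "measure eta (B n) = m n" for n
    by (simp_all add: A_def B_def m_def measure_shell_eq[of p0] measure_shell_eq[of q0])
  have AB: "A n \<inter> B k = {}" "A n \<inter> A k = {}" "B n \<inter> B k = {}" if "n \<noteq> k" for n k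
    using that N[of "n + N" "k + N"] by (auto simp: A_def B_def shell_disjoint)
  \<comment> \<open>The union with the swapped product provides the bosonic symmetry.\<close>
  define S where "S n = A n \<times> B n \<union> B n \<times> A n" for n
  have Sm[measurable]: "S n \<in> sets borel" for n
    unfolding S_def borel_prod[symmetric] by measurable
  have Sdisj: "S n \<inter> S k = {}" if "n \<noteq> k" for n k
    using AB[OF that] AB(1)[of k n] that by (auto simp: S_def)
  define w where "w n = measure eta2 (S n)" for n
  have w: "(m n)\<^sup>2 \<le> w n" for n
  proof -
    have "(m n)\<^sup>2 = measure eta2 (A n \<times> B n)"
      unfolding measure_def by (subst eta.emeasure_pair_measure_Times) (auto simp: enn2real_mult power2_eq_square mA[unfolded measure_def] mB[unfolded measure_def])
    also have "\<dots> \<le> w n" unfolding w_def by (rule eta2.finite_measure_mono) (auto simp: S_def)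
    finally show ?thesis .
  qed
  have Se: "S n \<in> sets (eta2 :: ((real^'n) \<times> (real^'n)) measure)" for n unfolding sets_eta2 by (rule Sm)
  have w0: "0 < w n" for n using w[of n] m0[of n] zero_less_power[of "m n" 2] by linarith
  define c where "c n = 1 / sqrt (w n)" for n
  have c2: "(c n)\<^sup>2 = 1 / w n" for n using w0[of n] by (simp add: c_def power_divide)
  have c0: "0 < c n" for n using w0[of n] by (simp add: c_def)
  define \<phi> where "\<phi> n p q = complex_of_real (c n * indicator (S n) (p, q))" for n p q
  have \<phi>m[measurable]: "(\<lambda>z. \<phi> n (fst z) (snd z)) \<in> borel_measurable borel" for n
    unfolding \<phi>_def by simp
  have per: "indicator (S n) (p + shiftv i, q) = (indicator (S n) (p, q) :: real)"
     "indicator (S n) (p, q + shiftv i) = (indicator (S n) (p, q) :: real)" for n p q i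
    by (simp_all add: S_def A_def B_def indicator_def shell_shift)
  have sym: "indicator (S n) (q, p) = (indicator (S n) (p, q) :: real)" for n p q
    by (auto simp: S_def indicator_def)
  have L2: "L2s (\<phi> n)" for n
    unfolding L2s_def per2_def
  proof (intro conjI allI)
    show "L2fn (\<phi> n)" by (rule l2norm_le(2)[OF \<phi>m, of _ "c n"]) (use c0[of n] in \<open>auto simp: \<phi>_def indicator_def norm_mult\<close>)
    show "\<phi> n p q = \<phi> n q p" for p q unfolding \<phi>_def sym[of n p q] ..
  qed (auto simp: \<phi>_def per)
  have ind: "integrable eta2 (indicat_real (S n))" for n by (rule integrable_real_indicator[OF Se]) (simp add: eta2.emeasure_finite less_top[symmetric])
  have on: "ip (\<phi> n) (\<phi> k) = (if n = k then 1 else 0)" for n k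
  proof -
    have "\<phi> n (fst z) (snd z) * cnj (\<phi> k (fst z) (snd z)) = complex_of_real ((if n = k then (c n)\<^sup>2 else 0) * indicator (S n) z)" for z
      using Sdisj[of n k] by (auto simp: \<phi>_def indicator_def power2_eq_square)
    then have "ip (\<phi> n) (\<phi> k) = complex_of_real (\<integral>z. (if n = k then (c n)\<^sup>2 else 0) * indicator (S n) z \<partial>eta2)"
      unfolding ip_eq[OF \<phi>m \<phi>m] by (simp only: integral_complex_of_real)
    also have "\<dots> = complex_of_real ((if n = k then (c n)\<^sup>2 else 0) * w n)"
      unfolding w_def using ind[of n] by (simp add: space_pair_measure)
    finally show ?thesis using w0[of n] by (cases "n = k") (simp_all add: c2)
  qed
  have nrm: "(\<integral>\<^sup>+z. ennreal ((norm (\<phi> n (fst z) (snd z)))\<^sup>2) \<partial>eta2) = 1" for n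
    by (rule orthonormal_norm[OF L2]) (simp add: on)
  \<comment> \<open>The mean is at most \<open>c n * m n \<le> 1\<close> times a sum of two
    indicators; that sum is at most 2, so its square is at most twice the sum.\<close>
  have mean: "(norm (pmean (\<phi> n) p))\<^sup>2 \<le> 2 * (indicator (A n) p + indicator (B n) p)" for n p
  proof -
    have "norm (pmean (\<phi> n) p) \<le> (\<integral>t. norm (\<phi> n p t) \<partial>eta)" unfolding pmean_def by (rule integral_norm_bound)
    also have "\<dots> \<le> (\<integral>t. c n * (indicator (A n) p * indicator (B n) t + indicator (B n) p * indicator (A n) t) \<partial>eta)"
    proof (rule eta_mono)
      show "norm (\<phi> n p t) \<le> c n * (indicator (A n) p * indicator (B n) t + indicator (B n) p * indicator (A n) t)" for t
        using c0[of n] by (auto simp: \<phi>_def norm_mult S_def indicator_def)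
      show "norm (norm (\<phi> n p t)) \<le> c n" for t using c0[of n] by (auto simp: \<phi>_def norm_mult indicator_def)
      show "norm (c n * (indicator (A n) p * indicator (B n) t + indicator (B n) p * indicator (A n) t)) \<le> c n * 2" for t
        using c0[of n] by (auto simp: indicator_def)
      show "(\<lambda>t. norm (\<phi> n p t)) \<in> borel_measurable borel"
        using section_measurable[OF \<phi>m, of n p] by measurable
    qed measurable
    also have "\<dots> = c n * m n * (indicator (A n) p + indicator (B n) p)"
      by (subst integral_mult_right_zero, subst Bochner_Integration.integral_add)
         (auto intro!: integrable_mult_right integrable_real_indicator simp: less_top[symmetric] eta.emeasure_finite mA mB algebra_simps)
    also have "\<dots> \<le> 1 * (indicator (A n) p + indicator (B n) p)"
    proof (intro mult_right_mono)
      have "m n \<le> sqrt (w n)" using w m0[of n] by (simp add: real_le_rsqrt)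
      then show "c n * m n \<le> 1" using w0[of n] by (simp add: c_def)
    qed simp
    finally have "(norm (pmean (\<phi> n) p))\<^sup>2 \<le> (1 * (indicator (A n) p + indicator (B n) p))\<^sup>2" by (intro power_mono) auto
    also have "\<dots> \<le> 2 * (indicator (A n) p + indicator (B n) p)" by (simp add: indicator_def)
    finally show ?thesis .
  qed
  have mean2: "(\<integral>\<^sup>+p. ennreal ((norm (pmean (\<phi> n) p))\<^sup>2) \<partial>eta) \<le> ennreal (4 * m n)" for n
  proof -
    have "(\<integral>\<^sup>+p. ennreal ((norm (pmean (\<phi> n) p))\<^sup>2) \<partial>eta) \<le> (\<integral>\<^sup>+p. ennreal (2 * (indicator (A n) p + indicator (B n) p)) \<partial>eta)"
      by (intro nn_integral_mono ennreal_leI mean)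
    also have "\<dots> = ennreal (\<integral>p. 2 * (indicator (A n) p + indicator (B n) p) \<partial>eta)"
      by (rule nn_integral_eq_integral) (auto intro!: integrable_mult_right integrable_real_indicator simp: less_top[symmetric] eta.emeasure_finite)
    also have "(\<integral>p. 2 * (indicator (A n) p + indicator (B n) p) \<partial>eta) = 4 * m n"
      by (subst integral_mult_right_zero, subst Bochner_Integration.integral_add)
         (auto intro!: integrable_real_indicator simp: less_top[symmetric] eta.emeasure_finite mA mB)
    finally show ?thesis .
  qed
  define D where "D n = 8 * real CARD('n) * (1/2) ^ (n + N)" for n
  have near: "\<bar>Etot K p q - Etot K p0 q0\<bar> \<le> D n" if "(p, q) \<in> S n" for p q n
  proof -
    have "Etot K p q = Etot K q p" by (simp add: Etot_def algebra_simps)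
    then show ?thesis using that Etot_near[of p p0 "n + N" q q0 K] Etot_near[of q p0 "n + N" p q0 K]
      unfolding S_def A_def B_def D_def by auto
  qed
  define \<psi> where "\<psi> n p q = Hop \<mu> K (\<phi> n) p q - complex_of_real (Etot K p0 q0) * \<phi> n p q" for n p q
  define T where "T n p q = pmean (\<phi> n) p + pmean (\<phi> n) q + pmean (\<phi> n) (K - p - q)" for n p q
  have \<psi>: "\<psi> n p q = of_real (Etot K p q - Etot K p0 q0) * \<phi> n p q + of_real \<mu> * T n p q" for n p q
    by (simp add: \<psi>_def Hop_def Vop_eq_pmean[OF L2] T_def algebra_simps)
  have [measurable]: "pmean (\<phi> n) \<in> borel_measurable borel" for n by (rule pmean_measurable[OF \<phi>m])
  have Tm[measurable]: "(\<lambda>z. T n (fst z) (snd z)) \<in> borel_measurable borel" for n unfolding T_def by measurable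
  have [measurable]: "(\<lambda>z. Etot K (fst z) (snd z)) \<in> borel_measurable borel" unfolding Etot_def eps_def by measurable
  have \<psi>m[measurable]: "(\<lambda>z. \<psi> n (fst z) (snd z)) \<in> borel_measurable borel" for n unfolding \<psi> by measurable
  \<comment> \<open>The first summand is the oscillation of the symbol on \<open>S n\<close>, the
    second the interaction: 9 from the three-term sum and \<open>4 * m n\<close> from the
    mean.\<close>
  define Y where "Y n = 2 * ((D n)\<^sup>2 + \<mu>\<^sup>2 * (9 * (4 * m n)))" for n
  have sq: "sqnorm (\<psi> n) \<le> ennreal (Y n)" for n
  proof -
    have "sqnorm (\<psi> n) = (\<integral>\<^sup>+z. ennreal ((norm (\<psi> n (fst z) (snd z)))\<^sup>2) \<partial>eta2)" by (rule sqnorm_eq[OF \<psi>m])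
    also have "\<dots> \<le> (\<integral>\<^sup>+z. 2 * (ennreal ((D n)\<^sup>2) * ennreal ((norm (\<phi> n (fst z) (snd z)))\<^sup>2) + ennreal (\<mu>\<^sup>2) * ennreal ((norm (T n (fst z) (snd z)))\<^sup>2)) \<partial>eta2)"
    proof (rule nn_integral_mono)
      fix z :: "(real^'n) \<times> (real^'n)"
      let ?p = "fst z" and ?q = "snd z"
      have "(norm (of_real (Etot K ?p ?q - Etot K p0 q0) * \<phi> n ?p ?q))\<^sup>2 \<le> (D n)\<^sup>2 * (norm (\<phi> n ?p ?q))\<^sup>2"
      proof (cases "z \<in> S n")
        case True
        then show ?thesis unfolding norm_mult norm_of_real power_mult_distrib using near[of ?p ?q n] by (intro mult_right_mono power_mono) auto
      next
        case False
        then show ?thesis by (simp add: \<phi>_def)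
      qed
      then have "ennreal ((norm (of_real (Etot K ?p ?q - Etot K p0 q0) * \<phi> n ?p ?q))\<^sup>2) \<le> ennreal ((D n)\<^sup>2) * ennreal ((norm (\<phi> n ?p ?q))\<^sup>2)"
        by (subst ennreal_mult[symmetric]) (auto intro: ennreal_leI)
      moreover have "ennreal ((norm (of_real \<mu> * T n ?p ?q))\<^sup>2) = ennreal (\<mu>\<^sup>2) * ennreal ((norm (T n ?p ?q))\<^sup>2)"
        unfolding norm_mult norm_of_real power_mult_distrib power2_abs by (rule ennreal_mult) auto
      ultimately have "2 * (ennreal ((norm (of_real (Etot K ?p ?q - Etot K p0 q0) * \<phi> n ?p ?q))\<^sup>2) + ennreal ((norm (of_real \<mu> * T n ?p ?q))\<^sup>2))
        \<le> 2 * (ennreal ((D n)\<^sup>2) * ennreal ((norm (\<phi> n ?p ?q))\<^sup>2) + ennreal (\<mu>\<^sup>2) * ennreal ((norm (T n ?p ?q))\<^sup>2))"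
        by (intro mult_left_mono add_mono) auto
      then show "ennreal ((norm (\<psi> n ?p ?q))\<^sup>2) \<le> 2 * (ennreal ((D n)\<^sup>2) * ennreal ((norm (\<phi> n ?p ?q))\<^sup>2) + ennreal (\<mu>\<^sup>2) * ennreal ((norm (T n ?p ?q))\<^sup>2))"
        unfolding \<psi> by (rule order_trans[OF ennreal_norm_add_power2])
    qed
    also have "\<dots> = 2 * (ennreal ((D n)\<^sup>2) * 1 + ennreal (\<mu>\<^sup>2) * (\<integral>\<^sup>+z. ennreal ((norm (T n (fst z) (snd z)))\<^sup>2) \<partial>eta2))"
      by (simp add: nn_integral_cmult nn_integral_add nrm)
    also have "\<dots> \<le> 2 * (ennreal ((D n)\<^sup>2) * 1 + ennreal (\<mu>\<^sup>2) * (9 * ennreal (4 * m n)))"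
    proof (intro mult_left_mono add_left_mono)
      have "(\<integral>\<^sup>+z. ennreal ((norm (T n (fst z) (snd z)))\<^sup>2) \<partial>eta2) \<le> 9 * (\<integral>\<^sup>+p. ennreal ((norm (pmean (\<phi> n) p))\<^sup>2) \<partial>eta)"
        unfolding T_def by (rule nn_integral_third_sum_square_le[OF _ pmean_per1[OF L2]]) measurable
      also have "\<dots> \<le> 9 * ennreal (4 * m n)" by (intro mult_left_mono mean2) simp
      finally show "(\<integral>\<^sup>+z. ennreal ((norm (T n (fst z) (snd z)))\<^sup>2) \<partial>eta2) \<le> 9 * ennreal (4 * m n)" .
    qed auto
    also have "\<dots> = ennreal (Y n)"
      unfolding Y_def using less_imp_le[OF m0[of n]]
      by (simp only: ennreal_mult ennreal_plus mult_nonneg_nonneg zero_le_power2 add_nonneg_nonneg zero_le_numeral ennreal_numeral mult_1_right)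
    finally show ?thesis .
  qed
  have bound: "l2norm (\<psi> n) \<le> sqrt (Y n)" for n
    unfolding l2norm_def
  proof (intro real_sqrt_le_mono enn2real_leI sq)
    show "0 \<le> Y n" using less_imp_le[OF m0[of n]] by (simp add: Y_def)
  qed
  have "D \<longlonglongrightarrow> 8 * real CARD('n) * 0" unfolding D_def
    by (intro tendsto_mult tendsto_const LIMSEQ_ignore_initial_segment LIMSEQ_power_zero) simp
  moreover have "m \<longlonglongrightarrow> 0" unfolding m_def by (intro LIMSEQ_ignore_initial_segment measure_shell_tendsto_0)
  ultimately have "(\<lambda>n. sqrt (Y n)) \<longlonglongrightarrow> sqrt (2 * ((8 * real CARD('n) * 0)\<^sup>2 + \<mu>\<^sup>2 * (9 * (4 * 0))))"
    unfolding Y_def by (intro tendsto_intros)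
  then have "(\<lambda>n. sqrt (Y n)) \<longlonglongrightarrow> 0" by simp
  then have "(\<lambda>n. l2norm (\<psi> n)) \<longlonglongrightarrow> 0"
    by (rule tendsto_sandwich[rotated 3]) (use bound in \<open>auto simp: l2norm_def\<close>)
  then show ?thesis unfolding ess_spec_def \<psi>_def using L2 on by blast
qed

context boson
begin

subsection \<open>Position of the ground state and of the eigenvalues\<close>

text \<open>Validity is open and inherited downwards, so everything below
  \<open>eK K + \<delta>\<close> lies off the essential spectrum. The margin \<open>\<delta>\<close>
  keeps the inequality strict after passing to the infimum.\<close>

lemma ess_spec_above_eK:
  fixes K :: "real^'n"
  assumes d: "CARD('n) \<le> 2"
  shows "\<exists>\<delta>>0. \<forall>x\<in>ess_spec (- s * \<kappa>) K. eK K + \<delta> \<le> s * x"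
proof -
  obtain \<delta> where \<delta>: "\<delta> > 0" "valid K (eK K + \<delta>)" using valid_open[OF subcritical_bdd(2)[OF d]] by blast
  have "eK K + \<delta> \<le> s * x" if x: "x \<in> ess_spec (- s * \<kappa>) K" for x
  proof (rule ccontr)
    assume "\<not> eK K + \<delta> \<le> s * x"
    then have "valid K (s * x)" by (intro valid_mono[OF \<delta>(2)]) simp
    then obtain c where c: "c > 0" "\<And>p t. c \<le> W K p t - s * x" "\<And>p. c \<le> Dl K (s * x) p" by (auto simp: valid_def)
    have "s * (s * x) \<notin> ess_spec (- s * \<kappa>) K"
      by (rule not_in_ess_spec[OF c(1)]) (use c(2,3) abs_ge_self order_trans in blast)+
    moreover have "s * (s * x) = x" using s by auto
    ultimately show False using x by simp
  qed
  then show ?thesis using \<delta>(1) by blast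
qed

text \<open>Beyond the symbol \<open>R\<close> is nonpositive and so \<open>Dl \<ge> 1\<close>. The
  bound guarantees that the supremum or infimum in \<open>tau_t\<close> and \<open>tau_b\<close> is
  a genuine one.\<close>

lemma ess_spec_bounded_above:
  fixes K :: "real^'n"
  assumes "x \<in> ess_spec (- s * \<kappa>) K"
  shows "s * x \<le> 12 * real CARD('n) + 1"
proof (rule ccontr)
  assume z: "\<not> s * x \<le> 12 * real CARD('n) + 1"
  have neg: "W K p t - s * x \<le> - 1" for p t using z abs_W_le[of K p t] by linarith
  have "s * (s * x) \<notin> ess_spec (- s * \<kappa>) K"
  proof (rule not_in_ess_spec[of 1])
    show "1 \<le> \<bar>W K p t - s * x\<bar>" for p t using neg[of p t] by linarith
    show "1 \<le> \<bar>Dl K (s * x) p\<bar>" for p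
    proof -
      have "R K (s * x) p t \<le> 0" for t unfolding R_def using neg[of p t] by (intro divide_nonneg_neg) auto
      then have "0 \<le> (\<integral>t. - R K (s * x) p (cv t) \<partial>eta)" by (intro Bochner_Integration.integral_nonneg) simp
      then have "(\<integral>t. R K (s * x) p (cv t) \<partial>eta) \<le> 0" by simp
      then have "\<kappa> * (\<integral>t. R K (s * x) p (cv t) \<partial>eta) \<le> 0" using \<kappa> by (simp add: mult_le_0_iff)
      then show ?thesis by (simp add: Dl_def)
    qed
  qed simp
  moreover have "s * (s * x) = x" using s by auto
  ultimately show False using assms by simp
qed

text \<open>The range of the symbol lies in the essential spectrum, so \<open>t\<close> bounds
  \<open>W\<close> as well and supplies the gap required by
  \<open>no_eigenvalue_above\<close>.\<close>

lemma no_eigenvalue_above_ess_spec: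
  fixes K :: "real^'n"
  assumes d: "CARD('n) \<le> 2" and t: "\<And>x. x \<in> ess_spec (- s * \<kappa>) K \<Longrightarrow> s * x \<le> t" and E: "t < s * E"
  shows "\<not> is_eigenvalue (- s * \<kappa>) K E"
proof -
  have "\<not> is_eigenvalue (- s * \<kappa>) K (s * (s * E))"
    by (rule no_eigenvalue_above[OF _ E]) (simp add: W_eq_Etot t Etot_in_ess_spec[OF d])
  moreover have "s * (s * E) = E" using s by auto
  ultimately show ?thesis by simp
qed

lemma ground_state_family:
  assumes d: "CARD('n::finite) \<le> 2"
  defines "E \<equiv> \<lambda>K :: real^'n. s * eK K" and "F \<equiv> \<lambda>(K :: real^'n) p q. complex_of_real (ground_state K p q)"
  shows "is_eigfn (- s * \<kappa>) K (E K) (F K)" "real_analytic (\<lambda>z. F K (fst z) (snd z))"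
    "per1 E" "per1 F" "real_analytic E" "L2_analytic F"
  unfolding E_def F_def
  using is_eigfn_ground_state[OF d] real_analytic_ground_state[OF d] L2_analytic_ground_state[OF d] real_analytic_scaleR[OF real_analytic_eK[OF d], of s]
  by (auto simp: per1_def shift_K_eq ground_state_periodic)

end

theorem theorem4p3:
  assumes "CARD('n::finite) = 1 \<or> CARD('n) = 2"
  shows
   "(\<forall>\<mu>::real. \<mu> < 0 \<longrightarrow>
      (\<exists>(E :: real^'n \<Rightarrow> real) (F :: real^'n \<Rightarrow> real^'n \<Rightarrow> real^'n \<Rightarrow> complex).
         (\<forall>K. E K < tau_b \<mu> K \<and> is_eigfn \<mu> K (E K) (F K) \<and>
              real_analytic (\<lambda>z. F K (fst z) (snd z))) \<and>
         per1 E \<and> per1 F \<and> real_analytic E \<and> L2_analytic F)) \<and>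
    (\<forall>\<mu>::real. \<mu> > 0 \<longrightarrow>
      (\<exists>(E :: real^'n \<Rightarrow> real) (F :: real^'n \<Rightarrow> real^'n \<Rightarrow> real^'n \<Rightarrow> complex).
         (\<forall>K. E K > tau_t \<mu> K \<and> is_eigfn \<mu> K (E K) (F K) \<and>
              real_analytic (\<lambda>z. F K (fst z) (snd z))) \<and>
         per1 E \<and> per1 F \<and> real_analytic E \<and> L2_analytic F)) \<and>
    (\<forall>\<mu>::real. \<forall>K :: real^'n. \<forall>E. \<mu> < 0 \<longrightarrow> is_eigenvalue \<mu> K E \<longrightarrow> \<not> E > tau_t \<mu> K) \<and>
    (\<forall>\<mu>::real. \<forall>K :: real^'n. \<forall>E. \<mu> > 0 \<longrightarrow> is_eigenvalue \<mu> K E \<longrightarrow> \<not> E < tau_b \<mu> K)"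
proof (intro conjI allI impI)
  have d: "CARD('n) \<le> 2" using assms by auto
  \<comment> \<open>Infimum and supremum of an empty set of reals carry no information, so
    nonemptiness comes before any comparison with \<open>tau_b\<close> or
    \<open>tau_t\<close>.\<close>
  have ne: "ess_spec \<mu> K \<noteq> {}" for \<mu> and K :: "real^'n" using Etot_in_ess_spec[OF d] by blast
  {
    fix \<mu> :: real assume \<mu>: "\<mu> < 0"
    interpret boson 1 "- \<mu>" using \<mu> by unfold_locales auto
    have "eK K < tau_b \<mu> K" for K :: "real^'n"
    proof -
      obtain \<delta> where \<delta>: "\<delta> > 0" "\<And>x. x \<in> ess_spec \<mu> K \<Longrightarrow> eK K + \<delta> \<le> x" using ess_spec_above_eK[OF d, of K] by auto
      have "eK K + \<delta> \<le> tau_b \<mu> K" unfolding tau_b_def by (rule cInf_greatest[OF ne \<delta>(2)])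
      then show ?thesis using \<delta>(1) by linarith
    qed
    then show "\<exists>(E :: real^'n \<Rightarrow> real) (F :: real^'n \<Rightarrow> real^'n \<Rightarrow> real^'n \<Rightarrow> complex).
         (\<forall>K. E K < tau_b \<mu> K \<and> is_eigfn \<mu> K (E K) (F K) \<and>
              real_analytic (\<lambda>z. F K (fst z) (snd z))) \<and>
         per1 E \<and> per1 F \<and> real_analytic E \<and> L2_analytic F"
      using ground_state_family[OF d] by (intro exI[of _ eK] exI[of _ "\<lambda>K p q. complex_of_real (ground_state K p q)"]) auto
  next
    fix \<mu> :: real and K :: "real^'n" and E
    assume \<mu>: "\<mu> < 0" and ev: "is_eigenvalue \<mu> K E"
    interpret boson 1 "- \<mu>" using \<mu> by unfold_locales auto
    have "bdd_above (ess_spec \<mu> K)" using ess_spec_bounded_above[of _ K] by (intro bdd_aboveI) auto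
    then have "x \<le> tau_t \<mu> K" if "x \<in> ess_spec \<mu> K" for x unfolding tau_t_def using that by (rule cSup_upper[rotated])
    then show "\<not> E > tau_t \<mu> K" using no_eigenvalue_above_ess_spec[OF d, of K "tau_t \<mu> K" E] ev by auto
  next
    fix \<mu> :: real assume \<mu>: "\<mu> > 0"
    \<comment> \<open>With \<open>s = -1\<close> the order is reversed: the ground state of the
      sign-flipped operator becomes an eigenvalue \<open>- eK K\<close> above the essential
      spectrum.\<close>
    interpret boson "-1" \<mu> using \<mu> by unfold_locales auto
    have "- eK K > tau_t \<mu> K" for K :: "real^'n"
    proof -
      obtain \<delta> where \<delta>: "\<delta> > 0" "\<And>x. x \<in> ess_spec \<mu> K \<Longrightarrow> eK K + \<delta> \<le> - x" using ess_spec_above_eK[OF d, of K] by auto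
      have "tau_t \<mu> K \<le> - eK K - \<delta>" unfolding tau_t_def
      proof (rule cSup_least[OF ne])
        show "x \<le> - eK K - \<delta>" if "x \<in> ess_spec \<mu> K" for x using \<delta>(2)[OF that] by linarith
      qed
      then show ?thesis using \<delta>(1) by linarith
    qed
    then show "\<exists>(E :: real^'n \<Rightarrow> real) (F :: real^'n \<Rightarrow> real^'n \<Rightarrow> real^'n \<Rightarrow> complex).
         (\<forall>K. E K > tau_t \<mu> K \<and> is_eigfn \<mu> K (E K) (F K) \<and>
              real_analytic (\<lambda>z. F K (fst z) (snd z))) \<and>
         per1 E \<and> per1 F \<and> real_analytic E \<and> L2_analytic F"
      using ground_state_family[OF d] by (intro exI[of _ "\<lambda>K. - eK K"] exI[of _ "\<lambda>K p q. complex_of_real (ground_state K p q)"]) auto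
  next
    fix \<mu> :: real and K :: "real^'n" and E
    assume \<mu>: "\<mu> > 0" and ev: "is_eigenvalue \<mu> K E"
    interpret boson "-1" \<mu> using \<mu> by unfold_locales auto
    \<comment> \<open>For \<open>s = -1\<close> the upper bound on \<open>s * x\<close> is a lower
      bound on \<open>x\<close>.\<close>
    have "bdd_below (ess_spec \<mu> K)" using ess_spec_bounded_above[of _ K] by (intro bdd_belowI[of _ "- (12 * real CARD('n) + 1)"]) force
    then have "tau_b \<mu> K \<le> x" if "x \<in> ess_spec \<mu> K" for x unfolding tau_b_def using that by (rule cInf_lower[rotated])
    then show "\<not> E < tau_b \<mu> K" using no_eigenvalue_above_ess_spec[OF d, of K "- tau_b \<mu> K" E] ev by auto
  }
qed

end
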